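(* Let $d\ge 1$ be an integer, let $X_1,X_2,\ldots$ be independent random points uniformly distributed in $Q_d=[0,1]^d$, and let $T_k$ and $H_k$ ($k\ge1$) be the chain record indices and the heights at the chain records. As $b\to\infty$, the scaled point process $\{(bH_k,\,T_k/b),\ k=1,2,\ldots\}$ converges weakly to a point process $\mathcal{R}$ in $\mathbb{R}_+^2$. The law of the limiting point process $\mathcal{R}$ is invariant under the hyperbolic shifts $(s,t)\mapsto(bs,t/b)$ for every $b>0$, and both coordinate projections of $\mathcal{R}$ are self-similar point processes on $\mathbb{R}_+$.
   Context: For $x,y\in\mathbb{R}^d$ write $x\prec y$ iff $x\neq y$ and $x^{(i)}\le y^{(i)}$ for all $i=1,\ldots,d$. The chain records of the sequence $X_1,X_2,\ldots$ are defined recursively: $T_1=1$, $R_1=X_1$, and for $k>1$, $T_k=\min\{n>T_{k-1}: X_n\prec R_{k-1}\}$, $R_k=X_{T_k}$. (Almost surely all $T_k$ are finite.) The height of $x\in Q_d$ is $h(x)=\prod_{i=1}^d x^{(i)}$, the Lebesgue measure of $\{y\in Q_d: y\prec x\}$, and $H_k=h(R_k)$. Here $\mathbb{R}_+=(0,\infty)$, and weak convergence of point processes is convergence in distribution of random locally finite point measures on $\mathbb{R}_+^2$ with respect to the vague topology. A point process on $\mathbb{R}_+$ is self-similar if its law is invariant under all homotheties $x\mapsto cx$, $c>0$. *)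

theory Defs
  imports "HOL-Probability.Probability"
begin

section \<open>Chain records\<close>

definition prec :: "real ^ 'n \<Rightarrow> real ^ 'n \<Rightarrow> bool" (infix "\<prec>" 50) where
  "x \<prec> y \<longleftrightarrow> x \<noteq> y \<and> (\<forall>i. x $ i \<le> y $ i)"

definition unit_cube :: "(real ^ 'n) set" where
  "unit_cube = {x. \<forall>i. 0 \<le> x $ i \<and> x $ i \<le> 1}"

definition height :: "real ^ 'n \<Rightarrow> real" where
  "height x = (\<Prod>i\<in>UNIV. x $ i)"

text \<open>
  Sequences and chain records are indexed from 1; the values at index 0 are never used.
  On enat, Inf is the minimum of a nonempty set and \<open>\<infinity>\<close> for the empty set, so
  \<open>chain_time x k = \<infinity>\<close> means that the sequence has fewer than \<open>k\<close> chain records.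
\<close>

fun chain_time :: "(nat \<Rightarrow> real ^ 'n) \<Rightarrow> nat \<Rightarrow> enat" where
  "chain_time x 0 = 0"
| "chain_time x (Suc 0) = 1"
| "chain_time x (Suc (Suc k)) =
     (case chain_time x (Suc k) of
        enat m \<Rightarrow> Inf {enat n | n. n > m \<and> x n \<prec> x m}
      | \<infinity> \<Rightarrow> \<infinity>)"

definition chain_index :: "(nat \<Rightarrow> real ^ 'n) \<Rightarrow> nat \<Rightarrow> nat" where
  "chain_index x k = the_enat (chain_time x k)"

definition chain_height :: "(nat \<Rightarrow> real ^ 'n) \<Rightarrow> nat \<Rightarrow> real" where
  "chain_height x k = height (x (chain_index x k))"

section \<open>Point measures and the vague topology\<close>

text \<open>
  The push-forward of the counting measure on \<open>I\<close> under \<open>p\<close> is the sum of the unit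
  masses at the points \<open>p i\<close>, counted with multiplicity.
\<close>

definition dirac_sum :: "'a::topological_space set \<Rightarrow> nat set \<Rightarrow> (nat \<Rightarrow> 'a) \<Rightarrow> 'a measure" where
  "dirac_sum S I p = distr (count_space I) (restrict_space borel S) p"

definition point_measures :: "'a::topological_space set \<Rightarrow> 'a measure set" where
  "point_measures S =
     {\<mu>. (\<exists>I p. p \<in> I \<rightarrow> S \<and> \<mu> = dirac_sum S I p) \<and>
         (\<forall>K. compact K \<and> K \<subseteq> S \<longrightarrow> emeasure \<mu> K < \<infinity>)}"

definition test_functions :: "'a::topological_space set \<Rightarrow> ('a \<Rightarrow> real) set" where
  "test_functions S =
     {f. continuous_on S f \<and> (\<exists>K. compact K \<and> K \<subseteq> S \<and> (\<forall>x\<in>S - K. f x = 0))}"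

text \<open>
  The coarsest topology on \<^term>\<open>point_measures S\<close> for which all the maps
  \<open>\<mu> \<mapsto> \<integral>f d\<mu>\<close> with \<open>f\<close> in \<^term>\<open>test_functions S\<close> are continuous.
\<close>

definition vague_topology :: "'a::topological_space set \<Rightarrow> 'a measure topology" where
  "vague_topology S = topology_generated_by
     {{\<mu> \<in> point_measures S. (\<integral>x. f x \<partial>\<mu>) \<in> U} | f U. f \<in> test_functions S \<and> open U}"

definition vague_borel :: "'a::topological_space set \<Rightarrow> 'a measure measure" where
  "vague_borel S = sigma (point_measures S) {U. openin (vague_topology S) U}"

section \<open>Point processes\<close>

definition point_process ::
    "'m measure \<Rightarrow> 'a::topological_space set \<Rightarrow> ('m \<Rightarrow> 'a measure) \<Rightarrow> bool" where
  "point_process M S N \<longleftrightarrow> prob_space M \<and> N \<in> M \<rightarrow>\<^sub>M vague_borel S"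

definition law ::
    "'m measure \<Rightarrow> 'a::topological_space set \<Rightarrow> ('m \<Rightarrow> 'a measure) \<Rightarrow> 'a measure measure" where
  "law M S N = distr M (vague_borel S) N"

definition push :: "'b::topological_space set \<Rightarrow> ('a \<Rightarrow> 'b) \<Rightarrow> 'a measure \<Rightarrow> 'b measure" where
  "push S g \<mu> = distr \<mu> (restrict_space borel S) g"

definition law_invariant ::
    "'m measure \<Rightarrow> 'a::topological_space set \<Rightarrow> ('m \<Rightarrow> 'a measure) \<Rightarrow> ('a \<Rightarrow> 'a) \<Rightarrow> bool" where
  "law_invariant M S N g \<longleftrightarrow>
     point_process M S (\<lambda>\<omega>. push S g (N \<omega>)) \<and> law M S (\<lambda>\<omega>. push S g (N \<omega>)) = law M S N"

definition weakly_converges ::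
    "'a::topological_space set \<Rightarrow> 'm measure \<Rightarrow> (real \<Rightarrow> 'm \<Rightarrow> 'a measure) \<Rightarrow>
     'p measure \<Rightarrow> ('p \<Rightarrow> 'a measure) \<Rightarrow> bool" where
  "weakly_converges S M N P R \<longleftrightarrow>
     (\<forall>\<^sub>F b in at_top. point_process M S (N b)) \<and> point_process P S R \<and>
     (\<forall>F. continuous_map (vague_topology S) euclideanreal F \<and>
          (\<exists>B. \<forall>\<mu>\<in>point_measures S. \<bar>F \<mu>\<bar> \<le> B) \<longrightarrow>
          ((\<lambda>b. \<integral>\<omega>. F (N b \<omega>) \<partial>M) \<longlongrightarrow> (\<integral>\<omega>. F (R \<omega>) \<partial>P)) at_top)"

abbreviation pos_reals :: "real set" where
  "pos_reals \<equiv> {0<..}"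

abbreviation pos_quadrant :: "(real \<times> real) set" where
  "pos_quadrant \<equiv> pos_reals \<times> pos_reals"

definition self_similar :: "'m measure \<Rightarrow> ('m \<Rightarrow> real measure) \<Rightarrow> bool" where
  "self_similar M N \<longleftrightarrow>
     point_process M pos_reals N \<and> (\<forall>c>0. law_invariant M pos_reals N (\<lambda>x. c * x))"

definition hyperbolic_shift :: "real \<Rightarrow> real \<times> real \<Rightarrow> real \<times> real" where
  "hyperbolic_shift b = (\<lambda>(s, t). (b * s, t / b))"

definition scaled_point :: "(nat \<Rightarrow> real ^ 'n) \<Rightarrow> real \<Rightarrow> nat \<Rightarrow> real \<times> real" where
  "scaled_point x b k = (b * chain_height x k, real (chain_index x k) / b)"

text \<open>
  For uniform samples, almost surely all record times are finite and all heights positive;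
  the restriction of the index set only matters on the exceptional null event.
\<close>

definition scaled_process :: "(nat \<Rightarrow> real ^ 'n) \<Rightarrow> real \<Rightarrow> (real \<times> real) measure" where
  "scaled_process x b = dirac_sum pos_quadrant
     {k. 1 \<le> k \<and> chain_time x k \<noteq> \<infinity> \<and> scaled_point x b k \<in> pos_quadrant} (scaled_point x b)"

end

theory Submission
  imports Defs
begin

text \<open>
  Given the current record \<open>r\<close>, the next one is uniform in the box below \<open>r\<close> and the
  waiting time is geometric with parameter \<open>height r\<close>. A uniform point has a height
  whose negative logarithm is a sum of \<open>d\<close> independent standard exponential variables, so
  the numbers \<open>- ln H\<^sub>k\<close> are every \<open>d\<close>-th point of a Poisson process on \<open>[0, \<infinity>)\<close>, and
  attaching an exponential mark to each point realises the geometric waiting times.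
  Scaling by \<open>b\<close> shifts the Poisson process by \<open>- ln b\<close>. By memorylessness this shifted
  process can be read off, for all \<open>b\<close> at once, from a two-sided Poisson process built
  from independent unit blocks; only the phase modulo \<open>d\<close> of the selected points depends
  on \<open>b\<close>. For a fixed phase the coupled point measures converge vaguely and almost
  surely, because geometric waiting times rescale to exponential ones, and the phase
  becomes uniform and independent of the blocks as \<open>b \<rightarrow> \<infinity>\<close>. The invariances then pass
  from the scaled processes to the limit.
\<close>

text \<open>The walk for \<open>b\<close> starts at \<open>- ln b\<close>, so a larger
  \<open>b\<close> means a start further to the left, while the picture in a fixed window should
  stay put. This is why the blocks are glued from right to left: from inside a window, whatever is
  prepended on the left is visible only through the time already elapsed and through a count of
  points modulo \<open>d\<close>. The elapsed time converges because a record at position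
  \<open>y\<close> contributes about \<open>exp y\<close>, which is summable over blocks receding to
  the left once the mass of a block has finite mean. The residue has no pathwise limit; it is frozen
  to a value \<open>r\<close>, convergence is proved for each \<open>r\<close>, and mixing is
  invoked only for expectations. The two coordinate projections are not continuous in the vague
  topology, because a strip over a compact set is not compact. The limit law is therefore built on
  the trace of the Borel sets on those measures whose projections are locally finite. There the
  projections are at least measurable, and this is enough to transport an invariance of
  laws.\<close>

section \<open>Point measures as sums of unit masses, and the vague topology\<close>

lemma space_dirac_sum [simp]: "space (dirac_sum S I p) = S"
  by (simp add: dirac_sum_def space_restrict_space)

lemma sets_dirac_sum [simp]: "sets (dirac_sum S I p) = sets (restrict_space borel S)"
  by (simp add: dirac_sum_def)

lemma emeasure_dirac_sum:
  assumes "p \<in> I \<rightarrow> S" "A \<in> sets (restrict_space borel S)"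
  shows "emeasure (dirac_sum S I p) A = emeasure (count_space I) {i\<in>I. p i \<in> A}"
proof -
  have "p -` A \<inter> I = {i\<in>I. p i \<in> A}" by auto
  then show ?thesis
    unfolding dirac_sum_def using assms
    by (subst emeasure_distr) (auto simp: space_restrict_space)
qed

lemma emeasure_dirac_sum_finite_iff:
  assumes "p \<in> I \<rightarrow> S" "A \<in> sets (restrict_space borel S)"
  shows "emeasure (dirac_sum S I p) A < \<infinity> \<longleftrightarrow> finite {i\<in>I. p i \<in> A}"
  using emeasure_dirac_sum[OF assms] by (simp add: emeasure_count_space of_nat_less_top)

lemma sets_restrict_compact:
  fixes K :: "'a::t2_space set"
  assumes "compact K" "K \<subseteq> S"
  shows "K \<in> sets (restrict_space borel S)"
  using assms by (auto simp: sets_restrict_space intro!: image_eqI[of _ _ K] compact_imp_closed borel_closed)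

lemma dirac_sum_in_point_measures:
  fixes S :: "'a::t2_space set"
  assumes "p \<in> I \<rightarrow> S" "\<And>K. compact K \<Longrightarrow> K \<subseteq> S \<Longrightarrow> finite {i\<in>I. p i \<in> K}"
  shows "dirac_sum S I p \<in> point_measures S"
proof -
  have "emeasure (dirac_sum S I p) K < \<infinity>" if "compact K" "K \<subseteq> S" for K
    using emeasure_dirac_sum_finite_iff[OF assms(1) sets_restrict_compact[OF that]] assms(2)[OF that]
    by simp
  then show ?thesis using assms(1) unfolding point_measures_def by blast
qed

lemma point_measuresE:
  fixes S :: "'a::t2_space set"
  assumes "\<mu> \<in> point_measures S"
  obtains I p where "p \<in> I \<rightarrow> S" "\<mu> = dirac_sum S I p"
    "\<And>K. compact K \<Longrightarrow> K \<subseteq> S \<Longrightarrow> finite {i\<in>I. p i \<in> K}"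
proof -
  from assms obtain I p where Ip: "p \<in> I \<rightarrow> S" "\<mu> = dirac_sum S I p"
    and fin: "\<forall>K. compact K \<and> K \<subseteq> S \<longrightarrow> emeasure \<mu> K < \<infinity>"
    unfolding point_measures_def by blast
  have "finite {i\<in>I. p i \<in> K}" if "compact K" "K \<subseteq> S" for K
    using emeasure_dirac_sum_finite_iff[OF Ip(1) sets_restrict_compact[OF that]] fin that Ip(2) by simp
  with Ip show ?thesis using that by blast
qed

lemma test_function_measurable:
  "f \<in> test_functions S \<Longrightarrow> f \<in> borel_measurable (restrict_space borel S)"
  unfolding test_functions_def by (auto intro: borel_measurable_continuous_on_restrict)

lemma integral_dirac_sum:
  fixes f :: "'a::topological_space \<Rightarrow> real"
  assumes "p \<in> I \<rightarrow> S" "f \<in> borel_measurable (restrict_space borel S)" "finite {i\<in>I. f (p i) \<noteq> 0}"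
  shows "(\<integral>x. f x \<partial>dirac_sum S I p) = (\<Sum>i | i \<in> I \<and> f (p i) \<noteq> 0. f (p i))"
proof -
  have "(\<integral>x. f x \<partial>dirac_sum S I p) = (\<integral>i. f (p i) \<partial>count_space I)"
    unfolding dirac_sum_def using assms(1,2) by (subst integral_distr) (auto simp: space_restrict_space)
  also have "\<dots> = (\<Sum>i | i \<in> I \<and> f (p i) \<noteq> 0. f (p i))"
    using assms(3) by (rule lebesgue_integral_count_space_finite_support)
  finally show ?thesis .
qed

lemma test_function_finite_support:
  fixes S :: "'a::t2_space set"
  assumes "f \<in> test_functions S" "p \<in> I \<rightarrow> S"
    "\<And>K. compact K \<Longrightarrow> K \<subseteq> S \<Longrightarrow> finite {i\<in>I. p i \<in> K}"
  shows "finite {i\<in>I. f (p i) \<noteq> 0}"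
proof -
  from assms(1) obtain K where K: "compact K" "K \<subseteq> S" "\<forall>x\<in>S - K. f x = 0"
    unfolding test_functions_def by blast
  have "{i\<in>I. f (p i) \<noteq> 0} \<subseteq> {i\<in>I. p i \<in> K}"
    using K assms(2) by fastforce
  then show ?thesis using assms(3)[OF K(1,2)] finite_subset by blast
qed

lemma integrable_test_function:
  fixes S :: "'a::t2_space set"
  assumes "\<mu> \<in> point_measures S" "f \<in> test_functions S"
  shows "integrable \<mu> f"
proof -
  obtain I p where Ip: "p \<in> I \<rightarrow> S" "\<mu> = dirac_sum S I p"
    "\<And>K. compact K \<Longrightarrow> K \<subseteq> S \<Longrightarrow> finite {i\<in>I. p i \<in> K}"
    using point_measuresE[OF assms(1)] by metis
  have "finite {i\<in>I. f (p i) \<noteq> 0}"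
    using test_function_finite_support[OF assms(2) Ip(1,3)] by blast
  then have "integrable (count_space I) (\<lambda>i. f (p i))"
    by (auto simp: integrable_iff_bounded nn_integral_count_space)
  then show ?thesis
    unfolding Ip(2) dirac_sum_def using Ip(1) test_function_measurable[OF assms(2)]
    by (subst integrable_distr_eq) (auto simp: space_restrict_space)
qed

lemma zero_test_function [simp]: "(\<lambda>x. 0) \<in> test_functions S"
  unfolding test_functions_def by (auto intro!: exI[of _ "{}"])

text \<open>The zero function with \<open>U = UNIV\<close> contributes the whole set to the
  generating family.\<close>

lemma topspace_vague [simp]: "topspace (vague_topology S) = point_measures S"
proof -
  let ?\<S> = "{{\<mu> \<in> point_measures S. (\<integral>x. f x \<partial>\<mu>) \<in> U} | f U. f \<in> test_functions S \<and> open U}"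
  have "point_measures S = {\<mu> \<in> point_measures S. (\<integral>x. 0 \<partial>\<mu>) \<in> (UNIV :: real set)}" by simp
  then have "point_measures S \<in> ?\<S>" using zero_test_function open_UNIV by blast
  then have "\<Union>?\<S> = point_measures S" by blast
  then show ?thesis
    unfolding vague_topology_def topology_generated_by_topspace .
qed

lemma openin_vague_subset: "openin (vague_topology S) U \<Longrightarrow> U \<subseteq> point_measures S"
  using openin_subset by fastforce

lemma space_vague_borel [simp]: "space (vague_borel S) = point_measures S"
  unfolding vague_borel_def by (rule space_measure_of) (auto dest: openin_vague_subset)

lemma sets_vague_borel:
  "sets (vague_borel S) = sigma_sets (point_measures S) {U. openin (vague_topology S) U}"
  unfolding vague_borel_def by (rule sets_measure_of) (auto dest: openin_vague_subset)

lemma sets_vague_borel_openin: "openin (vague_topology S) U \<Longrightarrow> U \<in> sets (vague_borel S)"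
  unfolding sets_vague_borel by auto

lemma openin_vague_basis:
  "f \<in> test_functions S \<Longrightarrow> open U \<Longrightarrow>
   openin (vague_topology S) {\<mu> \<in> point_measures S. (\<integral>x. f x \<partial>\<mu>) \<in> U}"
  unfolding vague_topology_def by (rule topology_generated_by_Basis) blast

lemma continuous_map_integral_vague:
  "f \<in> test_functions S \<Longrightarrow> continuous_map (vague_topology S) euclideanreal (\<lambda>\<mu>. \<integral>x. f x \<partial>\<mu>)"
  unfolding continuous_map_def by (auto intro: openin_vague_basis)

lemma continuous_map_vague_measurable:
  assumes "continuous_map (vague_topology S) euclideanreal F"
  shows "F \<in> borel_measurable (vague_borel S)"
proof (rule borel_measurableI)
  fix U :: "real set" assume "open U"
  then have "openin (vague_topology S) {\<mu> \<in> point_measures S. F \<mu> \<in> U}"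
    using assms unfolding continuous_map_def by auto
  moreover have "F -` U \<inter> space (vague_borel S) = {\<mu> \<in> point_measures S. F \<mu> \<in> U}" by auto
  ultimately show "F -` U \<inter> space (vague_borel S) \<in> sets (vague_borel S)"
    using sets_vague_borel_openin by metis
qed

text \<open>Only subbasic sets need a check, since \<open>eventually\<close> passes through finite
  intersections and arbitrary unions. The filter stays general because the limit is taken along real
  \<open>b\<close>.\<close>

lemma limitin_vague:
  assumes N: "eventually (\<lambda>b. N b \<in> point_measures S) F" and \<mu>: "\<mu> \<in> point_measures S"
    and lim: "\<And>f. f \<in> test_functions S \<Longrightarrow> ((\<lambda>b. \<integral>x. f x \<partial>N b) \<longlongrightarrow> (\<integral>x. f x \<partial>\<mu>)) F"
  shows "limitin (vague_topology S) N \<mu> F"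
  unfolding limitin_def
proof (intro conjI allI impI)
  show "\<mu> \<in> topspace (vague_topology S)" using \<mu> by simp
next
  fix W assume "openin (vague_topology S) W \<and> \<mu> \<in> W"
  then have W: "generate_topology_on {{\<mu> \<in> point_measures S. (\<integral>x. f x \<partial>\<mu>) \<in> U} | f U. f \<in> test_functions S \<and> open U} W"
    and "\<mu> \<in> W" unfolding vague_topology_def openin_topology_generated_by_iff by auto
  from W \<open>\<mu> \<in> W\<close> show "eventually (\<lambda>b. N b \<in> W) F"
  proof (induction rule: generate_topology_on.induct)
    case Empty then show ?case by simp
  next
    case (Int a b) then show ?case by (auto intro: eventually_conj)
  next
    case (UN K)
    then obtain k where "k \<in> K" "\<mu> \<in> k" by auto
    with UN have "eventually (\<lambda>b. N b \<in> k) F" by auto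
    then show ?case by eventually_elim (use \<open>k \<in> K\<close> in auto)
  next
    case (Basis s)
    then obtain f U where s: "s = {\<mu> \<in> point_measures S. (\<integral>x. f x \<partial>\<mu>) \<in> U}" "f \<in> test_functions S" "open U"
      by auto
    then have "eventually (\<lambda>b. (\<integral>x. f x \<partial>N b) \<in> U) F"
      using Basis lim[OF s(2)] topological_tendstoD by fastforce
    with N show ?case unfolding s by eventually_elim auto
  qed
qed

lemma limitin_continuous_map_tendsto:
  assumes "limitin X N \<mu> F" "continuous_map X euclideanreal G"
  shows "((\<lambda>b. G (N b)) \<longlongrightarrow> G \<mu>) F"
  using continuous_map_limit[OF assms(2,1)] by (simp add: comp_def)

lemma continuous_map_into_vague:
  assumes "T \<in> topspace X \<rightarrow> point_measures S"
    and "\<And>f. f \<in> test_functions S \<Longrightarrow> continuous_map X euclideanreal (\<lambda>x. \<integral>y. f y \<partial>T x)"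
  shows "continuous_map X (vague_topology S) T"
  unfolding vague_topology_def
proof (rule continuous_on_generated_topo)
  show "T ` topspace X \<subseteq> \<Union> {{\<mu> \<in> point_measures S. (\<integral>x. f x \<partial>\<mu>) \<in> U} |f U. f \<in> test_functions S \<and> open U}"
    using assms(1) topspace_vague[of S] unfolding vague_topology_def by (auto simp: Pi_def)
next
  fix W assume "W \<in> {{\<mu> \<in> point_measures S. (\<integral>x. f x \<partial>\<mu>) \<in> U} |f U. f \<in> test_functions S \<and> open U}"
  then obtain f U where W: "W = {\<mu> \<in> point_measures S. (\<integral>x. f x \<partial>\<mu>) \<in> U}" and f: "f \<in> test_functions S" and U: "open U"
    by blast
  have "T -` W \<inter> topspace X = {x \<in> topspace X. (\<integral>y. f y \<partial>T x) \<in> U}"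
    using assms(1) unfolding W by auto
  then show "openin X (T -` W \<inter> topspace X)"
    using assms(2)[OF f] U unfolding continuous_map_def by auto
qed

subsection \<open>Second countability of the vague topology\<close>

text \<open>A countable syntax for polynomials with rational coefficients, so that
  \<open>countable_datatype\<close> yields the countability of the approximating family at
  once.\<close>

datatype ratpoly = RConst rat | RVar nat | RAdd ratpoly ratpoly | RMul ratpoly ratpoly

instance ratpoly :: countable by countable_datatype

primrec reval :: "ratpoly \<Rightarrow> 'a::euclidean_space \<Rightarrow> real" where
  "reval (RConst c) x = of_rat c"
| "reval (RVar n) x = x \<bullet> from_nat_into Basis n"
| "reval (RAdd p q) x = reval p x + reval q x"
| "reval (RMul p q) x = reval p x * reval q x"

lemma continuous_on_reval [continuous_intros]: "continuous_on A (reval p)"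
proof (induction p)
  case (RConst c) then show ?case by simp
next
  case (RVar n) then show ?case by (simp add: continuous_intros)
next
  case (RAdd p q) then show ?case by (simp add: continuous_on_add)
next
  case (RMul p q) then show ?case by (simp add: continuous_on_mult)
qed

text \<open>Stone-Weierstrass asks for an algebra containing all real constants, which the rational
  polynomials are not. It is applied to their uniform closure on \<open>K\<close>, described by
  \<open>P\<close>; a second approximation then returns to a rational polynomial.\<close>

lemma ratpoly_dense:
  fixes f :: "'a::euclidean_space \<Rightarrow> real"
  assumes K: "compact K" and f: "continuous_on K f" and "0 < e"
  shows "\<exists>p. \<forall>x\<in>K. \<bar>f x - reval p x\<bar> < e"
proof -
  define P where "P g \<longleftrightarrow> continuous_on K g \<and> (\<forall>e>0. \<exists>p. \<forall>x\<in>K. \<bar>g x - reval p x\<bar> < e)"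
    for g :: "'a \<Rightarrow> real"
  have PD: "\<exists>p. \<forall>x\<in>K. \<bar>g x - reval p x\<bar> < e" if "P g" "e > 0" for g e
    using that unfolding P_def by blast
  have const: "P (\<lambda>x. c)" for c
    unfolding P_def
  proof (intro conjI allI impI)
    fix e :: real assume "0 < e"
    then have "c - e < c + e" by simp
    then obtain r where "c - e < of_rat r" "of_rat r < c + e" using of_rat_dense by blast
    then have "\<bar>c - of_rat r\<bar> < e" by linarith
    then show "\<exists>p. \<forall>x\<in>K. \<bar>c - reval p x\<bar> < e" by (intro exI[of _ "RConst r"]) auto
  qed auto
  have bdd: "\<exists>B>0. \<forall>x\<in>K. \<bar>g x\<bar> \<le> B" if "continuous_on K g" for g :: "'a \<Rightarrow> real"
    using compact_imp_bounded[OF compact_continuous_image[OF that K]]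
    unfolding bounded_pos by auto
  have add: "P (\<lambda>x. g x + h x)" if gh: "P g" "P h" for g h
    unfolding P_def
  proof (intro conjI allI impI)
    show "continuous_on K (\<lambda>x. g x + h x)" using gh unfolding P_def by (auto intro: continuous_intros)
    fix e :: real assume "0 < e"
    then obtain p q where p: "\<forall>x\<in>K. \<bar>g x - reval p x\<bar> < e / 2" and q: "\<forall>x\<in>K. \<bar>h x - reval q x\<bar> < e / 2"
      using PD[OF gh(1), of "e / 2"] PD[OF gh(2), of "e / 2"] by auto
    show "\<exists>p. \<forall>x\<in>K. \<bar>g x + h x - reval p x\<bar> < e"
    proof (intro exI[of _ "RAdd p q"] ballI)
      fix x assume "x \<in> K"
      then show "\<bar>g x + h x - reval (RAdd p q) x\<bar> < e"
        using p[rule_format, of x] q[rule_format, of x] unfolding reval.simps by linarith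
    qed
  qed
  have mult: "P (\<lambda>x. g x * h x)" if gh: "P g" "P h" for g h
    unfolding P_def
  proof (intro conjI allI impI)
    show "continuous_on K (\<lambda>x. g x * h x)" using gh unfolding P_def by (auto intro: continuous_intros)
    fix e :: real assume e: "0 < e"
    obtain B where B: "B > 0" "\<forall>x\<in>K. \<bar>g x\<bar> \<le> B" using bdd gh(1) unfolding P_def by blast
    obtain C where C: "C > 0" "\<forall>x\<in>K. \<bar>h x\<bar> \<le> C" using bdd gh(2) unfolding P_def by blast
    \<comment> \<open>Since \<open>\<epsilon> \<le> 1\<close>, the approximant of \<open>h\<close>
      is bounded by \<open>C + 1\<close>, and the error of the product is at most
      \<open>B * \<epsilon> + \<epsilon> * (C + 1)\<close>.\<close>
    define \<epsilon> where "\<epsilon> = min 1 (e / (B + C + 1))"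
    have "\<epsilon> \<le> e / (B + C + 1)" unfolding \<epsilon>_def by simp
    then have eps: "\<epsilon> > 0" "\<epsilon> \<le> 1" "\<epsilon> * (B + C + 1) \<le> e"
      using B(1) C(1) e by (auto simp: \<epsilon>_def le_divide_eq)
    obtain p q where p: "\<forall>x\<in>K. \<bar>g x - reval p x\<bar> < \<epsilon>" and q: "\<forall>x\<in>K. \<bar>h x - reval q x\<bar> < \<epsilon>"
      using PD[OF gh(1) eps(1)] PD[OF gh(2) eps(1)] by auto
    show "\<exists>p. \<forall>x\<in>K. \<bar>g x * h x - reval p x\<bar> < e"
    proof (intro exI[of _ "RMul p q"] ballI)
      fix x assume x: "x \<in> K"
      have "\<bar>reval q x\<bar> \<le> C + 1" using q[rule_format, OF x] C(2)[rule_format, OF x] eps(2) by linarith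
      have "g x * h x - reval p x * reval q x = g x * (h x - reval q x) + (g x - reval p x) * reval q x"
        by (simp add: algebra_simps)
      then have "\<bar>g x * h x - reval p x * reval q x\<bar> \<le> \<bar>g x\<bar> * \<bar>h x - reval q x\<bar> + \<bar>g x - reval p x\<bar> * \<bar>reval q x\<bar>"
        by (metis abs_mult abs_triangle_ineq)
      also have "\<dots> < B * \<epsilon> + \<epsilon> * (C + 1)"
      proof (rule add_le_less_mono)
        show "\<bar>g x\<bar> * \<bar>h x - reval q x\<bar> \<le> B * \<epsilon>"
          using B q x by (intro mult_mono) (auto simp: less_imp_le)
        have "\<bar>g x - reval p x\<bar> * \<bar>reval q x\<bar> \<le> \<bar>g x - reval p x\<bar> * (C + 1)"
          using \<open>\<bar>reval q x\<bar> \<le> C + 1\<close> by (intro mult_left_mono) auto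
        also have "\<dots> < \<epsilon> * (C + 1)" using p x C by (intro mult_strict_right_mono) auto
        finally show "\<bar>g x - reval p x\<bar> * \<bar>reval q x\<bar> < \<epsilon> * (C + 1)" .
      qed
      also have "\<dots> \<le> e" using eps(3) by (simp add: algebra_simps)
      finally show "\<bar>g x * h x - reval (RMul p q) x\<bar> < e" by simp
    qed
  qed
  have sep: "\<exists>f. P f \<and> f x \<noteq> f y" if "x \<noteq> y" for x y
  proof -
    from that obtain b where b: "b \<in> Basis" "x \<bullet> b \<noteq> y \<bullet> b" using euclidean_eq_iff by blast
    then obtain n where n: "from_nat_into Basis n = b"
      using from_nat_into_surj[of Basis b] countable_finite[OF finite_Basis] by blast
    have "P (\<lambda>x. x \<bullet> b)"
      unfolding P_def using n by (auto intro!: continuous_intros exI[of _ "RVar n"])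
    then show ?thesis using b by blast
  qed
  have "\<exists>g. P g \<and> (\<forall>x\<in>K. \<bar>f x - g x\<bar> < e / 2)"
    by (rule Stone_Weierstrass_HOL[OF K]) (use const add mult sep f \<open>0 < e\<close> P_def in auto)
  then obtain g where g: "P g" "\<forall>x\<in>K. \<bar>f x - g x\<bar> < e / 2" by blast
  then obtain p where p: "\<forall>x\<in>K. \<bar>g x - reval p x\<bar> < e / 2"
    using PD[of g "e / 2"] \<open>0 < e\<close> by auto
  have "\<bar>f x - reval p x\<bar> < e" if "x \<in> K" for x
    using g(2)[rule_format, OF that] p[rule_format, OF that] by linarith
  then show ?thesis by blast
qed

lemma cutoff_exists:
  fixes C D :: "'a::euclidean_space set"
  assumes "compact C" "C \<subseteq> interior D"
  obtains h :: "'a \<Rightarrow> real" where "continuous_on UNIV h" "\<And>x. 0 \<le> h x" "\<And>x. h x \<le> 1"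
    "\<And>x. x \<in> C \<Longrightarrow> h x = 1" "\<And>x. x \<notin> D \<Longrightarrow> h x = 0"
proof -
  have "C \<inter> - interior D = {}" using assms by blast
  then obtain h :: "'a \<Rightarrow> real" where h: "continuous_on UNIV h" "\<And>x. h x \<in> closed_segment 1 0"
    "\<And>x. x \<in> C \<Longrightarrow> h x = 1" "\<And>x. x \<in> - interior D \<Longrightarrow> h x = 0"
    using Urysohn[of C "- interior D" 1 0] assms(1) compact_imp_closed by (metis closed_Compl open_interior)
  moreover have "0 \<le> h x \<and> h x \<le> 1" for x
    using h(2)[of x] by (auto simp: closed_segment_eq_real_ivl)
  moreover have "x \<notin> D \<Longrightarrow> h x = 0" for x using h(4) interior_subset by blast
  ultimately show ?thesis using that by blast
qed

text \<open>In a compact exhaustion each set lies in the interior of the next, which leaves room for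
  a continuous function that is one on a set and zero off its successor. Every compact set is
  eventually swallowed by the exhaustion.\<close>

lemma cutoff_sequence_exists:
  fixes S :: "'a::euclidean_space set"
  assumes "open S"
  obtains h :: "nat \<Rightarrow> 'a \<Rightarrow> real" and D :: "nat \<Rightarrow> 'a set"
  where "\<And>n. continuous_on UNIV (h n)" "\<And>n x. 0 \<le> h n x" "\<And>n x. h n x \<le> 1"
    "\<And>n. compact (D n)" "\<And>n. D n \<subseteq> S" "\<And>n x. x \<notin> D n \<Longrightarrow> h n x = 0"
    "\<And>K. compact K \<Longrightarrow> K \<subseteq> S \<Longrightarrow> \<exists>N. \<forall>n\<ge>N. \<forall>x\<in>K. h n x = 1"
proof -
  obtain C where C: "\<And>n. compact(C n)" "\<And>n. C n \<subseteq> S" "\<And>n. C n \<subseteq> interior(C(Suc n))"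
    "\<Union>(range C) = S" "\<And>K. \<lbrakk>compact K; K \<subseteq> S\<rbrakk> \<Longrightarrow> \<exists>N. \<forall>n\<ge>N. K \<subseteq> (C n)"
    using open_Union_compact_subsets[OF assms] by metis
  have "\<exists>h :: 'a \<Rightarrow> real. continuous_on UNIV h \<and> (\<forall>x. 0 \<le> h x) \<and> (\<forall>x. h x \<le> 1) \<and>
    (\<forall>x \<in> C n. h x = 1) \<and> (\<forall>x. x \<notin> C (Suc n) \<longrightarrow> h x = 0)" for n
    using cutoff_exists[OF C(1) C(3), of n] by metis
  then obtain h :: "nat \<Rightarrow> 'a \<Rightarrow> real" where h: "\<And>n. continuous_on UNIV (h n) \<and> (\<forall>x. 0 \<le> h n x) \<and> (\<forall>x. h n x \<le> 1) \<and>
    (\<forall>x \<in> C n. h n x = 1) \<and> (\<forall>x. x \<notin> C (Suc n) \<longrightarrow> h n x = 0)" by metis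
  show ?thesis
  proof (rule that[of h "\<lambda>n. C (Suc n)"])
    fix K assume "compact K" "K \<subseteq> S"
    then obtain N where "\<forall>n\<ge>N. K \<subseteq> C n" using C(5) by blast
    then show "\<exists>N. \<forall>n\<ge>N. \<forall>x\<in>K. h n x = 1" using h by blast
  qed (use h C in auto)
qed

text \<open>Uniform closeness alone would not control integrals, since a point measure may have
  infinite total mass. The error is therefore measured by a multiple of a test function
  \<open>h\<close>, whose integral is finite; multiplying a rational polynomial by a cutoff produces
  exactly this kind of error.\<close>

lemma countable_test_functions:
  fixes S :: "'a::euclidean_space set"
  assumes "open S"
  obtains \<F> where "countable \<F>" "\<F> \<subseteq> test_functions S"
    "\<And>f. f \<in> test_functions S \<Longrightarrow> \<exists>h\<in>\<F>. \<forall>e>0. \<exists>g\<in>\<F>. \<forall>x\<in>S. \<bar>f x - g x\<bar> \<le> e * h x"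
proof -
  obtain h :: "nat \<Rightarrow> 'a \<Rightarrow> real" and D where h: "\<And>n. continuous_on UNIV (h n)" "\<And>n x. 0 \<le> h n x" "\<And>n x. h n x \<le> 1"
    "\<And>n. compact (D n)" "\<And>n. D n \<subseteq> S" "\<And>n x. x \<notin> D n \<Longrightarrow> h n x = 0"
    "\<And>K. compact K \<Longrightarrow> K \<subseteq> S \<Longrightarrow> \<exists>N. \<forall>n\<ge>N. \<forall>x\<in>K. h n x = 1"
    using cutoff_sequence_exists[OF assms] by blast
  define \<F> where "\<F> = range h \<union> range (\<lambda>(n, p). (\<lambda>x. reval p x * h n x))"
  show ?thesis
  proof (rule that)
    show "countable \<F>" unfolding \<F>_def by auto
    show "\<F> \<subseteq> test_functions S"
    proof
      fix f assume "f \<in> \<F>"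
      then have "\<exists>n. continuous_on S f \<and> (\<forall>x. x \<notin> D n \<longrightarrow> f x = 0)"
      proof (unfold \<F>_def, elim UnE rangeE)
        fix n assume "f = h n" then show ?thesis using h(6) continuous_on_subset[OF h(1)] by blast
      next
        fix np assume f: "f = (case np of (n, p) \<Rightarrow> \<lambda>x. reval p x * h n x)"
        obtain n p where "np = (n, p)" by force
        then have "f = (\<lambda>x. reval p x * h n x)" using f by simp
        then show ?thesis using h(6) continuous_on_subset[OF h(1), of S n]
          by (intro exI[of _ n]) (auto intro!: continuous_intros)
      qed
      then obtain n where "continuous_on S f" "\<forall>x. x \<notin> D n \<longrightarrow> f x = 0" by blast
      then show "f \<in> test_functions S"
        unfolding test_functions_def using h(4,5) by blast
    qed
    fix f assume f: "f \<in> test_functions S"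
    then obtain K where K: "continuous_on S f" "compact K" "K \<subseteq> S" "\<forall>x\<in>S - K. f x = 0"
      unfolding test_functions_def by blast
    obtain n where n: "\<forall>x\<in>K. h n x = 1" using h(7)[OF K(2,3)] by auto
    have eq: "f x = f x * h n x" if "x \<in> S" for x using K n that by (cases "x \<in> K") auto
    show "\<exists>h\<in>\<F>. \<forall>e>0. \<exists>g\<in>\<F>. \<forall>x\<in>S. \<bar>f x - g x\<bar> \<le> e * h x"
    proof (rule bexI[of _ "h n"], intro allI impI)
      show "h n \<in> \<F>" unfolding \<F>_def by auto
      fix e :: real assume "0 < e"
      then obtain p where p: "\<forall>x\<in>D n. \<bar>f x - reval p x\<bar> < e"
        using ratpoly_dense[OF h(4) continuous_on_subset[OF K(1) h(5)]] by metis
      have in_F: "(\<lambda>x. reval p x * h n x) \<in> \<F>" unfolding \<F>_def by auto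
      have "\<forall>x\<in>S. \<bar>f x - reval p x * h n x\<bar> \<le> e * h n x"
      proof
        fix x assume x: "x \<in> S"
        have "\<bar>f x - reval p x * h n x\<bar> = \<bar>f x - reval p x\<bar> * h n x"
          using eq[OF x] h(2)[of n x] by (metis abs_mult abs_of_nonneg left_diff_distrib)
        also have "\<dots> \<le> e * h n x"
          using p h(6)[of x n] h(2)[of n x] by (cases "x \<in> D n") (auto intro!: mult_right_mono simp: less_imp_le)
        finally show "\<bar>f x - reval p x * h n x\<bar> \<le> e * h n x" .
      qed
      then show "\<exists>g\<in>\<F>. \<forall>x\<in>S. \<bar>f x - g x\<bar> \<le> e * h n x" by (rule bexI[OF _ in_F])
    qed
  qed
qed

text \<open>Around \<open>\<mu>\<close>, one subbasic set keeps the integral of the envelope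
  \<open>h\<close> bounded, and another pins the integral of a member \<open>g\<close> of the
  countable family close to \<open>f\<close>. Together they pin the integral of
  \<open>f\<close>.\<close>

lemma vague_countable_subbasis:
  fixes S :: "'a::euclidean_space set"
  assumes "open S"
  obtains \<B> where "countable \<B>"
    "\<And>B. B \<in> \<B> \<Longrightarrow> \<exists>f U. f \<in> test_functions S \<and> open U \<and> B = {\<mu> \<in> point_measures S. (\<integral>x. f x \<partial>\<mu>) \<in> U}"
    "\<And>W \<mu>. openin (vague_topology S) W \<Longrightarrow> \<mu> \<in> W \<Longrightarrow>
       \<exists>\<A>. finite \<A> \<and> \<A> \<subseteq> \<B> \<and> \<mu> \<in> point_measures S \<inter> \<Inter>\<A> \<and> point_measures S \<inter> \<Inter>\<A> \<subseteq> W"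
proof -
  obtain \<F> where \<F>: "countable \<F>" "\<F> \<subseteq> test_functions S"
    "\<And>f. f \<in> test_functions S \<Longrightarrow> \<exists>h\<in>\<F>. \<forall>e>0. \<exists>g\<in>\<F>. \<forall>x\<in>S. \<bar>f x - g x\<bar> \<le> e * h x"
    using countable_test_functions[OF assms] by blast
  obtain \<U> :: "real set set" where \<U>: "countable \<U>" "topological_basis \<U>"
    using ex_countable_basis by blast
  define Bf where "Bf = (\<lambda>(f :: 'a \<Rightarrow> real, U). {\<mu> \<in> point_measures S. (\<integral>x. f x \<partial>\<mu>) \<in> U} :: 'a measure set)"
  define \<B> where "\<B> = Bf ` (\<F> \<times> \<U>)"
  have nbhd: "\<exists>B\<in>\<B>. \<mu> \<in> B \<and> (\<forall>\<nu>\<in>B. \<bar>(\<integral>x. g x \<partial>\<nu>) - (\<integral>x. g x \<partial>\<mu>)\<bar> < e)"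
    if "g \<in> \<F>" "\<mu> \<in> point_measures S" "0 < e" for g \<mu> and e :: real
  proof -
    have "open (ball (\<integral>x. g x \<partial>\<mu>) e)" "(\<integral>x. g x \<partial>\<mu>) \<in> ball (\<integral>x. g x \<partial>\<mu>) e" using that by auto
    then obtain U where U: "U \<in> \<U>" "(\<integral>x. g x \<partial>\<mu>) \<in> U" "U \<subseteq> ball (\<integral>x. g x \<partial>\<mu>) e"
      using topological_basisE[OF \<U>(2)] by metis
    have "Bf (g, U) \<in> \<B>" using U that unfolding \<B>_def by auto
    moreover have "\<mu> \<in> Bf (g, U)" using U that unfolding Bf_def by auto
    moreover have "\<bar>(\<integral>x. g x \<partial>\<nu>) - (\<integral>x. g x \<partial>\<mu>)\<bar> < e" if "\<nu> \<in> Bf (g, U)" for \<nu>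
    proof -
      have "(\<integral>x. g x \<partial>\<nu>) \<in> ball (\<integral>x. g x \<partial>\<mu>) e" using that U(3) unfolding Bf_def by auto
      then show ?thesis by (simp add: dist_real_def abs_minus_commute)
    qed
    ultimately show ?thesis by blast
  qed
  show ?thesis
  proof (rule that[of \<B>])
    show "countable \<B>" unfolding \<B>_def using \<F>(1) \<U>(1) by auto
    show "\<exists>f U. f \<in> test_functions S \<and> open U \<and> B = {\<mu> \<in> point_measures S. (\<integral>x. f x \<partial>\<mu>) \<in> U}" if "B \<in> \<B>" for B
      using that \<F>(2) topological_basis_open[OF \<U>(2)] unfolding \<B>_def Bf_def by fastforce
    fix W \<mu> assume "openin (vague_topology S) W" and \<mu>W: "\<mu> \<in> W"
    then have \<mu>: "\<mu> \<in> point_measures S" using openin_vague_subset by blast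
    have "generate_topology_on {{\<mu> \<in> point_measures S. (\<integral>x. f x \<partial>\<mu>) \<in> U} | f U. f \<in> test_functions S \<and> open U} W"
      using \<open>openin (vague_topology S) W\<close> unfolding vague_topology_def openin_topology_generated_by_iff .
    from this \<mu>W show "\<exists>\<A>. finite \<A> \<and> \<A> \<subseteq> \<B> \<and> \<mu> \<in> point_measures S \<inter> \<Inter>\<A> \<and> point_measures S \<inter> \<Inter>\<A> \<subseteq> W"
    proof (induction rule: generate_topology_on.induct)
      case Empty then show ?case by simp
    next
      case (Int a b)
      then obtain \<A> \<A>' where "finite \<A> \<and> \<A> \<subseteq> \<B> \<and> \<mu> \<in> point_measures S \<inter> \<Inter>\<A> \<and> point_measures S \<inter> \<Inter>\<A> \<subseteq> a"
        "finite \<A>' \<and> \<A>' \<subseteq> \<B> \<and> \<mu> \<in> point_measures S \<inter> \<Inter>\<A>' \<and> point_measures S \<inter> \<Inter>\<A>' \<subseteq> b"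
        by auto
      then show ?case by (intro exI[of _ "\<A> \<union> \<A>'"]) auto
    next
      case (UN K)
      then obtain k where k: "k \<in> K" "\<mu> \<in> k" by auto
      with UN obtain \<A> where "finite \<A> \<and> \<A> \<subseteq> \<B> \<and> \<mu> \<in> point_measures S \<inter> \<Inter>\<A> \<and> point_measures S \<inter> \<Inter>\<A> \<subseteq> k"
        by meson
      then show ?case using k by (intro exI[of _ \<A>]) auto
    next
      case (Basis s)
      then obtain f U where s: "s = {\<mu> \<in> point_measures S. (\<integral>x. f x \<partial>\<mu>) \<in> U}"
        and f: "f \<in> test_functions S" and U: "open U" by auto
      then have "(\<integral>x. f x \<partial>\<mu>) \<in> U" using Basis by auto
      then obtain e where e: "0 < e" "ball (\<integral>x. f x \<partial>\<mu>) e \<subseteq> U" using U open_contains_ball by blast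
      obtain h where h: "h \<in> \<F>" "\<And>e. e > 0 \<Longrightarrow> \<exists>g\<in>\<F>. \<forall>x\<in>S. \<bar>f x - g x\<bar> \<le> e * h x"
        using \<F>(3)[OF f] by blast
      \<comment> \<open>\<open>H\<close> bounds the integral of \<open>h\<close> at
        \<open>\<mu>\<close> and on all of \<open>B1\<close>. With
        \<open>\<delta> * H = e / 4\<close>, two approximation errors and the variation of the
        integral of \<open>g\<close> stay below \<open>3 * e / 4\<close>.\<close>
      define H where "H = \<bar>\<integral>x. h x \<partial>\<mu>\<bar> + 1"
      define \<delta> where "\<delta> = e / (4 * H)"
      have H: "H > 0" unfolding H_def by auto
      then have \<delta>: "\<delta> > 0" "\<delta> * H = e / 4" using e(1) unfolding \<delta>_def by auto
      obtain g where g: "g \<in> \<F>" "\<forall>x\<in>S. \<bar>f x - g x\<bar> \<le> \<delta> * h x" using h(2)[OF \<delta>(1)] by blast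
      have diff: "\<bar>(\<integral>x. f x \<partial>\<nu>) - (\<integral>x. g x \<partial>\<nu>)\<bar> \<le> \<delta> * (\<integral>x. h x \<partial>\<nu>)" if \<nu>: "\<nu> \<in> point_measures S" for \<nu>
      proof -
        have i: "integrable \<nu> f" "integrable \<nu> g" "integrable \<nu> h"
          using integrable_test_function[OF \<nu>] f g(1) h(1) \<F>(2) by auto
        have sp: "space \<nu> = S" using \<nu> by (auto elim!: point_measuresE)
        have "\<bar>(\<integral>x. f x \<partial>\<nu>) - (\<integral>x. g x \<partial>\<nu>)\<bar> = \<bar>\<integral>x. f x - g x \<partial>\<nu>\<bar>" using i by simp
        also have "\<dots> \<le> (\<integral>x. \<bar>f x - g x\<bar> \<partial>\<nu>)" by (rule integral_abs_bound)
        also have "\<dots> \<le> (\<integral>x. \<delta> * h x \<partial>\<nu>)"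
          using i g(2) sp by (intro integral_mono) auto
        finally show ?thesis by simp
      qed
      obtain B1 where B1: "B1 \<in> \<B>" "\<mu> \<in> B1" "\<forall>\<nu>\<in>B1. \<bar>(\<integral>x. h x \<partial>\<nu>) - (\<integral>x. h x \<partial>\<mu>)\<bar> < 1"
        using nbhd[OF h(1) \<mu>, of 1] by auto
      obtain B2 where B2: "B2 \<in> \<B>" "\<mu> \<in> B2" "\<forall>\<nu>\<in>B2. \<bar>(\<integral>x. g x \<partial>\<nu>) - (\<integral>x. g x \<partial>\<mu>)\<bar> < e / 4"
        using nbhd[OF g(1) \<mu>, of "e / 4"] e(1) by auto
      have sub: "point_measures S \<inter> \<Inter>{B1, B2} \<subseteq> s"
      proof
        fix \<nu> assume \<nu>: "\<nu> \<in> point_measures S \<inter> \<Inter>{B1, B2}"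
        have le: "\<delta> * (\<integral>x. h x \<partial>\<kappa>) \<le> e / 4" if "(\<integral>x. h x \<partial>\<kappa>) \<le> H" for \<kappa>
          using mult_left_mono[OF that, of \<delta>] \<delta> by simp
        have "\<bar>(\<integral>x. h x \<partial>\<nu>) - (\<integral>x. h x \<partial>\<mu>)\<bar> < 1" using B1(3) \<nu> by auto
        then have "(\<integral>x. h x \<partial>\<nu>) \<le> H" "(\<integral>x. h x \<partial>\<mu>) \<le> H" unfolding H_def by linarith+
        then have "\<bar>(\<integral>x. f x \<partial>\<nu>) - (\<integral>x. g x \<partial>\<nu>)\<bar> \<le> e / 4"
          "\<bar>(\<integral>x. f x \<partial>\<mu>) - (\<integral>x. g x \<partial>\<mu>)\<bar> \<le> e / 4"
          using diff[of \<nu>] diff[OF \<mu>] le[of \<nu>] le[of \<mu>] \<nu> by (meson IntE order_trans)+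
        moreover have "\<bar>(\<integral>x. g x \<partial>\<nu>) - (\<integral>x. g x \<partial>\<mu>)\<bar> < e / 4" using B2(3) \<nu> by auto
        ultimately have "\<bar>(\<integral>x. f x \<partial>\<nu>) - (\<integral>x. f x \<partial>\<mu>)\<bar> < e" by linarith
        then have "(\<integral>x. f x \<partial>\<nu>) \<in> ball (\<integral>x. f x \<partial>\<mu>) e" by (simp add: dist_real_def abs_minus_commute)
        then show "\<nu> \<in> s" using e(2) \<nu> unfolding s by auto
      qed
      show ?case using sub B1 B2 \<mu> by (intro exI[of _ "{B1, B2}"]) auto
    qed
  qed
qed

lemma vague_open_eq_UN:
  assumes "\<And>\<mu>. \<mu> \<in> W \<Longrightarrow> \<exists>\<A>. finite \<A> \<and> \<A> \<subseteq> \<B> \<and> \<mu> \<in> X \<inter> \<Inter>\<A> \<and> X \<inter> \<Inter>\<A> \<subseteq> W"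
  shows "W = (\<Union>\<A>\<in>{\<A>. finite \<A> \<and> \<A> \<subseteq> \<B> \<and> X \<inter> \<Inter>\<A> \<subseteq> W}. X \<inter> \<Inter>\<A>)"
proof
  show "W \<subseteq> (\<Union>\<A>\<in>{\<A>. finite \<A> \<and> \<A> \<subseteq> \<B> \<and> X \<inter> \<Inter>\<A> \<subseteq> W}. X \<inter> \<Inter>\<A>)"
  proof
    fix \<mu> assume "\<mu> \<in> W"
    from assms[OF this] obtain \<A> where "finite \<A> \<and> \<A> \<subseteq> \<B> \<and> \<mu> \<in> X \<inter> \<Inter>\<A> \<and> X \<inter> \<Inter>\<A> \<subseteq> W" ..
    then show "\<mu> \<in> (\<Union>\<A>\<in>{\<A>. finite \<A> \<and> \<A> \<subseteq> \<B> \<and> X \<inter> \<Inter>\<A> \<subseteq> W}. X \<inter> \<Inter>\<A>)"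
      by (intro UN_I[of \<A>]) auto
  qed
qed auto

text \<open>The sigma-algebra is generated by all open sets, not just by the test integrals. Second
  countability bridges the gap: an open set is a countable union of finite intersections of subbasic
  sets.\<close>

lemma measurable_vague_borelI:
  fixes S :: "'a::euclidean_space set"
  assumes S: "open S" and N: "\<And>\<omega>. \<omega> \<in> space M \<Longrightarrow> N \<omega> \<in> point_measures S"
    and meas: "\<And>f. f \<in> test_functions S \<Longrightarrow> (\<lambda>\<omega>. \<integral>x. f x \<partial>N \<omega>) \<in> borel_measurable M"
  shows "N \<in> M \<rightarrow>\<^sub>M vague_borel S"
proof (rule measurable_sigma_sets[OF sets_vague_borel])
  obtain \<B> where \<B>: "countable \<B>"
    "\<And>B. B \<in> \<B> \<Longrightarrow> \<exists>f U. f \<in> test_functions S \<and> open U \<and> B = {\<mu> \<in> point_measures S. (\<integral>x. f x \<partial>\<mu>) \<in> U}"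
    "\<And>W \<mu>. openin (vague_topology S) W \<Longrightarrow> \<mu> \<in> W \<Longrightarrow>
       \<exists>\<A>. finite \<A> \<and> \<A> \<subseteq> \<B> \<and> \<mu> \<in> point_measures S \<inter> \<Inter>\<A> \<and> point_measures S \<inter> \<Inter>\<A> \<subseteq> W"
    using vague_countable_subbasis[OF S] by blast
  show "{U. openin (vague_topology S) U} \<subseteq> Pow (point_measures S)" using openin_vague_subset by auto
  show "N \<in> space M \<rightarrow> point_measures S" using N by auto
  have B: "N -` B \<inter> space M \<in> sets M" if "B \<in> \<B>" for B
  proof -
    obtain f U where fU: "f \<in> test_functions S" "open U" "B = {\<mu> \<in> point_measures S. (\<integral>x. f x \<partial>\<mu>) \<in> U}"
      using \<B>(2)[OF \<open>B \<in> \<B>\<close>] by blast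
    have "N -` B \<inter> space M = (\<lambda>\<omega>. \<integral>x. f x \<partial>N \<omega>) -` U \<inter> space M" using N fU(3) by auto
    then show ?thesis using meas[OF fU(1)] fU(2) measurable_sets by (metis borel_open)
  qed
  fix W assume "W \<in> {U. openin (vague_topology S) U}"
  then have W: "openin (vague_topology S) W" by simp
  define \<C> where "\<C> = {\<A>. finite \<A> \<and> \<A> \<subseteq> \<B> \<and> point_measures S \<inter> \<Inter>\<A> \<subseteq> W}"
  have "countable \<C>"
    by (rule countable_subset[OF _ countable_Collect_finite_subset[OF \<B>(1)]]) (auto simp: \<C>_def)
  have "W = (\<Union>\<A>\<in>\<C>. point_measures S \<inter> \<Inter>\<A>)"
    unfolding \<C>_def by (rule vague_open_eq_UN[OF \<B>(3)[OF W]])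
  then have "N -` W \<inter> space M = (\<Union>\<A>\<in>\<C>. N -` (point_measures S \<inter> \<Inter>\<A>) \<inter> space M)" by auto
  also have "\<dots> \<in> sets M"
  proof (rule sets.countable_UN''[OF \<open>countable \<C>\<close>])
    fix \<A> assume "\<A> \<in> \<C>"
    then have fin: "finite \<A>" "\<A> \<subseteq> \<B>" unfolding \<C>_def by auto
    have "N -` (point_measures S \<inter> \<Inter>\<A>) \<inter> space M = {\<omega> \<in> space M. \<forall>B\<in>\<A>. \<omega> \<in> N -` B \<inter> space M}" using N by auto
    also have "\<dots> \<in> sets M"
    proof (rule sets.sets_Collect_finite_All)
      fix B assume "B \<in> \<A>"
      then have "N -` B \<inter> space M \<in> sets M" using B fin by blast
      moreover have "{\<omega> \<in> space M. \<omega> \<in> N -` B \<inter> space M} = N -` B \<inter> space M" by auto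
      ultimately show "{\<omega> \<in> space M. \<omega> \<in> N -` B \<inter> space M} \<in> sets M" by simp
    qed fact
    finally show "N -` (point_measures S \<inter> \<Inter>\<A>) \<inter> space M \<in> sets M" .
  qed
  finally show "N -` W \<inter> space M \<in> sets M" .
qed

lemma measurable_integral_vague:
  "f \<in> test_functions S \<Longrightarrow> (\<lambda>\<mu>. \<integral>x. f x \<partial>\<mu>) \<in> borel_measurable (vague_borel S)"
  by (intro continuous_map_vague_measurable continuous_map_integral_vague)

text \<open>Bounded continuous functions increase to the indicators of open sets.\<close>

lemma law_eqI:
  fixes S :: "'a::euclidean_space set"
  assumes S: "open S" and "prob_space P" "prob_space Q"
    and sets: "sets P = sets (vague_borel S)" "sets Q = sets (vague_borel S)"
    and eq: "\<And>F. continuous_map (vague_topology S) euclideanreal F \<Longrightarrow> (\<exists>B. \<forall>\<mu>\<in>point_measures S. \<bar>F \<mu>\<bar> \<le> B) \<Longrightarrow>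
       (\<integral>\<mu>. F \<mu> \<partial>P) = (\<integral>\<mu>. F \<mu> \<partial>Q)"
  shows "P = Q"
proof -
  interpret P: prob_space P by fact
  interpret Q: prob_space Q by fact
  have sp: "space P = point_measures S" "space Q = point_measures S"
    using sets_eq_imp_space_eq[OF sets(1)] sets_eq_imp_space_eq[OF sets(2)] by simp_all
  obtain \<B> where \<B>: "countable \<B>"
    "\<And>B. B \<in> \<B> \<Longrightarrow> \<exists>f U. f \<in> test_functions S \<and> open U \<and> B = {\<mu> \<in> point_measures S. (\<integral>x. f x \<partial>\<mu>) \<in> U}"
    "\<And>W \<mu>. openin (vague_topology S) W \<Longrightarrow> \<mu> \<in> W \<Longrightarrow>
       \<exists>\<A>. finite \<A> \<and> \<A> \<subseteq> \<B> \<and> \<mu> \<in> point_measures S \<inter> \<Inter>\<A> \<and> point_measures S \<inter> \<Inter>\<A> \<subseteq> W"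
    using vague_countable_subbasis[OF S] by blast
  \<comment> \<open>Finite intersections of the countable subbasis form a pi-system that contains
    the whole space and generates the Borel sets, so two probability measures need only be compared
    there.\<close>
  define E where "E = {W. \<exists>\<A>. finite \<A> \<and> \<A> \<subseteq> \<B> \<and> W = point_measures S \<inter> \<Inter>\<A>}"
  have E_sub: "E \<subseteq> Pow (point_measures S)" unfolding E_def by auto
  have Bopen: "openin (vague_topology S) B" if "B \<in> \<B>" for B
    using \<B>(2)[OF that] openin_vague_basis by blast
  have E_meas: "W \<in> sets (vague_borel S)" if W: "W \<in> E" for W
  proof -
    obtain \<A> where "finite \<A>" "\<A> \<subseteq> \<B>" "W = point_measures S \<inter> \<Inter>\<A>" using W unfolding E_def by blast
    have "openin (vague_topology S) (point_measures S \<inter> \<Inter>\<A>)" if "finite \<A>" "\<A> \<subseteq> \<B>" for \<A>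
      using that
    proof (induction \<A> rule: finite_induct)
      case empty show ?case using openin_topspace[of "vague_topology S"] by simp
    next
      case (insert B \<A>)
      then have "openin (vague_topology S) B" "openin (vague_topology S) (point_measures S \<inter> \<Inter>\<A>)"
        using Bopen by auto
      then have "openin (vague_topology S) (B \<inter> (point_measures S \<inter> \<Inter>\<A>))" by (rule openin_Int)
      then show ?case by (simp add: Int_left_commute)
    qed
    then have "openin (vague_topology S) W"
      using \<open>finite \<A>\<close> \<open>\<A> \<subseteq> \<B>\<close> \<open>W = _\<close> by simp
    then show ?thesis by (rule sets_vague_borel_openin)
  qed
  have gen: "sets (vague_borel S) = sigma_sets (point_measures S) E"
  proof
    show "sigma_sets (point_measures S) E \<subseteq> sets (vague_borel S)"
      using sets.sigma_sets_subset[of E "vague_borel S"] E_meas by auto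
    interpret sg: sigma_algebra "point_measures S" "sigma_sets (point_measures S) E"
      by (rule sigma_algebra_sigma_sets[OF E_sub])
    have "W \<in> sigma_sets (point_measures S) E" if W: "openin (vague_topology S) W" for W
    proof -
      define \<C> where "\<C> = {\<A>. finite \<A> \<and> \<A> \<subseteq> \<B> \<and> point_measures S \<inter> \<Inter>\<A> \<subseteq> W}"
      have "countable \<C>"
        by (rule countable_subset[OF _ countable_Collect_finite_subset[OF \<B>(1)]]) (auto simp: \<C>_def)
      moreover have "W = (\<Union>\<A>\<in>\<C>. point_measures S \<inter> \<Inter>\<A>)"
        unfolding \<C>_def by (rule vague_open_eq_UN[OF \<B>(3)[OF W]])
      moreover have "point_measures S \<inter> \<Inter>\<A> \<in> sigma_sets (point_measures S) E" if "\<A> \<in> \<C>" for \<A>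
        using that unfolding \<C>_def E_def by (intro sigma_sets.Basic) auto
      ultimately show ?thesis by (metis (no_types, lifting) sg.countable_UN'' )
    qed
    then show "sets (vague_borel S) \<subseteq> sigma_sets (point_measures S) E"
      unfolding sets_vague_borel by (intro sigma_sets_mono) auto
  qed
  show ?thesis
  proof (rule measure_eqI_generator_eq[of E "point_measures S" P Q "\<lambda>_. point_measures S"])
    show "Int_stable E"
    proof (rule Int_stableI)
      fix a b assume "a \<in> E" "b \<in> E"
      then obtain \<A> \<A>' where "finite \<A>" "\<A> \<subseteq> \<B>" "a = point_measures S \<inter> \<Inter>\<A>"
        "finite \<A>'" "\<A>' \<subseteq> \<B>" "b = point_measures S \<inter> \<Inter>\<A>'" unfolding E_def by blast
      then show "a \<inter> b \<in> E" unfolding E_def by (auto intro!: exI[of _ "\<A> \<union> \<A>'"])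
    qed
    show "range (\<lambda>_::nat. point_measures S) \<subseteq> E"
      unfolding E_def by (auto intro!: exI[of _ "{}"])
    show "sets P = sigma_sets (point_measures S) E" "sets Q = sigma_sets (point_measures S) E"
      using sets gen by auto
    fix W assume "W \<in> E"
    then obtain \<A> where \<A>: "finite \<A>" "\<A> \<subseteq> \<B>" "W = point_measures S \<inter> \<Inter>\<A>" unfolding E_def by blast
    have W[measurable]: "W \<in> sets (vague_borel S)" using E_meas[OF \<open>W \<in> E\<close>] .
    obtain f U where *: "\<And>B. B \<in> \<B> \<Longrightarrow> f B \<in> test_functions S \<and> open (U B) \<and>
        B = {\<mu> \<in> point_measures S. (\<integral>x. f B x \<partial>\<mu>) \<in> U B}"
      using \<B>(2) by metis
    have fU: "f B \<in> test_functions S" "open (U B)"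
      "\<mu> \<in> point_measures S \<Longrightarrow> indicator (U B) (\<integral>x. f B x \<partial>\<mu>) = (indicator B \<mu> :: real)" if "B \<in> \<B>" for B \<mu>
      using *[OF that] by (simp, simp) (smt (verit) *[OF that] indicator_def mem_Collect_eq)
    \<comment> \<open>\<^term>\<open>infdist x {}\<close> is \<open>0\<close>, hence the case distinction.\<close>
    define \<phi> where "\<phi> n V x = (if V = UNIV then 1 else min 1 (real n * infdist x (- V)))" for n and V :: "real set" and x
    have \<phi>_cont: "continuous_on UNIV (\<phi> n V)" for n V
      unfolding \<phi>_def by (cases "V = UNIV") (auto intro!: continuous_intros)
    have \<phi>_01: "0 \<le> \<phi> n V x" "\<phi> n V x \<le> 1" for n V x
      unfolding \<phi>_def by (auto simp: infdist_nonneg)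
    have \<phi>_lim: "(\<lambda>n. \<phi> n V x) \<longlonglongrightarrow> indicator V x" if "open V" for V x
    proof (cases "V = UNIV \<or> x \<notin> V")
      case True then show ?thesis
        unfolding \<phi>_def by (cases "V = UNIV") (auto simp: infdist_zero)
    next
      case False
      then have "infdist x (- V) > 0"
        using that in_closed_iff_infdist_zero[of "- V" x] infdist_nonneg[of x "- V"] by (auto simp: less_le)
      then obtain k where k: "1 \<le> real k * infdist x (- V)"
        by (metis less_imp_le reals_Archimedean3)
      have "eventually (\<lambda>n. \<phi> n V x = 1) sequentially"
      proof (rule eventually_sequentiallyI[of k])
        fix n assume "k \<le> n"
        then have "real k * infdist x (- V) \<le> real n * infdist x (- V)"
          by (intro mult_right_mono) (auto simp: infdist_nonneg)
        then show "\<phi> n V x = 1" using k unfolding \<phi>_def by auto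
      qed
      then show ?thesis using False by (simp add: tendsto_eventually)
    qed
    \<comment> \<open>A finite product of continuous functions with values in \<open>[0, 1]\<close>:
      it is an admissible functional and tends pointwise to the indicator of the intersection
      \<open>W\<close>.\<close>
    define F where "F n \<mu> = (\<Prod>B\<in>\<A>. \<phi> n (U B) (\<integral>x. f B x \<partial>\<mu>))" for n and \<mu> :: "'a measure"
    have F_cont: "continuous_map (vague_topology S) euclideanreal (F n)" for n
      unfolding F_def
    proof (rule continuous_map_prod[OF \<A>(1)])
      fix B assume "B \<in> \<A>"
      then have "continuous_map (vague_topology S) euclideanreal (\<lambda>\<mu>. \<integral>x. f B x \<partial>\<mu>)"
        using fU(1) \<A>(2) by (intro continuous_map_integral_vague) blast
      moreover have "continuous_map euclideanreal euclideanreal (\<phi> n (U B))" using \<phi>_cont by simp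
      ultimately show "continuous_map (vague_topology S) euclideanreal (\<lambda>\<mu>. \<phi> n (U B) (\<integral>x. f B x \<partial>\<mu>))"
        by (rule continuous_map_compose[unfolded comp_def])
    qed
    have F_01: "\<bar>F n \<mu>\<bar> \<le> 1" for n \<mu>
      unfolding F_def using \<phi>_01 by (auto simp: abs_prod intro!: prod_le_1)
    have F_lim: "(\<lambda>n. F n \<mu>) \<longlonglongrightarrow> indicator W \<mu>" if "\<mu> \<in> point_measures S" for \<mu>
    proof -
      have "(\<lambda>n. F n \<mu>) \<longlonglongrightarrow> (\<Prod>B\<in>\<A>. indicator (U B) (\<integral>x. f B x \<partial>\<mu>))"
        unfolding F_def using fU(2) \<A>(2) by (intro tendsto_prod \<phi>_lim) blast
      also have "(\<Prod>B\<in>\<A>. indicator (U B) (\<integral>x. f B x \<partial>\<mu>)) = (\<Prod>B\<in>\<A>. indicator B \<mu> :: real)"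
        using fU(3) \<A>(2) that by (intro prod.cong refl) blast
      also have "\<dots> = indicator W \<mu>"
        unfolding \<A>(3) using \<A>(1) that by (auto simp: indicator_def prod_zero_iff)
      finally show ?thesis .
    qed
    have *: "(\<lambda>n. \<integral>\<mu>. F n \<mu> \<partial>R) \<longlonglongrightarrow> measure R W" if "prob_space R" "sets R = sets (vague_borel S)" for R
    proof -
      interpret R: prob_space R by fact
      have spR: "space R = point_measures S" using sets_eq_imp_space_eq[OF that(2)] by simp
      have "(\<lambda>n. \<integral>\<mu>. F n \<mu> \<partial>R) \<longlonglongrightarrow> (\<integral>\<mu>. indicator W \<mu> \<partial>R)"
      proof (rule integral_dominated_convergence[where w = "\<lambda>_. 1"])
        show "F n \<in> borel_measurable R" for n
          using continuous_map_vague_measurable[OF F_cont] that(2) measurable_cong_sets by blast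
        show "indicator W \<in> borel_measurable R" using W that(2) by simp
      qed (use F_lim F_01 spR in auto)
      then show ?thesis using W that(2) by simp
    qed
    have "measure P W = measure Q W"
    proof (rule LIMSEQ_unique)
      show "(\<lambda>n. \<integral>\<mu>. F n \<mu> \<partial>P) \<longlonglongrightarrow> measure P W" by (rule *[OF \<open>prob_space P\<close> sets(1)])
      have "(\<integral>\<mu>. F n \<mu> \<partial>P) = (\<integral>\<mu>. F n \<mu> \<partial>Q)" for n
        using F_01 by (intro eq[OF F_cont] exI[of _ 1]) blast
      then show "(\<lambda>n. \<integral>\<mu>. F n \<mu> \<partial>P) \<longlonglongrightarrow> measure Q W"
        using *[OF \<open>prob_space Q\<close> sets(2)] by simp
    qed
    then show "emeasure P W = emeasure Q W"
      by (simp add: P.emeasure_eq_measure Q.emeasure_eq_measure)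
  qed (use E_sub in auto)
qed

section \<open>Measurability of random point measures\<close>

text \<open>The open sets \<open>S\<close> and \<open>- K\<close> cover the space, and the extension
  is \<open>f\<close> on the first and zero on the second. Total functions make the later sums over
  points free of side conditions.\<close>

lemma zero_extension_continuous:
  fixes S :: "'a::t2_space set"
  assumes "open S" "f \<in> test_functions S"
  shows "continuous_on UNIV (\<lambda>x. if x \<in> S then f x else 0)"
proof -
  obtain K where K: "continuous_on S f" "compact K" "K \<subseteq> S" "\<forall>x\<in>S - K. f x = 0"
    using assms(2) unfolding test_functions_def by blast
  have "continuous_on (S \<union> - K) (\<lambda>x. if x \<in> S then f x else 0)"
  proof (rule continuous_on_open_Un)
    show "open S" "open (- K)" using assms(1) K(2) by (auto intro: compact_imp_closed)
    show "continuous_on S (\<lambda>x. if x \<in> S then f x else 0)"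
      using K(1) by (rule continuous_on_eq) auto
    show "continuous_on (- K) (\<lambda>x. if x \<in> S then f x else 0)"
      by (rule continuous_on_eq[of _ "\<lambda>x. 0"]) (use K in auto)
  qed
  moreover have "S \<union> - K = UNIV" using K by blast
  ultimately show ?thesis by simp
qed

text \<open>Written as a series over all of \<open>nat\<close>, with membership in the index set
  moved into the summand, the integral depends measurably on a random index set and random
  points.\<close>

lemma integral_dirac_sum_suminf:
  fixes S :: "'a::t2_space set"
  assumes p: "p \<in> I \<rightarrow> S" and fin: "\<And>K. compact K \<Longrightarrow> K \<subseteq> S \<Longrightarrow> finite {i\<in>I. p i \<in> K}"
    and f: "f \<in> test_functions S"
  shows "(\<integral>x. f x \<partial>dirac_sum S I p) = (\<Sum>i. if i \<in> I then f (p i) else 0)"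
proof -
  have fs: "finite {i\<in>I. f (p i) \<noteq> 0}" by (rule test_function_finite_support[OF f p fin])
  then have "(\<integral>x. f x \<partial>dirac_sum S I p) = (\<Sum>i | i \<in> I \<and> f (p i) \<noteq> 0. f (p i))"
    by (intro integral_dirac_sum p test_function_measurable f)
  also have "\<dots> = (\<Sum>i | i \<in> I \<and> f (p i) \<noteq> 0. if i \<in> I then f (p i) else 0)"
    by (rule sum.cong) auto
  also have "\<dots> = (\<Sum>i. if i \<in> I then f (p i) else 0)"
    using fs by (intro suminf_finite[symmetric]) auto
  finally show ?thesis .
qed

lemma measurable_dirac_sum:
  fixes S :: "'a::euclidean_space set"
  assumes S: "open S"
    and p: "\<And>\<omega> i. \<omega> \<in> space M \<Longrightarrow> i \<in> I \<omega> \<Longrightarrow> p \<omega> i \<in> S"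
    and fin: "\<And>\<omega> K. \<omega> \<in> space M \<Longrightarrow> compact K \<Longrightarrow> K \<subseteq> S \<Longrightarrow> finite {i\<in>I \<omega>. p \<omega> i \<in> K}"
    and [measurable]: "\<And>i. Measurable.pred M (\<lambda>\<omega>. i \<in> I \<omega>)" "\<And>i. (\<lambda>\<omega>. p \<omega> i) \<in> borel_measurable M"
  shows "(\<lambda>\<omega>. dirac_sum S (I \<omega>) (p \<omega>)) \<in> M \<rightarrow>\<^sub>M vague_borel S"
proof (rule measurable_vague_borelI[OF S])
  show "dirac_sum S (I \<omega>) (p \<omega>) \<in> point_measures S" if "\<omega> \<in> space M" for \<omega>
    using p fin that by (intro dirac_sum_in_point_measures) auto
  fix f assume f: "f \<in> test_functions S"
  have [measurable]: "(\<lambda>x. if x \<in> S then f x else 0) \<in> borel_measurable borel"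
    using zero_extension_continuous[OF S f] by (rule borel_measurable_continuous_onI)
  have "(\<integral>x. f x \<partial>dirac_sum S (I \<omega>) (p \<omega>)) = (\<Sum>i. if i \<in> I \<omega> then (if p \<omega> i \<in> S then f (p \<omega> i) else 0) else 0)"
    if "\<omega> \<in> space M" for \<omega>
  proof -
    have "(\<integral>x. f x \<partial>dirac_sum S (I \<omega>) (p \<omega>)) = (\<Sum>i. if i \<in> I \<omega> then f (p \<omega> i) else 0)"
      using p fin that f by (intro integral_dirac_sum_suminf) auto
    also have "\<dots> = (\<Sum>i. if i \<in> I \<omega> then (if p \<omega> i \<in> S then f (p \<omega> i) else 0) else 0)"
      using p[OF that] by (intro suminf_cong) auto
    finally show ?thesis .
  qed
  moreover have "(\<lambda>\<omega>. \<Sum>i. if i \<in> I \<omega> then (if p \<omega> i \<in> S then f (p \<omega> i) else 0) else 0) \<in> borel_measurable M"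
  proof (rule borel_measurable_suminf)
    fix i
    have "(\<lambda>\<omega>. (\<lambda>x. if x \<in> S then f x else 0) (p \<omega> i)) \<in> borel_measurable M" by measurable
    then have [measurable]: "(\<lambda>\<omega>. if p \<omega> i \<in> S then f (p \<omega> i) else 0) \<in> borel_measurable M" .
    show "(\<lambda>\<omega>. if i \<in> I \<omega> then (if p \<omega> i \<in> S then f (p \<omega> i) else 0) else 0) \<in> borel_measurable M" by measurable
  qed
  ultimately show "(\<lambda>\<omega>. \<integral>x. f x \<partial>dirac_sum S (I \<omega>) (p \<omega>)) \<in> borel_measurable M"
    by (simp cong: measurable_cong)
qed

section \<open>Reindexing and images of point measures\<close>

lemma dirac_sum_cong:
  assumes "I = J" "\<And>i. i \<in> J \<Longrightarrow> p i = q i"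
  shows "dirac_sum S I p = dirac_sum S J q"
  unfolding dirac_sum_def assms(1) by (rule distr_cong) (simp_all add: assms(2))

lemma dirac_sum_reindex:
  assumes "bij_betw h J I" "p \<in> I \<rightarrow> S"
  shows "dirac_sum S I p = dirac_sum S J (p \<circ> h)"
proof -
  have "dirac_sum S I p = distr (distr (count_space J) (count_space I) h) (restrict_space borel S) p"
    unfolding dirac_sum_def distr_bij_count_space[OF assms(1)] ..
  also have "\<dots> = dirac_sum S J (p \<circ> h)"
    unfolding dirac_sum_def using assms
    by (intro distr_distr) (auto simp: space_restrict_space bij_betw_def)
  finally show ?thesis .
qed

lemma measurable_restrict_borel_continuous:
  assumes "continuous_on S g" "g \<in> S \<rightarrow> S'"
  shows "g \<in> restrict_space borel S \<rightarrow>\<^sub>M restrict_space borel S'"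
  using borel_measurable_continuous_on_restrict[OF assms(1)] assms(2)
  by (intro measurable_restrict_space2) (auto simp: space_restrict_space)

lemma push_dirac_sum:
  assumes "continuous_on S g" "g \<in> S \<rightarrow> S'" "p \<in> I \<rightarrow> S"
  shows "push S' g (dirac_sum S I p) = dirac_sum S' I (g \<circ> p)"
  unfolding push_def dirac_sum_def
  using assms by (intro distr_distr measurable_restrict_borel_continuous) (auto simp: space_restrict_space)

lemma sets_point_measure: "\<mu> \<in> point_measures S \<Longrightarrow> sets \<mu> = sets (restrict_space borel S)"
  unfolding point_measures_def by auto

lemma measurable_point_measure:
  assumes "\<mu> \<in> point_measures S" "f \<in> restrict_space borel S \<rightarrow>\<^sub>M N"
  shows "f \<in> \<mu> \<rightarrow>\<^sub>M N"
proof -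
  have "measurable \<mu> N = measurable (restrict_space borel S) N"
    by (rule measurable_cong_sets[OF sets_point_measure[OF assms(1)] refl])
  with assms(2) show ?thesis by blast
qed

lemma integral_push:
  fixes f :: "'b::topological_space \<Rightarrow> real"
  assumes "\<mu> \<in> point_measures S" "continuous_on S g" "g \<in> S \<rightarrow> S'" "f \<in> test_functions S'"
  shows "(\<integral>x. f x \<partial>push S' g \<mu>) = (\<integral>x. f (g x) \<partial>\<mu>)"
  unfolding push_def using assms
  by (intro integral_distr measurable_point_measure[OF assms(1)] measurable_restrict_borel_continuous test_function_measurable)

lemma integrable_push_iff:
  fixes f :: "'b::topological_space \<Rightarrow> real"
  assumes "\<mu> \<in> point_measures S" "continuous_on S g" "g \<in> S \<rightarrow> S'" "f \<in> test_functions S'"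
  shows "integrable (push S' g \<mu>) f \<longleftrightarrow> integrable \<mu> (\<lambda>x. f (g x))"
  unfolding push_def using assms
  by (intro integrable_distr_eq measurable_point_measure[OF assms(1)] measurable_restrict_borel_continuous test_function_measurable)

text \<open>The continuous left inverse \<open>k\<close> makes \<open>g\<close> proper: points
  mapped into a compact \<open>K\<close> lie in the compact image of \<open>K\<close> under
  \<open>k\<close>. The coordinate projections have no such inverse and are treated
  separately.\<close>

lemma push_in_point_measures:
  fixes S :: "'a::t2_space set" and S' :: "'b::t2_space set"
  assumes "\<mu> \<in> point_measures S" "continuous_on S g" "g \<in> S \<rightarrow> S'"
    "continuous_on S' k" "k \<in> S' \<rightarrow> S" "\<And>x. x \<in> S \<Longrightarrow> k (g x) = x"
  shows "push S' g \<mu> \<in> point_measures S'"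
proof -
  obtain I p where Ip: "p \<in> I \<rightarrow> S" "\<mu> = dirac_sum S I p"
    "\<And>K. compact K \<Longrightarrow> K \<subseteq> S \<Longrightarrow> finite {i\<in>I. p i \<in> K}"
    using point_measuresE[OF assms(1)] by metis
  show ?thesis
    unfolding Ip(2) push_dirac_sum[OF assms(2,3) Ip(1)]
  proof (rule dirac_sum_in_point_measures)
    show "g \<circ> p \<in> I \<rightarrow> S'" using Ip(1) assms(3) by auto
    fix K assume K: "compact K" "K \<subseteq> S'"
    have "compact (k ` K)" "k ` K \<subseteq> S"
      using K assms(5) compact_continuous_image[OF continuous_on_subset[OF assms(4) K(2)] K(1)] by auto
    then have "finite {i\<in>I. p i \<in> k ` K}" by (rule Ip(3))
    moreover have "{i\<in>I. (g \<circ> p) i \<in> K} \<subseteq> {i\<in>I. p i \<in> k ` K}"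
      using assms(6) Ip(1) by (auto simp: image_iff) (metis Pi_mem)
    ultimately show "finite {i\<in>I. (g \<circ> p) i \<in> K}" by (rule finite_subset[rotated])
  qed
qed

lemma test_function_compose:
  fixes S :: "'a::t2_space set" and S' :: "'b::t2_space set"
  assumes "f \<in> test_functions S'" "continuous_on S g" "g \<in> S \<rightarrow> S'"
    "continuous_on S' k" "k \<in> S' \<rightarrow> S" "\<And>x. x \<in> S \<Longrightarrow> k (g x) = x"
  shows "(\<lambda>x. f (g x)) \<in> test_functions S"
proof -
  obtain K where K: "continuous_on S' f" "compact K" "K \<subseteq> S'" "\<forall>x\<in>S' - K. f x = 0"
    using assms(1) unfolding test_functions_def by blast
  have "continuous_on S (\<lambda>x. f (g x))"
    using continuous_on_compose2[OF K(1) assms(2)] assms(3) by blast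
  moreover have "compact (k ` K)" "k ` K \<subseteq> S"
    using K assms(5) compact_continuous_image[OF continuous_on_subset[OF assms(4) K(3)] K(2)] by auto
  moreover have "f (g x) = 0" if "x \<in> S - k ` K" for x
  proof -
    have "g x \<notin> K" using that assms(6)[of x] by (metis DiffD1 DiffD2 image_eqI)
    then show ?thesis using K(4) assms(3) that by auto
  qed
  ultimately show ?thesis unfolding test_functions_def by blast
qed

lemma continuous_map_push:
  fixes S :: "'a::t2_space set" and S' :: "'b::t2_space set"
  assumes "continuous_on S g" "g \<in> S \<rightarrow> S'"
    "continuous_on S' k" "k \<in> S' \<rightarrow> S" "\<And>x. x \<in> S \<Longrightarrow> k (g x) = x"
  shows "continuous_map (vague_topology S) (vague_topology S') (push S' g)"
proof (rule continuous_map_into_vague)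
  show "push S' g \<in> topspace (vague_topology S) \<rightarrow> point_measures S'"
    using push_in_point_measures[OF _ assms] by simp
  fix f assume f: "f \<in> test_functions S'"
  have "continuous_map (vague_topology S) euclideanreal (\<lambda>\<mu>. \<integral>x. f (g x) \<partial>\<mu>)"
    by (rule continuous_map_integral_vague[OF test_function_compose[OF f assms]])
  then show "continuous_map (vague_topology S) euclideanreal (\<lambda>\<mu>. \<integral>y. f y \<partial>push S' g \<mu>)"
    by (rule continuous_map_eq) (simp add: integral_push[OF _ assms(1,2) f])
qed

lemma continuous_map_vague_measurable_map:
  assumes "continuous_map (vague_topology S) (vague_topology S') T"
  shows "T \<in> vague_borel S \<rightarrow>\<^sub>M vague_borel S'"
proof (rule measurable_sigma_sets[OF sets_vague_borel])
  show "{U. openin (vague_topology S') U} \<subseteq> Pow (point_measures S')" using openin_vague_subset by auto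
  show "T \<in> space (vague_borel S) \<rightarrow> point_measures S'"
    using assms by (auto simp: continuous_map_def)
  fix W assume "W \<in> {U. openin (vague_topology S') U}"
  then have "openin (vague_topology S) {\<mu> \<in> point_measures S. T \<mu> \<in> W}"
    using assms by (auto simp: continuous_map_def)
  moreover have "T -` W \<inter> space (vague_borel S) = {\<mu> \<in> point_measures S. T \<mu> \<in> W}" by auto
  ultimately show "T -` W \<inter> space (vague_borel S) \<in> sets (vague_borel S)"
    using sets_vague_borel_openin by metis
qed

section \<open>Hyperbolic shifts, scalings and coordinate projections\<close>

lemma open_pos_quadrant [simp]: "open pos_quadrant"
  by (intro open_Times open_greaterThan)

lemma hyperbolic_shift_maps:
  assumes "0 < c"
  shows "continuous_on pos_quadrant (hyperbolic_shift c)"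
    "hyperbolic_shift c \<in> pos_quadrant \<rightarrow> pos_quadrant"
    "continuous_on pos_quadrant (hyperbolic_shift (1 / c))"
    "hyperbolic_shift (1 / c) \<in> pos_quadrant \<rightarrow> pos_quadrant"
    "\<And>x. x \<in> pos_quadrant \<Longrightarrow> hyperbolic_shift (1 / c) (hyperbolic_shift c x) = x"
  using assms by (auto simp: hyperbolic_shift_def case_prod_unfold intro!: continuous_intros)

lemma scaling_maps:
  assumes "0 < (c::real)"
  shows "continuous_on pos_reals (\<lambda>x. c * x)" "(\<lambda>x. c * x) \<in> pos_reals \<rightarrow> pos_reals"
    "continuous_on pos_reals (\<lambda>x. (1 / c) * x)" "(\<lambda>x. (1 / c) * x) \<in> pos_reals \<rightarrow> pos_reals"
    "\<And>x. x \<in> pos_reals \<Longrightarrow> (1 / c) * (c * x) = x"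
  using assms by (auto intro!: continuous_intros)

text \<open>A locally finite measure on the quadrant may have infinitely many points over a compact
  set of first or second coordinates. The projections are point measures only on this smaller
  set.\<close>

definition projectable :: "(real \<times> real) measure set" where
  "projectable = {\<mu> \<in> point_measures pos_quadrant.
     push pos_reals fst \<mu> \<in> point_measures pos_reals \<and> push pos_reals snd \<mu> \<in> point_measures pos_reals}"

lemma fst_snd_maps:
  "continuous_on pos_quadrant (fst :: real \<times> real \<Rightarrow> real)" "fst \<in> pos_quadrant \<rightarrow> pos_reals"
  "continuous_on pos_quadrant (snd :: real \<times> real \<Rightarrow> real)" "snd \<in> pos_quadrant \<rightarrow> pos_reals"
  by (auto intro!: continuous_intros)

lemma dirac_sum_projectable:
  assumes p: "p \<in> I \<rightarrow> pos_quadrant"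
    and fin: "\<And>K. compact K \<Longrightarrow> K \<subseteq> pos_reals \<Longrightarrow> finite {i\<in>I. fst (p i) \<in> K}"
      "\<And>K. compact K \<Longrightarrow> K \<subseteq> pos_reals \<Longrightarrow> finite {i\<in>I. snd (p i) \<in> K}"
  shows "dirac_sum pos_quadrant I p \<in> projectable"
proof -
  have "dirac_sum pos_quadrant I p \<in> point_measures pos_quadrant"
  proof (rule dirac_sum_in_point_measures[OF p])
    fix K :: "(real \<times> real) set" assume K: "compact K" "K \<subseteq> pos_quadrant"
    then have "compact (fst ` K)" "fst ` K \<subseteq> pos_reals"
      using compact_continuous_image[OF continuous_on_fst[OF continuous_on_id] K(1)] by auto
    then have "finite {i\<in>I. fst (p i) \<in> fst ` K}" by (rule fin(1))
    then show "finite {i\<in>I. p i \<in> K}" by (rule finite_subset[rotated]) auto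
  qed
  moreover have "push pos_reals fst (dirac_sum pos_quadrant I p) \<in> point_measures pos_reals"
    unfolding push_dirac_sum[OF fst_snd_maps(1,2) p]
  proof (rule dirac_sum_in_point_measures)
    show "fst \<circ> p \<in> I \<rightarrow> pos_reals"
    proof
      fix i assume "i \<in> I"
      from Pi_mem[OF p this] show "(fst \<circ> p) i \<in> pos_reals" by (auto simp: mem_Times_iff)
    qed
  qed (use fin(1) in simp)
  moreover have "push pos_reals snd (dirac_sum pos_quadrant I p) \<in> point_measures pos_reals"
    unfolding push_dirac_sum[OF fst_snd_maps(3,4) p]
  proof (rule dirac_sum_in_point_measures)
    show "snd \<circ> p \<in> I \<rightarrow> pos_reals"
    proof
      fix i assume "i \<in> I"
      from Pi_mem[OF p this] show "(snd \<circ> p) i \<in> pos_reals" by (auto simp: mem_Times_iff)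
    qed
  qed (use fin(2) in simp)
  ultimately show ?thesis unfolding projectable_def by blast
qed

text \<open>
  Integrals against the projected measure are limits of integrals against the original
  one, cutting off the coordinate that is projected away.
\<close>

lemma measurable_push_projection:
  fixes u v :: "real \<times> real \<Rightarrow> real"
  assumes uv: "continuous_on pos_quadrant u" "u \<in> pos_quadrant \<rightarrow> pos_reals"
    "continuous_on pos_quadrant v" "v \<in> pos_quadrant \<rightarrow> pos_reals"
    and proper: "\<And>K L. compact K \<Longrightarrow> compact L \<Longrightarrow> K \<subseteq> pos_reals \<Longrightarrow> L \<subseteq> pos_reals \<Longrightarrow>
       compact {x \<in> pos_quadrant. u x \<in> K \<and> v x \<in> L}"
    and G: "G \<subseteq> {\<mu> \<in> point_measures pos_quadrant. push pos_reals u \<mu> \<in> point_measures pos_reals}"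
  shows "push pos_reals u \<in> restrict_space (vague_borel pos_quadrant) G \<rightarrow>\<^sub>M vague_borel pos_reals"
proof (rule measurable_vague_borelI[OF open_greaterThan])
  show "push pos_reals u \<mu> \<in> point_measures pos_reals" if "\<mu> \<in> space (restrict_space (vague_borel pos_quadrant) G)" for \<mu>
    using that G by (auto simp: space_restrict_space)
  fix f assume f: "f \<in> test_functions pos_reals"
  then obtain K where K: "continuous_on pos_reals f" "compact K" "K \<subseteq> pos_reals" "\<forall>x\<in>pos_reals - K. f x = 0"
    unfolding test_functions_def by blast
  obtain h :: "nat \<Rightarrow> real \<Rightarrow> real" and D where h: "\<And>n. continuous_on UNIV (h n)" "\<And>n x. 0 \<le> h n x" "\<And>n x. h n x \<le> 1"
    "\<And>n. compact (D n)" "\<And>n. D n \<subseteq> pos_reals" "\<And>n x. x \<notin> D n \<Longrightarrow> h n x = 0"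
    "\<And>K. compact K \<Longrightarrow> K \<subseteq> pos_reals \<Longrightarrow> \<exists>N. \<forall>n\<ge>N. \<forall>x\<in>K. h n x = 1"
    by (rule cutoff_sequence_exists[OF open_greaterThan[of "0 :: real"]]) blast
  have test: "(\<lambda>x. f (u x) * h n (v x)) \<in> test_functions pos_quadrant" for n
    unfolding test_functions_def mem_Collect_eq
  proof (intro conjI exI)
    show "continuous_on pos_quadrant (\<lambda>x. f (u x) * h n (v x))"
      using uv(2) by (intro continuous_on_mult continuous_on_compose2[OF K(1) uv(1)] continuous_on_compose2[OF h(1) uv(3)]) auto
    show "compact {x \<in> pos_quadrant. u x \<in> K \<and> v x \<in> D n}" by (rule proper[OF K(2) h(4) K(3) h(5)])
    show "\<forall>x\<in>pos_quadrant - {x \<in> pos_quadrant. u x \<in> K \<and> v x \<in> D n}. f (u x) * h n (v x) = 0"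
    proof
      fix x assume x: "x \<in> pos_quadrant - {x \<in> pos_quadrant. u x \<in> K \<and> v x \<in> D n}"
      then have "u x \<notin> K \<or> v x \<notin> D n" by blast
      then show "f (u x) * h n (v x) = 0"
      proof
        assume "u x \<notin> K"
        moreover have "u x \<in> pos_reals" using x uv(2) by blast
        ultimately show ?thesis using K(4) by auto
      qed (simp add: h(6))
    qed
  qed auto
  show "(\<lambda>\<mu>. \<integral>x. f x \<partial>push pos_reals u \<mu>) \<in> borel_measurable (restrict_space (vague_borel pos_quadrant) G)"
  proof (rule borel_measurable_LIMSEQ_real)
    show "(\<lambda>\<mu>. \<integral>x. f (u x) * h n (v x) \<partial>\<mu>) \<in> borel_measurable (restrict_space (vague_borel pos_quadrant) G)" for n
      by (intro measurable_restrict_space1 measurable_integral_vague test)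
    fix \<mu> assume "\<mu> \<in> space (restrict_space (vague_borel pos_quadrant) G)"
    then have \<mu>: "\<mu> \<in> point_measures pos_quadrant" "push pos_reals u \<mu> \<in> point_measures pos_reals"
      using G by (auto simp: space_restrict_space)
    have sp: "space \<mu> = pos_quadrant" using \<mu>(1) by (auto elim!: point_measuresE)
    \<comment> \<open>Membership in \<open>G\<close> enters here. The projected measure is locally
      finite, so \<open>f\<close> composed with \<open>u\<close> is integrable although its support
      in the quadrant need not be compact; its absolute value then dominates all the cut-off
      integrands.\<close>
    have int: "integrable \<mu> (\<lambda>x. f (u x))"
      using integrable_test_function[OF \<mu>(2) f] integrable_push_iff[OF \<mu>(1) uv(1,2) f] by blast
    have "(\<lambda>n. \<integral>x. f (u x) * h n (v x) \<partial>\<mu>) \<longlonglongrightarrow> (\<integral>x. f (u x) \<partial>\<mu>)"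
    proof (rule integral_dominated_convergence[where w = "\<lambda>x. \<bar>f (u x)\<bar>"])
      show "(\<lambda>x. f (u x)) \<in> borel_measurable \<mu>" using int by auto
      show "(\<lambda>x. f (u x) * h n (v x)) \<in> borel_measurable \<mu>" for n
        using integrable_test_function[OF \<mu>(1) test[of n]] by auto
      show "integrable \<mu> (\<lambda>x. \<bar>f (u x)\<bar>)" using int by auto
      show "AE x in \<mu>. norm (f (u x) * h n (v x)) \<le> \<bar>f (u x)\<bar>" for n
        using h(2,3) by (auto simp: abs_mult mult_left_le)
      show "AE x in \<mu>. (\<lambda>n. f (u x) * h n (v x)) \<longlonglongrightarrow> f (u x)"
      proof (rule AE_I2)
        fix x assume "x \<in> space \<mu>"
        then have "{v x} \<subseteq> pos_reals" using uv(4) sp by auto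
        then obtain N where N: "\<forall>n\<ge>N. h n (v x) = 1" using h(7)[of "{v x}"] by auto
        then have "eventually (\<lambda>n. f (u x) * h n (v x) = f (u x)) sequentially"
          by (intro eventually_sequentiallyI[of N]) auto
        then show "(\<lambda>n. f (u x) * h n (v x)) \<longlonglongrightarrow> f (u x)" by (rule tendsto_eventually)
      qed
    qed
    then show "(\<lambda>n. \<integral>x. f (u x) * h n (v x) \<partial>\<mu>) \<longlonglongrightarrow> (\<integral>x. f x \<partial>push pos_reals u \<mu>)"
      unfolding integral_push[OF \<mu>(1) uv(1,2) f] .
  qed
qed

lemma measurable_push_fst_snd:
  "push pos_reals fst \<in> restrict_space (vague_borel pos_quadrant) projectable \<rightarrow>\<^sub>M vague_borel pos_reals"
  "push pos_reals snd \<in> restrict_space (vague_borel pos_quadrant) projectable \<rightarrow>\<^sub>M vague_borel pos_reals"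
proof -
  have *: "{x \<in> pos_quadrant. fst x \<in> K \<and> snd x \<in> L} = K \<times> L" "{x \<in> pos_quadrant. snd x \<in> K \<and> fst x \<in> L} = L \<times> K"
    if "K \<subseteq> pos_reals" "L \<subseteq> pos_reals" for K L using that by auto
  show "push pos_reals fst \<in> restrict_space (vague_borel pos_quadrant) projectable \<rightarrow>\<^sub>M vague_borel pos_reals"
    by (rule measurable_push_projection[OF fst_snd_maps]) (auto simp: * projectable_def intro: compact_Times)
  show "push pos_reals snd \<in> restrict_space (vague_borel pos_quadrant) projectable \<rightarrow>\<^sub>M vague_borel pos_reals"
    by (rule measurable_push_projection[OF fst_snd_maps(3,4,1,2)]) (auto simp: * projectable_def intro: compact_Times)
qed

subsection \<open>Streams of independent random variables\<close>

text \<open>A uniqueness principle for laws of streams: two families of laws, indexed by a state,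
  that satisfy the same one-step recursion agree on cylinders by induction on their length. It will
  yield the restart of the Poisson process, the law of the records and the grouping of gaps. The
  good states \<open>G\<close> have to be preserved only almost surely.\<close>

lemma stream_family_eq:
  fixes \<alpha> \<beta> :: "'s \<Rightarrow> 'a stream measure" and nxt :: "'s \<Rightarrow> 'a \<Rightarrow> 's"
  assumes \<alpha>: "\<And>s. s \<in> G \<Longrightarrow> prob_space (\<alpha> s)" "\<And>s. s \<in> G \<Longrightarrow> sets (\<alpha> s) = sets (stream_space M)"
    and \<beta>: "\<And>s. s \<in> G \<Longrightarrow> prob_space (\<beta> s)" "\<And>s. s \<in> G \<Longrightarrow> sets (\<beta> s) = sets (stream_space M)"
    and step\<alpha>: "\<And>s f. s \<in> G \<Longrightarrow> f \<in> borel_measurable (stream_space M) \<Longrightarrow>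
       (\<integral>\<^sup>+\<omega>. f \<omega> \<partial>\<alpha> s) = (\<integral>\<^sup>+y. (\<integral>\<^sup>+\<omega>. f (y ## \<omega>) \<partial>\<alpha> (nxt s y)) \<partial>K s)"
    and step\<beta>: "\<And>s f. s \<in> G \<Longrightarrow> f \<in> borel_measurable (stream_space M) \<Longrightarrow>
       (\<integral>\<^sup>+\<omega>. f \<omega> \<partial>\<beta> s) = (\<integral>\<^sup>+y. (\<integral>\<^sup>+\<omega>. f (y ## \<omega>) \<partial>\<beta> (nxt s y)) \<partial>K s)"
    and G: "\<And>s. s \<in> G \<Longrightarrow> AE y in K s. nxt s y \<in> G"
    and s: "s \<in> G"
  shows "\<alpha> s = \<beta> s"
proof (rule stream_space_eq_scylinder[of _ _ "sets M" M "{space M}"])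
  show "sets M = sets (sigma (space M) (sets M))" by simp
  show "Int_stable (sets M)" by (auto simp: Int_stable_def)
  fix As assume As: "As \<in> lists (sets M)"
  from this s show "emeasure (\<alpha> s) (scylinder (space M) As) = emeasure (\<beta> s) (scylinder (space M) As)"
  proof (induction As arbitrary: s)
    case Nil
    then show ?case
      using prob_space.emeasure_space_1[OF \<alpha>(1)] prob_space.emeasure_space_1[OF \<beta>(1)]
        sets_eq_imp_space_eq[OF \<alpha>(2)] sets_eq_imp_space_eq[OF \<beta>(2)]
      by (metis scylinder.simps(1) space_stream_space)
  next
    case (Cons A As)
    have A: "A \<in> sets M" "\<forall>x\<in>set As. x \<in> sets M" using Cons by auto
    then have sc: "scylinder (space M) As \<in> sets (stream_space M)" "scylinder (space M) (A # As) \<in> sets (stream_space M)"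
      by (auto intro!: sets_scylinder simp del: scylinder.simps)
    have ind: "indicator (scylinder (space M) (A # As)) (y ## \<omega>) =
        (indicator A y * indicator (scylinder (space M) As) \<omega> :: ennreal)" for y \<omega>
      using scylinder_streams[of "space M" As] A(1)[THEN sets.sets_into_space]
      by (auto split: split_indicator)
    have *: "emeasure (\<gamma> s) (scylinder (space M) (A # As)) = (\<integral>\<^sup>+y. indicator A y * emeasure (\<gamma> (nxt s y)) (scylinder (space M) As) \<partial>K s)"
      if "\<And>s. s \<in> G \<Longrightarrow> sets (\<gamma> s) = sets (stream_space M)"
        "\<And>f. f \<in> borel_measurable (stream_space M) \<Longrightarrow>
       (\<integral>\<^sup>+\<omega>. f \<omega> \<partial>\<gamma> s) = (\<integral>\<^sup>+y. (\<integral>\<^sup>+\<omega>. f (y ## \<omega>) \<partial>\<gamma> (nxt s y)) \<partial>K s)" for \<gamma> :: "'s \<Rightarrow> 'a stream measure"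
    proof -
      have "emeasure (\<gamma> s) (scylinder (space M) (A # As)) = (\<integral>\<^sup>+\<omega>. indicator (scylinder (space M) (A # As)) \<omega> \<partial>\<gamma> s)"
        using sc(2) that(1)[OF Cons(4)] by (subst nn_integral_indicator) auto
      also have "\<dots> = (\<integral>\<^sup>+y. (\<integral>\<^sup>+\<omega>. indicator A y * indicator (scylinder (space M) As) \<omega> \<partial>\<gamma> (nxt s y)) \<partial>K s)"
        unfolding ind[symmetric] using sc(2) by (intro that(2)) auto
      also have "\<dots> = (\<integral>\<^sup>+y. indicator A y * emeasure (\<gamma> (nxt s y)) (scylinder (space M) As) \<partial>K s)"
        using G[OF Cons(4)] sc(1) that(1)
        by (intro nn_integral_cong_AE) (auto elim!: eventually_mono intro!: nn_integral_cmult_indicator)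
      finally show ?thesis .
    qed
    show ?case
      by (simp only: *[OF \<alpha>(2) step\<alpha>[OF Cons(4)]] *[OF \<beta>(2) step\<beta>[OF Cons(4)]])
        (use G[OF Cons(4)] Cons.IH in \<open>auto intro!: nn_integral_cong_AE elim!: eventually_mono\<close>)
  qed
qed (use \<alpha> \<beta> s in \<open>auto dest: sets.sets_into_space\<close>)

context prob_space
begin

text \<open>Resampling everything after the first \<open>n\<close> entries from an independent copy
  leaves the law unchanged; this is the form in which independence of past and future is
  used.\<close>

lemma nn_integral_stream_split:
  assumes [measurable]: "f \<in> borel_measurable (stream_space M)"
  shows "(\<integral>\<^sup>+\<omega>. f \<omega> \<partial>stream_space M) =
    (\<integral>\<^sup>+\<omega>. (\<integral>\<^sup>+\<omega>'. f (stake n \<omega> @- \<omega>') \<partial>stream_space M) \<partial>stream_space M)"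
proof -
  interpret S: prob_space "stream_space M" by (rule prob_space_stream_space)
  show ?thesis
    using assms
  proof (induction n arbitrary: f)
    case 0 then show ?case by (simp add: S.emeasure_space_1)
  next
    case (Suc n)
    note [measurable] = Suc(2)
    have *: "f (stake (Suc n) (y ## \<omega>) @- \<omega>') = f (y ## (stake n \<omega> @- \<omega>'))" for y \<omega> \<omega>' by simp
    have "(\<integral>\<^sup>+\<omega>. (\<integral>\<^sup>+\<omega>'. f (stake (Suc n) \<omega> @- \<omega>') \<partial>stream_space M) \<partial>stream_space M) =
      (\<integral>\<^sup>+y. (\<integral>\<^sup>+\<omega>. (\<integral>\<^sup>+\<omega>'. f (stake (Suc n) (y ## \<omega>) @- \<omega>') \<partial>stream_space M) \<partial>stream_space M) \<partial>M)"
      by (rule nn_integral_stream_space) measurable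
    also have "\<dots> = (\<integral>\<^sup>+y. (\<integral>\<^sup>+\<omega>. f (y ## \<omega>) \<partial>stream_space M) \<partial>M)"
      unfolding * by (intro nn_integral_cong Suc(1)[symmetric]) measurable
    also have "\<dots> = (\<integral>\<^sup>+\<omega>. f \<omega> \<partial>stream_space M)"
      by (rule nn_integral_stream_space[symmetric]) measurable
    finally show ?case ..
  qed
qed

lemma nn_integral_stream_prod:
  assumes [measurable]: "\<And>i. g i \<in> borel_measurable M"
  shows "(\<integral>\<^sup>+\<omega>. (\<Prod>i<n. g i (\<omega> !! i)) \<partial>stream_space M) = (\<Prod>i<n. \<integral>\<^sup>+x. g i x \<partial>M)"
proof -
  interpret S: prob_space "stream_space M" by (rule prob_space_stream_space)
  show ?thesis
    using assms
  proof (induction n arbitrary: g)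
    case 0 then show ?case by (simp add: S.emeasure_space_1)
  next
    case (Suc n)
    note [measurable] = Suc(2)
    have "(\<integral>\<^sup>+\<omega>. (\<Prod>i<Suc n. g i (\<omega> !! i)) \<partial>stream_space M) =
      (\<integral>\<^sup>+x. (\<integral>\<^sup>+\<omega>. (\<Prod>i<Suc n. g i ((x ## \<omega>) !! i)) \<partial>stream_space M) \<partial>M)"
      by (rule nn_integral_stream_space) measurable
    also have "\<dots> = (\<integral>\<^sup>+x. (\<integral>\<^sup>+\<omega>. g 0 x * (\<Prod>i<n. g (Suc i) (\<omega> !! i)) \<partial>stream_space M) \<partial>M)"
      by (subst prod.lessThan_Suc_shift) simp
    also have "\<dots> = (\<integral>\<^sup>+x. g 0 x * (\<Prod>i<n. \<integral>\<^sup>+x. g (Suc i) x \<partial>M) \<partial>M)"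
      using Suc(1)[of "\<lambda>i. g (Suc i)"] by (intro nn_integral_cong) (simp add: nn_integral_cmult)
    also have "\<dots> = (\<Prod>i<Suc n. \<integral>\<^sup>+x. g i x \<partial>M)"
      by (subst prod.lessThan_Suc_shift) (simp add: nn_integral_multc)
    finally show ?case .
  qed
qed

lemma AE_stream_space_snth:
  assumes [measurable]: "Measurable.pred M P" and "AE x in M. P x"
  shows "AE \<omega> in stream_space M. \<forall>n. P (\<omega> !! n)"
  using AE_stream_all[OF assms] by (simp add: stream_all_def stream.pred_set sset_range)

text \<open>Along an arithmetic progression \<open>K\<close> misses have probability
  \<open>(1 - prob A) ^ K\<close>, which tends to zero. Progressions of step \<open>d\<close> are
  needed because only every \<open>d\<close>-th point carries a record, in a phase that is not known
  beforehand.\<close>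

lemma AE_stream_space_recurrent:
  assumes A[measurable]: "A \<in> sets M" and pos: "0 < prob A" and d: "0 < (d::nat)"
  shows "AE \<omega> in stream_space M. \<forall>r. \<exists>k. \<omega> !! (r + k * d) \<in> A"
proof -
  interpret S: prob_space "stream_space M" by (rule prob_space_stream_space)
  have "AE \<omega> in stream_space M. \<exists>k. \<omega> !! (r + k * d) \<in> A" for r
  proof -
    let ?N = "{\<omega> \<in> space (stream_space M). \<forall>k. \<omega> !! (r + k * d) \<notin> A}"
    have [measurable]: "?N \<in> sets (stream_space M)" by measurable
    have le: "emeasure (stream_space M) ?N \<le> ennreal ((1 - prob A) ^ K)" for K
    proof -
      define J where "J = (\<lambda>k. r + k * d) ` {..<K}"
      define g where "g i x = (if i \<in> J then indicator (space M - A) x else 1 :: ennreal)" for i x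
      have [measurable]: "g i \<in> borel_measurable M" for i unfolding g_def by measurable
      have J: "J \<subseteq> {..<r + K * d}" "card J = K" "finite J"
        using d unfolding J_def by (auto simp: card_image inj_on_def add_less_le_mono)
      have ig: "(\<integral>\<^sup>+x. g i x \<partial>M) = (if i \<in> J then ennreal (1 - prob A) else 1)" for i
        unfolding g_def using A
        by (auto simp: emeasure_eq_measure prob_compl prob_space)
      have "emeasure (stream_space M) ?N = (\<integral>\<^sup>+\<omega>. indicator ?N \<omega> \<partial>stream_space M)" by simp
      also have "\<dots> \<le> (\<integral>\<^sup>+\<omega>. (\<Prod>i<r + K * d. g i (\<omega> !! i)) \<partial>stream_space M)"
      proof (rule nn_integral_mono)
        fix \<omega> assume "\<omega> \<in> space (stream_space M)"
        then have sp: "\<omega> !! i \<in> space M" for i using measurable_space[OF measurable_snth] by blast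
        show "indicator ?N \<omega> \<le> (\<Prod>i<r + K * d. g i (\<omega> !! i))"
        proof (cases "\<omega> \<in> ?N")
          case True
          then have "g i (\<omega> !! i) = 1" for i using sp unfolding g_def J_def by (auto simp: indicator_def)
          then show ?thesis by (simp add: indicator_def)
        qed auto
      qed
      also have "\<dots> = (\<Prod>i<r + K * d. \<integral>\<^sup>+x. g i x \<partial>M)" by (rule nn_integral_stream_prod) measurable
      also have "\<dots> = (\<Prod>i\<in>J. ennreal (1 - prob A))"
        unfolding ig using J by (simp add: prod.If_cases Int_absorb1)
      also have "\<dots> = ennreal ((1 - prob A) ^ K)" using J by (simp add: ennreal_power)
      finally show ?thesis .
    qed
    have "(\<lambda>K. (1 - prob A) ^ K) \<longlonglongrightarrow> 0"
      using pos prob_le_1[of A] by (intro LIMSEQ_power_zero) auto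
    then have "(\<lambda>K. ennreal ((1 - prob A) ^ K)) \<longlonglongrightarrow> ennreal 0" by (rule tendsto_ennrealI)
    then have "emeasure (stream_space M) ?N \<le> ennreal 0"
      by (rule LIMSEQ_le_const) (use le in blast)
    then have "emeasure (stream_space M) ?N = 0" by simp
    then show ?thesis by (intro AE_I[of _ _ ?N]) auto
  qed
  then show ?thesis by (simp add: AE_all_countable)
qed

text \<open>\<open>F\<close> reads only the first \<open>n\<close> entries, so it survives a
  resampling of the tail while \<open>sdrop n\<close> returns the resampled tail.\<close>

lemma nn_integral_stream_independent:
  assumes F[measurable]: "F \<in> stream_space M \<rightarrow>\<^sub>M N" and dep: "\<And>\<omega> \<omega>'. F (stake n \<omega> @- \<omega>') = F \<omega>"
    and g[measurable]: "case_prod g \<in> borel_measurable (stream_space M \<Otimes>\<^sub>M N)"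
  shows "(\<integral>\<^sup>+\<omega>. g (sdrop n \<omega>) (F \<omega>) \<partial>stream_space M) =
    (\<integral>\<^sup>+\<omega>. (\<integral>\<^sup>+\<omega>'. g \<omega>' (F \<omega>) \<partial>stream_space M) \<partial>stream_space M)"
proof -
  have "sdrop n (stake n \<omega> @- \<omega>') = \<omega>'" for \<omega> \<omega>' :: "'a stream" by (simp add: sdrop_shift)
  then show ?thesis
    using dep by (subst nn_integral_stream_split[where n = n]) auto
qed

end

subsection \<open>Marked Poisson processes as streams of gaps\<close>

definition expo :: "real measure" where
  "expo = density lborel (exponential_density 1)"

text \<open>The first component is the gap to the next point of a Poisson process, the second the
  mark from which a waiting time will be computed.\<close>

definition marked_expo :: "(real \<times> real) measure" where
  "marked_expo = expo \<Otimes>\<^sub>M expo"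

abbreviation gap_stream :: "(real \<times> real) stream measure" where
  "gap_stream \<equiv> stream_space marked_expo"

text \<open>Each entry is a whole marked Poisson process, of which only the part in a unit interval
  is used, except for the entry at \<open>0\<close>. This avoids a separate description of Poisson
  processes on bounded intervals.\<close>

abbreviation block_stream :: "(real \<times> real) stream stream measure" where
  "block_stream \<equiv> stream_space gap_stream"

lemma sets_expo [simp, measurable_cong]: "sets expo = sets borel"
  and space_expo [simp]: "space expo = UNIV"
  by (auto simp: expo_def)

interpretation expo: prob_space expo
  unfolding expo_def by (rule prob_space_exponential_density) simp

interpretation expo_pair: pair_prob_space expo expo ..

interpretation marked: prob_space marked_expo
  unfolding marked_expo_def by unfold_locales

lemma sets_marked_expo [measurable_cong]: "sets marked_expo = sets (borel \<Otimes>\<^sub>M borel)"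
  unfolding marked_expo_def by (rule sets_pair_measure_cong) auto

lemma space_marked_expo [simp]: "space marked_expo = UNIV"
  by (simp add: marked_expo_def space_pair_measure)

interpretation gaps: prob_space gap_stream
  by (rule marked.prob_space_stream_space)

lemma space_gaps [simp]: "space gap_stream = UNIV"
  by (simp add: space_stream_space)

lemma emeasure_gaps_UNIV [simp]: "emeasure gap_stream UNIV = 1"
  using gaps.emeasure_space_1 by simp

lemma emeasure_marked_UNIV [simp]: "emeasure marked_expo UNIV = 1"
  using marked.emeasure_space_1 by simp

lemma emeasure_expo_UNIV [simp]: "emeasure expo UNIV = 1"
  using expo.emeasure_space_1 by simp

lemma nn_integral_expo:
  assumes [measurable]: "f \<in> borel_measurable borel"
  shows "(\<integral>\<^sup>+x. f x \<partial>expo) = (\<integral>\<^sup>+x. ennreal (exponential_density 1 x) * f x \<partial>lborel)"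
  unfolding expo_def by (subst nn_integral_density) auto

text \<open>Translating by \<open>a\<close> multiplies the exponential density by
  \<open>exp (- a)\<close>.\<close>

lemma expo_memoryless:
  assumes [measurable]: "f \<in> borel_measurable borel" and "0 \<le> a"
  shows "(\<integral>\<^sup>+x. indicator {a<..} x * f x \<partial>expo) = ennreal (exp (- a)) * (\<integral>\<^sup>+x. f (a + x) \<partial>expo)"
proof -
  have "(\<integral>\<^sup>+x. indicator {a<..} x * f x \<partial>expo) =
      (\<integral>\<^sup>+x. ennreal (exponential_density 1 x) * (indicator {a<..} x * f x) \<partial>lborel)"
    by (rule nn_integral_expo) measurable
  also have "\<dots> = (\<integral>\<^sup>+x. ennreal (exponential_density 1 (a + x)) * (indicator {a<..} (a + x) * f (a + x)) \<partial>lborel)"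
    by (subst nn_integral_real_affine[where c = 1 and t = a]) auto
  also have "\<dots> = (\<integral>\<^sup>+x. ennreal (exp (- a)) * (ennreal (exponential_density 1 x) * f (a + x)) \<partial>lborel)"
  proof (rule nn_integral_cong_AE)
    \<comment> \<open>At \<open>x = 0\<close> the integrands differ: the indicator of
      \<open>{a<..}\<close> vanishes at \<open>a\<close>, while the exponential density at
      \<open>0\<close> is one.\<close>
    have "AE x in lborel. x \<noteq> (0::real)" by (rule AE_lborel_singleton)
    then show "AE x in lborel. ennreal (exponential_density 1 (a + x)) * (indicator {a<..} (a + x) * f (a + x)) =
        ennreal (exp (- a)) * (ennreal (exponential_density 1 x) * f (a + x))"
    proof eventually_elim
      fix x :: real assume "x \<noteq> 0"
      show "ennreal (exponential_density 1 (a + x)) * (indicator {a<..} (a + x) * f (a + x)) =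
        ennreal (exp (- a)) * (ennreal (exponential_density 1 x) * f (a + x))"
      proof (cases "0 < x")
        case True
        then have "exponential_density 1 (a + x) = exp (- a) * exponential_density 1 x"
          using \<open>0 \<le> a\<close> by (simp add: exponential_density_def mult_exp_exp)
        then show ?thesis using True
          by (simp add: ennreal_mult' mult.assoc)
      next
        case False
        then show ?thesis using \<open>x \<noteq> 0\<close> by (simp add: exponential_density_def)
      qed
    qed
  qed
  also have "\<dots> = ennreal (exp (- a)) * (\<integral>\<^sup>+x. f (a + x) \<partial>expo)"
    by (subst nn_integral_expo) (auto simp: nn_integral_cmult)
  finally show ?thesis .
qed

lemma AE_expo_pos: "AE x in expo. 0 < x"
proof -
  have "AE x in lborel. x \<noteq> (0::real)" by (rule AE_lborel_singleton)
  then have "AE x in lborel. 0 < ennreal (exponential_density 1 x) \<longrightarrow> 0 < x"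
    by eventually_elim (auto simp: exponential_density_def split: if_splits)
  then show ?thesis unfolding expo_def
    by (subst AE_density) auto
qed

lemma emeasure_expo_greaterThan: "0 \<le> a \<Longrightarrow> emeasure expo {a<..} = ennreal (exp (- a))"
  using expo_memoryless[of "\<lambda>_. 1" a] expo.emeasure_space_1 by simp

lemma nn_integral_marked_expo:
  assumes [measurable]: "f \<in> borel_measurable (borel \<Otimes>\<^sub>M borel)"
  shows "(\<integral>\<^sup>+y. f y \<partial>marked_expo) = (\<integral>\<^sup>+e. \<integral>\<^sup>+m. f (e, m) \<partial>expo \<partial>expo)"
  unfolding marked_expo_def by (subst expo.nn_integral_fst[symmetric]) auto

lemma AE_marked_expo_pos: "AE y in marked_expo. 0 < fst y \<and> 0 < snd y"
proof -
  have "AE x in expo. AE y in expo. 0 < x \<and> 0 < y"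
    using AE_expo_pos by (auto elim!: eventually_mono)
  moreover have "{y \<in> space (expo \<Otimes>\<^sub>M expo). 0 < fst y \<and> 0 < snd y} \<in> sets (expo \<Otimes>\<^sub>M expo)"
    by measurable
  ultimately show ?thesis unfolding marked_expo_def
    by (intro expo_pair.AE_pair_measure) simp_all
qed

lemma marked_expo_memoryless:
  assumes [measurable]: "f \<in> borel_measurable (borel \<Otimes>\<^sub>M borel)" and "0 \<le> a"
  shows "(\<integral>\<^sup>+y. indicator {a<..} (fst y) * f y \<partial>marked_expo) =
    ennreal (exp (- a)) * (\<integral>\<^sup>+y. f (a + fst y, snd y) \<partial>marked_expo)"
  using assms(2)
  by (simp add: nn_integral_marked_expo nn_integral_cmult expo_memoryless)

definition psum :: "(real \<times> real) stream \<Rightarrow> nat \<Rightarrow> real" where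
  "psum w n = (\<Sum>i<n. fst (w !! i))"

text \<open>The number of points in \<open>[0, a]\<close> when the gaps are positive:
  \<open>psum w (Suc n)\<close> is the position of the point with index \<open>n\<close>, counted
  from zero, and the first index beyond \<open>a\<close> equals the number of earlier points.
  \<open>recurrent\<close> ensures that such an index exists.\<close>

definition cnt :: "real \<Rightarrow> (real \<times> real) stream \<Rightarrow> nat" where
  "cnt a w = (LEAST n. a < psum w (Suc n))"

text \<open>The points of \<open>u\<close> up to \<open>a\<close>, followed by the points of
  \<open>v\<close> shifted by \<open>a\<close>. In terms of gaps only the one that straddles
  \<open>a\<close> is composite: it joins what \<open>u\<close> leaves up to \<open>a\<close> to the
  first gap of \<open>v\<close>, and it takes its mark from \<open>v\<close>.\<close>

definition conc :: "real \<Rightarrow> (real \<times> real) stream \<Rightarrow> (real \<times> real) stream \<Rightarrow> (real \<times> real) stream" where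
  "conc a u v = to_stream (\<lambda>n. if n < cnt a u then u !! n
     else if n = cnt a u then (a - psum u n + fst (v !! 0), snd (v !! 0)) else v !! (n - cnt a u))"

text \<open>The pathwise substitute for almost sure statements. Gaps of at least one send the
  positions to infinity. Marks of at least one, found in every residue class, send the time to
  infinity whatever the phase of the records.\<close>

definition recurrent :: "nat \<Rightarrow> (real \<times> real) stream \<Rightarrow> bool" where
  "recurrent d w \<longleftrightarrow> (\<forall>i. 0 < fst (w !! i) \<and> 0 < snd (w !! i)) \<and>
     (\<forall>r. \<exists>k. 1 \<le> fst (w !! (r + k * d)) \<and> 1 \<le> snd (w !! (r + k * d)))"

lemma AE_recurrent:
  assumes d: "0 < d"
  shows "AE w in gap_stream. recurrent d w"
proof -
  have "AE w in gap_stream. \<forall>i. 0 < fst (w !! i) \<and> 0 < snd (w !! i)"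
    by (rule marked.AE_stream_space_snth) (use AE_marked_expo_pos in measurable)
  moreover have "AE w in gap_stream. \<forall>r. \<exists>k. w !! (r + k * d) \<in> {1<..} \<times> {1<..}"
  proof (rule marked.AE_stream_space_recurrent[OF _ _ d])
    have "emeasure marked_expo ({1<..} \<times> {1<..}) = emeasure expo {1<..} * emeasure expo {1<..}"
      unfolding marked_expo_def by (rule expo.emeasure_pair_measure_Times) auto
    then show "0 < marked.prob ({1<..} \<times> {1<..})"
      by (simp add: emeasure_expo_greaterThan marked.emeasure_eq_measure ennreal_mult'[symmetric])
  qed (simp add: sets_marked_expo)
  ultimately show ?thesis
    unfolding recurrent_def by eventually_elim (simp add: mem_Times_iff, meson less_imp_le)
qed

lemma psum_mono:
  assumes "\<forall>i. 0 < fst (w !! i)" "m \<le> n"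
  shows "psum w m \<le> psum w n"
  unfolding psum_def using assms by (intro sum_mono2) (auto simp: less_imp_le)

lemma psum_unbounded:
  assumes "recurrent d w"
  shows "\<exists>n. a < psum w n"
proof -
  have "\<exists>n. real m \<le> psum w n" for m
  proof (induction m)
    case 0 show ?case by (intro exI[of _ 0]) (simp add: psum_def)
  next
    case (Suc m)
    then obtain n where n: "real m \<le> psum w n" by blast
    obtain k where k: "1 \<le> fst (w !! (n + k * d))" using assms unfolding recurrent_def by blast
    have "psum w n \<le> psum w (n + k * d)" using assms unfolding recurrent_def by (intro psum_mono) auto
    then have "real (Suc m) \<le> psum w (Suc (n + k * d))" using n k by (simp add: psum_def)
    then show ?case by blast
  qed
  then show ?thesis by (metis reals_Archimedean2 less_le_trans)
qed

lemma cnt_finite: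
  assumes "recurrent d w"
  shows "a < psum w (Suc (cnt a w))" "n < cnt a w \<Longrightarrow> psum w (Suc n) \<le> a"
proof -
  obtain n where "a < psum w n" using psum_unbounded[OF assms] by blast
  also have "\<dots> \<le> psum w (Suc n)" using assms unfolding recurrent_def by (intro psum_mono) auto
  finally show "a < psum w (Suc (cnt a w))" unfolding cnt_def by (rule LeastI)
  show "n < cnt a w \<Longrightarrow> psum w (Suc n) \<le> a" for n
    unfolding cnt_def using not_less_Least by force
qed

lemma psum_Stream: "psum (y ## u) (Suc n) = fst y + psum u n"
  unfolding psum_def by (subst sum.lessThan_Suc_shift) simp

lemma psum_0 [simp]: "psum w 0 = 0" by (simp add: psum_def)

lemma snth_conc:
  "conc a u v !! n = (if n < cnt a u then u !! n
     else if n = cnt a u then (a - psum u n + fst (v !! 0), snd (v !! 0)) else v !! (n - cnt a u))"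
  unfolding conc_def to_stream_def by simp

lemma cnt_Stream_less: "a < fst y \<Longrightarrow> cnt a (y ## u) = 0"
  unfolding cnt_def by (rule Least_eq_0) (simp add: psum_Stream)

lemma cnt_Stream_ge:
  assumes "fst y \<le> a" "recurrent d u"
  shows "cnt a (y ## u) = Suc (cnt (a - fst y) u)"
proof -
  have "a < psum (y ## u) (Suc (Suc (cnt (a - fst y) u)))"
    using cnt_finite(1)[OF assms(2), of "a - fst y"] by (simp add: psum_Stream)
  then have "(LEAST n. a < psum (y ## u) (Suc n)) = Suc (LEAST m. a < psum (y ## u) (Suc (Suc m)))"
    using assms(1) by (intro Least_Suc) (auto simp: psum_Stream)
  then show ?thesis unfolding cnt_def by (simp add: psum_Stream algebra_simps)
qed

lemma stream_eqI: "(\<And>n. u !! n = v !! n) \<Longrightarrow> u = v"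
  by (metis stream_smap_nats smap_alt)

lemma conc_Stream_less:
  assumes "a < fst y"
  shows "conc a (y ## u) v = (a + fst (shd v), snd (shd v)) ## stl v"
proof (rule stream_eqI)
  fix n show "conc a (y ## u) v !! n = ((a + fst (shd v), snd (shd v)) ## stl v) !! n"
    using cnt_Stream_less[OF assms] unfolding snth_conc by (cases n) auto
qed

text \<open>Reading one gap shortens the length still to be covered from \<open>a\<close> to
  \<open>a - fst y\<close>; this length is the state in the recursion for the law of
  \<open>conc\<close>.\<close>

lemma conc_Stream_ge:
  assumes "fst y \<le> a" "recurrent d u"
  shows "conc a (y ## u) v = y ## conc (a - fst y) u v"
proof (rule stream_eqI)
  fix n show "conc a (y ## u) v !! n = (y ## conc (a - fst y) u v) !! n"
  proof (cases n)
    case 0 then show ?thesis unfolding snth_conc cnt_Stream_ge[OF assms] by simp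
  next
    case (Suc m)
    have "(y ## conc (a - fst y) u v) !! n = conc (a - fst y) u v !! m" using Suc by simp
    then show ?thesis
      unfolding snth_conc cnt_Stream_ge[OF assms] Suc by (auto simp: psum_Stream)
  qed
qed

lemma measurable_psum [measurable]: "(\<lambda>w. psum w n) \<in> borel_measurable gap_stream"
  unfolding psum_def by measurable

lemma measurable_cnt [measurable]: "cnt a \<in> gap_stream \<rightarrow>\<^sub>M count_space UNIV"
  unfolding cnt_def by measurable

text \<open>The number of entries kept from \<open>u\<close> is random but takes countably many
  values: \<open>f k\<close> is the formula with that number frozen to \<open>k\<close>.\<close>

lemma measurable_conc [measurable]:
  "(\<lambda>(u, v). conc a u v) \<in> gap_stream \<Otimes>\<^sub>M gap_stream \<rightarrow>\<^sub>M gap_stream"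
proof (rule measurable_stream_space2)
  fix n
  define f where "f k = (\<lambda>(u, v). if n < k then u !! n
     else if n = k then (a - psum u n + fst (v !! 0), snd (v !! 0)) else v !! (n - k))" for k :: nat
  have m: "f k \<in> gap_stream \<Otimes>\<^sub>M gap_stream \<rightarrow>\<^sub>M marked_expo" for k
    unfolding f_def measurable_cong_sets[OF refl sets_marked_expo] by measurable
  have "(\<lambda>x. f (cnt a (fst x)) x) \<in> gap_stream \<Otimes>\<^sub>M gap_stream \<rightarrow>\<^sub>M marked_expo"
    by (rule measurable_compose_countable[OF m]) measurable
  also have "(\<lambda>x. f (cnt a (fst x)) x) = (\<lambda>x. (case x of (u, v) \<Rightarrow> conc a u v) !! n)"
    by (auto simp: f_def snth_conc fun_eq_iff)
  finally show "(\<lambda>x. (case x of (u, v) \<Rightarrow> conc a u v) !! n) \<in> gap_stream \<Otimes>\<^sub>M gap_stream \<rightarrow>\<^sub>M marked_expo" .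
qed

text \<open>
  By the lack of memory of the exponential distribution, a marked Poisson process that is
  continued after time \<^term>\<open>a\<close> by an independent one is a marked Poisson process.
\<close>

lemma distr_conc:
  assumes "0 \<le> a"
  shows "distr (gap_stream \<Otimes>\<^sub>M gap_stream) gap_stream (\<lambda>(u, v). conc a u v)
    = gap_stream"
proof -
  let ?S = gap_stream
  \<comment> \<open>A negative state means that the length \<open>a\<close> has already been passed;
    what follows is then a fresh stream.\<close>
  define \<beta> where "\<beta> a = (if 0 \<le> a then distr (?S \<Otimes>\<^sub>M ?S) ?S (\<lambda>(u, v). conc a u v) else ?S)" for a
  interpret SS: pair_prob_space ?S ?S ..
  have \<beta>_int: "(\<integral>\<^sup>+\<omega>. f \<omega> \<partial>\<beta> a) = (\<integral>\<^sup>+u. \<integral>\<^sup>+v. f (conc a u v) \<partial>?S \<partial>?S)"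
    if [measurable]: "f \<in> borel_measurable ?S" and "0 \<le> a" for f :: "_ \<Rightarrow> ennreal" and a
    using that unfolding \<beta>_def
    by (simp add: nn_integral_distr case_prod_unfold) (subst gaps.nn_integral_fst[symmetric], auto)
  have "?S = \<beta> a"
  proof (rule stream_family_eq[where G = UNIV and K = "\<lambda>_. marked_expo" and nxt = "\<lambda>a y. a - fst y" and M = marked_expo and \<alpha> = "\<lambda>_. ?S" and \<beta> = \<beta>])
    show "prob_space (\<beta> s)" for s
      unfolding \<beta>_def by (auto intro!: SS.prob_space_distr gaps.prob_space_axioms)
    show "sets (\<beta> s) = sets ?S" for s unfolding \<beta>_def by simp
    show "(\<integral>\<^sup>+\<omega>. f \<omega> \<partial>?S) = (\<integral>\<^sup>+y. \<integral>\<^sup>+\<omega>. f (y ## \<omega>) \<partial>?S \<partial>marked_expo)" if "f \<in> borel_measurable ?S" for f :: "_ \<Rightarrow> ennreal"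
      using that by (rule marked.nn_integral_stream_space)
    fix a and f :: "_ \<Rightarrow> ennreal" assume f[measurable]: "f \<in> borel_measurable ?S"
    show "(\<integral>\<^sup>+\<omega>. f \<omega> \<partial>\<beta> a) = (\<integral>\<^sup>+y. \<integral>\<^sup>+\<omega>. f (y ## \<omega>) \<partial>\<beta> (a - fst y) \<partial>marked_expo)"
    proof (cases "0 \<le> a")
      case False
      then have "(\<integral>\<^sup>+\<omega>. f \<omega> \<partial>\<beta> a) = (\<integral>\<^sup>+y. \<integral>\<^sup>+\<omega>. f (y ## \<omega>) \<partial>?S \<partial>marked_expo)"
        unfolding \<beta>_def using marked.nn_integral_stream_space[OF f] by simp
      also have "\<dots> = (\<integral>\<^sup>+y. \<integral>\<^sup>+\<omega>. f (y ## \<omega>) \<partial>\<beta> (a - fst y) \<partial>marked_expo)"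
        using AE_marked_expo_pos
      proof (intro nn_integral_cong_AE, eventually_elim)
        fix y :: "real \<times> real" assume "0 < fst y \<and> 0 < snd y"
        then show "(\<integral>\<^sup>+\<omega>. f (y ## \<omega>) \<partial>?S) = (\<integral>\<^sup>+\<omega>. f (y ## \<omega>) \<partial>\<beta> (a - fst y))"
          using False unfolding \<beta>_def by auto
      qed
      finally show ?thesis .
    next
      case True
      \<comment> \<open>\<open>c\<close> is the integral given that the first gap exceeds
        \<open>a\<close>. The first entry is then \<open>a\<close> plus a fresh gap, and by
        memorylessness this has the law of a gap conditioned to exceed \<open>a\<close>.\<close>
      define c where "c = (\<integral>\<^sup>+v. f ((a + fst (shd v), snd (shd v)) ## stl v) \<partial>?S)"
      define \<Psi> where "\<Psi> y = (\<integral>\<^sup>+u. \<integral>\<^sup>+v. f (conc a (y ## u) v) \<partial>?S \<partial>?S)" for y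
      define \<Theta> where "\<Theta> y = (\<integral>\<^sup>+v. f (y ## v) \<partial>?S)" for y
      have [measurable]: "\<Theta> \<in> borel_measurable marked_expo" unfolding \<Theta>_def by measurable
      have [measurable]: "\<Psi> \<in> borel_measurable marked_expo" unfolding \<Psi>_def by measurable
      have c: "c = (\<integral>\<^sup>+y. \<Theta> (a + fst y, snd y) \<partial>marked_expo)"
        unfolding c_def \<Theta>_def by (subst marked.nn_integral_stream_space) auto
      have \<Psi>_less: "\<Psi> y = c" if "a < fst y" for y
        unfolding \<Psi>_def c_def using that by (simp add: conc_Stream_less)
      have \<Psi>_ge: "\<Psi> y = (\<integral>\<^sup>+\<omega>. f (y ## \<omega>) \<partial>\<beta> (a - fst y))" if "fst y \<le> a" for y
      proof -
        have "\<Psi> y = (\<integral>\<^sup>+u. \<integral>\<^sup>+v. f (y ## conc (a - fst y) u v) \<partial>?S \<partial>?S)"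
          unfolding \<Psi>_def using AE_recurrent[of 1]
          by (intro nn_integral_cong_AE) (auto elim!: eventually_mono simp: conc_Stream_ge[OF that])
        also have "\<dots> = (\<integral>\<^sup>+\<omega>. f (y ## \<omega>) \<partial>\<beta> (a - fst y))"
          using that by (subst \<beta>_int) auto
        finally show ?thesis .
      qed
      have "(\<integral>\<^sup>+\<omega>. f \<omega> \<partial>\<beta> a) = (\<integral>\<^sup>+y. \<Psi> y \<partial>marked_expo)"
        unfolding \<beta>_int[OF f True] \<Psi>_def by (rule marked.nn_integral_stream_space) measurable
      also have "\<dots> = (\<integral>\<^sup>+y. indicator {..a} (fst y) * \<Psi> y + indicator {a<..} (fst y) * c \<partial>marked_expo)"
        using \<Psi>_less by (intro nn_integral_cong) (auto simp: indicator_def not_le)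
      also have "\<dots> = (\<integral>\<^sup>+y. indicator {..a} (fst y) * \<Psi> y \<partial>marked_expo) + (\<integral>\<^sup>+y. indicator {a<..} (fst y) * c \<partial>marked_expo)"
        by (rule nn_integral_add) measurable
      also have "(\<integral>\<^sup>+y. indicator {a<..} (fst y) * c \<partial>marked_expo) = (\<integral>\<^sup>+y. indicator {a<..} (fst y) * \<Theta> y \<partial>marked_expo)"
        using True by (simp add: marked_expo_memoryless c)
      also have "(\<integral>\<^sup>+y. indicator {..a} (fst y) * \<Psi> y \<partial>marked_expo) + (\<integral>\<^sup>+y. indicator {a<..} (fst y) * \<Theta> y \<partial>marked_expo)
          = (\<integral>\<^sup>+y. indicator {..a} (fst y) * \<Psi> y + indicator {a<..} (fst y) * \<Theta> y \<partial>marked_expo)"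
        by (rule nn_integral_add[symmetric]) measurable
      also have "\<dots> = (\<integral>\<^sup>+y. \<integral>\<^sup>+\<omega>. f (y ## \<omega>) \<partial>\<beta> (a - fst y) \<partial>marked_expo)"
        using \<Psi>_ge by (intro nn_integral_cong) (auto simp: indicator_def not_le \<Theta>_def \<beta>_def)
      finally show ?thesis .
    qed
  qed (auto simp: gaps.prob_space_axioms)
  then show ?thesis using assms unfolding \<beta>_def by simp
qed

lemma recurrent_conc:
  assumes "recurrent d u" "recurrent d v" "0 < d" "0 \<le> a"
  shows "recurrent d (conc a u v)"
  unfolding recurrent_def
proof (intro conjI allI)
  have pos: "0 < fst (u !! i)" "0 < fst (v !! i)" "0 < snd (u !! i)" "0 < snd (v !! i)" for i
    using assms unfolding recurrent_def by auto
  show "0 < snd (conc a u v !! i)" for i unfolding snth_conc using pos by (auto simp del: snth.simps)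
  show "0 < fst (conc a u v !! i)" for i
  proof -
    have "psum u (cnt a u) \<le> a \<or> cnt a u = 0"
      using cnt_finite(2)[OF assms(1), of "cnt a u - 1" a] by (cases "cnt a u") auto
    then show ?thesis unfolding snth_conc using pos \<open>0 \<le> a\<close> by (auto intro!: add_nonneg_pos simp del: snth.simps)
  qed
  fix r
  let ?K = "cnt a u"
  \<comment> \<open>Stepping \<open>?K + 1\<close> times by \<open>d\<close> leads strictly beyond
    the seam at index \<open>?K\<close>. From there on the entries are those of \<open>v\<close>
    with index shifted by \<open>?K\<close>, so the recurrence of \<open>v\<close> along the class
    of \<open>s\<close> can be used.\<close>
  have "?K + 1 \<le> (?K + 1) * d" using mult_le_mono2[of 1 d "?K + 1"] assms(3) by simp
  moreover define s where "s = r + (?K + 1) * d - ?K"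
  ultimately have s: "r + (?K + 1) * d = ?K + s" "0 < s" by linarith+
  obtain k where "1 \<le> fst (v !! (s + k * d))" "1 \<le> snd (v !! (s + k * d))"
    using assms(2) unfolding recurrent_def by blast
  moreover have "conc a u v !! (r + (?K + 1 + k) * d) = v !! (s + k * d)"
  proof -
    have "r + (?K + 1 + k) * d = ?K + (s + k * d)" using s by (simp add: algebra_simps)
    then show ?thesis using s(2) by (simp add: snth_conc)
  qed
  ultimately show "\<exists>k. 1 \<le> fst (conc a u v !! (r + k * d)) \<and> 1 \<le> snd (conc a u v !! (r + k * d))"
    by (intro exI[of _ "?K + 1 + k"]) simp
qed

subsection \<open>Every \<open>d\<close>-th point of a marked Poisson process\<close>

text \<open>\<open>j\<close> counts the points before the start of the walk, so the point with index
  \<open>n\<close> is number \<open>j + n + 1\<close> overall. In phase \<open>0\<close> the records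
  are the points with numbers \<open>d\<close>, \<open>2 d\<close> and so on. Only the residue of
  \<open>j\<close> matters, and negative values are welcome.\<close>

abbreviation record_at :: "nat \<Rightarrow> int \<Rightarrow> nat \<Rightarrow> bool" where
  "record_at d j n \<equiv> int d dvd j + int n + 1"

definition wpos :: "(real \<times> real) stream \<Rightarrow> real \<Rightarrow> nat \<Rightarrow> real" where
  "wpos w x n = x + psum w (Suc n)"

text \<open>\<open>inc\<close> is the rule that turns the position and the mark of a record into the
  waiting time that follows it. Keeping it abstract lets the scaled processes and the limit share
  one theory. The sum stops before \<open>n\<close>, since the waiting time attached to a record
  elapses after it.\<close>

definition wtime :: "nat \<Rightarrow> (real \<Rightarrow> real \<Rightarrow> real) \<Rightarrow> (real \<times> real) stream \<Rightarrow> real \<Rightarrow> int \<Rightarrow> real \<Rightarrow> nat \<Rightarrow> real" where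
  "wtime d inc w x j t n = t + (\<Sum>i<n. if record_at d j i then inc (wpos w x i) (snd (w !! i)) else 0)"

text \<open>A position is minus the logarithm of a scaled height; moving to the right means
  descending.\<close>

definition wpoint :: "nat \<Rightarrow> (real \<Rightarrow> real \<Rightarrow> real) \<Rightarrow> (real \<times> real) stream \<Rightarrow> real \<Rightarrow> int \<Rightarrow> real \<Rightarrow> nat \<Rightarrow> real \<times> real" where
  "wpoint d inc w x j t n = (exp (- wpos w x n), wtime d inc w x j t n)"

definition walk :: "nat \<Rightarrow> (real \<Rightarrow> real \<Rightarrow> real) \<Rightarrow> (real \<times> real) stream \<Rightarrow> real \<Rightarrow> int \<Rightarrow> real \<Rightarrow> (real \<times> real) measure" where
  "walk d inc w x j t = dirac_sum pos_quadrant
     {n. record_at d j n \<and> wpoint d inc w x j t n \<in> pos_quadrant} (wpoint d inc w x j t)"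

definition walk_sum :: "nat \<Rightarrow> (real \<Rightarrow> real \<Rightarrow> real) \<Rightarrow> (real \<times> real \<Rightarrow> real) \<Rightarrow> (real \<times> real) stream \<Rightarrow> real \<Rightarrow> int \<Rightarrow> real \<Rightarrow> real" where
  "walk_sum d inc f w x j t = (\<Sum>n. if record_at d j n then f (wpoint d inc w x j t n) else 0)"

lemma psum_conc_less: "n \<le> cnt a u \<Longrightarrow> psum (conc a u v) n = psum u n"
  unfolding psum_def by (intro sum.cong) (auto simp: snth_conc simp del: snth.simps)

lemma psum_conc_ge: "psum (conc a u v) (Suc (cnt a u + k)) = a + psum v (Suc k)"
proof (induction k)
  case 0
  have "psum (conc a u v) (Suc (cnt a u)) = psum u (cnt a u) + fst (conc a u v !! cnt a u)"
    using psum_conc_less[of "cnt a u" a u v] by (simp add: psum_def)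
  then show ?case by (simp add: snth_conc psum_def)
next
  case (Suc k)
  have "psum (conc a u v) (Suc (cnt a u + Suc k)) = psum (conc a u v) (Suc (cnt a u + k)) + fst (conc a u v !! (cnt a u + Suc k))"
    by (simp add: psum_def)
  then show ?case using Suc by (simp add: snth_conc psum_def del: snth.simps)
qed

lemma wpos_conc: "wpos (conc a u v) x (cnt a u + k) = wpos v (x + a) k"
  unfolding wpos_def psum_conc_ge by simp

text \<open>Past the seam a walk on \<open>conc a u v\<close> is a walk on \<open>v\<close>,
  restarted at \<open>x + a\<close> with the phase advanced by the number of points of
  \<open>u\<close> and with the time reached so far. Even at the seam the mark comes from
  \<open>v\<close>, so no increment is split.\<close>

lemma wtime_conc:
  "wtime d inc (conc a u v) x j t (cnt a u + k) = wtime d inc v (x + a) (j + int (cnt a u)) (wtime d inc u x j t (cnt a u)) k"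
proof (induction k)
  case 0
  have "wtime d inc (conc a u v) x j t (cnt a u) = wtime d inc u x j t (cnt a u)"
    unfolding wtime_def wpos_def
    by (intro arg_cong2[of _ _ _ _ "(+)"] sum.cong refl) (simp add: psum_conc_less snth_conc del: snth.simps)
  then show ?case by (simp add: wtime_def)
next
  case (Suc k)
  have "snd (conc a u v !! (cnt a u + k)) = snd (v !! k)" unfolding snth_conc by (cases k) auto
  moreover have "record_at d j (cnt a u + k) \<longleftrightarrow> record_at d (j + int (cnt a u)) k" by (simp add: algebra_simps)
  ultimately show ?case using Suc wpos_conc[of a u v x k] by (simp add: wtime_def)
qed

lemma wtime_shift: "wtime d inc w x j t n = t + wtime d inc w x j 0 n"
  by (simp add: wtime_def)

lemma recurrentD: "recurrent d w \<Longrightarrow> 0 < fst (w !! i)" "recurrent d w \<Longrightarrow> 0 < snd (w !! i)"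
  by (auto simp: recurrent_def)

lemma psum_pos: "recurrent d w \<Longrightarrow> 0 < psum w (Suc n)"
  unfolding psum_def using recurrentD(1) by (intro sum_pos) auto

lemma wpos_gt: "recurrent d w \<Longrightarrow> x < wpos w x n"
  unfolding wpos_def using psum_pos by simp

lemma wpos_unbounded:
  assumes "recurrent d w"
  shows "\<exists>N. \<forall>n\<ge>N. c < wpos w x n"
proof -
  obtain N where N: "c - x < psum w N" using psum_unbounded[OF assms] by blast
  have "c < wpos w x n" if "N \<le> n" for n
    using N psum_mono[of w N "Suc n"] recurrentD(1)[OF assms] that unfolding wpos_def by auto
  then show ?thesis by blast
qed

lemma wpoint_conc_less:
  assumes "n < cnt a u"
  shows "wpoint d inc (conc a u v) x j t n = wpoint d inc u x j t n"
  using assms unfolding wpoint_def wtime_def wpos_def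
  by (intro arg_cong2[of _ _ _ _ Pair] arg_cong2[of _ _ _ _ "(+)"] sum.cong refl)
    (auto simp: psum_conc_less snth_conc simp del: snth.simps)

text \<open>Since \<open>f\<close> vanishes at small heights and positions tend to infinity, the
  series has finitely many nonzero terms and may be cut at the seam.\<close>

lemma walk_sum_conc_split:
  assumes v: "recurrent d v" and f0: "0 < s0" "\<And>s t. s < s0 \<Longrightarrow> f (s, t) = 0"
  shows "walk_sum d inc f (conc a u v) x j t =
    (\<Sum>n<cnt a u. if record_at d j n then f (wpoint d inc u x j t n) else 0) +
    walk_sum d inc f v (x + a) (j + int (cnt a u)) (wtime d inc u x j t (cnt a u))"
proof -
  let ?K = "cnt a u"
  define g where "g n = (if record_at d j n then f (wpoint d inc (conc a u v) x j t n) else 0)" for n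
  define h where "h n = (if record_at d (j + int ?K) n then f (wpoint d inc v (x + a) (j + int ?K) (wtime d inc u x j t ?K) n) else 0)" for n
  have gh: "g (n + ?K) = h n" for n
  proof -
    have "wpoint d inc (conc a u v) x j t (n + ?K) = wpoint d inc v (x + a) (j + int ?K) (wtime d inc u x j t ?K) n"
      unfolding wpoint_def using wpos_conc[of a u v x n] wtime_conc[of d inc a u v x j t n]
      by (simp add: add.commute)
    then show ?thesis unfolding g_def h_def by (simp add: algebra_simps)
  qed
  obtain N where N: "\<forall>n\<ge>N. - ln s0 < wpos v (x + a) n" using wpos_unbounded[OF v] by blast
  have h0: "h n = 0" if "N \<le> n" for n
  proof -
    have "exp (- wpos v (x + a) n) < s0" using N that f0(1) by (metis exp_less_cancel_iff exp_ln minus_less_iff)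
    then show ?thesis unfolding h_def wpoint_def by (simp add: f0(2))
  qed
  have "summable h" by (rule summable_finite[of "{..<N}"]) (use h0 not_less in auto)
  then have "summable (\<lambda>n. g (n + ?K))" unfolding gh .
  then have "summable g" by (simp add: summable_iff_shift)
  then have "suminf g = (\<Sum>n. g (n + ?K)) + (\<Sum>i<?K. g i)" by (rule suminf_split_initial_segment)
  also have "\<dots> = (\<Sum>i<?K. g i) + suminf h" unfolding gh by simp
  also have "(\<Sum>i<?K. g i) = (\<Sum>n<?K. if record_at d j n then f (wpoint d inc u x j t n) else 0)"
    unfolding g_def by (intro sum.cong) (auto simp: wpoint_conc_less)
  finally show ?thesis unfolding walk_sum_def g_def h_def .
qed

text \<open>The points of \<open>u\<close> lie at positions at most \<open>x + a\<close>, hence at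
  heights where \<open>f\<close> vanishes. What remains of \<open>u\<close> is its effect on the
  phase and on the clock.\<close>

lemma walk_sum_conc:
  assumes u: "recurrent d u" and v: "recurrent d v"
    and f1: "\<And>s t. exp (- (x + a)) \<le> s \<Longrightarrow> f (s, t) = 0"
    and f0: "0 < s0" "\<And>s t. s < s0 \<Longrightarrow> f (s, t) = 0"
  shows "walk_sum d inc f (conc a u v) x j t =
    walk_sum d inc f v (x + a) (j + int (cnt a u)) (wtime d inc u x j t (cnt a u))"
proof -
  have "f (wpoint d inc u x j t n) = 0" if "n < cnt a u" for n
  proof -
    have "wpos u x n \<le> x + a" using cnt_finite(2)[OF u that] unfolding wpos_def by simp
    then show ?thesis unfolding wpoint_def by (simp add: f1)
  qed
  then have "(\<Sum>n<cnt a u. if record_at d j n then f (wpoint d inc u x j t n) else 0) = 0"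
    by (intro sum.neutral) simp
  then show ?thesis by (simp add: walk_sum_conc_split[where f = f and ?s0.0 = s0, OF v f0])
qed

subsection \<open>Blocks\<close>

text \<open>
  The stream \<open>\<omega> !! 0\<close> describes the points in \<open>[0, \<infinity>)\<close> and \<open>\<omega> !! i\<close> for \<open>i > 0\<close> those
  in \<open>[- i, 1 - i)\<close>.
\<close>

primrec blocks :: "nat \<Rightarrow> (real \<times> real) stream stream \<Rightarrow> (real \<times> real) stream" where
  "blocks 0 \<omega> = \<omega> !! 0"
| "blocks (Suc m) \<omega> = conc 1 (\<omega> !! Suc m) (blocks m \<omega>)"

text \<open>The phase at the left end \<open>- m\<close> of block \<open>m\<close> when the phase at
  position \<open>0\<close> is \<open>j\<close>: the points of the blocks in between are
  subtracted.\<close>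

definition phase :: "int \<Rightarrow> (real \<times> real) stream stream \<Rightarrow> nat \<Rightarrow> int" where
  "phase j \<omega> m = j - (\<Sum>i<m. int (cnt 1 (\<omega> !! Suc i)))"

definition block_time :: "nat \<Rightarrow> (real \<Rightarrow> real \<Rightarrow> real) \<Rightarrow> real \<Rightarrow> (real \<times> real) stream \<Rightarrow> real \<Rightarrow> int \<Rightarrow> real" where
  "block_time d inc a u x j = wtime d inc u x j 0 (cnt a u)"

text \<open>Up to a factor given by its position, this bounds the time spent in a unit block: both
  rules for waiting times satisfy \<open>inc y e \<le> (1 + e) * exp y\<close>.\<close>

definition mass :: "(real \<times> real) stream \<Rightarrow> real" where
  "mass w = (\<Sum>n<cnt 1 w. 1 + snd (w !! n))"

text \<open>The sample points for which the pathwise limit is proved. The weight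
  \<open>exp (- i)\<close> is the factor from the right end \<open>- i\<close> of block
  \<open>Suc i\<close>, and the series dominates the elapsed times uniformly in
  \<open>b\<close>.\<close>

definition admissible :: "nat \<Rightarrow> (real \<times> real) stream stream \<Rightarrow> bool" where
  "admissible d \<omega> \<longleftrightarrow> (\<forall>i. recurrent d (\<omega> !! i)) \<and> summable (\<lambda>i. exp (- real i) * mass (\<omega> !! Suc i))"

lemma admissibleD:
  "admissible d \<omega> \<Longrightarrow> recurrent d (\<omega> !! i)"
  "admissible d \<omega> \<Longrightarrow> summable (\<lambda>i. exp (- real i) * mass (\<omega> !! Suc i))"
  by (auto simp: admissible_def)

lemma recurrent_blocks: "admissible d \<omega> \<Longrightarrow> 0 < d \<Longrightarrow> recurrent d (blocks m \<omega>)"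
proof (induction m)
  case 0 then show ?case using admissibleD(1)[of d \<omega> 0] by simp
next
  case (Suc m) then show ?case unfolding blocks.simps by (intro recurrent_conc admissibleD(1)) auto
qed

lemma phase_Suc: "phase j \<omega> (Suc m) + int (cnt 1 (\<omega> !! Suc m)) = phase j \<omega> m"
  by (simp add: phase_def)

text \<open>The blocks beyond \<open>m\<close> lie to the left of \<open>- m\<close>, at heights
  where \<open>f\<close> vanishes. They are peeled off one by one, each adding its elapsed time to
  the clock.\<close>

lemma walk_sum_blocks:
  assumes \<omega>: "admissible d \<omega>" "0 < d"
    and f1: "\<And>s t. exp (real m) \<le> s \<Longrightarrow> f (s, t) = 0"
    and f0: "0 < s0" "\<And>s t. s < s0 \<Longrightarrow> f (s, t) = 0"
  shows "walk_sum d inc f (blocks (m + k) \<omega>) (- real (m + k)) (phase j \<omega> (m + k)) t =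
    walk_sum d inc f (blocks m \<omega>) (- real m) (phase j \<omega> m)
      (t + (\<Sum>i<k. block_time d inc 1 (\<omega> !! Suc (m + i)) (- real (Suc (m + i))) (phase j \<omega> (Suc (m + i)))))"
proof (induction k arbitrary: t)
  case 0 then show ?case by simp
next
  case (Suc k)
  have "walk_sum d inc f (blocks (m + Suc k) \<omega>) (- real (m + Suc k)) (phase j \<omega> (m + Suc k)) t =
    walk_sum d inc f (conc 1 (\<omega> !! Suc (m + k)) (blocks (m + k) \<omega>)) (- real (Suc (m + k))) (phase j \<omega> (Suc (m + k))) t"
    by (simp del: snth.simps)
  also have "\<dots> = walk_sum d inc f (blocks (m + k) \<omega>) (- real (Suc (m + k)) + 1) (phase j \<omega> (Suc (m + k)) + int (cnt 1 (\<omega> !! Suc (m + k))))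
     (wtime d inc (\<omega> !! Suc (m + k)) (- real (Suc (m + k))) (phase j \<omega> (Suc (m + k))) t (cnt 1 (\<omega> !! Suc (m + k))))"
  proof (rule walk_sum_conc[where f = f and ?s0.0 = s0, OF admissibleD(1)[OF \<omega>(1)] recurrent_blocks[OF \<omega>] _ f0])
    fix s t assume "exp (- (- real (Suc (m + k)) + 1)) \<le> s"
    moreover have "exp (real m) \<le> exp (- (- real (Suc (m + k)) + 1))" by simp
    ultimately show "f (s, t) = 0" by (intro f1) linarith
  qed
  also have "\<dots> = walk_sum d inc f (blocks (m + k) \<omega>) (- real (m + k)) (phase j \<omega> (m + k))
     (t + block_time d inc 1 (\<omega> !! Suc (m + k)) (- real (Suc (m + k))) (phase j \<omega> (Suc (m + k))))"
    unfolding phase_Suc block_time_def using wtime_shift[of d inc "\<omega> !! Suc (m + k)" _ _ t] by simp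
  finally show ?case unfolding Suc.IH by (simp add: algebra_simps del: snth.simps)
qed

lemma cnt_mono:
  assumes "recurrent d u" "a \<le> b" shows "cnt a u \<le> cnt b u"
proof (rule ccontr)
  assume "\<not> cnt a u \<le> cnt b u"
  then have "psum u (Suc (cnt b u)) \<le> a" using cnt_finite(2)[OF assms(1)] by simp
  then show False using cnt_finite(1)[OF assms(1), of b] assms(2) by simp
qed

text \<open>All contributing points lie at positions at most \<open>x + a \<le> z\<close>, and there
  are at most as many as in the full unit block. The bound depends neither on the phase nor on the
  rule \<open>inc\<close>, which is what dominated convergence will need.\<close>

lemma block_time_bounds:
  assumes u: "recurrent d u" and "a \<le> 1" "x + a \<le> z"
    and inc: "\<And>y e. x < y \<Longrightarrow> 0 < e \<Longrightarrow> 0 \<le> inc y e \<and> inc y e \<le> (1 + e) * exp y"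
  shows "0 \<le> block_time d inc a u x j" "block_time d inc a u x j \<le> exp z * mass u"
proof -
  let ?g = "\<lambda>i. if record_at d j i then inc (wpos u x i) (snd (u !! i)) else 0"
  have inc': "0 \<le> inc (wpos u x i) (snd (u !! i))" "inc (wpos u x i) (snd (u !! i)) \<le> (1 + snd (u !! i)) * exp (wpos u x i)" for i
    using inc[OF wpos_gt[OF u] recurrentD(2)[OF u]] by blast+
  show "0 \<le> block_time d inc a u x j"
    unfolding block_time_def wtime_def using inc'(1) by (simp add: sum_nonneg)
  have "block_time d inc a u x j = (\<Sum>i<cnt a u. ?g i)" by (simp add: block_time_def wtime_def)
  also have "\<dots> \<le> (\<Sum>i<cnt a u. exp z * (1 + snd (u !! i)))"
  proof (rule sum_mono)
    fix i assume i: "i \<in> {..<cnt a u}"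
    have e: "0 < snd (u !! i)" using recurrentD(2)[OF u] .
    have "wpos u x i \<le> z" using cnt_finite(2)[OF u, of i a] i assms(3) unfolding wpos_def by simp
    then have "(1 + snd (u !! i)) * exp (wpos u x i) \<le> (1 + snd (u !! i)) * exp z"
      using e by (intro mult_left_mono) auto
    then have "inc (wpos u x i) (snd (u !! i)) \<le> exp z * (1 + snd (u !! i))"
      using inc'(2)[of i] by (simp add: mult.commute)
    then show "?g i \<le> exp z * (1 + snd (u !! i))" using e by simp
  qed
  also have "\<dots> \<le> (\<Sum>i<cnt 1 u. exp z * (1 + snd (u !! i)))"
  proof (rule sum_mono2)
    show "{..<cnt a u} \<subseteq> {..<cnt 1 u}" using cnt_mono[OF u assms(2)] by auto
    show "0 \<le> exp z * (1 + snd (u !! b))" for b using recurrentD(2)[OF u, of b] by simp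
  qed simp
  also have "\<dots> = exp z * mass u" unfolding mass_def by (simp add: sum_distrib_left)
  finally show "block_time d inc a u x j \<le> exp z * mass u" .
qed

section \<open>Waiting times before and in the limit\<close>

definition limit_inc :: "real \<Rightarrow> real \<Rightarrow> real" where
  "limit_inc y e = e * exp y"

text \<open>At position \<open>y\<close> the unscaled height is \<open>p = exp (- y) / b\<close>.
  For a standard exponential \<open>e\<close> the floor of \<open>e / - ln (1 - p)\<close> is a
  geometric number of failures; one is added for the success, and time is divided by
  \<open>b\<close>. As \<open>p\<close> tends to zero the quotient is close to
  \<open>e / p = b * e * exp y\<close>, which explains \<open>limit_inc\<close>.\<close>

definition waiting_inc :: "real \<Rightarrow> real \<Rightarrow> real \<Rightarrow> real" where
  "waiting_inc b y e = (1 + real (nat \<lfloor>e / - ln (1 - exp (- y) / b)\<rfloor>)) / b"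

lemma limit_inc_bounds: "0 < e \<Longrightarrow> 0 \<le> limit_inc y e \<and> limit_inc y e \<le> (1 + e) * exp y"
  unfolding limit_inc_def by simp

text \<open>All bounds come from \<open>p \<le> - ln (1 - p) \<le> p / (1 - p)\<close> together with
  an error of at most one from the floor. The last bound absorbs \<open>1 / b\<close> into
  \<open>exp y\<close>, which is where \<open>- ln b < y\<close> is used.\<close>

lemma waiting_inc_bounds:
  assumes b: "0 < b" and y: "- ln b < y" and e: "0 < e"
  shows "e * exp y * (1 - exp (- y) / b) \<le> waiting_inc b y e" "waiting_inc b y e \<le> 1 / b + e * exp y"
    "0 \<le> waiting_inc b y e \<and> waiting_inc b y e \<le> (1 + e) * exp y"
proof -
  define p where "p = exp (- y) / b"
  define z where "z = e / - ln (1 - p)"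
  have "exp (- y) < exp (ln b)" using y by (subst exp_less_cancel_iff) simp
  then have p: "0 < p" "p < 1" using b by (auto simp: p_def)
  have l1: "p \<le> - ln (1 - p)" using ln_add_one_self_le_self2[of "- p"] p by simp
  have "ln (1 / (1 - p)) \<le> 1 / (1 - p) - 1" using p by (intro ln_le_minus_one) simp
  also have "1 / (1 - p) - 1 = p / (1 - p)" using p by (simp add: field_simps)
  finally have l2: "- ln (1 - p) \<le> p / (1 - p)" using p by (simp add: ln_div)
  have ep: "e / p = b * (e * exp y)" using b by (simp add: p_def exp_minus field_simps)
  have z0: "0 < z" unfolding z_def using e l1 p by (intro divide_pos_pos) auto
  have z1: "z \<le> e / p" unfolding z_def using e l1 p by (intro frac_le) auto
  have "e / (p / (1 - p)) \<le> z" unfolding z_def using e l1 l2 p by (intro frac_le) auto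
  moreover have "e / (p / (1 - p)) = e / p * (1 - p)" by simp
  ultimately have z2: "e / p * (1 - p) \<le> z" by simp
  have fl: "real (nat \<lfloor>z\<rfloor>) \<le> z" "z \<le> 1 + real (nat \<lfloor>z\<rfloor>)" using z0 by linarith+
  have w: "waiting_inc b y e = (1 + real (nat \<lfloor>z\<rfloor>)) / b" by (simp add: waiting_inc_def z_def p_def)
  have "b * (e * exp y) * (1 - p) \<le> 1 + real (nat \<lfloor>z\<rfloor>)" using z2 fl(2) unfolding ep by linarith
  then show "e * exp y * (1 - exp (- y) / b) \<le> waiting_inc b y e"
    using b by (simp only: w p_def[symmetric] pos_le_divide_eq) (simp only: mult_ac)
  have "1 + real (nat \<lfloor>z\<rfloor>) \<le> 1 + b * (e * exp y)" using z1 fl(1) unfolding ep by linarith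
  then have "waiting_inc b y e \<le> (1 + b * (e * exp y)) / b"
    unfolding w using b by (intro divide_right_mono) auto
  then show up: "waiting_inc b y e \<le> 1 / b + e * exp y" using b by (simp add: add_divide_distrib)
  have "1 / b = exp (- ln b)" using b by (simp add: exp_minus inverse_eq_divide)
  also have "\<dots> \<le> exp y" using y by simp
  finally have "1 / b \<le> exp y" .
  then show "0 \<le> waiting_inc b y e \<and> waiting_inc b y e \<le> (1 + e) * exp y"
    using up b unfolding w by (auto simp: algebra_simps)
qed

lemma waiting_inc_tendsto:
  assumes e: "0 < e"
  shows "((\<lambda>b. waiting_inc b y e) \<longlongrightarrow> limit_inc y e) at_top"
proof (rule tendsto_sandwich)
  have ev: "eventually (\<lambda>b. 0 < b \<and> - ln b < y) at_top"
    using eventually_gt_at_top[of "max 0 (exp (- y))"]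
  proof eventually_elim
    fix b :: real assume b: "max 0 (exp (- y)) < b"
    have "0 < b" "exp (- y) < b" using b by linarith+
    then have "ln (exp (- y)) < ln b" by (subst ln_less_cancel_iff) auto
    then show "0 < b \<and> - ln b < y" using \<open>0 < b\<close> by simp
  qed
  show "\<forall>\<^sub>F b in at_top. e * exp y * (1 - exp (- y) / b) \<le> waiting_inc b y e"
    using ev by eventually_elim (use waiting_inc_bounds(1) e in blast)
  show "\<forall>\<^sub>F b in at_top. waiting_inc b y e \<le> 1 / b + e * exp y"
    using ev by eventually_elim (use waiting_inc_bounds(2) e in blast)
  have z: "((\<lambda>b::real. c / b) \<longlongrightarrow> 0) at_top" for c :: real
    by (rule tendsto_divide_0[OF tendsto_const filterlim_at_top_imp_at_infinity[OF filterlim_ident]])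
  have "((\<lambda>b::real. e * exp y * (1 - exp (- y) / b)) \<longlongrightarrow> e * exp y * (1 - 0)) at_top"
    by (intro tendsto_intros z)
  then show "((\<lambda>b::real. e * exp y * (1 - exp (- y) / b)) \<longlongrightarrow> limit_inc y e) at_top"
    by (simp add: limit_inc_def)
  have "((\<lambda>b::real. 1 / b + e * exp y) \<longlongrightarrow> 0 + e * exp y) at_top"
    by (intro tendsto_intros z)
  then show "((\<lambda>b::real. 1 / b + e * exp y) \<longlongrightarrow> limit_inc y e) at_top"
    by (simp add: limit_inc_def)
qed

text \<open>The time at which the limit process arrives at position \<open>- m\<close>: the total
  spent in the infinitely many blocks further to the left.\<close>

definition limit_time :: "nat \<Rightarrow> int \<Rightarrow> (real \<times> real) stream stream \<Rightarrow> nat \<Rightarrow> real" where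
  "limit_time d j \<omega> m = (\<Sum>i. block_time d limit_inc 1 (\<omega> !! Suc (m + i)) (- real (Suc (m + i))) (phase j \<omega> (Suc (m + i))))"

lemma limit_block_time_bounds:
  assumes "admissible d \<omega>"
  shows "0 \<le> block_time d limit_inc 1 (\<omega> !! Suc i) (- real (Suc i)) j'"
    "block_time d limit_inc 1 (\<omega> !! Suc i) (- real (Suc i)) j' \<le> exp (- real i) * mass (\<omega> !! Suc i)"
  using block_time_bounds[OF admissibleD(1)[OF assms], of 1 "- real (Suc i)" "- real i" limit_inc] limit_inc_bounds
  by (simp_all del: snth.simps)

lemma summable_limit_block_time:
  assumes "admissible d \<omega>"
  shows "summable (\<lambda>i. block_time d limit_inc 1 (\<omega> !! Suc (m + i)) (- real (Suc (m + i))) (phase j \<omega> (Suc (m + i))))"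
proof (rule summable_comparison_test')
  show "summable (\<lambda>i. exp (- real (m + i)) * mass (\<omega> !! Suc (m + i)))"
    using summable_ignore_initial_segment[OF admissibleD(2)[OF assms], of m] by (simp only: add.commute)
  show "norm (block_time d limit_inc 1 (\<omega> !! Suc (m + i)) (- real (Suc (m + i))) (phase j \<omega> (Suc (m + i))))
     \<le> exp (- real (m + i)) * mass (\<omega> !! Suc (m + i))" for i
    using limit_block_time_bounds[OF assms, of "m + i"] by (simp only: real_norm_def abs_of_nonneg)
qed

lemma limit_time_Suc:
  assumes "admissible d \<omega>"
  shows "limit_time d j \<omega> m = limit_time d j \<omega> (Suc m) +
    block_time d limit_inc 1 (\<omega> !! Suc m) (- real (Suc m)) (phase j \<omega> (Suc m))"
  using suminf_split_head[OF summable_limit_block_time[OF assms, of m j]]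
  unfolding limit_time_def by (simp del: snth.simps)

lemma limit_time_tendsto:
  assumes "admissible d \<omega>"
  shows "(\<lambda>m. limit_time d j \<omega> m) \<longlonglongrightarrow> 0"
proof -
  let ?a = "\<lambda>i. block_time d limit_inc 1 (\<omega> !! Suc i) (- real (Suc i)) (phase j \<omega> (Suc i))"
  have s: "summable ?a" using summable_limit_block_time[OF assms, of 0 j] by simp
  have "limit_time d j \<omega> m = suminf ?a - sum ?a {..<m}" for m
    unfolding limit_time_def using suminf_minus_initial_segment[OF s, of m] by (simp only: add.commute)
  moreover have "(\<lambda>m. suminf ?a - sum ?a {..<m}) \<longlonglongrightarrow> suminf ?a - suminf ?a"
    by (intro tendsto_intros summable_LIMSEQ s)
  ultimately show ?thesis by simp
qed

subsection \<open>Almost sure convergence\<close>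

text \<open>The integer \<open>m\<close> with \<open>m < ln b \<le> m + 1\<close>. The partial block
  that reaches from \<open>- ln b\<close> to \<open>- m\<close> thus has a length in
  \<open>(0, 1]\<close>.\<close>

definition full_blocks :: "real \<Rightarrow> nat" where
  "full_blocks b = nat (\<lceil>ln b\<rceil> - 1)"

lemma full_blocks_bounds:
  assumes "1 < b"
  shows "real (full_blocks b) < ln b" "ln b \<le> real (full_blocks b) + 1"
proof -
  have "0 < ln b" using assms by simp
  then have "real (full_blocks b) = real_of_int \<lceil>ln b\<rceil> - 1" unfolding full_blocks_def by simp
  then show "real (full_blocks b) < ln b" "ln b \<le> real (full_blocks b) + 1" by linarith+
qed

lemma full_blocks_at_top: "filterlim full_blocks at_top at_top"
  unfolding filterlim_at_top
proof
  fix n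
  have "eventually (\<lambda>b. exp (real n + 1) < b) at_top" by (rule eventually_gt_at_top)
  then show "eventually (\<lambda>b. n \<le> full_blocks b) at_top"
  proof eventually_elim
    fix b :: real assume b: "exp (real n + 1) < b"
    moreover have "1 < exp (real n + 1)" by simp
    ultimately have "1 < b" by linarith
    have "ln (exp (real n + 1)) < ln b" using b \<open>1 < b\<close> by (subst ln_less_cancel_iff) auto
    then show "n \<le> full_blocks b" using full_blocks_bounds(2)[OF \<open>1 < b\<close>] by simp
  qed
qed

text \<open>All values of \<open>b\<close> read the same blocks. From \<open>- ln b\<close> to
  \<open>- m\<close> the initial part of block \<open>Suc m\<close> is used, so this piece slides
  with \<open>b\<close>; its contribution to the clock vanishes in the limit. Here \<open>j\<close>
  is the phase at position \<open>0\<close>, and the starting time \<open>1 / b\<close> is the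
  scaled index of the first record.\<close>

definition coupled_process :: "nat \<Rightarrow> (real \<times> real) stream stream \<Rightarrow> int \<Rightarrow> real \<Rightarrow> (real \<times> real) measure" where
  "coupled_process d \<omega> j b = (let m = full_blocks b; a = ln b - real m in
     walk d (waiting_inc b) (conc a (\<omega> !! Suc m) (blocks m \<omega>)) (- ln b)
       (phase j \<omega> m - int (cnt a (\<omega> !! Suc m))) (1 / b))"

definition coupled_time :: "nat \<Rightarrow> (real \<times> real) stream stream \<Rightarrow> int \<Rightarrow> nat \<Rightarrow> real \<Rightarrow> real" where
  "coupled_time d \<omega> j m0 b = (let m = full_blocks b; a = ln b - real m in
     1 / b + block_time d (waiting_inc b) a (\<omega> !! Suc m) (- ln b) (phase j \<omega> m - int (cnt a (\<omega> !! Suc m)))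
     + (\<Sum>i<m - m0. block_time d (waiting_inc b) 1 (\<omega> !! Suc (m0 + i)) (- real (Suc (m0 + i))) (phase j \<omega> (Suc (m0 + i)))))"

text \<open>The partial block and the whole blocks beyond \<open>m0\<close> lie where
  \<open>f\<close> vanishes; peeling them off leaves only the clock reading at
  \<open>- m0\<close>.\<close>

lemma walk_sum_coupled:
  assumes \<omega>: "admissible d \<omega>" "0 < d" and b: "1 < b" and m0: "m0 \<le> full_blocks b"
    and f1: "\<And>s t. exp (real m0) \<le> s \<Longrightarrow> f (s, t) = 0"
    and f0: "0 < s0" "\<And>s t. s < s0 \<Longrightarrow> f (s, t) = 0"
  shows "(let m = full_blocks b; a = ln b - real m in
     walk_sum d (waiting_inc b) f (conc a (\<omega> !! Suc m) (blocks m \<omega>)) (- ln b)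
       (phase j \<omega> m - int (cnt a (\<omega> !! Suc m))) (1 / b)) =
     walk_sum d (waiting_inc b) f (blocks m0 \<omega>) (- real m0) (phase j \<omega> m0) (coupled_time d \<omega> j m0 b)"
proof -
  define m a where "m = full_blocks b" and "a = ln b - real m"
  define k where "k = m - m0"
  have mk: "m = m0 + k" using m0 by (simp add: m_def k_def)
  have "walk_sum d (waiting_inc b) f (conc a (\<omega> !! Suc m) (blocks m \<omega>)) (- ln b)
       (phase j \<omega> m - int (cnt a (\<omega> !! Suc m))) (1 / b) =
     walk_sum d (waiting_inc b) f (blocks m \<omega>) (- ln b + a) (phase j \<omega> m - int (cnt a (\<omega> !! Suc m)) + int (cnt a (\<omega> !! Suc m)))
       (wtime d (waiting_inc b) (\<omega> !! Suc m) (- ln b) (phase j \<omega> m - int (cnt a (\<omega> !! Suc m))) (1 / b) (cnt a (\<omega> !! Suc m)))"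
  proof (rule walk_sum_conc[where f = f and ?s0.0 = s0, OF admissibleD(1)[OF \<omega>(1)] recurrent_blocks[OF \<omega>] _ f0])
    fix s t assume "exp (- (- ln b + a)) \<le> s"
    moreover have "exp (real m0) \<le> exp (- (- ln b + a))" using mk by (simp add: a_def)
    ultimately show "f (s, t) = 0" by (intro f1) linarith
  qed
  also have "\<dots> = walk_sum d (waiting_inc b) f (blocks (m0 + k) \<omega>) (- real (m0 + k)) (phase j \<omega> (m0 + k))
       (1 / b + block_time d (waiting_inc b) a (\<omega> !! Suc m) (- ln b) (phase j \<omega> m - int (cnt a (\<omega> !! Suc m))))"
    unfolding block_time_def using wtime_shift[of d "waiting_inc b" "\<omega> !! Suc m" _ _ "1 / b"]
    by (simp add: a_def mk)
  also have "\<dots> = walk_sum d (waiting_inc b) f (blocks m0 \<omega>) (- real m0) (phase j \<omega> m0) (coupled_time d \<omega> j m0 b)"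
    by (subst walk_sum_blocks[where f = f and ?s0.0 = s0, OF \<omega> f1 f0])
      (simp_all only: coupled_time_def Let_def m_def[symmetric] a_def[symmetric] k_def[symmetric])
  finally show ?thesis unfolding Let_def m_def[symmetric] a_def[symmetric] .
qed

text \<open>The partial block costs at most one term of the convergent series of weighted masses, a
  term whose index tends to infinity. The whole blocks are handled by dominated convergence for
  series, with the weighted masses as dominating sequence.\<close>

lemma coupled_time_tendsto:
  assumes \<omega>: "admissible d \<omega>"
  shows "((\<lambda>b. coupled_time d \<omega> j m0 b) \<longlongrightarrow> limit_time d j \<omega> m0) at_top"
proof -
  let ?B = "\<lambda>i. exp (- real i) * mass (\<omega> !! Suc i)"
  have sB: "summable ?B" by (rule admissibleD(2)[OF \<omega>])
  have b1: "eventually (\<lambda>b. 1 < (b::real)) at_top" by (rule eventually_gt_at_top)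
  have "((\<lambda>b::real. 1 / b) \<longlongrightarrow> 0) at_top"
    by (rule tendsto_divide_0[OF tendsto_const filterlim_at_top_imp_at_infinity[OF filterlim_ident]])
  moreover have "((\<lambda>b. block_time d (waiting_inc b) (ln b - real (full_blocks b)) (\<omega> !! Suc (full_blocks b)) (- ln b)
      (phase j \<omega> (full_blocks b) - int (cnt (ln b - real (full_blocks b)) (\<omega> !! Suc (full_blocks b))))) \<longlongrightarrow> 0) at_top"
    (is "(?p \<longlongrightarrow> 0) at_top")
  proof (rule tendsto_sandwich)
    have inc: "0 \<le> waiting_inc b y e \<and> waiting_inc b y e \<le> (1 + e) * exp y"
      if "1 < b" "- ln b < y" "0 < e" for b y e using waiting_inc_bounds(3)[of b y e] that by simp
    have *: "0 \<le> ?p b \<and> ?p b \<le> ?B (full_blocks b)" if "1 < b" for b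
      using block_time_bounds[OF admissibleD(1)[OF \<omega>], of "ln b - real (full_blocks b)" "- ln b" "- real (full_blocks b)" "waiting_inc b"]
        inc[OF that] full_blocks_bounds[OF that] by (simp del: snth.simps)
    show "\<forall>\<^sub>F b in at_top. 0 \<le> ?p b" using b1 by eventually_elim (use * in blast)
    show "\<forall>\<^sub>F b in at_top. ?p b \<le> ?B (full_blocks b)" using b1 by eventually_elim (use * in blast)
    show "((\<lambda>b. ?B (full_blocks b)) \<longlongrightarrow> 0) at_top"
      by (rule filterlim_compose[OF summable_LIMSEQ_zero[OF sB] full_blocks_at_top])
  qed simp
  moreover have "((\<lambda>b. \<Sum>i<full_blocks b - m0. block_time d (waiting_inc b) 1 (\<omega> !! Suc (m0 + i)) (- real (Suc (m0 + i))) (phase j \<omega> (Suc (m0 + i))))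
      \<longlongrightarrow> limit_time d j \<omega> m0) at_top"
  proof -
    \<comment> \<open>Padding with zeros turns a sum whose length grows with \<open>b\<close> into a
      series with a fixed index set.\<close>
    define c where "c i b = (if i < full_blocks b - m0 then
      block_time d (waiting_inc b) 1 (\<omega> !! Suc (m0 + i)) (- real (Suc (m0 + i))) (phase j \<omega> (Suc (m0 + i))) else 0)" for i b
    have "((\<lambda>b. suminf (\<lambda>i. c i b)) \<longlongrightarrow> limit_time d j \<omega> m0) at_top"
      unfolding limit_time_def
    proof (rule tannerys_theorem[THEN conjunct2, THEN conjunct2])
      show "summable (\<lambda>i. ?B (m0 + i))"
        using summable_ignore_initial_segment[OF sB, of m0] by (simp only: add.commute)
      have "norm (c i b) \<le> ?B (m0 + i)" if "1 < b" for i b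
      proof (cases "i < full_blocks b - m0")
        case True
        have "real (Suc (m0 + i)) \<le> real (full_blocks b)" using True by linarith
        then have "- ln b \<le> - real (Suc (m0 + i))" using full_blocks_bounds[OF that] by linarith
        then have "0 \<le> waiting_inc b y e \<and> waiting_inc b y e \<le> (1 + e) * exp y"
          if "- real (Suc (m0 + i)) < y" "0 < e" for y e
          using waiting_inc_bounds(3)[of b y e] that \<open>1 < b\<close> by simp
        then have "0 \<le> c i b \<and> c i b \<le> ?B (m0 + i)"
          using block_time_bounds[OF admissibleD(1)[OF \<omega>], of 1 "- real (Suc (m0 + i))" "- real (m0 + i)" "waiting_inc b"] True
          unfolding c_def by (simp del: snth.simps)
        then show ?thesis by simp
      next
        case False
        have "0 \<le> mass (\<omega> !! Suc (m0 + i))"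
          unfolding mass_def using recurrentD(2)[OF admissibleD(1)[OF \<omega>]]
          by (intro sum_nonneg) (simp add: add_nonneg_nonneg less_imp_le del: snth.simps)
        then show ?thesis using False unfolding c_def by simp
      qed
      then show "\<forall>\<^sub>F (i, b) in at_top \<times>\<^sub>F at_top. norm (c i b) \<le> ?B (m0 + i)"
        using b1 by (auto simp: eventually_prod_filter intro!: exI[of _ "\<lambda>_. True"] exI[of _ "\<lambda>b. 1 < b"])
      fix i
      have "eventually (\<lambda>b. i + m0 < full_blocks b) at_top"
        using full_blocks_at_top eventually_gt_at_top[of "i + m0"] by (auto simp: filterlim_iff)
      then have ev: "eventually (\<lambda>b. block_time d (waiting_inc b) 1 (\<omega> !! Suc (m0 + i)) (- real (Suc (m0 + i))) (phase j \<omega> (Suc (m0 + i))) = c i b) at_top"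
        by eventually_elim (auto simp: c_def)
      have "((\<lambda>b. block_time d (waiting_inc b) 1 (\<omega> !! Suc (m0 + i)) (- real (Suc (m0 + i))) (phase j \<omega> (Suc (m0 + i))))
        \<longlongrightarrow> block_time d limit_inc 1 (\<omega> !! Suc (m0 + i)) (- real (Suc (m0 + i))) (phase j \<omega> (Suc (m0 + i)))) at_top"
        unfolding block_time_def wtime_def
        by (intro tendsto_add tendsto_const tendsto_sum)
          (use waiting_inc_tendsto[OF recurrentD(2)[OF admissibleD(1)[OF \<omega>]]] in \<open>simp del: snth.simps\<close>)
      then show "((\<lambda>b. c i b) \<longlongrightarrow> block_time d limit_inc 1 (\<omega> !! Suc (m0 + i)) (- real (Suc (m0 + i))) (phase j \<omega> (Suc (m0 + i)))) at_top"
        by (rule Lim_transform_eventually[OF _ ev])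
    qed simp
    moreover have "suminf (\<lambda>i. c i b) = (\<Sum>i<full_blocks b - m0. block_time d (waiting_inc b) 1 (\<omega> !! Suc (m0 + i)) (- real (Suc (m0 + i))) (phase j \<omega> (Suc (m0 + i))))" for b
    proof -
      have "suminf (\<lambda>i. c i b) = (\<Sum>i<full_blocks b - m0. c i b)"
        by (rule suminf_finite) (auto simp: c_def)
      then show ?thesis by (simp add: c_def del: snth.simps)
    qed
    ultimately show ?thesis by simp
  qed
  ultimately have "((\<lambda>b. coupled_time d \<omega> j m0 b) \<longlongrightarrow> 0 + 0 + limit_time d j \<omega> m0) at_top"
    unfolding coupled_time_def Let_def by (intro tendsto_add)
  then show ?thesis by simp
qed

text \<open>Which points can contribute is decided by their positions, and these involve neither
  \<open>b\<close> nor the clock. So a fixed finite number of terms remains, each continuous in the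
  waiting times.\<close>

lemma walk_sum_tendsto:
  assumes w: "recurrent d w" and f: "continuous_on UNIV f"
    and f0: "0 < s0" "\<And>s t. s < s0 \<Longrightarrow> f (s, t) = 0"
    and t: "(tb \<longlongrightarrow> t) at_top"
  shows "((\<lambda>b. walk_sum d (waiting_inc b) f w x j (tb b)) \<longlongrightarrow> walk_sum d limit_inc f w x j t) at_top"
proof -
  obtain N where N: "\<forall>n\<ge>N. - ln s0 < wpos w x n" using wpos_unbounded[OF w] by blast
  have eq: "walk_sum d inc f w x j t = (\<Sum>n<N. if record_at d j n then f (wpoint d inc w x j t n) else 0)" for inc t
    unfolding walk_sum_def
  proof (rule suminf_finite)
    fix n assume "n \<notin> {..<N}"
    then have "exp (- wpos w x n) < s0" using N f0(1) by (metis exp_less_cancel_iff exp_ln lessThan_iff minus_less_iff not_less)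
    then show "(if record_at d j n then f (wpoint d inc w x j t n) else 0) = 0"
      unfolding wpoint_def by (simp add: f0(2))
  qed simp
  show ?thesis
    unfolding eq
  proof (rule tendsto_sum)
    fix n
    have "((\<lambda>b. wpoint d (waiting_inc b) w x j (tb b) n) \<longlongrightarrow> wpoint d limit_inc w x j t n) at_top"
      unfolding wpoint_def wtime_def
      by (intro tendsto_Pair tendsto_add tendsto_const tendsto_sum t)
        (use waiting_inc_tendsto[OF recurrentD(2)[OF w]] in \<open>simp del: snth.simps\<close>)
    then have "((\<lambda>b. f (wpoint d (waiting_inc b) w x j (tb b) n)) \<longlongrightarrow> f (wpoint d limit_inc w x j t n)) at_top"
      by (rule continuous_on_tendsto_compose[OF f]) auto
    then show "((\<lambda>b. if record_at d j n then f (wpoint d (waiting_inc b) w x j (tb b) n) else 0)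
      \<longlongrightarrow> (if record_at d j n then f (wpoint d limit_inc w x j t n) else 0)) at_top" by simp
  qed
qed

declare sets_marked_expo [measurable_cong del]

lemma compact_pos_bounds:
  fixes K :: "real set"
  assumes "compact K" "K \<subseteq> pos_reals"
  obtains s0 s1 where "0 < s0" "\<And>x. x \<in> K \<Longrightarrow> s0 \<le> x \<and> x \<le> s1"
proof (cases "K = {}")
  case True then show ?thesis using that[of 1 1] by simp
next
  case False
  then obtain l u where l: "l \<in> K" "\<forall>x\<in>K. l \<le> x" and u: "u \<in> K" "\<forall>x\<in>K. x \<le> u"
    using compact_attains_inf[OF assms(1)] compact_attains_sup[OF assms(1)] by metis
  show ?thesis by (rule that[of l u]) (use l u assms(2) in auto)
qed

abbreviation extend0 :: "(real \<times> real \<Rightarrow> real) \<Rightarrow> real \<times> real \<Rightarrow> real" where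
  "extend0 f x \<equiv> (if x \<in> pos_quadrant then f x else 0)"

lemma test_function_bounds:
  assumes "f \<in> test_functions pos_quadrant"
  obtains s0 s1 where "0 < s0" "\<And>s t. s < s0 \<Longrightarrow> extend0 f (s, t) = 0" "\<And>s t. s1 < s \<Longrightarrow> extend0 f (s, t) = 0"
proof -
  obtain K where K: "compact K" "K \<subseteq> pos_quadrant" "\<forall>x\<in>pos_quadrant - K. f x = 0"
    using assms unfolding test_functions_def by blast
  have "compact (fst ` K)" "fst ` K \<subseteq> pos_reals"
    using compact_continuous_image[OF continuous_on_fst[OF continuous_on_id] K(1)] K(2) by auto
  then obtain s0 s1 where s: "0 < s0" "\<And>x. x \<in> fst ` K \<Longrightarrow> s0 \<le> x \<and> x \<le> s1"
    using compact_pos_bounds by metis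
  have *: "extend0 f (s, t) = 0" if "s < s0 \<or> s1 < s" for s t
  proof (cases "(s, t) \<in> K")
    case True
    then have "s \<in> fst ` K" by force
    then have "s0 \<le> s \<and> s \<le> s1" by (rule s(2))
    then show ?thesis using that by linarith
  next
    case False then show ?thesis using K(3) by auto
  qed
  show ?thesis by (rule that[of s0 s1]) (use s(1) * in blast)+
qed

subsection \<open>Local finiteness and measurability of walks\<close>

lemma wtime_ge_card:
  assumes "\<And>y e. c \<le> inc y e" "0 \<le> c"
  shows "t + c * real (card {i. i < n \<and> record_at d j i}) \<le> wtime d inc w x j t n"
proof -
  have "c * real (card {i. i < n \<and> record_at d j i}) = (\<Sum>i\<in>{i. i < n \<and> record_at d j i}. c)" by simp
  also have "\<dots> = (\<Sum>i<n. if record_at d j i then c else 0)"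
    by (subst sum.inter_filter[symmetric]) (auto intro!: sum.cong)
  also have "\<dots> \<le> (\<Sum>i<n. if record_at d j i then inc (wpos w x i) (snd (w !! i)) else 0)"
    using assms by (intro sum_mono) auto
  finally show ?thesis unfolding wtime_def by simp
qed

text \<open>Every record advances the clock by at least \<open>c\<close>, so a bounded time allows
  only finitely many of them. Waiting times satisfy this with \<open>c = 1 / b\<close>;
  \<open>limit_inc\<close> has no such lower bound, and the limit needs another argument.\<close>

lemma walk_locally_finite:
  assumes inc: "\<And>y e. c \<le> inc y e" "0 < c" and K: "compact K" "K \<subseteq> pos_quadrant"
  shows "finite {n \<in> {n. record_at d j n \<and> wpoint d inc w x j t n \<in> pos_quadrant}. wpoint d inc w x j t n \<in> K}"
proof -
  have "compact (snd ` K)"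
    using compact_continuous_image[OF continuous_on_snd[OF continuous_on_id] K(1)] by auto
  then have "bdd_above (snd ` K)" by (intro bounded_imp_bdd_above compact_imp_bounded)
  then obtain T where T: "\<And>x. x \<in> K \<Longrightarrow> snd x \<le> T" unfolding bdd_above_def by auto
  let ?A = "{n. record_at d j n \<and> wtime d inc w x j t n \<le> T}"
  have "finite ?A"
  proof (rule ccontr)
    assume inf: "infinite ?A"
    obtain k :: nat where k: "(T - t) / c < real k" using reals_Archimedean2 by blast
    obtain B where B: "B \<subseteq> ?A" "finite B" "card B = Suc k" using infinite_arbitrarily_large[OF inf] by blast
    have "B \<noteq> {}" using B(3) by auto
    then have n: "Max B \<in> B" using B(2) by simp
    have "B - {Max B} \<subseteq> {i. i < Max B \<and> record_at d j i}"
    proof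
      fix i assume i: "i \<in> B - {Max B}"
      then have "i \<le> Max B" "i \<noteq> Max B" using B(2) by auto
      then show "i \<in> {i. i < Max B \<and> record_at d j i}" using i B(1) by auto
    qed
    then have "card (B - {Max B}) \<le> card {i. i < Max B \<and> record_at d j i}" by (intro card_mono) auto
    then have "k \<le> card {i. i < Max B \<and> record_at d j i}" using B n by simp
    then have "c * real k \<le> c * real (card {i. i < Max B \<and> record_at d j i})" using inc(2) by simp
    moreover have "T < t + c * real k" using k inc(2) by (simp add: pos_divide_less_eq algebra_simps)
    moreover have "wtime d inc w x j t (Max B) \<le> T" using n B(1) by blast
    ultimately show False using wtime_ge_card[where inc = inc and c = c, OF inc(1) less_imp_le[OF inc(2)], where t = t and n = "Max B" and d = d and j = j and w = w and x = x] by linarith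
  qed
  moreover have "{n \<in> {n. record_at d j n \<and> wpoint d inc w x j t n \<in> pos_quadrant}. wpoint d inc w x j t n \<in> K} \<subseteq> ?A"
    using T by (auto simp: wpoint_def)
  ultimately show ?thesis by (rule finite_subset[rotated])
qed

lemma waiting_inc_ge: "0 < b \<Longrightarrow> 1 / b \<le> waiting_inc b y e"
  unfolding waiting_inc_def by (intro divide_right_mono) auto

lemma walk_point_measure:
  assumes "\<And>y e. c \<le> inc y e" "0 < c"
  shows "walk d inc w x j t \<in> point_measures pos_quadrant"
  unfolding walk_def using walk_locally_finite[OF assms] by (intro dirac_sum_in_point_measures) auto

lemma integral_walk:
  assumes inc: "\<And>y e. c \<le> inc y e" "0 < c" and f: "f \<in> test_functions pos_quadrant"
  shows "(\<integral>x. f x \<partial>walk d inc w x j t) = walk_sum d inc (extend0 f) w x j t"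
proof -
  have "(\<integral>x. f x \<partial>walk d inc w x j t) = (\<Sum>n. if n \<in> {n. record_at d j n \<and> wpoint d inc w x j t n \<in> pos_quadrant} then f (wpoint d inc w x j t n) else 0)"
    unfolding walk_def by (rule integral_dirac_sum_suminf[OF _ walk_locally_finite[OF inc] f]) auto
  also have "\<dots> = walk_sum d inc (extend0 f) w x j t"
    unfolding walk_sum_def by (intro suminf_cong) simp
  finally show ?thesis .
qed

lemma measurable_waiting_inc [measurable]:
  assumes [measurable]: "f \<in> borel_measurable M" "g \<in> borel_measurable M"
  shows "(\<lambda>x. waiting_inc b (f x) (g x)) \<in> borel_measurable M"
  unfolding waiting_inc_def by measurable

lemma measurable_limit_inc [measurable]:
  assumes [measurable]: "f \<in> borel_measurable M" "g \<in> borel_measurable M"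
  shows "(\<lambda>x. limit_inc (f x) (g x)) \<in> borel_measurable M"
  unfolding limit_inc_def by measurable

lemma measurable_fst_snth [measurable]:
  assumes [measurable]: "W \<in> M \<rightarrow>\<^sub>M gap_stream"
  shows "(\<lambda>x. fst (W x !! n)) \<in> borel_measurable M" "(\<lambda>x. snd (W x !! n)) \<in> borel_measurable M"
proof -
  have 1: "(\<lambda>x. W x !! n) \<in> M \<rightarrow>\<^sub>M marked_expo" by measurable
  have 2: "fst \<in> borel_measurable marked_expo" "snd \<in> borel_measurable marked_expo"
    unfolding measurable_cong_sets[OF sets_marked_expo refl] by auto
  show "(\<lambda>x. fst (W x !! n)) \<in> borel_measurable M" "(\<lambda>x. snd (W x !! n)) \<in> borel_measurable M"
    by (rule measurable_compose[OF 1 2(1)], rule measurable_compose[OF 1 2(2)])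
qed

lemma measurable_wpos [measurable]:
  assumes [measurable]: "W \<in> M \<rightarrow>\<^sub>M gap_stream"
  shows "(\<lambda>\<omega>. wpos (W \<omega>) x n) \<in> borel_measurable M"
  unfolding wpos_def psum_def by measurable

lemma measurable_wtime:
  assumes inc: "\<And>f g. f \<in> borel_measurable M \<Longrightarrow> g \<in> borel_measurable M \<Longrightarrow> (\<lambda>x. inc (f x) (g x)) \<in> borel_measurable M"
    and [measurable]: "W \<in> M \<rightarrow>\<^sub>M gap_stream" "J \<in> M \<rightarrow>\<^sub>M count_space UNIV" "T \<in> borel_measurable M"
  shows "(\<lambda>\<omega>. wtime d inc (W \<omega>) x (J \<omega>) (T \<omega>) n) \<in> borel_measurable M"
proof -
  have [measurable]: "(\<lambda>\<omega>. inc (wpos (W \<omega>) x i) (snd (W \<omega> !! i))) \<in> borel_measurable M" for i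
    by (intro inc) measurable
  show ?thesis unfolding wtime_def by measurable
qed

lemma measurable_wpoint:
  assumes inc: "\<And>f g. f \<in> borel_measurable M \<Longrightarrow> g \<in> borel_measurable M \<Longrightarrow> (\<lambda>x. inc (f x) (g x)) \<in> borel_measurable M"
    and [measurable]: "W \<in> M \<rightarrow>\<^sub>M gap_stream" "J \<in> M \<rightarrow>\<^sub>M count_space UNIV" "T \<in> borel_measurable M"
  shows "(\<lambda>\<omega>. wpoint d inc (W \<omega>) x (J \<omega>) (T \<omega>) n) \<in> borel_measurable M"
proof -
  have [measurable]: "(\<lambda>\<omega>. wtime d inc (W \<omega>) x (J \<omega>) (T \<omega>) n) \<in> borel_measurable M"
    by (rule measurable_wtime[OF assms])
  show ?thesis unfolding wpoint_def by measurable
qed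

lemma measurable_record_at [measurable]:
  assumes [measurable]: "J \<in> M \<rightarrow>\<^sub>M count_space UNIV"
  shows "Measurable.pred M (\<lambda>\<omega>. record_at d (J \<omega>) n)"
  by measurable

lemma pos_quadrant_borel [measurable]: "pos_quadrant \<in> sets borel"
  by (intro borel_open open_pos_quadrant)

lemma measurable_walk:
  assumes b: "0 < b" and W[measurable]: "W \<in> M \<rightarrow>\<^sub>M gap_stream" "J \<in> M \<rightarrow>\<^sub>M count_space UNIV"
  shows "(\<lambda>\<omega>. walk d (waiting_inc b) (W \<omega>) x (J \<omega>) t) \<in> M \<rightarrow>\<^sub>M vague_borel pos_quadrant"
  unfolding walk_def
proof (rule measurable_dirac_sum[OF open_pos_quadrant])
  have [measurable]: "(\<lambda>\<omega>. wpoint d (waiting_inc b) (W \<omega>) x (J \<omega>) t i) \<in> borel_measurable M" for i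
    by (rule measurable_wpoint[OF measurable_waiting_inc W borel_measurable_const]) simp_all
  show "(\<lambda>\<omega>. wpoint d (waiting_inc b) (W \<omega>) x (J \<omega>) t i) \<in> borel_measurable M" for i
    by measurable
  show "Measurable.pred M (\<lambda>\<omega>. i \<in> {n. record_at d (J \<omega>) n \<and> wpoint d (waiting_inc b) (W \<omega>) x (J \<omega>) t n \<in> pos_quadrant})" for i
    unfolding mem_Collect_eq by measurable
  fix \<omega> and K :: "(real \<times> real) set"
  assume "compact K" "K \<subseteq> pos_quadrant"
  then show "finite {i \<in> {n. record_at d (J \<omega>) n \<and> wpoint d (waiting_inc b) (W \<omega>) x (J \<omega>) t n \<in> pos_quadrant}. wpoint d (waiting_inc b) (W \<omega>) x (J \<omega>) t i \<in> K}"
    using waiting_inc_ge[OF b] b by (intro walk_locally_finite[of "1 / b"]) auto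
qed auto

lemma measurable_blocks [measurable]: "blocks m \<in> block_stream \<rightarrow>\<^sub>M gap_stream"
proof (induction m)
  case 0 then show ?case by (simp add: measurable_shd del: snth.simps) measurable
next
  case (Suc m)
  have "(\<lambda>\<omega>. (\<lambda>(u, v). conc 1 u v) (\<omega> !! Suc m, blocks m \<omega>)) \<in> block_stream \<rightarrow>\<^sub>M gap_stream"
    by (rule measurable_compose[OF measurable_Pair measurable_conc]) (use Suc in measurable)
  then show ?case by (simp del: snth.simps)
qed

lemma measurable_phase [measurable]: "(\<lambda>\<omega>. phase j \<omega> m) \<in> block_stream \<rightarrow>\<^sub>M count_space UNIV"
proof -
  have [measurable]: "(\<lambda>\<omega>. int (cnt 1 (\<omega> !! Suc i))) \<in> block_stream \<rightarrow>\<^sub>M count_space UNIV" for i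
  proof -
    have "(\<lambda>\<omega>. cnt 1 (\<omega> !! Suc i)) \<in> block_stream \<rightarrow>\<^sub>M count_space UNIV"
      by (rule measurable_compose[OF measurable_snth measurable_cnt])
    then show ?thesis by (rule measurable_compose) simp
  qed
  have "(\<lambda>\<omega>. \<Sum>i<m. int (cnt 1 (\<omega> !! Suc i))) \<in> block_stream \<rightarrow>\<^sub>M count_space UNIV"
    by (induction m) auto
  then show ?thesis unfolding phase_def by measurable
qed

lemma measurable_coupled_process:
  assumes "1 < b"
  shows "(\<lambda>\<omega>. coupled_process d \<omega> j b) \<in> block_stream \<rightarrow>\<^sub>M vague_borel pos_quadrant"
proof -
  define m a where "m = full_blocks b" and "a = ln b - real m"
  have c[measurable]: "(\<lambda>\<omega>. cnt a (\<omega> !! Suc m)) \<in> block_stream \<rightarrow>\<^sub>M count_space UNIV"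
    by (rule measurable_compose[OF measurable_snth measurable_cnt])
  have "(\<lambda>\<omega>. walk d (waiting_inc b) (conc a (\<omega> !! Suc m) (blocks m \<omega>)) (- ln b) (phase j \<omega> m - int (cnt a (\<omega> !! Suc m))) (1 / b))
    \<in> block_stream \<rightarrow>\<^sub>M vague_borel pos_quadrant"
  proof (rule measurable_walk)
    have "(\<lambda>\<omega>. (\<lambda>(u, v). conc a u v) (\<omega> !! Suc m, blocks m \<omega>)) \<in> block_stream \<rightarrow>\<^sub>M gap_stream"
      by (rule measurable_compose[OF measurable_Pair measurable_conc]) measurable
    then show "(\<lambda>\<omega>. conc a (\<omega> !! Suc m) (blocks m \<omega>)) \<in> block_stream \<rightarrow>\<^sub>M gap_stream"
      by simp
    show "(\<lambda>\<omega>. phase j \<omega> m - int (cnt a (\<omega> !! Suc m))) \<in> block_stream \<rightarrow>\<^sub>M count_space UNIV"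
      by measurable
  qed (use assms in simp)
  then show ?thesis unfolding coupled_process_def Let_def m_def[symmetric] a_def[symmetric] .
qed

subsection \<open>The limit process\<close>

text \<open>The limit extends infinitely far to the left and is not a single walk. Each block is
  described from its own left end \<open>- i\<close>, with the phase and the elapsed time
  there.\<close>

definition limit_point :: "nat \<Rightarrow> int \<Rightarrow> (real \<times> real) stream stream \<Rightarrow> nat \<Rightarrow> nat \<Rightarrow> real \<times> real" where
  "limit_point d j \<omega> i n = wpoint d limit_inc (\<omega> !! i) (- real i) (phase j \<omega> i) (limit_time d j \<omega> i) n"

definition in_block :: "(real \<times> real) stream stream \<Rightarrow> nat \<Rightarrow> nat \<Rightarrow> bool" where
  "in_block \<omega> i n \<longleftrightarrow> i = 0 \<or> n < cnt 1 (\<omega> !! i)"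

text \<open>A pair of block number and index inside the block is coded as one natural number, as
  \<open>dirac_sum\<close> requires.\<close>

definition limit_index :: "nat \<Rightarrow> int \<Rightarrow> (real \<times> real) stream stream \<Rightarrow> nat set" where
  "limit_index d j \<omega> = {c. in_block \<omega> (fst (prod_decode c)) (snd (prod_decode c)) \<and>
     record_at d (phase j \<omega> (fst (prod_decode c))) (snd (prod_decode c)) \<and>
     limit_point d j \<omega> (fst (prod_decode c)) (snd (prod_decode c)) \<in> pos_quadrant}"

definition limit_enum :: "nat \<Rightarrow> int \<Rightarrow> (real \<times> real) stream stream \<Rightarrow> nat \<Rightarrow> real \<times> real" where
  "limit_enum d j \<omega> c = limit_point d j \<omega> (fst (prod_decode c)) (snd (prod_decode c))"

definition limit_process :: "nat \<Rightarrow> int \<Rightarrow> (real \<times> real) stream stream \<Rightarrow> (real \<times> real) measure" where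
  "limit_process d j \<omega> = dirac_sum pos_quadrant (limit_index d j \<omega>) (limit_enum d j \<omega>)"

lemma limit_enum_in: "limit_enum d j \<omega> \<in> limit_index d j \<omega> \<rightarrow> pos_quadrant"
  by (auto simp: limit_index_def limit_enum_def)

lemma block_wpos_le:
  assumes "admissible d \<omega>" "in_block \<omega> (Suc i) n"
  shows "wpos (\<omega> !! Suc i) (- real (Suc i)) n \<le> - real i"
  using cnt_finite(2)[OF admissibleD(1)[OF assms(1)], of n 1 "Suc i"] assms(2)
  unfolding in_block_def wpos_def by (simp del: snth.simps)

text \<open>Heights at most \<open>s1\<close> exclude the blocks far to the left, heights at least
  \<open>s0\<close> exclude late points of block \<open>0\<close>, and every other block has
  finitely many points.\<close>

lemma limit_point_finite_fst:
  assumes \<omega>: "admissible d \<omega>" and s0: "0 < s0"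
  shows "\<exists>m N. \<forall>i n. in_block \<omega> i n \<and> s0 \<le> fst (limit_point d j \<omega> i n) \<and> fst (limit_point d j \<omega> i n) \<le> s1 \<longrightarrow> i \<le> m \<and> n < N"
proof -
  obtain m :: nat where m: "s1 < exp (real m)"
    using reals_Archimedean2[of s1] exp_ge_add_one_self by (metis add.commute le_less_trans less_add_one less_eq_real_def order_less_le_trans)
  obtain N0 where N0: "\<forall>n\<ge>N0. - ln s0 < wpos (\<omega> !! 0) 0 n" using wpos_unbounded[OF admissibleD(1)[OF \<omega>]] by blast
  \<comment> \<open>A crude common bound: no block up to \<open>m\<close> has more points than all
    of them together.\<close>
  define N where "N = N0 + (\<Sum>i<Suc m. cnt 1 (\<omega> !! i))"
  have "i \<le> m \<and> n < N" if i: "in_block \<omega> i n" and s: "s0 \<le> fst (limit_point d j \<omega> i n)" "fst (limit_point d j \<omega> i n) \<le> s1" for i n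
  proof (cases i)
    case 0
    have "n < N0"
    proof (rule ccontr)
      assume "\<not> n < N0"
      then have "exp (- wpos (\<omega> !! 0) 0 n) < s0" using N0 s0 by (metis exp_less_cancel_iff exp_ln minus_less_iff not_less)
      then show False using s 0 by (simp add: limit_point_def wpoint_def)
    qed
    then show ?thesis using 0 by (simp add: N_def)
  next
    case (Suc i')
    have "exp (real i') \<le> exp (- wpos (\<omega> !! Suc i') (- real (Suc i')) n)"
      using block_wpos_le[OF \<omega>, of i' n] i Suc by simp
    also have "\<dots> \<le> s1" using s Suc by (simp add: limit_point_def wpoint_def del: snth.simps)
    finally have "exp (real i') < exp (real m)" using m by linarith
    then have im: "i \<le> m" using Suc by simp
    have "n < cnt 1 (\<omega> !! i)" using i Suc by (simp add: in_block_def)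
    also have "\<dots> \<le> (\<Sum>i<Suc m. cnt 1 (\<omega> !! i))" using im by (intro member_le_sum) auto
    finally show ?thesis using im by (simp add: N_def)
  qed
  then show ?thesis by blast
qed

lemma limit_wtime_mono:
  assumes w: "recurrent d w" and "n \<le> n'"
  shows "wtime d limit_inc w x j t n \<le> wtime d limit_inc w x j t n'"
  unfolding wtime_def using assms(2) recurrentD(2)[OF w]
  by (intro add_left_mono sum_mono2) (auto simp: limit_inc_def less_imp_le)

text \<open>At positions \<open>y \<ge> 0\<close> the factor \<open>exp y\<close> is at least one,
  so every record with a mark of at least one advances the clock by at least one.\<close>

lemma limit_wtime_unbounded:
  assumes w: "recurrent d w" and d: "0 < d" and x: "0 \<le> x"
  shows "\<exists>N. \<forall>n\<ge>N. T < wtime d limit_inc w x j t n"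
proof -
  have *: "\<exists>n. t + real k \<le> wtime d limit_inc w x j t n" for k
  proof (induction k)
    case 0 show ?case by (intro exI[of _ 0]) (simp add: wtime_def)
  next
    case (Suc k)
    then obtain n where n: "t + real k \<le> wtime d limit_inc w x j t n" by blast
    \<comment> \<open>The first index from \<open>n\<close> on that carries a record. Steps of
      \<open>d\<close> preserve this, and recurrence along the class of \<open>r\<close> finds a
      record with a large mark.\<close>
    define r where "r = n + nat ((- (j + int n + 1)) mod int d)"
    obtain k' where k': "1 \<le> snd (w !! (r + k' * d))" using w unfolding recurrent_def by blast
    define q where "q = r + k' * d"
    have "int r = int n + (- (j + int n + 1)) mod int d" unfolding r_def using d by simp
    then have "(j + int r + 1) mod int d = (j + int n + 1 + (- (j + int n + 1)) mod int d) mod int d"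
      by (simp add: algebra_simps)
    also have "\<dots> = 0" by (simp add: mod_add_right_eq)
    finally have "int d dvd j + int r + 1" by (simp add: dvd_eq_mod_eq_0)
    then have "int d dvd (j + int r + 1) + int k' * int d" using dvd_triv_right[of "int d" "int k'"] by (rule dvd_add)
    moreover have "(j + int r + 1) + int k' * int d = j + int q + 1" by (simp add: q_def)
    ultimately have rec: "record_at d j q" by simp
    have "0 \<le> wpos w x q" using wpos_gt[OF w, of x q] x by linarith
    then have "1 * 1 \<le> snd (w !! q) * exp (wpos w x q)" using k' by (intro mult_mono) (auto simp: q_def)
    then have "wtime d limit_inc w x j t q + 1 \<le> wtime d limit_inc w x j t (Suc q)"
      using rec by (simp add: wtime_def limit_inc_def)
    moreover have "wtime d limit_inc w x j t n \<le> wtime d limit_inc w x j t q"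
      by (rule limit_wtime_mono[OF w]) (simp add: q_def r_def)
    ultimately have "t + real (Suc k) \<le> wtime d limit_inc w x j t (Suc q)" using n by simp
    then show ?case by blast
  qed
  obtain k :: nat where "T - t < real k" using reals_Archimedean2 by blast
  moreover obtain N where "t + real k \<le> wtime d limit_inc w x j t N" using * by blast
  ultimately have "T < wtime d limit_inc w x j t N" by linarith
  then have "\<forall>n\<ge>N. T < wtime d limit_inc w x j t n" using limit_wtime_mono[OF w, of N _ x j t] order_less_le_trans by blast
  then show ?thesis by blast
qed

text \<open>Times at least \<open>t0\<close> exclude the blocks far to the left, because the clock
  reading at their right ends tends to zero. Times at most \<open>t1\<close> bound the index in
  block \<open>0\<close>.\<close>

lemma limit_point_finite_snd:
  assumes \<omega>: "admissible d \<omega>" and d: "0 < d" and t0: "0 < t0"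
  shows "\<exists>m N. \<forall>i n. in_block \<omega> i n \<and> t0 \<le> snd (limit_point d j \<omega> i n) \<and> snd (limit_point d j \<omega> i n) \<le> t1 \<longrightarrow> i \<le> m \<and> n < N"
proof -
  have "eventually (\<lambda>m. limit_time d j \<omega> m < t0) sequentially"
    by (rule order_tendstoD(2)[OF limit_time_tendsto[OF \<omega>] t0])
  then obtain m where m: "\<forall>i\<ge>m. limit_time d j \<omega> i < t0" unfolding eventually_sequentially by blast
  obtain N0 where N0: "\<forall>n\<ge>N0. t1 < wtime d limit_inc (\<omega> !! 0) 0 (phase j \<omega> 0) (limit_time d j \<omega> 0) n"
    using limit_wtime_unbounded[OF admissibleD(1)[OF \<omega>] d, of 0] by blast
  define N where "N = N0 + (\<Sum>i<Suc m. cnt 1 (\<omega> !! i))"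
  have "i \<le> m \<and> n < N" if i: "in_block \<omega> i n" and s: "t0 \<le> snd (limit_point d j \<omega> i n)" "snd (limit_point d j \<omega> i n) \<le> t1" for i n
  proof (cases i)
    case 0
    have "n < N0"
    proof (rule ccontr)
      assume "\<not> n < N0"
      then have "t1 < wtime d limit_inc (\<omega> !! 0) 0 (phase j \<omega> 0) (limit_time d j \<omega> 0) n" using N0 by simp
      then show False using s 0 by (simp add: limit_point_def wpoint_def)
    qed
    then show ?thesis using 0 by (simp add: N_def)
  next
    case (Suc i')
    have n: "n < cnt 1 (\<omega> !! Suc i')" using i Suc by (simp add: in_block_def)
    have "snd (limit_point d j \<omega> i n) \<le> wtime d limit_inc (\<omega> !! Suc i') (- real (Suc i')) (phase j \<omega> (Suc i')) (limit_time d j \<omega> (Suc i')) (cnt 1 (\<omega> !! Suc i'))"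
      unfolding limit_point_def wpoint_def Suc snd_conv
      by (rule limit_wtime_mono[OF admissibleD(1)[OF \<omega>]]) (use n in simp)
    also have "\<dots> = limit_time d j \<omega> i'"
      unfolding limit_time_Suc[OF \<omega>, of j i'] block_time_def by (rule wtime_shift)
    finally have "t0 \<le> limit_time d j \<omega> i'" using s(1) by linarith
    then have "\<not> m \<le> i'" using m by force
    then have im: "i \<le> m" using Suc by simp
    have "n < cnt 1 (\<omega> !! i)" using n Suc by simp
    also have "\<dots> \<le> (\<Sum>i<Suc m. cnt 1 (\<omega> !! i))" using im by (intro member_le_sum) auto
    finally show ?thesis using im by (simp add: N_def)
  qed
  then show ?thesis by blast
qed

lemma limit_index_finite:
  assumes "\<exists>m N. \<forall>i n. in_block \<omega> i n \<and> P (limit_point d j \<omega> i n) \<longrightarrow> i \<le> m \<and> n < N"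
  shows "finite {c \<in> limit_index d j \<omega>. P (limit_enum d j \<omega> c)}"
proof -
  obtain m N where mN: "\<forall>i n. in_block \<omega> i n \<and> P (limit_point d j \<omega> i n) \<longrightarrow> i \<le> m \<and> n < N"
    using assms by blast
  have "{c \<in> limit_index d j \<omega>. P (limit_enum d j \<omega> c)} \<subseteq> prod_encode ` ({..m} \<times> {..<N})"
  proof
    fix c assume "c \<in> {c \<in> limit_index d j \<omega>. P (limit_enum d j \<omega> c)}"
    then have "prod_decode c \<in> {..m} \<times> {..<N}"
      using mN unfolding limit_index_def limit_enum_def by (auto simp: mem_Times_iff)
    then show "c \<in> prod_encode ` ({..m} \<times> {..<N})" by (metis image_eqI prod_decode_inverse)
  qed
  then show ?thesis by (rule finite_subset) simp
qed

lemma limit_process_projectable: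
  assumes \<omega>: "admissible d \<omega>" and d: "0 < d"
  shows "limit_process d j \<omega> \<in> projectable"
  unfolding limit_process_def
proof (rule dirac_sum_projectable[OF limit_enum_in])
  fix K :: "real set" assume K: "compact K" "K \<subseteq> pos_reals"
  then obtain s0 s1 where s: "0 < s0" "\<And>x. x \<in> K \<Longrightarrow> s0 \<le> x \<and> x \<le> s1" using compact_pos_bounds by metis
  have "finite {c \<in> limit_index d j \<omega>. s0 \<le> fst (limit_enum d j \<omega> c) \<and> fst (limit_enum d j \<omega> c) \<le> s1}"
    by (rule limit_index_finite[where P = "\<lambda>p. s0 \<le> fst p \<and> fst p \<le> s1"]) (rule limit_point_finite_fst[OF \<omega> s(1)])
  then show "finite {c \<in> limit_index d j \<omega>. fst (limit_enum d j \<omega> c) \<in> K}"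
    by (rule finite_subset[rotated]) (use s(2) in auto)
  have "finite {c \<in> limit_index d j \<omega>. s0 \<le> snd (limit_enum d j \<omega> c) \<and> snd (limit_enum d j \<omega> c) \<le> s1}"
    by (rule limit_index_finite[where P = "\<lambda>p. s0 \<le> snd p \<and> snd p \<le> s1"]) (rule limit_point_finite_snd[OF \<omega> d s(1)])
  then show "finite {c \<in> limit_index d j \<omega>. snd (limit_enum d j \<omega> c) \<in> K}"
    by (rule finite_subset[rotated]) (use s(2) in auto)
qed

lemma walk_sum_limit_blocks:
  assumes \<omega>: "admissible d \<omega>" "0 < d" and f0: "0 < s0" "\<And>s t. s < s0 \<Longrightarrow> f (s, t) = 0"
  shows "walk_sum d limit_inc f (blocks m \<omega>) (- real m) (phase j \<omega> m) (limit_time d j \<omega> m) =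
    (\<Sum>i<m. \<Sum>n<cnt 1 (\<omega> !! Suc i). if record_at d (phase j \<omega> (Suc i)) n then f (limit_point d j \<omega> (Suc i) n) else 0)
    + (\<Sum>n. if record_at d (phase j \<omega> 0) n then f (limit_point d j \<omega> 0 n) else 0)"
proof (induction m)
  case 0 show ?case unfolding walk_sum_def limit_point_def blocks.simps by simp
next
  case (Suc m)
  have x: "- real (Suc m) + 1 = - real m" by simp
  have t: "wtime d limit_inc (\<omega> !! Suc m) (- real (Suc m)) (phase j \<omega> (Suc m)) (limit_time d j \<omega> (Suc m)) (cnt 1 (\<omega> !! Suc m)) = limit_time d j \<omega> m"
    unfolding limit_time_Suc[OF \<omega>(1), of j m] block_time_def by (rule wtime_shift)
  have "walk_sum d limit_inc f (blocks (Suc m) \<omega>) (- real (Suc m)) (phase j \<omega> (Suc m)) (limit_time d j \<omega> (Suc m)) =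
    (\<Sum>n<cnt 1 (\<omega> !! Suc m). if record_at d (phase j \<omega> (Suc m)) n then f (limit_point d j \<omega> (Suc m) n) else 0)
    + walk_sum d limit_inc f (blocks m \<omega>) (- real (Suc m) + 1) (phase j \<omega> (Suc m) + int (cnt 1 (\<omega> !! Suc m)))
     (wtime d limit_inc (\<omega> !! Suc m) (- real (Suc m)) (phase j \<omega> (Suc m)) (limit_time d j \<omega> (Suc m)) (cnt 1 (\<omega> !! Suc m)))"
    unfolding blocks.simps limit_point_def
    by (rule walk_sum_conc_split[where f = f and ?s0.0 = s0, OF recurrent_blocks[OF \<omega>] f0])
  then show ?case unfolding x t phase_Suc Suc by (simp del: snth.simps)
qed

text \<open>A test function sees only the blocks up to some \<open>m\<close>. On these the limit
  process is a walk on \<open>blocks m\<close>, started with the phase and the clock reading that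
  the blocks beyond \<open>m\<close> produce.\<close>

lemma integral_limit_process:
  assumes \<omega>: "admissible d \<omega>" "0 < d" and f: "f \<in> test_functions pos_quadrant"
    and f0: "0 < s0" "\<And>s t. s < s0 \<Longrightarrow> extend0 f (s, t) = 0" and f1: "\<And>s t. exp (real m) \<le> s \<Longrightarrow> extend0 f (s, t) = 0"
  shows "(\<integral>x. f x \<partial>limit_process d j \<omega>) =
    walk_sum d limit_inc (extend0 f) (blocks m \<omega>) (- real m) (phase j \<omega> m) (limit_time d j \<omega> m)"
proof -
  define g where "g i n = (if record_at d (phase j \<omega> i) n then extend0 f (limit_point d j \<omega> i n) else 0)" for i n
  define G where "G p = (if in_block \<omega> (fst p) (snd p) then g (fst p) (snd p) else 0)" for p
  have pm: "limit_process d j \<omega> \<in> point_measures pos_quadrant"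
    using limit_process_projectable[OF \<omega>] by (simp add: projectable_def)
  have fin: "finite {c \<in> limit_index d j \<omega>. limit_enum d j \<omega> c \<in> K}" if "compact K" "K \<subseteq> pos_quadrant" for K
  proof -
    have "emeasure (limit_process d j \<omega>) K < \<infinity>" using pm that unfolding point_measures_def by blast
    then show ?thesis unfolding limit_process_def
      using emeasure_dirac_sum_finite_iff[OF limit_enum_in sets_restrict_compact[OF that]] by blast
  qed
  have "(\<integral>x. f x \<partial>limit_process d j \<omega>) = (\<Sum>c. if c \<in> limit_index d j \<omega> then f (limit_enum d j \<omega> c) else 0)"
    unfolding limit_process_def by (rule integral_dirac_sum_suminf[OF limit_enum_in fin f])
  also have "\<dots> = (\<Sum>c. G (prod_decode c))"
    by (intro suminf_cong) (auto simp: G_def g_def limit_index_def limit_enum_def)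
  also have "\<dots> = (\<Sum>i<m. \<Sum>n<cnt 1 (\<omega> !! Suc i). g (Suc i) n) + (\<Sum>n. g 0 n)"
  proof -
    obtain m' N' where mN': "\<forall>i n. in_block \<omega> i n \<and> s0 \<le> fst (limit_point d j \<omega> i n) \<and> fst (limit_point d j \<omega> i n) \<le> exp (real m) \<longrightarrow> i \<le> m' \<and> n < N'"
      using limit_point_finite_fst[OF \<omega>(1) f0(1)] by blast
    define N where "N = N' + (\<Sum>i<Suc m. cnt 1 (\<omega> !! i))"
    have cN: "cnt 1 (\<omega> !! i) \<le> N" if "i \<le> m" for i
    proof -
      have "cnt 1 (\<omega> !! i) \<le> (\<Sum>i<Suc m. cnt 1 (\<omega> !! i))" using that by (intro member_le_sum) auto
      then show ?thesis by (simp add: N_def)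
    qed
    \<comment> \<open>Blocks beyond \<open>m\<close> lie at heights at least
      \<open>exp (real m)\<close>, where \<open>f\<close> vanishes. Outside a finite rectangle the
      summand is thus zero, and inside it the order of summation is free. \<open>N\<close> is large
      enough for the rectangle to contain every truncated block up to \<open>m\<close>.\<close>
    have G0: "G (i, n) = 0" if "\<not> (i \<le> m \<and> n < N)" for i n
    proof (rule ccontr)
      assume "G (i, n) \<noteq> 0"
      then have *: "in_block \<omega> i n" "extend0 f (limit_point d j \<omega> i n) \<noteq> 0" by (auto simp: G_def g_def split: if_splits)
      obtain s t where st: "limit_point d j \<omega> i n = (s, t)" by force
      have nz: "extend0 f (s, t) \<noteq> 0" using *(2) unfolding st .
      have "s0 \<le> s"
      proof (rule ccontr)
        assume "\<not> s0 \<le> s"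
        then have "s < s0" by simp
        from f0(2)[OF this, of t] nz show False by contradiction
      qed
      have "s < exp (real m)"
      proof (rule ccontr)
        assume "\<not> s < exp (real m)"
        then have "exp (real m) \<le> s" by simp
        from f1[OF this, of t] nz show False by contradiction
      qed
      have "n < N'" using mN'[rule_format, of i n] *(1) st \<open>s0 \<le> s\<close> \<open>s < exp (real m)\<close> by simp
      then have "n < N" by (simp add: N_def)
      moreover have "i \<le> m"
      proof (cases i)
        case (Suc i')
        have "exp (real i') \<le> exp (- wpos (\<omega> !! Suc i') (- real (Suc i')) n)"
          using block_wpos_le[OF \<omega>(1), of i' n] *(1) Suc by simp
        also have "\<dots> = s" using st Suc by (simp add: limit_point_def wpoint_def del: snth.simps)
        finally have "exp (real i') < exp (real m)" using \<open>s < exp (real m)\<close> by linarith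
        then show ?thesis using Suc by simp
      qed simp
      ultimately show False using that by blast
    qed
    have "(\<Sum>c. G (prod_decode c)) = (\<Sum>c\<in>prod_encode ` ({..m} \<times> {..<N}). G (prod_decode c))"
    proof (rule suminf_finite)
      fix c assume c: "c \<notin> prod_encode ` ({..m} \<times> {..<N})"
      have "prod_decode c \<notin> {..m} \<times> {..<N}"
      proof
        assume "prod_decode c \<in> {..m} \<times> {..<N}"
        then have "prod_encode (prod_decode c) \<in> prod_encode ` ({..m} \<times> {..<N})" by (rule imageI)
        then show False using c by simp
      qed
      then show "G (prod_decode c) = 0" using G0[of "fst (prod_decode c)" "snd (prod_decode c)"] by (auto simp: mem_Times_iff)
    qed simp
    also have "\<dots> = (\<Sum>p\<in>{..m} \<times> {..<N}. G p)"
      by (subst sum.reindex) (auto simp: inj_prod_encode)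
    also have "\<dots> = (\<Sum>i\<le>m. \<Sum>n<N. G (i, n))" by (simp add: sum.cartesian_product)
    also have "\<dots> = (\<Sum>n<N. G (0, n)) + (\<Sum>i<m. \<Sum>n<N. G (Suc i, n))"
      unfolding lessThan_Suc_atMost[symmetric] by (subst sum.lessThan_Suc_shift) simp
    also have "(\<Sum>n<N. G (0, n)) = (\<Sum>n. g 0 n)"
    proof -
      have "(\<Sum>n. g 0 n) = (\<Sum>n<N. g 0 n)"
      proof (rule suminf_finite)
        fix n assume "n \<notin> {..<N}"
        then show "g 0 n = 0" using G0[of 0 n] by (simp add: G_def in_block_def)
      qed simp
      then show ?thesis by (simp add: G_def in_block_def)
    qed
    also have "(\<Sum>i<m. \<Sum>n<N. G (Suc i, n)) = (\<Sum>i<m. \<Sum>n<cnt 1 (\<omega> !! Suc i). g (Suc i) n)"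
    proof (rule sum.cong[OF refl])
      fix i assume "i \<in> {..<m}"
      then have "cnt 1 (\<omega> !! Suc i) \<le> N" using cN[of "Suc i"] by simp
      then have "(\<Sum>n<N. G (Suc i, n)) = (\<Sum>n<cnt 1 (\<omega> !! Suc i). G (Suc i, n))"
        by (intro sum.mono_neutral_right) (auto simp: G_def in_block_def simp del: snth.simps)
      also have "\<dots> = (\<Sum>n<cnt 1 (\<omega> !! Suc i). g (Suc i) n)"
        by (rule sum.cong) (auto simp: G_def in_block_def)
      finally show "(\<Sum>n<N. G (Suc i, n)) = (\<Sum>n<cnt 1 (\<omega> !! Suc i). g (Suc i) n)" .
    qed
    finally show ?thesis by simp
  qed
  also have "\<dots> = walk_sum d limit_inc (extend0 f) (blocks m \<omega>) (- real m) (phase j \<omega> m) (limit_time d j \<omega> m)"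
    unfolding g_def by (rule walk_sum_limit_blocks[where f = "\<lambda>x. extend0 f x" and ?s0.0 = s0, OF \<omega> f0, symmetric])
  finally show ?thesis .
qed

text \<open>Once \<open>m\<close> is large enough for the support of \<open>f\<close>, both
  integrals are sums over the same stream \<open>blocks m\<close> with the same phase. They differ
  only in the waiting times and in the clock reading at \<open>- m\<close>, and both of these
  converge.\<close>

lemma coupled_process_limit:
  assumes \<omega>: "admissible d \<omega>" and d: "0 < d"
  shows "limitin (vague_topology pos_quadrant) (\<lambda>b. coupled_process d \<omega> j b) (limit_process d j \<omega>) at_top"
proof (rule limitin_vague)
  have b1: "eventually (\<lambda>b. 1 < (b::real)) at_top" by (rule eventually_gt_at_top)
  have inc: "1 / b \<le> waiting_inc b y e" "0 < 1 / b" if "1 < b" for b y e using waiting_inc_ge that by auto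
  show "eventually (\<lambda>b. coupled_process d \<omega> j b \<in> point_measures pos_quadrant) at_top"
    using b1 by eventually_elim (auto simp: coupled_process_def Let_def intro!: walk_point_measure[OF inc])
  show "limit_process d j \<omega> \<in> point_measures pos_quadrant"
    using limit_process_projectable[OF \<omega> d] by (simp add: projectable_def)
  fix f assume f: "f \<in> test_functions pos_quadrant"
  obtain s0 s1 where s: "0 < s0" "\<And>s t. s < s0 \<Longrightarrow> extend0 f (s, t) = 0" "\<And>s t. s1 < s \<Longrightarrow> extend0 f (s, t) = 0"
    using test_function_bounds[OF f] by blast
  obtain m :: nat where m: "s1 < real m" using reals_Archimedean2 by blast
  have f1: "extend0 f (s, t) = 0" if "exp (real m) \<le> s" for s t
  proof -
    have "real m + 1 \<le> exp (real m)" using exp_ge_add_one_self[of "real m"] by linarith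
    then show ?thesis using that m by (intro s(3)) linarith
  qed
  have "((\<lambda>b. walk_sum d (waiting_inc b) (extend0 f) (blocks m \<omega>) (- real m) (phase j \<omega> m) (coupled_time d \<omega> j m b))
    \<longlongrightarrow> walk_sum d limit_inc (extend0 f) (blocks m \<omega>) (- real m) (phase j \<omega> m) (limit_time d j \<omega> m)) at_top"
    by (rule walk_sum_tendsto[where f = "\<lambda>x. extend0 f x" and ?s0.0 = s0, OF recurrent_blocks[OF \<omega> d]
        zero_extension_continuous[OF open_pos_quadrant f] s(1,2) coupled_time_tendsto[OF \<omega>]])
  moreover have "eventually (\<lambda>b. walk_sum d (waiting_inc b) (extend0 f) (blocks m \<omega>) (- real m) (phase j \<omega> m) (coupled_time d \<omega> j m b) =
      (\<integral>x. f x \<partial>coupled_process d \<omega> j b)) at_top"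
  proof -
    have "eventually (\<lambda>b. m \<le> full_blocks b) at_top"
      using full_blocks_at_top unfolding filterlim_at_top by blast
    with b1 show ?thesis
    proof eventually_elim
      fix b :: real assume b: "1 < b" "m \<le> full_blocks b"
      show "walk_sum d (waiting_inc b) (extend0 f) (blocks m \<omega>) (- real m) (phase j \<omega> m) (coupled_time d \<omega> j m b) =
        (\<integral>x. f x \<partial>coupled_process d \<omega> j b)"
        unfolding coupled_process_def Let_def integral_walk[OF inc[OF b(1)] f]
        using walk_sum_coupled[where f = "\<lambda>x. extend0 f x" and ?s0.0 = s0, OF \<omega> d b f1 s(1,2)] by (simp add: Let_def)
    qed
  qed
  ultimately have "((\<lambda>b. \<integral>x. f x \<partial>coupled_process d \<omega> j b) \<longlongrightarrow>
      walk_sum d limit_inc (extend0 f) (blocks m \<omega>) (- real m) (phase j \<omega> m) (limit_time d j \<omega> m)) at_top"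
    by (rule Lim_transform_eventually)
  then show "((\<lambda>b. \<integral>x. f x \<partial>coupled_process d \<omega> j b) \<longlongrightarrow> (\<integral>x. f x \<partial>limit_process d j \<omega>)) at_top"
    by (subst integral_limit_process[OF \<omega> d f s(1,2) f1])
qed

lemma measurable_limit_enum:
  "(\<lambda>\<omega>. limit_enum d j \<omega> c) \<in> borel_measurable (block_stream)"
  "Measurable.pred (block_stream) (\<lambda>\<omega>. c \<in> limit_index d j \<omega>)"
proof -
  let ?\<Xi> = block_stream
  have cm[measurable]: "(\<lambda>\<omega>. cnt 1 (\<omega> !! i)) \<in> ?\<Xi> \<rightarrow>\<^sub>M count_space UNIV" for i
    by (rule measurable_compose[OF measurable_snth measurable_cnt])
  have sm[measurable]: "(\<lambda>\<omega>. \<omega> !! i) \<in> ?\<Xi> \<rightarrow>\<^sub>M gap_stream" for i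
    by (rule measurable_snth)
  have wt: "(\<lambda>\<omega>. wtime d limit_inc (\<omega> !! i) x (phase j \<omega> k) (T \<omega>) n) \<in> borel_measurable ?\<Xi>"
    if "T \<in> borel_measurable ?\<Xi>" for i x k T n
    by (rule measurable_wtime[OF measurable_limit_inc sm measurable_phase that])
  have "(\<lambda>\<omega>. block_time d limit_inc 1 (\<omega> !! i) x (phase j \<omega> k)) \<in> borel_measurable ?\<Xi>" for i x k
    unfolding block_time_def
    by (rule measurable_compose_countable[OF wt cm]) simp
  then have lt: "(\<lambda>\<omega>. limit_time d j \<omega> i) \<in> borel_measurable ?\<Xi>" for i
    unfolding limit_time_def by (intro borel_measurable_suminf)
  have [measurable]: "(\<lambda>\<omega>. limit_point d j \<omega> i n) \<in> borel_measurable ?\<Xi>" for i n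
    unfolding limit_point_def by (rule measurable_wpoint[OF measurable_limit_inc sm measurable_phase lt])
  show "(\<lambda>\<omega>. limit_enum d j \<omega> c) \<in> borel_measurable ?\<Xi>"
    unfolding limit_enum_def by measurable
  show "Measurable.pred ?\<Xi> (\<lambda>\<omega>. c \<in> limit_index d j \<omega>)"
    unfolding limit_index_def mem_Collect_eq in_block_def by measurable
qed

text \<open>Off \<open>A\<close> the enumerated points may accumulate, so the null measure is
  substituted there to keep every value a point measure with locally finite projections.\<close>

lemma measurable_limit_process:
  assumes d: "0 < d" and A[measurable]: "A \<in> sets (block_stream)"
    and adm: "\<And>\<omega>. \<omega> \<in> A \<Longrightarrow> admissible d \<omega>"
  shows "(\<lambda>\<omega>. if \<omega> \<in> A then limit_process d j \<omega> else dirac_sum pos_quadrant {} (\<lambda>_. (0, 0)))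
    \<in> block_stream \<rightarrow>\<^sub>M restrict_space (vague_borel pos_quadrant) projectable"
proof (rule measurable_restrict_space2)
  let ?\<Xi> = block_stream
  have null: "dirac_sum pos_quadrant {} (\<lambda>_. (0, 0)) \<in> projectable"
    by (rule dirac_sum_projectable) auto
  show "(\<lambda>\<omega>. if \<omega> \<in> A then limit_process d j \<omega> else dirac_sum pos_quadrant {} (\<lambda>_. (0, 0))) \<in> space ?\<Xi> \<rightarrow> projectable"
    using limit_process_projectable[OF adm d] null by auto
  have "(\<lambda>\<omega>. dirac_sum pos_quadrant (if \<omega> \<in> A then limit_index d j \<omega> else {}) (limit_enum d j \<omega>)) \<in> ?\<Xi> \<rightarrow>\<^sub>M vague_borel pos_quadrant"
  proof (rule measurable_dirac_sum[OF open_pos_quadrant])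
    note [measurable] = measurable_limit_enum[where d = d and j = j]
    show "Measurable.pred ?\<Xi> (\<lambda>\<omega>. i \<in> (if \<omega> \<in> A then limit_index d j \<omega> else {}))" for i
    proof -
      have [measurable]: "Measurable.pred ?\<Xi> (\<lambda>\<omega>. \<omega> \<in> A)" using A by (simp add: pred_def)
      have "(\<lambda>\<omega>. i \<in> (if \<omega> \<in> A then limit_index d j \<omega> else {})) = (\<lambda>\<omega>. \<omega> \<in> A \<and> i \<in> limit_index d j \<omega>)" by auto
      then show ?thesis by simp
    qed
    show "(\<lambda>\<omega>. limit_enum d j \<omega> i) \<in> borel_measurable ?\<Xi>" for i by measurable
    show "limit_enum d j \<omega> i \<in> pos_quadrant" if "i \<in> (if \<omega> \<in> A then limit_index d j \<omega> else {})" for \<omega> i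
      using that Pi_mem[OF limit_enum_in] by (auto split: if_splits)
    fix \<omega> and K :: "(real \<times> real) set" assume K: "compact K" "K \<subseteq> pos_quadrant"
    show "finite {i \<in> if \<omega> \<in> A then limit_index d j \<omega> else {}. limit_enum d j \<omega> i \<in> K}"
    proof (cases "\<omega> \<in> A")
      case True
      have "limit_process d j \<omega> \<in> point_measures pos_quadrant"
        using limit_process_projectable[OF adm[OF True] d] by (simp add: projectable_def)
      then have "emeasure (limit_process d j \<omega>) K < \<infinity>" using K unfolding point_measures_def by blast
      then show ?thesis unfolding limit_process_def
        using emeasure_dirac_sum_finite_iff[OF limit_enum_in sets_restrict_compact[OF K]] True by simp
    qed simp
  qed
  moreover have "dirac_sum pos_quadrant (if \<omega> \<in> A then limit_index d j \<omega> else {}) (limit_enum d j \<omega>) =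
    (if \<omega> \<in> A then limit_process d j \<omega> else dirac_sum pos_quadrant {} (\<lambda>_. (0, 0)))" for \<omega>
    unfolding limit_process_def by (simp, intro impI dirac_sum_cong) auto
  ultimately show "(\<lambda>\<omega>. if \<omega> \<in> A then limit_process d j \<omega> else dirac_sum pos_quadrant {} (\<lambda>_. (0, 0))) \<in> ?\<Xi> \<rightarrow>\<^sub>M vague_borel pos_quadrant"
    by simp
qed

section \<open>Finite mean of the mass of a block, and almost sure admissibility\<close>

lemma nn_integral_expo_exp:
  assumes "c < 1"
  shows "(\<integral>\<^sup>+x. ennreal (exp (c * x)) \<partial>expo) = ennreal (1 / (1 - c))"
proof -
  interpret E: prob_space "density lborel (exponential_density (1 - c))"
    using assms by (intro prob_space_exponential_density) simp
  have "(\<integral>\<^sup>+x. ennreal (exp (c * x)) \<partial>expo) = (\<integral>\<^sup>+x. ennreal (exponential_density 1 x) * ennreal (exp (c * x)) \<partial>lborel)"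
    by (rule nn_integral_expo) measurable
  also have "\<dots> = (\<integral>\<^sup>+x. ennreal (1 / (1 - c)) * ennreal (exponential_density (1 - c) x) \<partial>lborel)"
  proof (rule nn_integral_cong)
    fix x :: real
    have "exponential_density 1 x * exp (c * x) = 1 / (1 - c) * exponential_density (1 - c) x"
    proof (cases "x < 0")
      case False
      have "exp (- x) * exp (c * x) = exp (- x * (1 - c))" by (simp add: mult_exp_exp algebra_simps)
      then show ?thesis using assms False by (simp add: exponential_density_def)
    qed (simp add: exponential_density_def)
    moreover have "0 \<le> exponential_density 1 x" "0 \<le> exponential_density (1 - c) x" using assms by auto
    ultimately show "ennreal (exponential_density 1 x) * ennreal (exp (c * x)) = ennreal (1 / (1 - c)) * ennreal (exponential_density (1 - c) x)"
      using assms by (simp add: ennreal_mult'[symmetric] ennreal_mult[symmetric])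
  qed
  also have "\<dots> = ennreal (1 / (1 - c)) * (\<integral>\<^sup>+x. ennreal (exponential_density (1 - c) x) \<partial>lborel)"
    by (rule nn_integral_cmult) measurable
  also have "(\<integral>\<^sup>+x. ennreal (exponential_density (1 - c) x) \<partial>lborel) = 1"
    using E.emeasure_space_1 by (simp add: emeasure_density)
  finally show ?thesis by simp
qed

text \<open>An exponential Chebyshev bound. The point with index \<open>k\<close> counts only if
  \<open>psum w (Suc k) \<le> 1\<close>, and then \<open>1 \<le> exp (1 - psum w (Suc k))\<close>, a
  product over independent gaps with mean \<open>1 / 2\<close> for each factor. The mark enters
  through \<open>1 + e \<le> 2 * exp (e / 2)\<close>, of mean \<open>4\<close>. The terms are
  dominated by a geometric series.\<close>

lemma nn_integral_mass_finite: "(\<integral>\<^sup>+w. ennreal (mass w) \<partial>gap_stream) < \<infinity>"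
proof -
  define g where "g k i y = (if i < k then ennreal (exp (- fst y)) else ennreal (exp (- fst y)) * ennreal (2 * exp (snd y / 2)))"
    for k i :: nat and y :: "real \<times> real"
  have [measurable]: "g k i \<in> borel_measurable marked_expo" for k i
    unfolding g_def measurable_cong_sets[OF sets_marked_expo refl] by measurable
  have half: "(\<integral>\<^sup>+x. ennreal (exp (- x)) \<partial>expo) = ennreal (1 / 2)" using nn_integral_expo_exp[of "-1"] by simp
  have two: "(\<integral>\<^sup>+x. ennreal (2 * exp (x / 2)) \<partial>expo) = ennreal 4"
    using nn_integral_expo_exp[of "1/2"] by (simp add: ennreal_mult nn_integral_cmult ennreal_mult'[symmetric])
  have ig: "(\<integral>\<^sup>+y. g k i y \<partial>marked_expo) = (if i < k then ennreal (1 / 2) else ennreal 2)" for k i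
  proof (cases "i < k")
    case True
    then have "(\<integral>\<^sup>+y. g k i y \<partial>marked_expo) = (\<integral>\<^sup>+e. \<integral>\<^sup>+m. ennreal (exp (- e)) \<partial>expo \<partial>expo)"
      unfolding g_def by (subst nn_integral_marked_expo) auto
    then show ?thesis using half True by simp
  next
    case False
    then have "(\<integral>\<^sup>+y. g k i y \<partial>marked_expo) = (\<integral>\<^sup>+e. \<integral>\<^sup>+m. ennreal (exp (- e)) * ennreal (2 * exp (m / 2)) \<partial>expo \<partial>expo)"
      unfolding g_def by (subst nn_integral_marked_expo) auto
    also have "\<dots> = (\<integral>\<^sup>+e. ennreal (exp (- e)) * ennreal 4 \<partial>expo)"
      by (subst nn_integral_cmult) (auto simp: two)
    also have "\<dots> = ennreal (1 / 2) * ennreal 4" by (subst nn_integral_multc) (auto simp: half)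
    also have "\<dots> = ennreal (1 / 2 * 4)" by (rule ennreal_mult'[symmetric]) simp
    also have "\<dots> = ennreal 2" by simp
    finally show ?thesis using False by simp
  qed
  have "(\<integral>\<^sup>+w. ennreal (mass w) \<partial>gap_stream) \<le> (\<integral>\<^sup>+w. (\<Sum>k. ennreal (exp 1) * (\<Prod>i<Suc k. g k i (w !! i))) \<partial>gap_stream)"
  proof (rule nn_integral_mono_AE, rule eventually_mono[OF AE_recurrent[OF zero_less_one]])
    fix w assume w: "recurrent 1 w"
    have "ennreal (mass w) = (\<Sum>k<cnt 1 w. ennreal (1 + snd (w !! k)))"
      unfolding mass_def using recurrentD(2)[OF w] by (subst sum_ennreal) (auto simp: add_nonneg_nonneg less_imp_le)
    also have "\<dots> \<le> (\<Sum>k<cnt 1 w. ennreal (exp 1) * (\<Prod>i<Suc k. g k i (w !! i)))"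
    proof (rule sum_mono)
      fix k assume "k \<in> {..<cnt 1 w}"
      then have ps: "psum w (Suc k) \<le> 1" using cnt_finite(2)[OF w] by simp
      have "(\<Prod>i<Suc k. g k i (w !! i)) = (\<Prod>i<k. ennreal (exp (- fst (w !! i)))) * (ennreal (exp (- fst (w !! k))) * ennreal (2 * exp (snd (w !! k) / 2)))"
        by (simp add: g_def del: snth.simps)
      also have "(\<Prod>i<k. ennreal (exp (- fst (w !! i)))) = ennreal (exp (- psum w k))"
        by (simp add: prod_ennreal exp_sum[symmetric] sum_negf psum_def)
      also have "ennreal (exp (- psum w k)) * (ennreal (exp (- fst (w !! k))) * ennreal (2 * exp (snd (w !! k) / 2))) =
          ennreal (exp (- psum w k) * (exp (- fst (w !! k)) * (2 * exp (snd (w !! k) / 2))))"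
        by (simp only: ennreal_mult' exp_ge_zero)
      also have "exp (- psum w k) * (exp (- fst (w !! k)) * (2 * exp (snd (w !! k) / 2))) =
          exp (- psum w (Suc k)) * (2 * exp (snd (w !! k) / 2))"
        by (simp only: mult.assoc[symmetric] mult_exp_exp) (simp add: psum_def)
      finally have p: "(\<Prod>i<Suc k. g k i (w !! i)) = ennreal (exp (- psum w (Suc k)) * (2 * exp (snd (w !! k) / 2)))" .
      have "1 + snd (w !! k) \<le> 2 * exp (snd (w !! k) / 2)"
        using exp_ge_add_one_self[of "snd (w !! k) / 2"] by linarith
      also have "\<dots> \<le> exp (1 - psum w (Suc k)) * (2 * exp (snd (w !! k) / 2))" using ps by simp
      also have "\<dots> = exp 1 * (exp (- psum w (Suc k)) * (2 * exp (snd (w !! k) / 2)))" by (simp add: exp_diff exp_minus field_simps)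
      finally have "1 + snd (w !! k) \<le> exp 1 * (exp (- psum w (Suc k)) * (2 * exp (snd (w !! k) / 2)))" .
      then have "ennreal (1 + snd (w !! k)) \<le> ennreal (exp 1 * (exp (- psum w (Suc k)) * (2 * exp (snd (w !! k) / 2))))"
        by (rule ennreal_leI)
      then show "ennreal (1 + snd (w !! k)) \<le> ennreal (exp 1) * (\<Prod>i<Suc k. g k i (w !! i))"
        unfolding p by (simp add: ennreal_mult'[symmetric] del: snth.simps)
    qed
    also have "\<dots> \<le> (\<Sum>k. ennreal (exp 1) * (\<Prod>i<Suc k. g k i (w !! i)))"
      by (rule sum_le_suminf) auto
    finally show "ennreal (mass w) \<le> (\<Sum>k. ennreal (exp 1) * (\<Prod>i<Suc k. g k i (w !! i)))" .
  qed
  also have "\<dots> = (\<Sum>k. \<integral>\<^sup>+w. ennreal (exp 1) * (\<Prod>i<Suc k. g k i (w !! i)) \<partial>gap_stream)"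
    by (rule nn_integral_suminf) measurable
  also have "\<dots> = (\<Sum>k. ennreal (2 * exp 1 * (1 / 2) ^ k))"
  proof (rule suminf_cong)
    fix k
    have "(\<integral>\<^sup>+w. ennreal (exp 1) * (\<Prod>i<Suc k. g k i (w !! i)) \<partial>gap_stream) =
      ennreal (exp 1) * (\<Prod>i<Suc k. \<integral>\<^sup>+y. g k i y \<partial>marked_expo)"
      by (subst nn_integral_cmult, measurable, subst marked.nn_integral_stream_prod) auto
    also have "(\<Prod>i<Suc k. \<integral>\<^sup>+y. g k i y \<partial>marked_expo) = ennreal ((1 / 2) ^ k) * ennreal 2"
    proof -
      have "(\<Prod>i<k. \<integral>\<^sup>+y. g k i y \<partial>marked_expo) = (\<Prod>i<k. ennreal (1 / 2))"
        by (rule prod.cong) (simp_all only: ig lessThan_iff if_True)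
      also have "\<dots> = ennreal (1 / 2) ^ k" by (simp only: prod_constant card_lessThan)
      also have "\<dots> = ennreal ((1 / 2) ^ k)" by (rule ennreal_power) simp
      finally show ?thesis by (simp only: prod.lessThan_Suc ig less_irrefl if_False)
    qed
    also have "ennreal (exp 1) * (ennreal ((1 / 2) ^ k) * ennreal 2) = ennreal (exp 1 * ((1 / 2) ^ k * 2))"
      by (simp only: ennreal_mult' zero_le_power exp_ge_zero zero_le_divide_1_iff zero_le_numeral)
    also have "exp 1 * ((1 / 2) ^ k * 2) = 2 * exp 1 * (1 / 2 :: real) ^ k" by (simp only: mult_ac)
    finally show "(\<integral>\<^sup>+w. ennreal (exp 1) * (\<Prod>i<Suc k. g k i (w !! i)) \<partial>gap_stream) = ennreal (2 * exp 1 * (1 / 2) ^ k)" .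
  qed
  also have "\<dots> = ennreal (\<Sum>k. 2 * exp 1 * (1 / 2) ^ k)"
    by (rule suminf_ennreal2) (auto intro!: summable_mult summable_geometric)
  also have "\<dots> < \<infinity>" by simp
  finally show ?thesis .
qed

interpretation block_space: prob_space block_stream
  by (rule gaps.prob_space_stream_space)

lemma space_block_space [simp]: "space (block_stream) = UNIV"
  by (simp add: space_stream_space)

lemma (in prob_space) nn_integral_stream_snth:
  assumes [measurable]: "f \<in> borel_measurable M"
  shows "(\<integral>\<^sup>+\<omega>. f (\<omega> !! i) \<partial>stream_space M) = (\<integral>\<^sup>+x. f x \<partial>M)"
proof (induction i)
  case 0
  interpret S: prob_space "stream_space M" by (rule prob_space_stream_space)
  show ?case by (subst nn_integral_stream_space) (auto simp: S.emeasure_space_1)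
next
  case (Suc i)
  have "(\<integral>\<^sup>+\<omega>. f (\<omega> !! Suc i) \<partial>stream_space M) = (\<integral>\<^sup>+x. \<integral>\<^sup>+\<omega>. f ((x ## \<omega>) !! Suc i) \<partial>stream_space M \<partial>M)"
    by (rule nn_integral_stream_space) measurable
  then show ?case using Suc by (simp add: emeasure_space_1)
qed

lemma measurable_mass [measurable]: "mass \<in> borel_measurable gap_stream"
proof -
  have "(\<lambda>w. (\<lambda>k w. \<Sum>n<k. 1 + snd (w !! n)) (cnt 1 w) w) \<in> borel_measurable gap_stream"
    by (rule measurable_compose_countable) measurable
  then show ?thesis unfolding mass_def by simp
qed

text \<open>By Tonelli the series of weighted masses has the finite mean \<open>C\<close> times a
  geometric series, hence is almost surely finite.\<close>

lemma AE_admissible: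
  assumes "0 < d"
  shows "AE \<omega> in block_stream. admissible d \<omega>"
proof -
  let ?\<Xi> = block_stream
  have [measurable]: "Measurable.pred gap_stream (recurrent d)"
    unfolding recurrent_def by measurable
  have 1: "AE \<omega> in ?\<Xi>. \<forall>i. recurrent d (\<omega> !! i)"
    by (rule gaps.AE_stream_space_snth[OF _ AE_recurrent[OF assms]]) measurable
  have [measurable]: "(\<lambda>\<omega>. mass (\<omega> !! i)) \<in> borel_measurable ?\<Xi>" for i
    by (rule measurable_compose[OF measurable_snth measurable_mass])
  define C where "C = (\<integral>\<^sup>+w. ennreal (mass w) \<partial>gap_stream)"
  have C: "C < \<infinity>" unfolding C_def by (rule nn_integral_mass_finite)
  have "(\<integral>\<^sup>+\<omega>. (\<Sum>i. ennreal (exp (- real i)) * ennreal (mass (\<omega> !! Suc i))) \<partial>?\<Xi>) =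
    (\<Sum>i. \<integral>\<^sup>+\<omega>. ennreal (exp (- real i)) * ennreal (mass (\<omega> !! Suc i)) \<partial>?\<Xi>)"
    by (rule nn_integral_suminf) measurable
  also have "\<dots> = (\<Sum>i. ennreal (exp (- real i)) * C)"
    unfolding C_def
  proof (rule suminf_cong)
    fix i
    show "(\<integral>\<^sup>+\<omega>. ennreal (exp (- real i)) * ennreal (mass (\<omega> !! Suc i)) \<partial>?\<Xi>) =
      ennreal (exp (- real i)) * (\<integral>\<^sup>+w. ennreal (mass w) \<partial>gap_stream)"
      using gaps.nn_integral_stream_snth[of "\<lambda>w. ennreal (mass w)" "Suc i"]
      by (subst nn_integral_cmult) (auto simp del: snth.simps)
  qed
  also have "\<dots> = (\<Sum>i. ennreal (exp (- real i))) * C" by simp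
  also have "(\<Sum>i. ennreal (exp (- real i))) = ennreal (\<Sum>i. exp (- real i))"
  proof (rule suminf_ennreal2)
    have "summable (\<lambda>i. exp (- 1 :: real) ^ i)" by (rule summable_geometric) simp
    then show "summable (\<lambda>i. exp (- real i))" by (simp add: exp_of_nat_mult[symmetric])
  qed simp
  finally have "(\<integral>\<^sup>+\<omega>. (\<Sum>i. ennreal (exp (- real i)) * ennreal (mass (\<omega> !! Suc i))) \<partial>?\<Xi>) \<noteq> \<infinity>"
    using C by (simp add: ennreal_mult_eq_top_iff less_top)
  then have "AE \<omega> in ?\<Xi>. (\<Sum>i. ennreal (exp (- real i)) * ennreal (mass (\<omega> !! Suc i))) \<noteq> \<infinity>"
    by (intro nn_integral_PInf_AE) measurable
  with 1 show ?thesis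
  proof eventually_elim
    fix \<omega> assume r: "\<forall>i. recurrent d (\<omega> !! i)"
      and fin: "(\<Sum>i. ennreal (exp (- real i)) * ennreal (mass (\<omega> !! Suc i))) \<noteq> \<infinity>"
    have m0: "0 \<le> mass (\<omega> !! Suc i)" for i
      unfolding mass_def using recurrentD(2)[of d "\<omega> !! Suc i"] r
      by (intro sum_nonneg) (simp add: add_nonneg_nonneg less_imp_le del: snth.simps)
    have "summable (\<lambda>i. exp (- real i) * mass (\<omega> !! Suc i))"
    proof (rule summable_suminf_not_top)
      show "(\<Sum>i. ennreal (exp (- real i) * mass (\<omega> !! Suc i))) \<noteq> top"
        using fin m0 by (simp add: ennreal_mult del: snth.simps)
    qed (simp add: m0 del: snth.simps)
    then show "admissible d \<omega>" unfolding admissible_def using r by blast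
  qed
qed

subsection \<open>Uniform points in the cube\<close>

lemma nn_integral_neg_ln:
  assumes [measurable]: "g \<in> borel_measurable borel"
  shows "(\<integral>\<^sup>+y. indicator {0..1} y * g (- ln y) \<partial>lborel) = (\<integral>\<^sup>+x. g x \<partial>expo)"
proof -
  let ?U = "uniform_measure lborel {0..1::real}"
  interpret U: prob_space ?U by (rule prob_space_uniform_measure) auto
  have "distributed ?U lborel (\<lambda>y. - ln y) (exponential_density 1)"
  proof (rule exponential_distributedI)
    fix a :: real assume a: "0 \<le> a"
    \<comment> \<open>The point \<open>0\<close> belongs to the set because \<open>ln 0 = 0\<close>;
      being a null set it does no harm.\<close>
    have eq: "{0..1} \<inter> {x. - ln x \<le> a} = {exp (- a)..1} \<union> {0}"
    proof (rule set_eqI)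
      fix x :: real
      have "- ln x \<le> a \<longleftrightarrow> exp (- a) \<le> x" if "0 < x"
        using that ln_ge_iff[of x "- a"] by (simp add: minus_le_iff)
      moreover have "0 < x" if "exp (- a) \<le> x" using that exp_gt_zero[of "- a"] by linarith
      ultimately show "x \<in> {0..1} \<inter> {x. - ln x \<le> a} \<longleftrightarrow> x \<in> {exp (- a)..1} \<union> {0}"
        using a by (cases "0 < x") (auto simp: not_less)
    qed
    have "emeasure ?U {x \<in> space ?U. - ln x \<le> a} = emeasure lborel ({0..1} \<inter> {x. - ln x \<le> a})"
    proof -
      have "{x \<in> space borel. - ln x \<le> a} \<in> sets (borel :: real measure)" by measurable
      then have "{x. - ln x \<le> a} \<in> sets (borel :: real measure)" by simp
      then show ?thesis by (simp add: divide_ennreal_def)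
    qed
    also have "\<dots> = emeasure lborel {exp (- a)..1}"
      unfolding eq by (rule emeasure_Un_null_set) auto
    also have "\<dots> = ennreal (1 - exp (- a * 1))" using a by (subst emeasure_lborel_Icc) auto
    finally show "emeasure ?U {x \<in> space ?U. - ln x \<le> a} = 1 - ennreal (exp (- a * 1))"
      using a by (simp add: ennreal_minus[symmetric])
  qed auto
  then have d: "distr ?U lborel (\<lambda>y. - ln y) = expo"
    unfolding expo_def by (rule distributed_distr_eq_density)
  have "(\<integral>\<^sup>+x. g x \<partial>expo) = (\<integral>\<^sup>+y. g (- ln y) \<partial>?U)"
    unfolding d[symmetric] by (rule nn_integral_distr) auto
  also have "\<dots> = (\<integral>\<^sup>+y. indicator {0..1} y * g (- ln y) \<partial>lborel)"
    unfolding uniform_measure_def by (subst nn_integral_density) (auto simp: divide_ennreal_def)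
  finally show ?thesis ..
qed

text \<open>The expectation of \<open>g\<close> at a sum of \<open>k\<close> independent standard
  exponential variables, that is, under a gamma law. The iterated form matches both the coordinates
  of a uniform point and the gaps of a stream, so no gamma density is involved.\<close>

primrec exp_iter :: "nat \<Rightarrow> (real \<Rightarrow> ennreal) \<Rightarrow> ennreal" where
  "exp_iter 0 g = g 0"
| "exp_iter (Suc k) g = (\<integral>\<^sup>+e. exp_iter k (\<lambda>x. g (e + x)) \<partial>expo)"

lemma measurable_exp_iter:
  assumes [measurable]: "g \<in> borel_measurable borel"
  shows "(\<lambda>s. exp_iter k (\<lambda>x. g (s + x))) \<in> borel_measurable borel"
proof (induction k)
  case 0
  show ?case by simp
next
  case (Suc k)
  note [measurable] = Suc
  have "(\<lambda>(s, e). (\<lambda>s. exp_iter k (\<lambda>x. g (s + x))) (s + e)) \<in> borel_measurable (borel \<Otimes>\<^sub>M expo)"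
    by measurable
  then have [measurable]: "(\<lambda>(s, e). exp_iter k (\<lambda>x. g (s + (e + x)))) \<in> borel_measurable (borel \<Otimes>\<^sub>M expo)"
    by (simp add: add.assoc)
  show ?case unfolding exp_iter.simps by measurable
qed

interpretation lborel_product: product_sigma_finite "\<lambda>_. lborel :: real measure" ..

text \<open>Integrating out one coordinate of the cube contributes one exponential variable.\<close>

lemma nn_integral_PiM_neg_ln:
  assumes "finite I" "g \<in> borel_measurable borel"
  shows "(\<integral>\<^sup>+x. (\<Prod>i\<in>I. indicator {0..1} (x i)) * g (\<Sum>i\<in>I. - ln (x i)) \<partial>Pi\<^sub>M I (\<lambda>_. lborel)) = exp_iter (card I) g"
  using assms
proof (induction I arbitrary: g rule: finite_induct)
  case empty
  then show ?case by (subst PiM_empty) (simp add: nn_integral_count_space_finite)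
next
  case (insert i I)
  note [measurable] = insert(4)
  have upd: "(\<Prod>j\<in>insert i I. indicator {0..1} ((x(i := y)) j)) * g (\<Sum>j\<in>insert i I. - ln ((x(i := y)) j)) =
    indicator {0..1} y * ((\<Prod>j\<in>I. indicator {0..1} (x j)) * g (- ln y + (\<Sum>j\<in>I. - ln (x j))))" for x y
  proof -
    have "(\<Prod>j\<in>I. indicator {0..1} ((x(i := y)) j)) = (\<Prod>j\<in>I. indicator {0..1} (x j) :: ennreal)"
      using insert(2) by (intro prod.cong) auto
    moreover have "(\<Sum>j\<in>I. - ln ((x(i := y)) j)) = (\<Sum>j\<in>I. - ln (x j))"
      using insert(2) by (intro sum.cong) auto
    ultimately show ?thesis using insert(1,2) by (simp add: mult.assoc)
  qed
  have [measurable]: "(\<lambda>e. exp_iter (card I) (\<lambda>s. g (e + s))) \<in> borel_measurable borel"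
    by (rule measurable_exp_iter[OF insert(4)])
  have "(\<integral>\<^sup>+x. (\<Prod>j\<in>insert i I. indicator {0..1} (x j)) * g (\<Sum>j\<in>insert i I. - ln (x j)) \<partial>Pi\<^sub>M (insert i I) (\<lambda>_. lborel)) =
    (\<integral>\<^sup>+y. \<integral>\<^sup>+x. indicator {0..1} y * ((\<Prod>j\<in>I. indicator {0..1} (x j)) * g (- ln y + (\<Sum>j\<in>I. - ln (x j)))) \<partial>Pi\<^sub>M I (\<lambda>_. lborel) \<partial>lborel)"
    unfolding upd[symmetric] by (rule lborel_product.product_nn_integral_insert_rev[OF insert(1,2)]) measurable
  also have "\<dots> = (\<integral>\<^sup>+y. indicator {0..1} y * exp_iter (card I) (\<lambda>s. g (- ln y + s)) \<partial>lborel)"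
  proof (rule nn_integral_cong)
    fix y :: real
    have "(\<integral>\<^sup>+x. indicator {0..1} y * ((\<Prod>j\<in>I. indicator {0..1} (x j)) * g (- ln y + (\<Sum>j\<in>I. - ln (x j)))) \<partial>Pi\<^sub>M I (\<lambda>_. lborel)) =
      indicator {0..1} y * (\<integral>\<^sup>+x. ((\<Prod>j\<in>I. indicator {0..1} (x j)) * g (- ln y + (\<Sum>j\<in>I. - ln (x j)))) \<partial>Pi\<^sub>M I (\<lambda>_. lborel))"
      by (rule nn_integral_cmult) measurable
    also have "(\<integral>\<^sup>+x. ((\<Prod>j\<in>I. indicator {0..1} (x j)) * g (- ln y + (\<Sum>j\<in>I. - ln (x j)))) \<partial>Pi\<^sub>M I (\<lambda>_. lborel)) =
      exp_iter (card I) (\<lambda>s. g (- ln y + s))"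
      by (rule insert(3)) measurable
    finally show "(\<integral>\<^sup>+x. indicator {0..1} y * ((\<Prod>j\<in>I. indicator {0..1} (x j)) * g (- ln y + (\<Sum>j\<in>I. - ln (x j)))) \<partial>Pi\<^sub>M I (\<lambda>_. lborel)) =
      indicator {0..1} y * exp_iter (card I) (\<lambda>s. g (- ln y + s))" .
  qed
  also have "\<dots> = (\<integral>\<^sup>+e. exp_iter (card I) (\<lambda>s. g (e + s)) \<partial>expo)"
    by (rule nn_integral_neg_ln) measurable
  also have "\<dots> = exp_iter (card (insert i I)) g" using insert(1,2) by simp
  finally show ?case .
qed

lemma Basis_cart_eq: "(Basis :: (real ^ 'n) set) = range (\<lambda>i. axis i 1)"
  unfolding Basis_vec_def by auto

lemma inj_axis_1: "inj (\<lambda>i. axis i 1 :: real ^ 'n)"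
  by (auto intro!: injI simp: axis_eq_axis)

lemma unit_cube_iff_Basis: "(u :: real ^ 'n) \<in> unit_cube \<longleftrightarrow> (\<forall>b\<in>Basis. u \<bullet> b \<in> {0..1})"
  unfolding unit_cube_def Basis_cart_eq by (auto simp: inner_axis)

lemma indicator_unit_cube: "indicator unit_cube (u :: real ^ 'n) = (\<Prod>b\<in>Basis. indicator {0..1} (u \<bullet> b) :: ennreal)"
proof (cases "u \<in> unit_cube")
  case True
  then have "indicator {0..1} (u \<bullet> b) = (1 :: ennreal)" if "b \<in> Basis" for b
    using that unfolding unit_cube_iff_Basis by (auto simp: indicator_def)
  then show ?thesis using True by simp
next
  case False
  then obtain b where "b \<in> Basis" "u \<bullet> b \<notin> {0..1}" unfolding unit_cube_iff_Basis by blast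
  then have "\<exists>b\<in>Basis. indicator {0..1} (u \<bullet> b) = (0 :: ennreal)" by (auto simp: indicator_def)
  then show ?thesis using False by (simp add: prod_zero_iff)
qed

lemma height_eq_Basis: "height (u :: real ^ 'n) = (\<Prod>b\<in>Basis. u \<bullet> b)"
  unfolding height_def Basis_cart_eq by (subst prod.reindex[OF inj_axis_1]) (simp add: inner_axis)

lemma measurable_vec_nth [measurable]:
  assumes [measurable]: "f \<in> borel_measurable M"
  shows "(\<lambda>x. (f x :: real ^ 'n) $ i) \<in> borel_measurable M"
proof -
  have "continuous_on UNIV (\<lambda>u :: real ^ 'n. u $ i)" by (intro continuous_intros)
  then have "(\<lambda>u :: real ^ 'n. u $ i) \<in> borel_measurable borel" by (rule borel_measurable_continuous_onI)
  then show ?thesis by (rule measurable_compose[OF assms])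
qed

lemma measurable_height [measurable]:
  assumes [measurable]: "f \<in> borel_measurable M"
  shows "(\<lambda>x. height (f x :: real ^ 'n)) \<in> borel_measurable M"
  unfolding height_def by measurable

lemma measurable_unit_cube [measurable]: "(unit_cube :: (real ^ 'n) set) \<in> sets borel"
proof -
  have "{u \<in> space borel. \<forall>i. 0 \<le> (u :: real ^ 'n) $ i \<and> u $ i \<le> 1} \<in> sets borel" by measurable
  then show ?thesis unfolding unit_cube_def by simp
qed

lemma emeasure_unit_cube: "emeasure lborel (unit_cube :: (real ^ 'n) set) = 1"
proof -
  have "emeasure lborel (unit_cube :: (real ^ 'n) set) = (\<integral>\<^sup>+u. indicator (unit_cube :: (real ^ 'n) set) u \<partial>lborel)" by simp
  also have "\<dots> = (\<Prod>b\<in>(Basis :: (real ^ 'n) set). \<integral>\<^sup>+x. indicator {0..1::real} x \<partial>lborel)"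
    unfolding indicator_unit_cube by (rule nn_integral_lborel_prod) auto
  finally show ?thesis by simp
qed

abbreviation cube_measure :: "(real ^ 'n) measure" where
  "cube_measure \<equiv> uniform_measure lborel unit_cube"

lemma prob_space_cube: "prob_space (cube_measure :: (real ^ 'n) measure)"
  by (rule prob_space_uniform_measure) (auto simp: emeasure_unit_cube)

lemma emeasure_cube_UNIV: "emeasure (cube_measure :: (real ^ 'n) measure) UNIV = 1"
  using prob_space.emeasure_space_1[OF prob_space_cube] by simp

interpretation cube: prob_space "cube_measure :: (real ^ 'n) measure"
  by (rule prob_space_cube)

lemma nn_integral_cube:
  assumes [measurable]: "f \<in> borel_measurable borel"
  shows "(\<integral>\<^sup>+u. f u \<partial>cube_measure) = (\<integral>\<^sup>+u. indicator unit_cube u * f (u :: real ^ 'n) \<partial>lborel)"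
  unfolding uniform_measure_def
  by (subst nn_integral_density) (auto simp: emeasure_unit_cube divide_ennreal_def)

lemma AE_lborel_coordinate: "AE u in lborel. (u :: real ^ 'n) $ i \<noteq> c"
proof -
  have "negligible {u :: real ^ 'n. u \<bullet> axis i 1 = c}" by (rule negligible_standard_hyperplane) simp
  then have "{u :: real ^ 'n. u $ i = c} \<in> null_sets (completion lborel)"
    unfolding negligible_iff_null_sets by (simp add: inner_axis)
  moreover have "{u :: real ^ 'n. u $ i = c} \<in> sets lborel"
  proof -
    have "{u \<in> space borel. (u :: real ^ 'n) $ i = c} \<in> sets borel" by measurable
    then show ?thesis by simp
  qed
  ultimately have "{u :: real ^ 'n. u $ i = c} \<in> null_sets lborel" using null_sets_completion_iff by blast
  then show ?thesis using AE_not_in by fastforce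
qed

lemma AE_cube: "AE u in cube_measure. \<forall>i. 0 < (u :: real ^ 'n) $ i \<and> u $ i < 1"
proof -
  have "AE u in lborel. \<forall>i. (u :: real ^ 'n) $ i \<noteq> 0 \<and> u $ i \<noteq> 1"
    by (simp add: AE_all_countable AE_conj_iff AE_lborel_coordinate)
  then have "AE u in lborel. 0 < indicator unit_cube u / emeasure lborel (unit_cube :: (real ^ 'n) set) \<longrightarrow> (\<forall>i. 0 < (u :: real ^ 'n) $ i \<and> u $ i < 1)"
  proof eventually_elim
    fix u :: "real ^ 'n" assume u: "\<forall>i. u $ i \<noteq> 0 \<and> u $ i \<noteq> 1"
    show "0 < indicator unit_cube u / emeasure lborel (unit_cube :: (real ^ 'n) set) \<longrightarrow> (\<forall>i. 0 < u $ i \<and> u $ i < 1)"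
    proof (intro impI allI)
      fix i assume "0 < indicator unit_cube u / emeasure lborel (unit_cube :: (real ^ 'n) set)"
      then have "u \<in> unit_cube"
        by (cases "u \<in> unit_cube") (auto simp: divide_ennreal_def)
      then have "0 \<le> u $ i" "u $ i \<le> 1" by (auto simp: unit_cube_def)
      then show "0 < u $ i \<and> u $ i < 1" using u by (simp add: less_le)
    qed
  qed
  then show ?thesis unfolding uniform_measure_def by (subst AE_density) auto
qed

lemma neg_ln_height:
  fixes u :: "real ^ 'n"
  assumes "\<And>i. 0 < u $ i"
  shows "- ln (height u) = (\<Sum>b\<in>Basis. - ln (u \<bullet> b))"
proof -
  have "u \<bullet> b \<noteq> 0" if b: "b \<in> Basis" for b
  proof -
    obtain i where "b = axis i 1" using b unfolding Basis_cart_eq by blast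
    then show ?thesis using assms[of i] by (simp add: inner_axis)
  qed
  then show ?thesis unfolding height_eq_Basis by (subst ln_prod) (auto simp: sum_negf)
qed

text \<open>Minus the logarithm of the height is a sum over coordinates, and Lebesgue measure is the
  image of a product measure under the sum over the basis; so the product formula applies with one
  factor per dimension.\<close>

lemma nn_integral_neg_ln_height:
  assumes [measurable]: "g \<in> borel_measurable borel"
  shows "(\<integral>\<^sup>+u. g (- ln (height u)) \<partial>(cube_measure :: (real ^ 'n) measure)) = exp_iter CARD('n) g"
proof -
  let ?B = "Basis :: (real ^ 'n) set"
  have "(\<integral>\<^sup>+u. g (- ln (height u)) \<partial>(cube_measure :: (real ^ 'n) measure)) = (\<integral>\<^sup>+u. g (\<Sum>b\<in>?B. - ln (u \<bullet> b)) \<partial>cube_measure)"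
    using AE_cube by (intro nn_integral_cong_AE) (auto elim!: eventually_mono simp: neg_ln_height)
  also have "\<dots> = (\<integral>\<^sup>+u. (\<Prod>b\<in>?B. indicator {0..1} (u \<bullet> b)) * g (\<Sum>b\<in>?B. - ln (u \<bullet> b)) \<partial>lborel)"
    by (subst nn_integral_cube) (auto simp: indicator_unit_cube)
  also have "\<dots> = (\<integral>\<^sup>+u. (\<Prod>b\<in>?B. indicator {0..1} (u \<bullet> b)) * g (\<Sum>b\<in>?B. - ln (u \<bullet> b))
      \<partial>distr (\<Pi>\<^sub>M b\<in>?B. lborel) borel (\<lambda>f. \<Sum>b\<in>?B. f b *\<^sub>R b))"
    unfolding lborel_eq_real lborel_def[symmetric] ..
  also have "\<dots> = (\<integral>\<^sup>+x. (\<Prod>b\<in>?B. indicator {0..1} ((\<Sum>c\<in>?B. x c *\<^sub>R c) \<bullet> b)) * g (\<Sum>b\<in>?B. - ln ((\<Sum>c\<in>?B. x c *\<^sub>R c) \<bullet> b)) \<partial>(\<Pi>\<^sub>M b\<in>?B. lborel))"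
    by (rule nn_integral_distr) measurable
  also have "\<dots> = (\<integral>\<^sup>+x. (\<Prod>b\<in>?B. indicator {0..1} (x b)) * g (\<Sum>b\<in>?B. - ln (x b)) \<partial>(\<Pi>\<^sub>M b\<in>?B. lborel))"
    by (intro nn_integral_cong arg_cong2[of _ _ _ _ "(*)"] prod.cong arg_cong[of _ _ g] sum.cong refl)
      (simp_all add: inner_sum_left_Basis)
  also have "\<dots> = exp_iter CARD('n) g"
    by (subst nn_integral_PiM_neg_ln) auto
  finally show ?thesis .
qed

section \<open>Scaling the cube onto the box below a record\<close>

definition scale :: "real ^ 'n \<Rightarrow> real ^ 'n \<Rightarrow> real ^ 'n" where
  "scale r u = (\<chi> i. r $ i * u $ i)"

lemma scale_nth [simp]: "scale r u $ i = r $ i * u $ i"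
  by (simp add: scale_def)

lemma height_scale: "height (scale r u) = height r * height u"
  by (simp add: height_def prod.distrib)

lemma measurable_scale [measurable]:
  assumes [measurable]: "f \<in> borel_measurable M" "g \<in> borel_measurable M"
  shows "(\<lambda>x. scale (f x :: real ^ 'n) (g x)) \<in> borel_measurable M"
  by (rule borel_measurable_continuous_Pair[OF assms]) (auto simp: scale_def intro!: continuous_intros)

lemma height_pos: "(\<And>i. 0 < r $ i) \<Longrightarrow> 0 < height r"
  unfolding height_def by (intro prod_pos) auto

text \<open>The Jacobian of a diagonal map is the product of its entries, here
  \<open>height r\<close>.\<close>

lemma nn_integral_scale:
  fixes r :: "real ^ 'n"
  assumes r: "\<And>i. 0 < r $ i" and [measurable]: "F \<in> borel_measurable borel"
  shows "(\<integral>\<^sup>+u. F u \<partial>lborel) = ennreal (height r) * (\<integral>\<^sup>+u. F (scale r u) \<partial>lborel)"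
proof -
  have nth: "r \<bullet> b = r $ axis_index b" if "b \<in> Basis" for b
    using axis_index[OF that] by (metis inner_axis' inner_commute inner_real_def mult_1 cart_eq_inner_axis)
  have T: "(0 + (\<Sum>j\<in>Basis. ((r \<bullet> j) * (x \<bullet> j)) *\<^sub>R j)) = scale r x" for x
  proof (rule euclidean_eqI)
    fix b :: "real ^ 'n" assume b: "b \<in> Basis"
    then obtain i where i: "b = axis i 1" unfolding Basis_cart_eq by blast
    have "(0 + (\<Sum>j\<in>Basis. ((r \<bullet> j) * (x \<bullet> j)) *\<^sub>R j)) \<bullet> b = (r \<bullet> b) * (x \<bullet> b)"
      using b by (simp add: inner_sum_left_Basis)
    then show "(0 + (\<Sum>j\<in>Basis. ((r \<bullet> j) * (x \<bullet> j)) *\<^sub>R j)) \<bullet> b = scale r x \<bullet> b"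
      unfolding i by (simp add: inner_axis)
  qed
  have pos: "0 < r \<bullet> j" if "j \<in> Basis" for j using nth[OF that] r by simp
  have "lborel = density (distr lborel borel (scale r)) (\<lambda>_. ennreal (\<Prod>j\<in>Basis. \<bar>r \<bullet> j\<bar>))"
    using lborel_affine_euclidean[of "\<lambda>j. r \<bullet> j" 0] pos unfolding T by (simp add: less_imp_neq[symmetric])
  also have "(\<Prod>j\<in>Basis. \<bar>r \<bullet> j\<bar>) = height r"
    unfolding height_eq_Basis using pos by (intro prod.cong refl abs_of_pos)
  finally have "(\<integral>\<^sup>+u. F u \<partial>lborel) = (\<integral>\<^sup>+u. F u \<partial>density (distr lborel borel (scale r)) (\<lambda>_. ennreal (height r)))"
    by simp
  also have "\<dots> = (\<integral>\<^sup>+u. ennreal (height r) * F u \<partial>distr lborel borel (scale r))"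
    by (subst nn_integral_density) auto
  also have "\<dots> = ennreal (height r) * (\<integral>\<^sup>+u. F (scale r u) \<partial>lborel)"
    by (simp add: nn_integral_distr nn_integral_cmult)
  finally show ?thesis .
qed

lemma measurable_prec [measurable]:
  assumes [measurable]: "f \<in> borel_measurable M" "g \<in> borel_measurable M"
  shows "Measurable.pred M (\<lambda>x. (f x :: real ^ 'n) \<prec> g x)"
  unfolding prec_def vec_eq_iff by measurable

text \<open>The change of variables \<open>x = scale r u\<close>: a uniform point that falls below
  \<open>r\<close> is distributed as \<open>scale r u\<close> with \<open>u\<close> uniform, and it
  falls there with probability \<open>height r\<close>.\<close>

lemma nn_integral_below:
  fixes r :: "real ^ 'n"
  assumes r: "\<And>i. 0 < r $ i \<and> r $ i \<le> 1" and [measurable]: "g \<in> borel_measurable borel"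
  shows "(\<integral>\<^sup>+x. indicator {x. x \<prec> r} x * g x \<partial>cube_measure) = ennreal (height r) * (\<integral>\<^sup>+u. g (scale r u) \<partial>cube_measure)"
proof -
  have [measurable]: "{x. x \<prec> r} \<in> sets borel"
  proof -
    have "{x \<in> space borel. x \<prec> r} \<in> sets borel" by measurable
    then show ?thesis by simp
  qed
  have "(\<integral>\<^sup>+x. indicator {x. x \<prec> r} x * g x \<partial>cube_measure) = (\<integral>\<^sup>+x. indicator unit_cube x * (indicator {x. x \<prec> r} x * g x) \<partial>lborel)"
    by (rule nn_integral_cube) measurable
  also have "\<dots> = ennreal (height r) * (\<integral>\<^sup>+u. indicator unit_cube (scale r u) * (indicator {x. x \<prec> r} (scale r u) * g (scale r u)) \<partial>lborel)"
    using r by (intro nn_integral_scale) auto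
  also have "(\<integral>\<^sup>+u. indicator unit_cube (scale r u) * (indicator {x. x \<prec> r} (scale r u) * g (scale r u)) \<partial>lborel) =
    (\<integral>\<^sup>+u. indicator unit_cube u * g (scale r u) \<partial>lborel)"
  proof (rule nn_integral_cong_AE)
    \<comment> \<open>The corner \<open>(1, ..., 1)\<close> is mapped to \<open>r\<close> itself,
      which is not strictly below \<open>r\<close>.\<close>
    have "AE u in lborel. u \<noteq> ((\<chi> i. 1) :: real ^ 'n)" by (rule AE_lborel_singleton)
    then show "AE u in lborel. indicator unit_cube (scale r u) * (indicator {x. x \<prec> r} (scale r u) * g (scale r u)) =
      indicator unit_cube u * g (scale r u)"
    proof eventually_elim
      fix u :: "real ^ 'n" assume u: "u \<noteq> (\<chi> i. 1)"
      have le: "r $ i * u $ i \<le> r $ i \<longleftrightarrow> u $ i \<le> 1" for i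
        using mult_le_cancel_left_pos[of "r $ i" "u $ i" 1] r by simp
      have ge: "0 \<le> r $ i * u $ i \<longleftrightarrow> 0 \<le> u $ i" for i
        using r[of i] by (simp add: zero_le_mult_iff less_le_not_le)
      have ne: "scale r u \<noteq> r"
      proof
        assume "scale r u = r"
        then have "r $ i * u $ i = r $ i" for i by (metis scale_nth)
        then have "u $ i = 1" for i using r[of i] by (metis less_irrefl mult_cancel_left1)
        then show False using u by (simp add: vec_eq_iff)
      qed
      have "scale r u \<in> unit_cube \<and> scale r u \<prec> r \<longleftrightarrow> u \<in> unit_cube"
      proof
        assume "scale r u \<in> unit_cube \<and> scale r u \<prec> r"
        then show "u \<in> unit_cube" using le ge by (auto simp: unit_cube_def prec_def)
      next
        assume u: "u \<in> unit_cube"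
        then have *: "0 \<le> r $ i * u $ i" "r $ i * u $ i \<le> r $ i" for i using le ge by (auto simp: unit_cube_def)
        moreover have "r $ i * u $ i \<le> 1" for i using *(2)[of i] r[of i] by linarith
        ultimately show "scale r u \<in> unit_cube \<and> scale r u \<prec> r" using ne by (auto simp: unit_cube_def prec_def)
      qed
      then show "indicator unit_cube (scale r u) * (indicator {x. x \<prec> r} (scale r u) * g (scale r u)) =
        indicator unit_cube u * g (scale r u)" by (auto simp: indicator_def)
    qed
  qed
  also have "\<dots> = (\<integral>\<^sup>+u. g (scale r u) \<partial>cube_measure)" by (rule nn_integral_cube[symmetric]) measurable
  finally show ?thesis .
qed

lemma emeasure_below:
  fixes r :: "real ^ 'n"
  assumes r: "\<And>i. 0 < r $ i \<and> r $ i \<le> 1"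
  shows "emeasure cube_measure {x. x \<prec> r} = ennreal (height r)"
proof -
  have [measurable]: "{x. x \<prec> r} \<in> sets borel"
  proof -
    have "{x \<in> space borel. x \<prec> r} \<in> sets borel" by measurable
    then show ?thesis by simp
  qed
  have "emeasure cube_measure {x. x \<prec> r} = (\<integral>\<^sup>+x. indicator {x. x \<prec> r} x * 1 \<partial>cube_measure)"
    by (simp del: emeasure_uniform_measure)
  also have "\<dots> = ennreal (height r)"
    by (subst nn_integral_below[OF r]) (auto simp: emeasure_cube_UNIV simp del: emeasure_uniform_measure)
  finally show ?thesis .
qed

text \<open>With \<open>l = - ln (1 - p)\<close>, the floor of \<open>e / l\<close> is at least
  \<open>n\<close> iff \<open>e \<ge> n * l\<close>, which has probability
  \<open>exp (- n * l) = (1 - p) ^ n\<close>.\<close>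

lemma nn_integral_geometric:
  assumes p: "0 < p" "p < 1"
  shows "(\<integral>\<^sup>+e. g (nat \<lfloor>e / - ln (1 - p)\<rfloor>) \<partial>expo) = (\<Sum>n. ennreal ((1 - p) ^ n) * (ennreal p * g n))"
proof -
  define l where "l = - ln (1 - p)"
  have l: "0 < l" using p by (simp add: l_def)
  define N where "N e = nat \<lfloor>e / l\<rfloor>" for e
  have [measurable]: "N \<in> borel \<rightarrow>\<^sub>M count_space UNIV" unfolding N_def by measurable
  have ge: "emeasure expo {e. n \<le> N e} = ennreal ((1 - p) ^ n)" for n
  proof -
    have "emeasure expo {e. n \<le> N e} = emeasure expo {real n * l<..}"
    proof (rule emeasure_eq_AE)
      \<comment> \<open>The boundary point is removed because the tail of \<open>expo\<close> is
        known for open half-lines.\<close>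
      have "AE x in lborel. x \<noteq> real n * l" by (rule AE_lborel_singleton)
      then have "AE e in expo. e \<noteq> real n * l" unfolding expo_def by (subst AE_density) (auto elim!: eventually_mono)
      with AE_expo_pos show "AE e in expo. e \<in> {e. n \<le> N e} \<longleftrightarrow> e \<in> {real n * l<..}"
      proof eventually_elim
        fix e :: real assume e: "0 < e" "e \<noteq> real n * l"
        have "n \<le> N e \<longleftrightarrow> int n \<le> \<lfloor>e / l\<rfloor>" using e(1) l by (simp add: N_def le_nat_iff)
        also have "\<dots> \<longleftrightarrow> real n \<le> e / l" by (simp add: le_floor_iff)
        also have "\<dots> \<longleftrightarrow> real n * l \<le> e" using l by (simp add: pos_le_divide_eq)
        also have "\<dots> \<longleftrightarrow> real n * l < e" using e(2) by auto
        finally show "e \<in> {e. n \<le> N e} \<longleftrightarrow> e \<in> {real n * l<..}" by simp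
      qed
      have "{e \<in> space borel. n \<le> N e} \<in> sets borel" by measurable
      then show "{e. n \<le> N e} \<in> sets expo" by simp
    qed simp
    also have "\<dots> = ennreal (exp (- (real n * l)))" using l by (intro emeasure_expo_greaterThan) auto
    also have "exp (- (real n * l)) = (1 - p) ^ n"
      using p by (simp add: l_def exp_of_nat_mult)
    finally show ?thesis .
  qed
  have eq: "emeasure expo {e. N e = n} = ennreal ((1 - p) ^ n * p)" for n
  proof -
    have m: "{e. n \<le> N e} \<in> sets expo" for n
    proof -
      have "{e \<in> space borel. n \<le> N e} \<in> sets borel" by measurable
      then show ?thesis by simp
    qed
    have "{e. N e = n} = {e. n \<le> N e} - {e. Suc n \<le> N e}" by auto
    also have "emeasure expo \<dots> = emeasure expo {e. n \<le> N e} - emeasure expo {e. Suc n \<le> N e}"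
      using m by (intro emeasure_Diff) (auto simp: expo.emeasure_eq_measure)
    also have "\<dots> = ennreal ((1 - p) ^ n - (1 - p) ^ Suc n)"
      unfolding ge using p by (intro ennreal_minus) simp
    also have "(1 - p) ^ n - (1 - p) ^ Suc n = (1 - p) ^ n * p" by (simp add: algebra_simps)
    finally show ?thesis .
  qed
  have mN: "{e. N e = n} \<in> sets expo" for n
  proof -
    have "{e \<in> space borel. N e = n} \<in> sets borel" by measurable
    then show ?thesis by simp
  qed
  have "(\<integral>\<^sup>+e. g (N e) \<partial>expo) = (\<integral>\<^sup>+e. (\<Sum>n. g n * indicator {e. N e = n} e) \<partial>expo)"
  proof (rule nn_integral_cong)
    fix e
    have "(\<Sum>n. g n * indicator {e. N e = n} e) = (\<Sum>n\<in>{N e}. g n * indicator {e. N e = n} e)"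
      by (rule suminf_finite) auto
    then show "g (N e) = (\<Sum>n. g n * indicator {e. N e = n} e)" by simp
  qed
  also have "\<dots> = (\<Sum>n. \<integral>\<^sup>+e. g n * indicator {e. N e = n} e \<partial>expo)"
    using mN by (intro nn_integral_suminf) simp
  also have "\<dots> = (\<Sum>n. ennreal ((1 - p) ^ n) * (ennreal p * g n))"
    using p mN by (intro suminf_cong) (simp add: nn_integral_cmult_indicator eq ennreal_mult' ac_simps)
  finally show ?thesis unfolding N_def l_def .
qed

subsection \<open>Asymptotic independence of the phase\<close>

text \<open>The number of points between \<open>- ln b\<close> and \<open>0\<close> in the coupled
  construction. With this number as \<open>j\<close>, the walk for \<open>b\<close> starts in phase
  \<open>0\<close>.\<close>

definition count_before :: "real \<Rightarrow> (real \<times> real) stream stream \<Rightarrow> int" where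
  "count_before b \<omega> = (\<Sum>i<full_blocks b. int (cnt 1 (\<omega> !! Suc i))) +
     int (cnt (ln b - real (full_blocks b)) (\<omega> !! Suc (full_blocks b)))"

text \<open>What is left of \<open>count_before\<close> once finitely many blocks are frozen:
  \<open>n\<close> whole blocks and a partial one of length \<open>s\<close>, all fresh, counted
  from the entry at \<open>0\<close>.\<close>

definition tail_count :: "nat \<Rightarrow> real \<Rightarrow> (real \<times> real) stream stream \<Rightarrow> int" where
  "tail_count n s \<omega> = (\<Sum>i<n. int (cnt 1 (\<omega> !! i))) + int (cnt s (\<omega> !! n))"

lemma measurable_sum_cnt [measurable]:
  "(\<lambda>\<omega>. \<Sum>i<(n::nat). int (cnt a (\<omega> !! g i))) \<in> block_stream \<rightarrow>\<^sub>M count_space UNIV"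
  by (induction n) auto

lemma measurable_tail_count [measurable]:
  "tail_count n s \<in> block_stream \<rightarrow>\<^sub>M count_space UNIV"
  unfolding tail_count_def by measurable

lemma measurable_count_before [measurable]:
  "count_before b \<in> block_stream \<rightarrow>\<^sub>M count_space UNIV"
  unfolding count_before_def by measurable

lemma tail_count_Stream: "tail_count (Suc n) s (u ## \<omega>) = int (cnt 1 u) + tail_count n s \<omega>"
  unfolding tail_count_def by (subst sum.lessThan_Suc_shift) simp

text \<open>It suffices that the first \<open>k\<close> gaps are small and the next one exceeds
  \<open>1\<close>, an event of positive product probability.\<close>

lemma cnt_positive_prob: "0 < gaps.prob {u. cnt 1 u = k}"
proof -
  let ?\<xi> = gap_stream
  \<comment> \<open>Up to \<open>k\<close> gaps of at most this size sum to at most one.\<close>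
  define c where "c = 1 / real (Suc k)"
  define B where "B i = (if i < k then {..c} \<times> UNIV else {1<..} \<times> UNIV :: (real \<times> real) set)" for i :: nat
  have B[measurable]: "B i \<in> sets marked_expo" for i unfolding B_def sets_marked_expo by simp
  define E where "E = {u. \<forall>i<Suc k. u !! i \<in> B i}"
  have E[measurable]: "E \<in> sets ?\<xi>"
  proof -
    have "{u \<in> space ?\<xi>. \<forall>i<Suc k. u !! i \<in> B i} \<in> sets ?\<xi>" by measurable
    then show ?thesis by (simp add: E_def)
  qed
  have pB: "0 < emeasure marked_expo (B i)" for i
  proof -
    have "expo.prob {c<..} = exp (- c)"
      using emeasure_expo_greaterThan[of c] by (simp add: measure_def c_def)
    moreover have "expo.prob (space expo - {c<..}) = 1 - expo.prob {c<..}" by (rule expo.prob_compl) simp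
    moreover have "space expo - {c<..} = {..c}" by auto
    ultimately have "0 < expo.prob {..c}" by (simp add: c_def)
    then have "0 < emeasure expo {..c}" by (simp add: expo.emeasure_eq_measure)
    moreover have "0 < emeasure expo {1<..}" by (simp add: emeasure_expo_greaterThan)
    moreover have "emeasure marked_expo (A \<times> UNIV) = emeasure expo A" if "A \<in> sets borel" for A
      unfolding marked_expo_def using that by (subst expo.emeasure_pair_measure_Times) auto
    ultimately show ?thesis unfolding B_def by simp
  qed
  have "emeasure ?\<xi> E = (\<integral>\<^sup>+u. indicator E u \<partial>?\<xi>)" by simp
  also have "\<dots> = (\<integral>\<^sup>+u. (\<Prod>i<Suc k. indicator (B i) (u !! i)) \<partial>?\<xi>)"
    by (intro nn_integral_cong) (auto simp: E_def indicator_def prod_eq_1_iff simp del: snth.simps prod.lessThan_Suc split: if_splits)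
  also have "\<dots> = (\<Prod>i<Suc k. \<integral>\<^sup>+y. indicator (B i) y \<partial>marked_expo)"
    by (rule marked.nn_integral_stream_prod) measurable
  also have "\<dots> = (\<Prod>i<Suc k. emeasure marked_expo (B i))" by simp
  finally have "0 < emeasure ?\<xi> E" using pB by (simp add: prod_zero_iff zero_less_iff_neq_zero del: prod.lessThan_Suc)
  also have "emeasure ?\<xi> E \<le> emeasure ?\<xi> {u. cnt 1 u = k}"
  proof (rule emeasure_mono_AE)
    have "{u \<in> space ?\<xi>. cnt 1 u = k} \<in> sets ?\<xi>" by measurable
    then show "{u. cnt 1 u = k} \<in> sets ?\<xi>" by simp
    show "AE u in ?\<xi>. u \<in> E \<longrightarrow> u \<in> {u. cnt 1 u = k}"
      using AE_recurrent[OF zero_less_one]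
    proof (eventually_elim, intro impI)
      fix u assume r: "recurrent 1 u" and u: "u \<in> E"
      have "(LEAST n. 1 < psum u (Suc n)) = k"
      proof (rule Least_equality)
        have "u !! k \<in> B k" using u by (simp add: E_def)
        then have "1 < fst (u !! k)" by (auto simp: B_def)
        moreover have "0 \<le> psum u k" unfolding psum_def using recurrentD(1)[OF r] by (intro sum_nonneg) (simp add: less_imp_le)
        ultimately show "1 < psum u (Suc k)" by (simp add: psum_def)
        fix n assume n: "1 < psum u (Suc n)"
        show "k \<le> n"
        proof (rule ccontr)
          assume "\<not> k \<le> n"
          then have "n < k" by simp
          have "psum u (Suc n) \<le> (\<Sum>i<Suc n. c)"
            unfolding psum_def
          proof (rule sum_mono)
            fix i assume "i \<in> {..<Suc n}"
            then have "i < k" using \<open>n < k\<close> by simp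
            moreover have "u !! i \<in> B i" using u \<open>i < k\<close> by (simp add: E_def)
            ultimately show "fst (u !! i) \<le> c" by (auto simp: B_def)
          qed
          also have "\<dots> = real (Suc n) * c" by simp
          also have "\<dots> \<le> 1" using \<open>n < k\<close> by (simp add: c_def divide_simps)
          finally show False using n by simp
        qed
      qed
      then show "u \<in> {u. cnt 1 u = k}" by (simp add: cnt_def)
    qed
  qed
  finally show ?thesis by (simp add: gaps.emeasure_eq_measure)
qed

lemma sum_over_residues:
  assumes d: "0 < (d::nat)"
  shows "(\<Sum>k<d. if int d dvd x + int k then g k else 0) = (g (nat ((- x) mod int d)) :: real)"
proof -
  define k0 where "k0 = nat ((- x) mod int d)"
  have k0: "k0 < d" "int k0 = (- x) mod int d" using d by (auto simp: k0_def nat_less_iff)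
  have iff: "int d dvd x + int k \<longleftrightarrow> k = k0" if "k < d" for k
  proof
    assume "int d dvd x + int k"
    then have "(- x) mod int d = int k mod int d"
      by (simp add: mod_eq_dvd_iff) (metis add.commute add_uminus_conv_diff dvd_minus_iff minus_add_distrib minus_minus)
    then show "k = k0" using k0(2) that by simp
  next
    assume "k = k0"
    have "(x + int k0) mod int d = (x + (- x)) mod int d" unfolding k0(2) by (rule mod_add_right_eq)
    then show "int d dvd x + int k" using \<open>k = k0\<close> by (simp add: dvd_eq_mod_eq_0)
  qed
  have "(\<Sum>k<d. if int d dvd x + int k then g k else 0) = (\<Sum>k<d. if k = k0 then g k else 0)"
    by (rule sum.cong) (auto simp: iff)
  also have "\<dots> = g k0" using k0(1) by simp
  finally show ?thesis by (simp add: k0_def)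
qed

text \<open>
  The residue of the number of points in one block charges every class, so each further
  block contracts the distance of the residue to the uniform distribution.
\<close>

lemma tail_count_equidistributed:
  assumes d: "0 < d"
  obtains \<rho> where "0 \<le> \<rho>" "\<rho> < 1"
    "\<And>n s r. \<bar>block_space.prob {\<omega>. int d dvd tail_count n s \<omega> - r} - 1 / real d\<bar> \<le> \<rho> ^ n"
proof -
  let ?\<xi> = gap_stream and ?\<Xi> = block_stream
  define q where "q n s r = block_space.prob {\<omega>. int d dvd tail_count n s \<omega> - r}" for n s r
  define \<kappa> where "\<kappa> k = gaps.prob {u. int d dvd int (cnt 1 u) - int k}" for k
  have ms: "{\<omega>. int d dvd tail_count n s \<omega> - r} \<in> sets ?\<Xi>" for n s r
  proof -
    have "{\<omega> \<in> space ?\<Xi>. int d dvd tail_count n s \<omega> - r} \<in> sets ?\<Xi>" by measurable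
    then show ?thesis by simp
  qed
  have mk: "{u. int d dvd int (cnt 1 u) - r} \<in> sets ?\<xi>" for r
  proof -
    have "{u \<in> space ?\<xi>. int d dvd int (cnt 1 u) - r} \<in> sets ?\<xi>" by measurable
    then show ?thesis by simp
  qed
  have sum_q: "(\<Sum>k<d. q n s (r - int k)) = 1" for n s r
  proof -
    have "(\<Sum>k<d. q n s (r - int k)) = (\<Sum>k<d. \<integral>\<omega>. indicator {\<omega>. int d dvd tail_count n s \<omega> - (r - int k)} \<omega> \<partial>?\<Xi>)"
      unfolding q_def using ms by simp
    also have "\<dots> = (\<integral>\<omega>. (\<Sum>k<d. indicator {\<omega>. int d dvd tail_count n s \<omega> - (r - int k)} \<omega>) \<partial>?\<Xi>)"
      using ms by (intro Bochner_Integration.integral_sum[symmetric]) (simp add: block_space.emeasure_eq_measure)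
    also have "\<dots> = (\<integral>\<omega>. 1 \<partial>?\<Xi>)"
    proof (rule Bochner_Integration.integral_cong[OF refl])
      fix \<omega>
      have "(\<Sum>k<d. indicator {\<omega>. int d dvd tail_count n s \<omega> - (r - int k)} \<omega>) =
        (\<Sum>k<d. if int d dvd (tail_count n s \<omega> - r) + int k then 1 else 0 :: real)"
        by (intro sum.cong refl) (simp add: indicator_def algebra_simps)
      then show "(\<Sum>k<d. indicator {\<omega>. int d dvd tail_count n s \<omega> - (r - int k)} \<omega>) = (1 :: real)"
        using sum_over_residues[OF d, of _ "\<lambda>_. 1"] by simp
    qed
    also have "\<dots> = 1" using block_space.prob_space by simp
    finally show ?thesis .
  qed
  have sum_\<kappa>: "(\<Sum>k<d. \<kappa> k) = 1"
  proof -
    have "(\<Sum>k<d. \<kappa> k) = (\<Sum>k<d. \<integral>u. indicator {u. int d dvd int (cnt 1 u) - int k} u \<partial>?\<xi>)"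
      unfolding \<kappa>_def using mk by simp
    also have "\<dots> = (\<integral>u. (\<Sum>k<d. indicator {u. int d dvd int (cnt 1 u) - int k} u) \<partial>?\<xi>)"
      using mk by (intro Bochner_Integration.integral_sum[symmetric]) (simp add: gaps.emeasure_eq_measure)
    also have "\<dots> = (\<integral>u. 1 \<partial>?\<xi>)"
    proof (rule Bochner_Integration.integral_cong[OF refl])
      fix u
      have "(\<Sum>k<d. indicator {u. int d dvd int (cnt 1 u) - int k} u) =
        (\<Sum>k<d. if int d dvd - int (cnt 1 u) + int k then 1 else 0 :: real)"
        by (intro sum.cong refl) (simp add: indicator_def dvd_diff_commute)
      then show "(\<Sum>k<d. indicator {u. int d dvd int (cnt 1 u) - int k} u) = (1 :: real)"
        by (simp only: sum_over_residues[OF d])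
    qed
    also have "\<dots> = 1" using gaps.prob_space by simp
    finally show ?thesis .
  qed
  have step: "q (Suc n) s r = (\<Sum>k<d. \<kappa> k * q n s (r - int k))" for n s r
  proof -
    have "ennreal (q (Suc n) s r) = (\<integral>\<^sup>+u. emeasure ?\<Xi> {\<omega> \<in> space ?\<Xi>. u ## \<omega> \<in> {\<omega>. int d dvd tail_count (Suc n) s \<omega> - r}} \<partial>?\<xi>)"
      unfolding q_def block_space.emeasure_eq_measure[symmetric] by (rule gaps.emeasure_stream_space[OF ms])
    also have "\<dots> = (\<integral>\<^sup>+u. ennreal (q n s (r - int (cnt 1 u))) \<partial>?\<xi>)"
      by (simp add: tail_count_Stream q_def block_space.emeasure_eq_measure algebra_simps)
    also have "\<dots> = (\<integral>\<^sup>+u. (\<Sum>k<d. ennreal (q n s (r - int k)) * indicator {u. int d dvd int (cnt 1 u) - int k} u) \<partial>?\<xi>)"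
    proof (rule nn_integral_cong)
      fix u
      have per: "q n s (r - int (cnt 1 u)) = q n s (r - int k)" if "int d dvd int (cnt 1 u) - int k" for k
      proof -
        have "int d dvd x - (r - int (cnt 1 u)) \<longleftrightarrow> int d dvd x - (r - int k)" for x
        proof -
          have "x - (r - int (cnt 1 u)) = (x - (r - int k)) + (int (cnt 1 u) - int k)" by simp
          then show ?thesis using dvd_add_left_iff[OF that] by metis
        qed
        then show ?thesis by (simp add: q_def)
      qed
      have "ennreal (q n s (r - int (cnt 1 u))) = ennreal (\<Sum>k<d. if int d dvd - int (cnt 1 u) + int k then q n s (r - int (cnt 1 u)) else 0)"
        by (simp only: sum_over_residues[OF d])
      also have "\<dots> = (\<Sum>k<d. ennreal (if int d dvd - int (cnt 1 u) + int k then q n s (r - int (cnt 1 u)) else 0))"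
        by (rule sum_ennreal[symmetric]) (simp add: q_def)
      also have "\<dots> = (\<Sum>k<d. ennreal (q n s (r - int k)) * indicator {u. int d dvd int (cnt 1 u) - int k} u)"
      proof (rule sum.cong[OF refl])
        fix k
        have "int d dvd - int (cnt 1 u) + int k \<longleftrightarrow> int d dvd int (cnt 1 u) - int k"
          by (simp add: dvd_diff_commute)
        then show "ennreal (if int d dvd - int (cnt 1 u) + int k then q n s (r - int (cnt 1 u)) else 0) =
          ennreal (q n s (r - int k)) * indicator {u. int d dvd int (cnt 1 u) - int k} u"
          using per[of k] by (simp add: indicator_def)
      qed
      finally show "ennreal (q n s (r - int (cnt 1 u))) = (\<Sum>k<d. ennreal (q n s (r - int k)) * indicator {u. int d dvd int (cnt 1 u) - int k} u)" .
    qed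
    also have "\<dots> = (\<Sum>k<d. \<integral>\<^sup>+u. ennreal (q n s (r - int k)) * indicator {u. int d dvd int (cnt 1 u) - int k} u \<partial>?\<xi>)"
      using mk by (intro nn_integral_sum) simp
    also have "\<dots> = (\<Sum>k<d. ennreal (\<kappa> k * q n s (r - int k)))"
    proof (rule sum.cong[OF refl])
      fix k
      have "(\<integral>\<^sup>+u. ennreal (q n s (r - int k)) * indicator {u. int d dvd int (cnt 1 u) - int k} u \<partial>?\<xi>) =
        ennreal (q n s (r - int k)) * emeasure ?\<xi> {u. int d dvd int (cnt 1 u) - int k}"
        by (rule nn_integral_cmult_indicator[OF mk])
      also have "emeasure ?\<xi> {u. int d dvd int (cnt 1 u) - int k} = ennreal (\<kappa> k)"
        unfolding \<kappa>_def by (rule gaps.emeasure_eq_measure)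
      also have "ennreal (q n s (r - int k)) * ennreal (\<kappa> k) = ennreal (q n s (r - int k) * \<kappa> k)"
        by (rule ennreal_mult''[symmetric]) (simp add: \<kappa>_def)
      finally show "(\<integral>\<^sup>+u. ennreal (q n s (r - int k)) * indicator {u. int d dvd int (cnt 1 u) - int k} u \<partial>?\<xi>) = ennreal (\<kappa> k * q n s (r - int k))"
        by (simp only: mult.commute)
    qed
    also have "\<dots> = ennreal (\<Sum>k<d. \<kappa> k * q n s (r - int k))"
      by (rule sum_ennreal) (simp add: \<kappa>_def q_def)
    finally show ?thesis
      by (subst (asm) ennreal_inj) (auto simp: q_def \<kappa>_def intro!: sum_nonneg)
  qed
  \<comment> \<open>A Doeblin constant: one block moves the residue to any given class with
    probability at least \<open>\<delta>\<close>.\<close>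
  define \<delta> where "\<delta> = Min (\<kappa> ` {..<d})"
  have \<kappa>_pos: "0 < \<kappa> k" for k
  proof -
    have "gaps.prob {u. cnt 1 u = k} \<le> \<kappa> k"
      unfolding \<kappa>_def using mk by (intro gaps.finite_measure_mono) auto
    then show ?thesis using cnt_positive_prob[of k] by linarith
  qed
  have \<delta>: "0 < \<delta>" "\<And>k. k < d \<Longrightarrow> \<delta> \<le> \<kappa> k"
  proof -
    have ne: "\<kappa> ` {..<d} \<noteq> {}" using d by auto
    show "0 < \<delta>" unfolding \<delta>_def using ne \<kappa>_pos by (subst Min_gr_iff) auto
    show "\<delta> \<le> \<kappa> k" if "k < d" for k unfolding \<delta>_def using that by (intro Min_le) auto
  qed
  have "real d * \<delta> = (\<Sum>k<d. \<delta>)" by simp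
  also have "\<dots> \<le> (\<Sum>k<d. \<kappa> k)" using \<delta>(2) by (intro sum_mono) auto
  finally have d\<delta>: "real d * \<delta> \<le> 1" using sum_\<kappa> by simp
  have bound: "\<bar>q n s r - 1 / real d\<bar> \<le> (1 - real d * \<delta>) ^ n" for n s r
  proof (induction n arbitrary: r)
    case 0
    have "0 \<le> q 0 s r" "q 0 s r \<le> 1" by (auto simp: q_def)
    moreover have "0 \<le> 1 / real d" "1 / real d \<le> 1" using d by auto
    ultimately show ?case unfolding power_0 abs_le_iff by linarith
  next
    case (Suc n)
    \<comment> \<open>The deviations from \<open>1 / real d\<close> sum to zero over the residues,
      so every weight \<open>\<kappa> k\<close> may be lowered by \<open>\<delta>\<close> without
      changing the average. The remaining weights are nonnegative with total
      \<open>1 - real d * \<delta>\<close>, which is the contraction factor.\<close>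
    have "(\<Sum>k<d. q n s (r - int k) - 1 / real d) = 0"
      using sum_q[of n s r] d by (simp add: sum_subtractf)
    then have "(\<Sum>k<d. \<delta> * (q n s (r - int k) - 1 / real d)) = 0"
      by (simp add: sum_distrib_left[symmetric])
    moreover have "(\<Sum>k<d. \<kappa> k * (q n s (r - int k) - 1 / real d)) = q (Suc n) s r - 1 / real d"
      unfolding step using sum_\<kappa> by (simp add: right_diff_distrib sum_subtractf sum_divide_distrib[symmetric])
    ultimately have "q (Suc n) s r - 1 / real d = (\<Sum>k<d. (\<kappa> k - \<delta>) * (q n s (r - int k) - 1 / real d))"
      by (simp add: left_diff_distrib sum_subtractf)
    also have "\<bar>\<dots>\<bar> \<le> (\<Sum>k<d. \<bar>(\<kappa> k - \<delta>) * (q n s (r - int k) - 1 / real d)\<bar>)" by (rule sum_abs)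
    also have "\<dots> \<le> (\<Sum>k<d. (\<kappa> k - \<delta>) * (1 - real d * \<delta>) ^ n)"
      using Suc \<delta>(2) by (intro sum_mono) (auto simp: abs_mult intro!: mult_left_mono)
    also have "\<dots> = (1 - real d * \<delta>) ^ Suc n"
      using sum_\<kappa> by (simp add: sum_distrib_right[symmetric] sum_subtractf)
    finally show ?case .
  qed
  show ?thesis
    by (rule that[of "1 - real d * \<delta>"]) (use d\<delta> \<delta>(1) d bound in \<open>auto simp: q_def\<close>)
qed

lemma sum_lessThan_add: "(\<Sum>i<n + k. f i) = (\<Sum>i<n. f i) + (\<Sum>i<k. f (n + i) :: int)" for n k :: nat
  by (induction k) (auto simp: add.assoc)

lemma count_before_split:
  assumes "n \<le> full_blocks b"
  shows "count_before b (stake (Suc n) \<omega> @- \<omega>') =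
    (\<Sum>i<n. int (cnt 1 (\<omega> !! Suc i))) + tail_count (full_blocks b - n) (ln b - real (full_blocks b)) \<omega>'"
proof -
  let ?m = "full_blocks b"
  have lt: "(stake (Suc n) \<omega> @- \<omega>') !! Suc i = \<omega> !! Suc i" if "i < n" for i
    using that by (simp add: shift_snth stake_nth del: snth.simps stake.simps)
  have ge: "(stake (Suc n) \<omega> @- \<omega>') !! Suc (n + i) = \<omega>' !! i" for i
    by (simp add: shift_snth del: snth.simps stake.simps)
  obtain k where k: "?m = n + k" using assms le_Suc_ex by blast
  have "(\<Sum>i<?m. int (cnt 1 ((stake (Suc n) \<omega> @- \<omega>') !! Suc i))) =
    (\<Sum>i<n. int (cnt 1 (\<omega> !! Suc i))) + (\<Sum>i<?m - n. int (cnt 1 (\<omega>' !! i)))"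
    unfolding k by (simp add: sum_lessThan_add lt ge del: snth.simps stake.simps)
  moreover have "(stake (Suc n) \<omega> @- \<omega>') !! Suc ?m = \<omega>' !! (?m - n)"
    using ge[of "?m - n"] assms by simp
  ultimately show ?thesis unfolding count_before_def tail_count_def by (simp del: snth.simps stake.simps)
qed

lemma count_before_sets: "{\<omega>. int d dvd count_before b \<omega> - r} \<in> sets (block_stream)"
proof -
  have "{\<omega> \<in> space (block_stream). int d dvd count_before b \<omega> - r} \<in> sets (block_stream)"
    by measurable
  then show ?thesis by simp
qed

lemma mixing_cylinder:
  assumes d: "0 < d" and A: "A \<in> sets (block_stream)"
    and dep: "\<And>\<omega> \<omega>'. stake n \<omega> @- \<omega>' \<in> A \<longleftrightarrow> \<omega> \<in> A"
  shows "((\<lambda>b. block_space.prob (A \<inter> {\<omega>. int d dvd count_before b \<omega> - r})) \<longlongrightarrow> block_space.prob A / real d) at_top"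
proof -
  let ?\<Xi> = block_stream
  obtain \<rho> where \<rho>: "0 \<le> \<rho>" "\<rho> < 1"
    "\<And>n s r. \<bar>block_space.prob {\<omega>. int d dvd tail_count n s \<omega> - r} - 1 / real d\<bar> \<le> \<rho> ^ n"
    using tail_count_equidistributed[OF d] by metis
  \<comment> \<open>One more entry is frozen: \<open>count_before\<close> skips the entry at
    \<open>0\<close>, so its first \<open>n\<close> blocks carry the indices \<open>1\<close> to
    \<open>n\<close>.\<close>
  have dep': "stake (Suc n) \<omega> @- \<omega>' \<in> A \<longleftrightarrow> \<omega> \<in> A" for \<omega> \<omega>'
    using dep[of \<omega> "\<omega> !! n ## \<omega>'"] by (simp add: stake_Suc del: stake.simps)
  have *: "\<bar>block_space.prob (A \<inter> {\<omega>. int d dvd count_before b \<omega> - r}) - block_space.prob A / real d\<bar> \<le> \<rho> ^ (full_blocks b - n)"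
    if b: "n \<le> full_blocks b" for b
  proof -
    define s \<epsilon> where "s = ln b - real (full_blocks b)" and "\<epsilon> = \<rho> ^ (full_blocks b - n)"
    define S where "S \<omega> = (\<Sum>i<n. int (cnt 1 (\<omega> !! Suc i)))" for \<omega> :: "(real \<times> real) stream stream"
    have "emeasure ?\<Xi> (A \<inter> {\<omega>. int d dvd count_before b \<omega> - r}) = (\<integral>\<^sup>+\<omega>. indicator (A \<inter> {\<omega>. int d dvd count_before b \<omega> - r}) \<omega> \<partial>?\<Xi>)"
      using A count_before_sets by simp
    also have "\<dots> = (\<integral>\<^sup>+\<omega>. \<integral>\<^sup>+\<omega>'. indicator (A \<inter> {\<omega>. int d dvd count_before b \<omega> - r}) (stake (Suc n) \<omega> @- \<omega>') \<partial>?\<Xi> \<partial>?\<Xi>)"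
      using A count_before_sets by (intro gaps.nn_integral_stream_split) simp
    also have "\<dots> = (\<integral>\<^sup>+\<omega>. indicator A \<omega> * emeasure ?\<Xi> {\<omega>'. int d dvd tail_count (full_blocks b - n) s \<omega>' - (r - S \<omega>)} \<partial>?\<Xi>)"
    proof (rule nn_integral_cong)
      fix \<omega>
      have m: "{\<omega>'. int d dvd tail_count (full_blocks b - n) s \<omega>' - (r - S \<omega>)} \<in> sets ?\<Xi>"
      proof -
        have "{\<omega>' \<in> space ?\<Xi>. int d dvd tail_count (full_blocks b - n) s \<omega>' - (r - S \<omega>)} \<in> sets ?\<Xi>" by measurable
        then show ?thesis by simp
      qed
      have "indicator (A \<inter> {\<omega>. int d dvd count_before b \<omega> - r}) (stake (Suc n) \<omega> @- \<omega>') =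
        (indicator A \<omega> * indicator {\<omega>'. int d dvd tail_count (full_blocks b - n) s \<omega>' - (r - S \<omega>)} \<omega>' :: ennreal)" for \<omega>'
      proof -
        have c: "count_before b (stake (Suc n) \<omega> @- \<omega>') - r = tail_count (full_blocks b - n) s \<omega>' - (r - S \<omega>)"
          unfolding count_before_split[OF b] S_def s_def by simp
        show ?thesis unfolding indicator_inter_arith unfolding indicator_def mem_Collect_eq c dep' ..
      qed
      then show "(\<integral>\<^sup>+\<omega>'. indicator (A \<inter> {\<omega>. int d dvd count_before b \<omega> - r}) (stake (Suc n) \<omega> @- \<omega>') \<partial>?\<Xi>) =
        indicator A \<omega> * emeasure ?\<Xi> {\<omega>'. int d dvd tail_count (full_blocks b - n) s \<omega>' - (r - S \<omega>)}"
        using m by (simp add: nn_integral_cmult_indicator)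
    qed
    finally have eq: "emeasure ?\<Xi> (A \<inter> {\<omega>. int d dvd count_before b \<omega> - r}) =
      (\<integral>\<^sup>+\<omega>. indicator A \<omega> * emeasure ?\<Xi> {\<omega>'. int d dvd tail_count (full_blocks b - n) s \<omega>' - (r - S \<omega>)} \<partial>?\<Xi>)" .
    have q: "emeasure ?\<Xi> {\<omega>'. int d dvd tail_count (full_blocks b - n) s \<omega>' - (r - S \<omega>)} \<le> ennreal (1 / real d + \<epsilon>)"
      "ennreal (1 / real d - \<epsilon>) \<le> emeasure ?\<Xi> {\<omega>'. int d dvd tail_count (full_blocks b - n) s \<omega>' - (r - S \<omega>)}" for \<omega>
      unfolding block_space.emeasure_eq_measure
      using \<rho>(3)[of "full_blocks b - n" s "r - S \<omega>", folded \<epsilon>_def]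
      by (rule_tac [!] ennreal_leI) linarith+
    have "\<epsilon> \<ge> 0" using \<rho>(1) by (simp add: \<epsilon>_def)
    have "emeasure ?\<Xi> (A \<inter> {\<omega>. int d dvd count_before b \<omega> - r}) \<le> (\<integral>\<^sup>+\<omega>. indicator A \<omega> * ennreal (1 / real d + \<epsilon>) \<partial>?\<Xi>)"
      unfolding eq using q(1) by (intro nn_integral_mono mult_left_mono) auto
    also have "\<dots> = ennreal (block_space.prob A * (1 / real d + \<epsilon>))"
      using A \<open>\<epsilon> \<ge> 0\<close> by (subst nn_integral_multc) (auto simp: block_space.emeasure_eq_measure ennreal_mult')
    finally have up: "block_space.prob (A \<inter> {\<omega>. int d dvd count_before b \<omega> - r}) \<le> block_space.prob A * (1 / real d + \<epsilon>)"
      using \<open>\<epsilon> \<ge> 0\<close> unfolding block_space.emeasure_eq_measure by (subst (asm) ennreal_le_iff) auto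
    have "ennreal (block_space.prob A * (1 / real d - \<epsilon>)) = (\<integral>\<^sup>+\<omega>. indicator A \<omega> * ennreal (1 / real d - \<epsilon>) \<partial>?\<Xi>)"
      using A by (subst nn_integral_multc) (auto simp: block_space.emeasure_eq_measure ennreal_mult')
    also have "\<dots> \<le> emeasure ?\<Xi> (A \<inter> {\<omega>. int d dvd count_before b \<omega> - r})"
      unfolding eq using q(2) by (intro nn_integral_mono mult_left_mono) auto
    finally have lo: "block_space.prob A * (1 / real d - \<epsilon>) \<le> block_space.prob (A \<inter> {\<omega>. int d dvd count_before b \<omega> - r})"
      unfolding block_space.emeasure_eq_measure by (subst (asm) ennreal_le_iff) auto
    have "block_space.prob A * \<epsilon> \<le> 1 * \<epsilon>" using \<open>\<epsilon> \<ge> 0\<close> by (intro mult_right_mono) auto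
    then show ?thesis using up lo unfolding \<epsilon>_def[symmetric] by (simp add: abs_le_iff algebra_simps)
  qed
  have "((\<lambda>b. block_space.prob (A \<inter> {\<omega>. int d dvd count_before b \<omega> - r}) - block_space.prob A / real d) \<longlongrightarrow> 0) at_top"
  proof (rule Lim_null_comparison)
    have "eventually (\<lambda>b. n \<le> full_blocks b) at_top"
      using full_blocks_at_top unfolding filterlim_at_top by blast
    then show "\<forall>\<^sub>F b in at_top. norm (block_space.prob (A \<inter> {\<omega>. int d dvd count_before b \<omega> - r}) - block_space.prob A / real d) \<le> \<rho> ^ (full_blocks b - n)"
      by eventually_elim (use * in simp)
    have "(\<lambda>k. \<rho> ^ k) \<longlonglongrightarrow> 0" using \<rho> by (intro LIMSEQ_power_zero) simp
    moreover have "filterlim (\<lambda>k::nat. k - n) at_top at_top" by (rule filterlim_minus_const_nat_at_top)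
    ultimately show "((\<lambda>b. \<rho> ^ (full_blocks b - n)) \<longlongrightarrow> 0) at_top"
      using filterlim_compose[OF filterlim_compose[of "\<lambda>k. \<rho> ^ k" "nhds 0" at_top "\<lambda>k. k - n" at_top] full_blocks_at_top] by blast
  qed
  then show ?thesis by (rule LIM_zero_cancel)
qed

text \<open>A Dynkin argument. Cylinders form a generating pi-system, complements are obtained by
  subtraction, and for disjoint unions the series converges uniformly in \<open>b\<close>, dominated
  by the probabilities of the pieces.\<close>

lemma mixing_set:
  assumes d: "0 < d" and A: "A \<in> sets (block_stream)"
  shows "((\<lambda>b. block_space.prob (A \<inter> {\<omega>. int d dvd count_before b \<omega> - r})) \<longlongrightarrow> block_space.prob A / real d) at_top"
proof -
  let ?\<Xi> = block_stream
  let ?J = "\<lambda>b. {\<omega>. int d dvd count_before b \<omega> - r}"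
  define E where "E = {A \<in> sets ?\<Xi>. \<exists>n. \<forall>\<omega> \<omega>'. stake n \<omega> @- \<omega>' \<in> A \<longleftrightarrow> \<omega> \<in> A}"
  have stake_more: "stake (n + k) \<omega> @- \<omega>' = stake n \<omega> @- (stake k (sdrop n \<omega>) @- \<omega>')" for n k and \<omega> \<omega>' :: "(real \<times> real) stream stream"
    by (simp only: stake_add[symmetric] shift_append)
  have "Int_stable E"
  proof (rule Int_stableI)
    fix A B assume "A \<in> E" "B \<in> E"
    then obtain n m where AB: "A \<in> sets ?\<Xi>" "B \<in> sets ?\<Xi>"
      and n: "\<And>\<omega> \<omega>'. stake n \<omega> @- \<omega>' \<in> A \<longleftrightarrow> \<omega> \<in> A" and m: "\<And>\<omega> \<omega>'. stake m \<omega> @- \<omega>' \<in> B \<longleftrightarrow> \<omega> \<in> B"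
      unfolding E_def by blast
    have "stake (n + m) \<omega> @- \<omega>' \<in> A \<inter> B \<longleftrightarrow> \<omega> \<in> A \<inter> B" for \<omega> \<omega>'
      using n m stake_more[of n m \<omega> \<omega>'] stake_more[of m n \<omega> \<omega>'] by (metis IntD1 IntD2 IntI add.commute)
    then show "A \<inter> B \<in> E" unfolding E_def using AB by blast
  qed
  have sub: "E \<subseteq> Pow UNIV" by simp
  have "sets ?\<Xi> \<subseteq> sigma_sets UNIV E"
  proof -
    have "sets ?\<Xi> \<subseteq> sets (sigma UNIV E)"
    proof (rule sets_stream_space_in_sets)
      show "space (sigma UNIV E) = streams (space gap_stream)" by simp
      fix i
      show "(\<lambda>\<omega>. \<omega> !! i) \<in> sigma UNIV E \<rightarrow>\<^sub>M gap_stream"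
      proof (rule measurableI)
        fix B assume B: "B \<in> sets gap_stream"
        have "(\<lambda>\<omega>. \<omega> !! i) -` B \<inter> space ?\<Xi> \<in> sets ?\<Xi>" by (rule measurable_sets[OF measurable_snth B])
        then have "(\<lambda>\<omega>. \<omega> !! i) -` B \<in> sets ?\<Xi>" by simp
        moreover have "stake (Suc i) \<omega> @- \<omega>' \<in> (\<lambda>\<omega>. \<omega> !! i) -` B \<longleftrightarrow> \<omega> \<in> (\<lambda>\<omega>. \<omega> !! i) -` B" for \<omega> \<omega>' :: "(real \<times> real) stream stream"
          by (simp add: shift_snth stake_nth del: stake.simps)
        ultimately have "(\<lambda>\<omega>. \<omega> !! i) -` B \<in> E" unfolding E_def by blast
        then show "(\<lambda>\<omega>. \<omega> !! i) -` B \<inter> space (sigma UNIV E) \<in> sets (sigma UNIV E)"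
          by (auto intro: sigma_sets.Basic)
      qed simp
    qed
    then show ?thesis by simp
  qed
  with A have "A \<in> sigma_sets UNIV E" by blast
  with \<open>Int_stable E\<close> sub
  have "A \<in> sets ?\<Xi> \<and> ((\<lambda>b. block_space.prob (A \<inter> ?J b)) \<longlongrightarrow> block_space.prob A / real d) at_top"
  proof (induction A rule: sigma_sets_induct_disjoint)
    case (basic A)
    then show ?case unfolding E_def using mixing_cylinder[OF d] by blast
  next
    case empty then show ?case by simp
  next
    case (compl A)
    \<comment> \<open>The whole space is a cylinder of length zero.\<close>
    have U: "((\<lambda>b. block_space.prob (UNIV \<inter> ?J b)) \<longlongrightarrow> block_space.prob UNIV / real d) at_top"
      by (rule mixing_cylinder[OF d, of _ 0]) (use sets.top[of ?\<Xi>] in auto)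
    have "block_space.prob ((UNIV - A) \<inter> ?J b) = block_space.prob (UNIV \<inter> ?J b) - block_space.prob (A \<inter> ?J b)" for b
    proof -
      have "(UNIV - A) \<inter> ?J b = (UNIV \<inter> ?J b) - (A \<inter> ?J b)" by blast
      then show ?thesis
        using compl count_before_sets[of d b r] by (simp only:) (intro block_space.finite_measure_Diff; auto)
    qed
    moreover have "block_space.prob (UNIV - A) = block_space.prob UNIV - block_space.prob A"
      using compl sets.top[of ?\<Xi>] by (intro block_space.finite_measure_Diff) auto
    moreover have "UNIV - A \<in> sets ?\<Xi>" using compl sets.compl_sets[of A ?\<Xi>] by simp
    ultimately show ?case
      using tendsto_diff[OF U conjunct2[OF compl(2)]] by (simp add: diff_divide_distrib)
  next
    case (union A)
    then have As: "A i \<in> sets ?\<Xi>" "((\<lambda>b. block_space.prob (A i \<inter> ?J b)) \<longlongrightarrow> block_space.prob (A i) / real d) at_top" for i by auto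
    have dis: "disjoint_family A" by fact
    have sm: "(\<lambda>i. block_space.prob (A i)) sums block_space.prob (\<Union>(range A))"
      using As dis by (intro block_space.finite_measure_UNION) auto
    have "((\<lambda>b. \<Sum>i. block_space.prob (A i \<inter> ?J b)) \<longlongrightarrow> (\<Sum>i. block_space.prob (A i) / real d)) at_top"
    proof (rule tannerys_theorem[THEN conjunct2, THEN conjunct2])
      show "summable (\<lambda>i. block_space.prob (A i))" using sm by (rule sums_summable)
      show "\<forall>\<^sub>F (i, b) in at_top \<times>\<^sub>F at_top. norm (block_space.prob (A i \<inter> ?J b)) \<le> block_space.prob (A i)"
        using As(1) by (intro always_eventually) (auto intro!: block_space.finite_measure_mono)
    qed (use As in auto)
    moreover have "(\<Sum>i. block_space.prob (A i \<inter> ?J b)) = block_space.prob (\<Union>(range A) \<inter> ?J b)" for b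
    proof -
      have "(\<lambda>i. block_space.prob (A i \<inter> ?J b)) sums block_space.prob (\<Union>(range (\<lambda>i. A i \<inter> ?J b)))"
        using As(1) count_before_sets[of d b r] dis
        by (intro block_space.finite_measure_UNION) (auto simp: disjoint_family_on_def)
      moreover have "\<Union>(range (\<lambda>i. A i \<inter> ?J b)) = \<Union>(range A) \<inter> ?J b" by auto
      ultimately show ?thesis by (metis sums_unique)
    qed
    moreover have "(\<Sum>i. block_space.prob (A i) / real d) = block_space.prob (\<Union>(range A)) / real d"
      using sums_unique[OF sums_divide[OF sm, of "real d"]] by simp
    moreover have "\<Union>(range A) \<in> sets ?\<Xi>" using As(1) by auto
    ultimately show ?case by simp
  qed
  then show ?thesis by simp
qed

text \<open>Indicators are covered by \<open>mixing_set\<close>, and linearity extends them to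
  simple functions. The last step is an approximation in the mean, whose error is uniform in
  \<open>b\<close> since the indicator is at most one.\<close>

lemma mixing:
  fixes \<phi> :: "(real \<times> real) stream stream \<Rightarrow> real"
  assumes d: "0 < d" and \<phi>: "integrable (block_stream) \<phi>"
  shows "((\<lambda>b. \<integral>\<omega>. indicator {\<omega>. int d dvd count_before b \<omega> - r} \<omega> * \<phi> \<omega> \<partial>block_stream)
    \<longlongrightarrow> (\<integral>\<omega>. \<phi> \<omega> \<partial>block_stream) / real d) at_top"
  using \<phi>
proof (induct rule: integrable_induct)
  let ?\<Xi> = block_stream
  let ?J = "\<lambda>b. {\<omega>. int d dvd count_before b \<omega> - r}"
  have J: "?J b \<in> sets ?\<Xi>" for b by (rule count_before_sets)
  have int: "integrable ?\<Xi> (\<lambda>\<omega>. indicator (?J b) \<omega> * f \<omega>)" if "integrable ?\<Xi> f" for b and f :: "_ \<Rightarrow> real"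
    using integrable_mult_indicator[OF J that, of b] by simp
  {
    case (base A c)
    have "(\<integral>\<omega>. indicator (?J b) \<omega> * (indicator A \<omega> *\<^sub>R c) \<partial>?\<Xi>) = block_space.prob (A \<inter> ?J b) * c" for b
    proof -
      have "(\<integral>\<omega>. indicator (?J b) \<omega> * (indicator A \<omega> *\<^sub>R c) \<partial>?\<Xi>) = (\<integral>\<omega>. indicator (A \<inter> ?J b) \<omega> * c \<partial>?\<Xi>)"
        by (intro Bochner_Integration.integral_cong refl) (auto simp: indicator_def)
      then show ?thesis using base(1) J[of b] by simp
    qed
    moreover have "(\<integral>\<omega>. indicator A \<omega> *\<^sub>R c \<partial>?\<Xi>) = block_space.prob A * c" using base(1) by simp
    ultimately show ?case
      using tendsto_mult_right[OF mixing_set[OF d base(1)], of r c] by (simp add: mult.commute)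
  next
    case (add f g)
    have "(\<integral>\<omega>. indicator (?J b) \<omega> * (f \<omega> + g \<omega>) \<partial>?\<Xi>) = (\<integral>\<omega>. indicator (?J b) \<omega> * f \<omega> \<partial>?\<Xi>) + (\<integral>\<omega>. indicator (?J b) \<omega> * g \<omega> \<partial>?\<Xi>)" for b
      using int[OF add(1)] int[OF add(3)] by (simp add: distrib_left)
    then show ?case using tendsto_add[OF add(2,4)] add(1,3) by (simp add: add_divide_distrib)
  next
    case (lim f s)
    \<comment> \<open>The approximants satisfy
      \<open>\<bar>s i\<bar> \<le> 2 * \<bar>f\<bar>\<close>, whence the dominating function
      \<open>3 * \<bar>f\<bar>\<close>.\<close>
    have L1: "(\<lambda>i. \<integral>\<omega>. \<bar>s i \<omega> - f \<omega>\<bar> \<partial>?\<Xi>) \<longlonglongrightarrow> (\<integral>\<omega>. 0 \<partial>?\<Xi>)"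
    proof (rule integral_dominated_convergence[where w = "\<lambda>\<omega>. 3 * \<bar>f \<omega>\<bar>"])
      show "AE \<omega> in ?\<Xi>. norm \<bar>s i \<omega> - f \<omega>\<bar> \<le> 3 * \<bar>f \<omega>\<bar>" for i
      proof (rule AE_I2)
        fix \<omega> assume "\<omega> \<in> space ?\<Xi>"
        from lim(4)[OF this, of i] show "norm \<bar>s i \<omega> - f \<omega>\<bar> \<le> 3 * \<bar>f \<omega>\<bar>" by simp
      qed
      show "AE \<omega> in ?\<Xi>. (\<lambda>i. \<bar>s i \<omega> - f \<omega>\<bar>) \<longlonglongrightarrow> 0"
      proof (rule AE_I2)
        fix \<omega> assume "\<omega> \<in> space ?\<Xi>"
        then have "(\<lambda>i. s i \<omega> - f \<omega>) \<longlonglongrightarrow> 0" using lim(3) by (simp add: LIM_zero)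
        then show "(\<lambda>i. \<bar>s i \<omega> - f \<omega>\<bar>) \<longlonglongrightarrow> 0" by (rule tendsto_rabs_zero)
      qed
    qed (use lim in auto)
    show ?case
      unfolding tendsto_iff
    proof (intro allI impI)
      fix e :: real assume e: "0 < e"
      have "eventually (\<lambda>i. (\<integral>\<omega>. \<bar>s i \<omega> - f \<omega>\<bar> \<partial>?\<Xi>) < e / 3) sequentially"
        using order_tendstoD(2)[OF L1, of "e / 3"] e by simp
      then obtain i where i: "(\<integral>\<omega>. \<bar>s i \<omega> - f \<omega>\<bar> \<partial>?\<Xi>) < e / 3" by (auto simp: eventually_sequentially)
      have "eventually (\<lambda>b. dist (\<integral>\<omega>. indicator (?J b) \<omega> * s i \<omega> \<partial>?\<Xi>) ((\<integral>\<omega>. s i \<omega> \<partial>?\<Xi>) / real d) < e / 3) at_top"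
        by (rule tendstoD[OF lim(2)]) (use e in simp)
      then show "eventually (\<lambda>b. dist (\<integral>\<omega>. indicator (?J b) \<omega> * f \<omega> \<partial>?\<Xi>) ((\<integral>\<omega>. f \<omega> \<partial>?\<Xi>) / real d) < e) at_top"
      proof eventually_elim
        fix b assume b: "dist (\<integral>\<omega>. indicator (?J b) \<omega> * s i \<omega> \<partial>?\<Xi>) ((\<integral>\<omega>. s i \<omega> \<partial>?\<Xi>) / real d) < e / 3"
        have "\<bar>(\<integral>\<omega>. indicator (?J b) \<omega> * s i \<omega> \<partial>?\<Xi>) - (\<integral>\<omega>. indicator (?J b) \<omega> * f \<omega> \<partial>?\<Xi>)\<bar>
          = \<bar>\<integral>\<omega>. indicator (?J b) \<omega> * s i \<omega> - indicator (?J b) \<omega> * f \<omega> \<partial>?\<Xi>\<bar>"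
          using int[OF lim(1)] int[OF lim(5)] by simp
        also have "\<dots> \<le> (\<integral>\<omega>. \<bar>indicator (?J b) \<omega> * s i \<omega> - indicator (?J b) \<omega> * f \<omega>\<bar> \<partial>?\<Xi>)" by (rule integral_abs_bound)
        also have "\<dots> \<le> (\<integral>\<omega>. \<bar>s i \<omega> - f \<omega>\<bar> \<partial>?\<Xi>)"
          using int[OF lim(1)] int[OF lim(5)] lim(1,5) by (intro integral_mono) (auto simp: indicator_def)
        finally have 1: "\<bar>(\<integral>\<omega>. indicator (?J b) \<omega> * s i \<omega> \<partial>?\<Xi>) - (\<integral>\<omega>. indicator (?J b) \<omega> * f \<omega> \<partial>?\<Xi>)\<bar> < e / 3" using i by linarith
        have "\<bar>(\<integral>\<omega>. s i \<omega> \<partial>?\<Xi>) - (\<integral>\<omega>. f \<omega> \<partial>?\<Xi>)\<bar> = \<bar>\<integral>\<omega>. s i \<omega> - f \<omega> \<partial>?\<Xi>\<bar>" using lim(1,5) by simp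
        also have "\<dots> \<le> (\<integral>\<omega>. \<bar>s i \<omega> - f \<omega>\<bar> \<partial>?\<Xi>)" by (rule integral_abs_bound)
        finally have "\<bar>(\<integral>\<omega>. s i \<omega> \<partial>?\<Xi>) - (\<integral>\<omega>. f \<omega> \<partial>?\<Xi>)\<bar> < e / 3" using i by linarith
        moreover have "\<bar>(\<integral>\<omega>. s i \<omega> \<partial>?\<Xi>) / real d - (\<integral>\<omega>. f \<omega> \<partial>?\<Xi>) / real d\<bar> \<le> \<bar>(\<integral>\<omega>. s i \<omega> \<partial>?\<Xi>) - (\<integral>\<omega>. f \<omega> \<partial>?\<Xi>)\<bar>"
        proof -
          have "\<bar>x\<bar> / real d \<le> \<bar>x\<bar>" for x :: real using d by (simp add: divide_le_eq mult_le_cancel_left1)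
          then show ?thesis by (simp add: diff_divide_distrib[symmetric])
        qed
        ultimately show "dist (\<integral>\<omega>. indicator (?J b) \<omega> * f \<omega> \<partial>?\<Xi>) ((\<integral>\<omega>. f \<omega> \<partial>?\<Xi>) / real d) < e"
          using 1 b unfolding dist_real_def by linarith
      qed
    qed
  }
qed

subsection \<open>The sequence of chain records\<close>

text \<open>Counted from zero, the index of the first success is also the number of failures before
  it.\<close>

definition hit :: "real ^ 'n \<Rightarrow> (real ^ 'n) stream \<Rightarrow> nat" where
  "hit r \<omega> = (LEAST n. \<omega> !! n \<prec> r)"

text \<open>Every record is paired with the number of failures before its successor, so consecutive
  record times differ by one plus the second component. The first entry is the given record
  \<open>r\<close> itself.\<close>

primcorec recs :: "real ^ 'n \<Rightarrow> (real ^ 'n) stream \<Rightarrow> ((real ^ 'n) \<times> nat) stream" where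
  "recs r \<omega> = (r, hit r \<omega>) ## recs (\<omega> !! hit r \<omega>) (sdrop (Suc (hit r \<omega>)) \<omega>)"

definition wait :: "real ^ 'n \<Rightarrow> real \<Rightarrow> nat" where
  "wait r e = nat \<lfloor>e / - ln (1 - height r)\<rfloor>"

text \<open>The same kind of stream built from independent uniform factors and exponential marks. In
  contrast to \<open>recs\<close>, the first entry is already one step below
  \<open>r\<close>.\<close>

primcorec chain :: "real ^ 'n \<Rightarrow> ((real ^ 'n) \<times> real) stream \<Rightarrow> ((real ^ 'n) \<times> nat) stream" where
  "chain r v = (scale r (fst (shd v)), wait (scale r (fst (shd v))) (snd (shd v))) ## chain (scale r (fst (shd v))) (stl v)"

abbreviation record_space :: "((real ^ 'n) \<times> nat) measure" where
  "record_space \<equiv> borel \<Otimes>\<^sub>M count_space UNIV"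

abbreviation cube_stream :: "(real ^ 'n) stream measure" where
  "cube_stream \<equiv> stream_space cube_measure"

lemma prob_space_cube_stream: "prob_space (cube_stream :: (real ^ 'n) stream measure)"
  by (rule prob_space.prob_space_stream_space[OF prob_space_cube])

interpretation cube_stream: prob_space "cube_stream :: (real ^ 'n) stream measure"
  by (rule prob_space_cube_stream)

lemma sets_cube_stream: "sets (cube_stream :: (real ^ 'n) stream measure) = sets (stream_space borel)"
  by (rule sets_stream_space_cong) simp

lemma measurable_hit [measurable]:
  assumes [measurable]: "R \<in> borel_measurable N" "W \<in> N \<rightarrow>\<^sub>M stream_space borel"
  shows "(\<lambda>x. hit (R x :: real ^ 'n) (W x)) \<in> N \<rightarrow>\<^sub>M count_space UNIV"
  unfolding hit_def by measurable

lemma measurable_sdrop_random: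
  assumes [measurable]: "k \<in> N \<rightarrow>\<^sub>M count_space UNIV" "W \<in> N \<rightarrow>\<^sub>M stream_space M"
  shows "(\<lambda>x. sdrop (k x) (W x)) \<in> N \<rightarrow>\<^sub>M stream_space M" "(\<lambda>x. W x !! k x) \<in> N \<rightarrow>\<^sub>M M"
proof -
  have "(\<lambda>x. sdrop i (W x)) \<in> N \<rightarrow>\<^sub>M stream_space M" for i :: nat by measurable
  then show "(\<lambda>x. sdrop (k x) (W x)) \<in> N \<rightarrow>\<^sub>M stream_space M" by (rule measurable_compose_countable) measurable
  have "(\<lambda>x. W x !! i) \<in> N \<rightarrow>\<^sub>M M" for i :: nat by measurable
  then show "(\<lambda>x. W x !! k x) \<in> N \<rightarrow>\<^sub>M M" by (rule measurable_compose_countable) measurable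
qed

lemma measurable_recs:
  assumes "R \<in> borel_measurable N" "W \<in> N \<rightarrow>\<^sub>M stream_space borel"
  shows "(\<lambda>x. recs (R x :: real ^ 'n) (W x)) \<in> N \<rightarrow>\<^sub>M stream_space record_space"
proof -
  define F where "F f \<longleftrightarrow> (\<exists>R W. R \<in> borel_measurable N \<and> W \<in> N \<rightarrow>\<^sub>M stream_space borel \<and> f = (\<lambda>x. recs (R x :: real ^ 'n) (W x)))" for f
  have "F (\<lambda>x. recs (R x) (W x))" unfolding F_def using assms by blast
  then show ?thesis
  proof (coinduct rule: measurable_stream_coinduct)
    case (shd f)
    then obtain R W where [measurable]: "R \<in> borel_measurable N" "W \<in> N \<rightarrow>\<^sub>M stream_space borel" and f: "f = (\<lambda>x. recs (R x :: real ^ 'n) (W x))"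
      unfolding F_def by blast
    show ?case unfolding f by simp
  next
    case (stl f)
    then obtain R W where [measurable]: "R \<in> borel_measurable N" "W \<in> N \<rightarrow>\<^sub>M stream_space borel" and f: "f = (\<lambda>x. recs (R x :: real ^ 'n) (W x))"
      unfolding F_def by blast
    have k: "(\<lambda>x. hit (R x) (W x)) \<in> N \<rightarrow>\<^sub>M count_space UNIV" "(\<lambda>x. Suc (hit (R x) (W x))) \<in> N \<rightarrow>\<^sub>M count_space UNIV"
      by measurable
    have "(\<lambda>x. W x !! hit (R x) (W x)) \<in> borel_measurable N" "(\<lambda>x. sdrop (Suc (hit (R x) (W x))) (W x)) \<in> N \<rightarrow>\<^sub>M stream_space borel"
      using measurable_sdrop_random(2)[OF k(1), of W borel] measurable_sdrop_random(1)[OF k(2), of W borel] by simp_all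
    then show ?case unfolding F_def f
      by (intro exI[of _ "\<lambda>x. W x !! hit (R x) (W x)"] exI[of _ "\<lambda>x. sdrop (Suc (hit (R x) (W x))) (W x)"]) simp
  qed
qed

lemma measurable_wait [measurable]:
  assumes [measurable]: "R \<in> borel_measurable N" "E \<in> borel_measurable N"
  shows "(\<lambda>x. wait (R x :: real ^ 'n) (E x)) \<in> N \<rightarrow>\<^sub>M count_space UNIV"
  unfolding wait_def by measurable

lemma measurable_fst_shd [measurable]:
  assumes [measurable]: "V \<in> N \<rightarrow>\<^sub>M stream_space (borel \<Otimes>\<^sub>M borel)"
  shows "(\<lambda>x. fst (shd (V x))) \<in> borel_measurable N" "(\<lambda>x. snd (shd (V x))) \<in> borel_measurable N"
  by (rule measurable_compose[OF measurable_compose[OF assms measurable_shd] measurable_fst],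
      rule measurable_compose[OF measurable_compose[OF assms measurable_shd] measurable_snd])

lemma measurable_chain:
  assumes "R \<in> borel_measurable N" "V \<in> N \<rightarrow>\<^sub>M stream_space (borel \<Otimes>\<^sub>M borel)"
  shows "(\<lambda>x. chain (R x :: real ^ 'n) (V x)) \<in> N \<rightarrow>\<^sub>M stream_space record_space"
proof -
  define F where "F f \<longleftrightarrow> (\<exists>R V. R \<in> borel_measurable N \<and> V \<in> N \<rightarrow>\<^sub>M stream_space (borel \<Otimes>\<^sub>M borel) \<and> f = (\<lambda>x. chain (R x :: real ^ 'n) (V x)))" for f
  have "F (\<lambda>x. chain (R x) (V x))" unfolding F_def using assms by blast
  then show ?thesis
  proof (coinduct rule: measurable_stream_coinduct)
    case (shd f)
    then obtain R V where [measurable]: "R \<in> borel_measurable N" "V \<in> N \<rightarrow>\<^sub>M stream_space (borel \<Otimes>\<^sub>M borel)" and f: "f = (\<lambda>x. chain (R x :: real ^ 'n) (V x))"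
      unfolding F_def by blast
    show ?case unfolding f by simp
  next
    case (stl f)
    then obtain R V where [measurable]: "R \<in> borel_measurable N" "V \<in> N \<rightarrow>\<^sub>M stream_space (borel \<Otimes>\<^sub>M borel)" and f: "f = (\<lambda>x. chain (R x :: real ^ 'n) (V x))"
      unfolding F_def by blast
    have "(\<lambda>x. scale (R x) (fst (shd (V x)))) \<in> borel_measurable N" "(\<lambda>x. stl (V x)) \<in> N \<rightarrow>\<^sub>M stream_space (borel \<Otimes>\<^sub>M borel)" by measurable
    then show ?case unfolding F_def f
      by (intro exI[of _ "\<lambda>x. scale (R x) (fst (shd (V x)))"] exI[of _ "\<lambda>x. stl (V x)"]) simp
  qed
qed

lemma sets_below:
  fixes r :: "real ^ 'n"
  shows "{x. x \<prec> r} \<in> sets borel" "{x. \<not> x \<prec> r} \<in> sets borel"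
proof -
  have "{x \<in> space borel. x \<prec> r} \<in> sets borel" "{x \<in> space borel. \<not> x \<prec> r} \<in> sets borel" by measurable
  then show "{x. x \<prec> r} \<in> sets borel" "{x. \<not> x \<prec> r} \<in> sets borel" by simp_all
qed

text \<open>Fubini one entry at a time: the \<open>n\<close> failures split off as factors, and the
  stream behind the hit stays fresh.\<close>

lemma hit_split:
  fixes r :: "real ^ 'n"
  assumes [measurable]: "case_prod f \<in> borel_measurable (borel \<Otimes>\<^sub>M stream_space borel)"
  shows "(\<integral>\<^sup>+\<omega>. (\<Prod>i<n. indicator {x. \<not> x \<prec> r} (\<omega> !! i)) * (indicator {x. x \<prec> r} (\<omega> !! n) * f (\<omega> !! n) (sdrop (Suc n) \<omega>)) \<partial>cube_stream) =
    emeasure cube_measure {x. \<not> x \<prec> r} ^ n * (\<integral>\<^sup>+x. indicator {x. x \<prec> r} x * (\<integral>\<^sup>+\<omega>. f x \<omega> \<partial>cube_stream) \<partial>cube_measure)"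
proof -
  note [measurable] = sets_below(1)[of r] sets_below(2)[of r]
  have [measurable_cong]: "sets (cube_stream :: (real ^ 'n) stream measure) = sets (stream_space borel)" by (rule sets_cube_stream)
  have [measurable]: "(\<lambda>\<omega>. f (\<omega> !! n) (sdrop (Suc n) \<omega>)) \<in> borel_measurable (stream_space borel)" for n
  proof -
    have "(\<lambda>\<omega>. case_prod f (\<omega> !! n, sdrop (Suc n) \<omega>)) \<in> borel_measurable (stream_space borel)"
      by (rule measurable_compose[OF measurable_Pair assms]) measurable
    then show ?thesis by simp
  qed
  have step: "(\<integral>\<^sup>+\<omega>. F \<omega> \<partial>(cube_stream :: (real ^ 'n) stream measure)) = (\<integral>\<^sup>+x. \<integral>\<^sup>+\<omega>. F (x ## \<omega>) \<partial>cube_stream \<partial>cube_measure)"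
    if "F \<in> borel_measurable (stream_space borel)" for F
    by (rule prob_space.nn_integral_stream_space[OF prob_space_cube]) (use that in measurable)
  show ?thesis
  proof (induction n)
    case 0
    have "(\<integral>\<^sup>+\<omega>. (\<Prod>i<0. indicator {x. \<not> x \<prec> r} (\<omega> !! i)) * (indicator {x. x \<prec> r} (\<omega> !! 0) * f (\<omega> !! 0) (sdrop (Suc 0) \<omega>)) \<partial>cube_stream) =
      (\<integral>\<^sup>+x. \<integral>\<^sup>+\<omega>. indicator {x. x \<prec> r} x * f x \<omega> \<partial>cube_stream \<partial>cube_measure)"
    proof -
      have "(\<lambda>\<omega>. indicator {x. x \<prec> r} (\<omega> !! 0) * f (\<omega> !! 0) (sdrop (Suc 0) \<omega>)) \<in> borel_measurable (stream_space borel)"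
        by measurable
      from step[OF this] show ?thesis by simp
    qed
    also have "\<dots> = (\<integral>\<^sup>+x. indicator {x. x \<prec> r} x * (\<integral>\<^sup>+\<omega>. f x \<omega> \<partial>cube_stream) \<partial>cube_measure)"
      by (intro nn_integral_cong nn_integral_cmult) measurable
    finally show ?case by simp
  next
    case (Suc n)
    have "(\<integral>\<^sup>+\<omega>. (\<Prod>i<Suc n. indicator {x. \<not> x \<prec> r} (\<omega> !! i)) * (indicator {x. x \<prec> r} (\<omega> !! Suc n) * f (\<omega> !! Suc n) (sdrop (Suc (Suc n)) \<omega>)) \<partial>cube_stream) =
      (\<integral>\<^sup>+x. \<integral>\<^sup>+\<omega>. (\<Prod>i<Suc n. indicator {x. \<not> x \<prec> r} ((x ## \<omega>) !! i)) * (indicator {x. x \<prec> r} ((x ## \<omega>) !! Suc n) * f ((x ## \<omega>) !! Suc n) (sdrop (Suc (Suc n)) (x ## \<omega>))) \<partial>cube_stream \<partial>cube_measure)"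
      by (rule step) measurable
    also have "\<dots> = (\<integral>\<^sup>+x. \<integral>\<^sup>+\<omega>. indicator {x. \<not> x \<prec> r} x * ((\<Prod>i<n. indicator {x. \<not> x \<prec> r} (\<omega> !! i)) * (indicator {x. x \<prec> r} (\<omega> !! n) * f (\<omega> !! n) (sdrop (Suc n) \<omega>))) \<partial>cube_stream \<partial>cube_measure)"
      by (subst prod.lessThan_Suc_shift) (simp add: mult.assoc)
    also have "\<dots> = (\<integral>\<^sup>+x. indicator {x. \<not> x \<prec> r} x * (emeasure cube_measure {x. \<not> x \<prec> r} ^ n * (\<integral>\<^sup>+x. indicator {x. x \<prec> r} x * (\<integral>\<^sup>+\<omega>. f x \<omega> \<partial>cube_stream) \<partial>cube_measure)) \<partial>cube_measure)"
      unfolding Suc[symmetric] by (intro nn_integral_cong nn_integral_cmult) measurable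
    also have "\<dots> = emeasure cube_measure {x. \<not> x \<prec> r} * (emeasure cube_measure {x. \<not> x \<prec> r} ^ n * (\<integral>\<^sup>+x. indicator {x. x \<prec> r} x * (\<integral>\<^sup>+\<omega>. f x \<omega> \<partial>cube_stream) \<partial>cube_measure))"
      by (subst nn_integral_multc) (auto simp del: emeasure_uniform_measure)
    finally show ?case by (simp add: mult.assoc del: emeasure_uniform_measure)
  qed
qed

lemma emeasure_not_below:
  fixes r :: "real ^ 'n"
  assumes r: "\<And>i. 0 < r $ i \<and> r $ i \<le> 1"
  shows "emeasure cube_measure {x. \<not> x \<prec> r} = ennreal (1 - height r)"
proof -
  note m = sets_below(1)[of r]
  have h: "0 \<le> height r" using height_pos[of r] r by (simp add: less_imp_le)
  have "{x. \<not> x \<prec> r} = space cube_measure - {x. x \<prec> r}" by auto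
  also have "emeasure cube_measure \<dots> = emeasure cube_measure (space (cube_measure :: (real ^ 'n) measure)) - emeasure cube_measure {x. x \<prec> r}"
  proof (rule emeasure_compl)
    show "{x. x \<prec> r} \<in> sets cube_measure" using m by simp
    show "emeasure cube_measure {x. x \<prec> r} \<noteq> \<infinity>" unfolding emeasure_below[OF r] by simp
  qed
  also have "emeasure cube_measure (space (cube_measure :: (real ^ 'n) measure)) = 1"
    using emeasure_cube_UNIV by simp
  also have "1 - emeasure cube_measure {x. x \<prec> r} = ennreal (1 - height r)"
    unfolding emeasure_below[OF r] using h by (simp add: ennreal_minus[symmetric])
  finally show ?thesis .
qed

lemma AE_hit:
  fixes r :: "real ^ 'n"
  assumes r: "\<And>i. 0 < r $ i \<and> r $ i \<le> 1"
  shows "AE \<omega> in cube_stream. \<exists>n. \<omega> !! n \<prec> r"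
proof -
  note m = sets_below(1)[of r]
  have "0 < height r" using height_pos[of r] r by simp
  then have p: "0 < measure cube_measure {x. x \<prec> r}" using emeasure_below[OF r] by (simp add: measure_def del: emeasure_uniform_measure)
  have "AE \<omega> in cube_stream. \<forall>k. \<exists>n. \<omega> !! (k + n * 1) \<in> {x. x \<prec> r}"
    by (rule prob_space.AE_stream_space_recurrent[OF prob_space_cube]) (use m p in simp_all)
  then show ?thesis by eventually_elim auto
qed

text \<open>The strong Markov property in explicit form. The number of failures is geometric with
  parameter \<open>height r\<close>, the record that follows is \<open>scale r u\<close> with
  \<open>u\<close> uniform, the rest of the stream is fresh, and the three are independent. The
  proof sums over the value of \<open>hit\<close>.\<close>

lemma nn_integral_hit:
  fixes r :: "real ^ 'n"
  assumes r: "\<And>i. 0 < r $ i \<and> r $ i \<le> 1" and f: "\<And>n. case_prod (f n) \<in> borel_measurable (borel \<Otimes>\<^sub>M stream_space borel)"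
  shows "(\<integral>\<^sup>+\<omega>. f (hit r \<omega>) (\<omega> !! hit r \<omega>) (sdrop (Suc (hit r \<omega>)) \<omega>) \<partial>cube_stream) =
    (\<Sum>n. ennreal ((1 - height r) ^ n) * (ennreal (height r) * (\<integral>\<^sup>+u. \<integral>\<^sup>+\<omega>. f n (scale r u) \<omega> \<partial>cube_stream \<partial>cube_measure)))"
proof -
  note [measurable] = f
  have [measurable_cong]: "sets (cube_stream :: (real ^ 'n) stream measure) = sets (stream_space borel)" by (rule sets_cube_stream)
  note [measurable] = sets_below(1)[of r] sets_below(2)[of r]
  define g where "g n \<omega> = (\<Prod>i<n. indicator {x. \<not> x \<prec> r} (\<omega> !! i)) * (indicator {x. x \<prec> r} (\<omega> !! n) * f n (\<omega> !! n) (sdrop (Suc n) \<omega>))" for n \<omega>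
  have [measurable]: "(\<lambda>\<omega>. f n (\<omega> !! n) (sdrop (Suc n) \<omega>)) \<in> borel_measurable (stream_space borel)" for n
  proof -
    have "(\<lambda>\<omega>. case_prod (f n) (\<omega> !! n, sdrop (Suc n) \<omega>)) \<in> borel_measurable (stream_space borel)"
      by (rule measurable_compose[OF measurable_Pair f]) measurable
    then show ?thesis by simp
  qed
  have [measurable]: "g n \<in> borel_measurable (stream_space borel)" for n unfolding g_def by measurable
  have h: "0 < height r" "height r \<le> 1"
    using height_pos[of r] r prod_le_1[of UNIV "\<lambda>i. r $ i"] by (auto simp: height_def less_imp_le)
  have "(\<integral>\<^sup>+\<omega>. f (hit r \<omega>) (\<omega> !! hit r \<omega>) (sdrop (Suc (hit r \<omega>)) \<omega>) \<partial>cube_stream) = (\<integral>\<^sup>+\<omega>. (\<Sum>n. g n \<omega>) \<partial>cube_stream)"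
    using AE_hit[OF r]
  proof (intro nn_integral_cong_AE, eventually_elim)
    fix \<omega> :: "(real ^ 'n) stream" assume ex: "\<exists>n. \<omega> !! n \<prec> r"
    have hit1: "\<omega> !! hit r \<omega> \<prec> r" unfolding hit_def using ex by (rule LeastI_ex)
    have hit2: "\<not> \<omega> !! i \<prec> r" if "i < hit r \<omega>" for i using that unfolding hit_def by (rule not_less_Least)
    have "(\<Sum>n. g n \<omega>) = (\<Sum>n\<in>{hit r \<omega>}. g n \<omega>)"
    proof (rule suminf_finite)
      fix n assume "n \<notin> {hit r \<omega>}"
      then consider "n < hit r \<omega>" | "hit r \<omega> < n" by fastforce
      then show "g n \<omega> = 0"
      proof cases
        case 1 then show ?thesis using hit2[OF 1] by (simp add: g_def)
      next
        case 2
        have "(\<Prod>i<n. indicator {x. \<not> x \<prec> r} (\<omega> !! i)) = (0 :: ennreal)"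
          using 2 hit1 by (intro prod_zero bexI[of _ "hit r \<omega>"]) auto
        then show ?thesis by (simp add: g_def)
      qed
    qed simp
    also have "\<dots> = f (hit r \<omega>) (\<omega> !! hit r \<omega>) (sdrop (Suc (hit r \<omega>)) \<omega>)"
    proof -
      have "(\<Prod>i<hit r \<omega>. indicator {x. \<not> x \<prec> r} (\<omega> !! i)) = (1 :: ennreal)"
        using hit2 by (intro prod.neutral) auto
      then show ?thesis using hit1 by (simp add: g_def)
    qed
    finally show "f (hit r \<omega>) (\<omega> !! hit r \<omega>) (sdrop (Suc (hit r \<omega>)) \<omega>) = (\<Sum>n. g n \<omega>)" ..
  qed
  also have "\<dots> = (\<Sum>n. \<integral>\<^sup>+\<omega>. g n \<omega> \<partial>cube_stream)" by (rule nn_integral_suminf) measurable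
  also have "\<dots> = (\<Sum>n. ennreal ((1 - height r) ^ n) * (ennreal (height r) * (\<integral>\<^sup>+u. \<integral>\<^sup>+\<omega>. f n (scale r u) \<omega> \<partial>cube_stream \<partial>cube_measure)))"
  proof (rule suminf_cong)
    fix n
    have mm: "(\<lambda>x. \<integral>\<^sup>+\<omega>. f n x \<omega> \<partial>cube_stream) \<in> borel_measurable borel" by measurable
    have "(\<integral>\<^sup>+\<omega>. g n \<omega> \<partial>cube_stream) = emeasure cube_measure {x. \<not> x \<prec> r} ^ n * (\<integral>\<^sup>+x. indicator {x. x \<prec> r} x * (\<integral>\<^sup>+\<omega>. f n x \<omega> \<partial>cube_stream) \<partial>cube_measure)"
      unfolding g_def by (rule hit_split[OF f])
    also have "emeasure cube_measure {x. \<not> x \<prec> r} ^ n = ennreal ((1 - height r) ^ n)"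
      unfolding emeasure_not_below[OF r] using h by (intro ennreal_power) simp
    also have "(\<integral>\<^sup>+x. indicator {x. x \<prec> r} x * (\<integral>\<^sup>+\<omega>. f n x \<omega> \<partial>cube_stream) \<partial>cube_measure) =
      ennreal (height r) * (\<integral>\<^sup>+u. \<integral>\<^sup>+\<omega>. f n (scale r u) \<omega> \<partial>cube_stream \<partial>cube_measure)"
      by (rule nn_integral_below[OF r mm])
    finally show "(\<integral>\<^sup>+\<omega>. g n \<omega> \<partial>cube_stream) = ennreal ((1 - height r) ^ n) * (ennreal (height r) * (\<integral>\<^sup>+u. \<integral>\<^sup>+\<omega>. f n (scale r u) \<omega> \<partial>cube_stream \<partial>cube_measure))" .
  qed
  finally show ?thesis .
qed

text \<open>Both families of laws satisfy one recursion with the current record as state. For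
  \<open>recs\<close> the number of failures is geometric by \<open>nn_integral_hit\<close>; for
  \<open>chain\<close> it is computed from an exponential mark; \<open>nn_integral_geometric\<close>
  identifies the two. Averaging over \<open>u\<close> on the left makes up for the extra step that
  \<open>chain\<close> has already taken.\<close>

lemma recs_chain_law:
  fixes r :: "real ^ 'n"
  assumes "\<And>i. 0 < r $ i \<and> r $ i \<le> 1"
  shows "distr (cube_measure \<Otimes>\<^sub>M cube_stream) (stream_space record_space) (\<lambda>(u, \<omega>). recs (scale r u) \<omega>) =
    distr (stream_space (cube_measure \<Otimes>\<^sub>M expo)) (stream_space record_space) (chain r)"
proof -
  let ?S = "cube_stream :: (real ^ 'n) stream measure"
  let ?C = "cube_measure :: (real ^ 'n) measure"
  let ?V = "stream_space (?C \<Otimes>\<^sub>M expo)"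
  interpret CE: pair_prob_space ?C expo by unfold_locales
  interpret CS: pair_prob_space ?C ?S by unfold_locales
  interpret V: prob_space ?V by (rule CE.prob_space_stream_space)
  have [measurable_cong]: "sets ?S = sets (stream_space borel)" by (rule sets_cube_stream)
  have sCE: "sets (?C \<Otimes>\<^sub>M expo) = sets (borel \<Otimes>\<^sub>M borel)" by (rule sets_pair_measure_cong) auto
  have [measurable_cong]: "sets ?V = sets (stream_space (borel \<Otimes>\<^sub>M borel))" by (rule sets_stream_space_cong[OF sCE])
  define \<alpha> where "\<alpha> r = distr (?C \<Otimes>\<^sub>M ?S) (stream_space record_space) (\<lambda>(u, \<omega>). recs (scale r u) \<omega>)" for r
  define \<beta> where "\<beta> r = distr ?V (stream_space record_space) (chain r)" for r
  define K where "K r = distr (?C \<Otimes>\<^sub>M expo) record_space (\<lambda>(u, e). (scale r u, wait (scale r u) e))" for r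
  have m\<alpha>: "(\<lambda>(u, \<omega>). recs (scale r u) \<omega>) \<in> ?C \<Otimes>\<^sub>M ?S \<rightarrow>\<^sub>M stream_space record_space" for r
    unfolding case_prod_unfold by (rule measurable_recs) measurable
  have m\<beta>: "chain r \<in> ?V \<rightarrow>\<^sub>M stream_space record_space" for r :: "real ^ 'n"
    by (rule measurable_chain) measurable
  have mK: "(\<lambda>(u, e). (scale r u, wait (scale r u) e)) \<in> ?C \<Otimes>\<^sub>M expo \<rightarrow>\<^sub>M record_space" for r
    by measurable
  have \<alpha>_int: "(\<integral>\<^sup>+\<omega>. f \<omega> \<partial>\<alpha> r) = (\<integral>\<^sup>+u. \<integral>\<^sup>+\<omega>. f (recs (scale r u) \<omega>) \<partial>?S \<partial>?C)"
    if f[measurable]: "f \<in> borel_measurable (stream_space record_space)" for f :: "_ \<Rightarrow> ennreal" and r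
  proof -
    have "(\<integral>\<^sup>+\<omega>. f \<omega> \<partial>\<alpha> r) = (\<integral>\<^sup>+x. f (case x of (u, \<omega>) \<Rightarrow> recs (scale r u) \<omega>) \<partial>(?C \<Otimes>\<^sub>M ?S))"
      unfolding \<alpha>_def by (rule nn_integral_distr[OF m\<alpha>]) measurable
    also have "\<dots> = (\<integral>\<^sup>+u. \<integral>\<^sup>+\<omega>. f (recs (scale r u) \<omega>) \<partial>?S \<partial>?C)"
      using measurable_compose[OF m\<alpha> f] by (subst prob_space_imp_sigma_finite[OF prob_space_cube_stream, THEN sigma_finite_measure.nn_integral_fst, symmetric]) auto
    finally show ?thesis .
  qed
  have K_int: "(\<integral>\<^sup>+y. g y \<partial>K r) = (\<integral>\<^sup>+u. \<integral>\<^sup>+e. g (scale r u, wait (scale r u) e) \<partial>expo \<partial>?C)"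
    if g[measurable]: "g \<in> borel_measurable record_space" for g :: "_ \<Rightarrow> ennreal" and r
  proof -
    have "(\<integral>\<^sup>+y. g y \<partial>K r) = (\<integral>\<^sup>+x. g (case x of (u, e) \<Rightarrow> (scale r u, wait (scale r u) e)) \<partial>(?C \<Otimes>\<^sub>M expo))"
      unfolding K_def by (rule nn_integral_distr[OF mK]) measurable
    also have "\<dots> = (\<integral>\<^sup>+u. \<integral>\<^sup>+e. g (scale r u, wait (scale r u) e) \<partial>expo \<partial>?C)"
      using measurable_compose[OF mK g] by (subst expo.nn_integral_fst[symmetric]) auto
    finally show ?thesis .
  qed
  have "\<alpha> r = \<beta> r"
  proof (rule stream_family_eq[where G = "{r. \<forall>i. 0 < r $ i \<and> r $ i \<le> 1}" and K = K and nxt = "\<lambda>r y. fst y" and M = record_space])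
    show "prob_space (\<alpha> r)" for r unfolding \<alpha>_def by (rule CS.prob_space_distr[OF m\<alpha>])
    show "prob_space (\<beta> r)" for r unfolding \<beta>_def by (rule V.prob_space_distr[OF m\<beta>])
    show "r \<in> {r. \<forall>i. 0 < r $ i \<and> r $ i \<le> 1}" using assms by simp
    fix r :: "real ^ 'n" assume "r \<in> {r. \<forall>i. 0 < r $ i \<and> r $ i \<le> 1}"
    then have r: "\<And>i. 0 < r $ i \<and> r $ i \<le> 1" by simp
    have su: "0 < scale r u $ i" "scale r u $ i < 1" if "\<forall>i. 0 < u $ i \<and> u $ i < 1" for u i
    proof -
      show "0 < scale r u $ i" using r that by simp
      have "r $ i * u $ i \<le> 1 * u $ i" using r that by (intro mult_right_mono) (auto simp: less_imp_le)
      then show "scale r u $ i < 1" unfolding scale_nth using that[rule_format, of i] by linarith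
    qed
    show "AE y in K r. fst y \<in> {r. \<forall>i. 0 < r $ i \<and> r $ i \<le> 1}"
    proof -
      have "AE x in ?C \<Otimes>\<^sub>M expo. \<forall>i. 0 < fst x $ i \<and> fst x $ i < 1"
      proof (rule CE.AE_pair_measure)
        show "{x \<in> space (?C \<Otimes>\<^sub>M expo). \<forall>i. 0 < fst x $ i \<and> fst x $ i < 1} \<in> sets (?C \<Otimes>\<^sub>M expo)" by measurable
        show "AE u in ?C. AE e in expo. \<forall>i. 0 < fst (u, e) $ i \<and> fst (u, e) $ i < 1" using AE_cube by simp
      qed
      then have "AE x in ?C \<Otimes>\<^sub>M expo. fst (case x of (u, e) \<Rightarrow> (scale r u, wait (scale r u) e)) \<in> {r. \<forall>i. 0 < r $ i \<and> r $ i \<le> 1}"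
        by eventually_elim (use su in \<open>auto simp: case_prod_unfold less_imp_le\<close>)
      then show ?thesis unfolding K_def by (subst AE_distr_iff[OF mK]) auto
    qed
    fix f :: "((real ^ 'n) \<times> nat) stream \<Rightarrow> ennreal" assume f[measurable]: "f \<in> borel_measurable (stream_space record_space)"
    define \<Phi> where "\<Phi> y = (\<integral>\<^sup>+\<omega>. f (y ## \<omega>) \<partial>\<alpha> (fst y))" for y
    have \<Phi>: "\<Phi> y = (\<integral>\<^sup>+u. \<integral>\<^sup>+\<omega>. f (y ## recs (scale (fst y) u) \<omega>) \<partial>?S \<partial>?C)" for y
    proof -
      have "(\<lambda>\<omega>. f (y ## \<omega>)) \<in> borel_measurable (stream_space record_space)"
        by (rule measurable_compose[OF _ f], rule measurable_Stream) (auto simp: space_pair_measure)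
      then show ?thesis unfolding \<Phi>_def by (rule \<alpha>_int)
    qed
    have [measurable]: "\<Phi> \<in> borel_measurable record_space"
    proof -
      have [measurable]: "(\<lambda>x. f (fst (fst x) ## recs (scale (fst (fst (fst x))) (snd (fst x))) (snd x))) \<in> borel_measurable ((record_space \<Otimes>\<^sub>M ?C) \<Otimes>\<^sub>M ?S)"
        by (rule measurable_compose[OF _ f], rule measurable_Stream, measurable, rule measurable_recs) measurable
      have "(\<lambda>y. \<integral>\<^sup>+u. \<integral>\<^sup>+\<omega>. f (y ## recs (scale (fst y) u) \<omega>) \<partial>?S \<partial>?C) \<in> borel_measurable record_space"
      proof (rule cube.borel_measurable_nn_integral)
        have "(\<lambda>x. \<integral>\<^sup>+\<omega>. f (fst x ## recs (scale (fst (fst x)) (snd x)) \<omega>) \<partial>?S) \<in> borel_measurable (record_space \<Otimes>\<^sub>M ?C)"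
          by (rule cube_stream.borel_measurable_nn_integral) (simp add: case_prod_unfold)
        then show "(\<lambda>(y, u). \<integral>\<^sup>+\<omega>. f (y ## recs (scale (fst y) u) \<omega>) \<partial>?S) \<in> borel_measurable (record_space \<Otimes>\<^sub>M ?C)"
          by (simp add: case_prod_unfold)
      qed
      then show ?thesis unfolding \<Phi>[abs_def] .
    qed
    have "(\<integral>\<^sup>+\<omega>. f \<omega> \<partial>\<alpha> r) = (\<integral>\<^sup>+u. \<integral>\<^sup>+e. \<Phi> (scale r u, wait (scale r u) e) \<partial>expo \<partial>?C)"
      unfolding \<alpha>_int[OF f]
      using AE_cube
    proof (intro nn_integral_cong_AE, eventually_elim)
      fix u :: "real ^ 'n" assume u: "\<forall>i. 0 < u $ i \<and> u $ i < 1"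
      define q where "q = scale r u"
      have q: "\<And>i. 0 < q $ i \<and> q $ i \<le> 1" using su[OF u] by (auto simp: q_def less_imp_le)
      have "height q < 1"
      proof -
        \<comment> \<open>With factors in \<open>(0, 1]\<close> the height is at most any one
          coordinate, and \<open>undefined\<close> names one. The strict bound
          \<open>height q < 1\<close> is what the geometric law asks of its parameter.\<close>
        have "height q \<le> q $ undefined"
        proof -
          have "height q = q $ undefined * (\<Prod>i\<in>UNIV - {undefined}. q $ i)"
            unfolding height_def by (subst prod.remove[of UNIV undefined]) auto
          also have "\<dots> \<le> q $ undefined * 1"
            using q by (intro mult_left_mono prod_le_1) (auto simp: less_imp_le)
          finally show ?thesis by simp
        qed
        then show ?thesis using su(2)[OF u, of undefined] by (simp add: q_def)
      qed
      moreover have "0 < height q" using q by (intro height_pos) simp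
      ultimately have p: "0 < height q" "height q < 1" by auto
      have mf: "case_prod (\<lambda>x \<omega>. f ((q, n) ## recs x \<omega>)) \<in> borel_measurable (borel \<Otimes>\<^sub>M stream_space borel)" for n
        unfolding case_prod_unfold
        by (rule measurable_compose[OF _ f], rule measurable_Stream, simp add: space_pair_measure, rule measurable_recs) measurable
      have "(\<integral>\<^sup>+\<omega>. f (recs q \<omega>) \<partial>?S) = (\<integral>\<^sup>+\<omega>. f ((q, hit q \<omega>) ## recs (\<omega> !! hit q \<omega>) (sdrop (Suc (hit q \<omega>)) \<omega>)) \<partial>?S)"
        by (subst recs.code) simp
      also have "\<dots> = (\<Sum>n. ennreal ((1 - height q) ^ n) * (ennreal (height q) * (\<integral>\<^sup>+u. \<integral>\<^sup>+\<omega>. f ((q, n) ## recs (scale q u) \<omega>) \<partial>?S \<partial>?C)))"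
        by (rule nn_integral_hit[OF q mf])
      also have "\<dots> = (\<Sum>n. ennreal ((1 - height q) ^ n) * (ennreal (height q) * \<Phi> (q, n)))"
        unfolding \<Phi> by simp
      also have "\<dots> = (\<integral>\<^sup>+e. \<Phi> (q, wait q e) \<partial>expo)"
        unfolding wait_def by (rule nn_integral_geometric[OF p, symmetric])
      finally show "(\<integral>\<^sup>+\<omega>. f (recs (scale r u) \<omega>) \<partial>?S) = (\<integral>\<^sup>+e. \<Phi> (scale r u, wait (scale r u) e) \<partial>expo)"
        unfolding q_def .
    qed
    also have "\<dots> = (\<integral>\<^sup>+y. \<Phi> y \<partial>K r)" by (rule K_int[symmetric]) measurable
    finally show "(\<integral>\<^sup>+\<omega>. f \<omega> \<partial>\<alpha> r) = (\<integral>\<^sup>+y. \<integral>\<^sup>+\<omega>. f (y ## \<omega>) \<partial>\<alpha> (fst y) \<partial>K r)" unfolding \<Phi>_def .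
    define \<Psi> where "\<Psi> y = (\<integral>\<^sup>+v. f (y ## chain (fst y) v) \<partial>?V)" for y
    have [measurable]: "\<Psi> \<in> borel_measurable record_space"
      unfolding \<Psi>_def
    proof (rule V.borel_measurable_nn_integral)
      show "(\<lambda>(y, v). f (y ## chain (fst y) v)) \<in> borel_measurable (record_space \<Otimes>\<^sub>M ?V)"
        unfolding case_prod_unfold
        by (rule measurable_compose[OF _ f], rule measurable_Stream, measurable, rule measurable_chain) measurable
    qed
    have "(\<integral>\<^sup>+\<omega>. f \<omega> \<partial>\<beta> r) = (\<integral>\<^sup>+v. f (chain r v) \<partial>?V)"
      unfolding \<beta>_def by (rule nn_integral_distr[OF m\<beta>]) measurable
    also have "\<dots> = (\<integral>\<^sup>+x. \<integral>\<^sup>+v. f (chain r (x ## v)) \<partial>?V \<partial>(?C \<Otimes>\<^sub>M expo))"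
      by (rule CE.nn_integral_stream_space) (rule measurable_compose[OF m\<beta> f])
    also have "\<dots> = (\<integral>\<^sup>+x. \<Psi> (case x of (u, e) \<Rightarrow> (scale r u, wait (scale r u) e)) \<partial>(?C \<Otimes>\<^sub>M expo))"
      by (subst chain.code) (simp add: \<Psi>_def case_prod_unfold)
    also have "\<dots> = (\<integral>\<^sup>+y. \<Psi> y \<partial>K r)"
      unfolding K_def by (rule nn_integral_distr[OF mK, symmetric]) measurable
    also have "\<dots> = (\<integral>\<^sup>+y. \<integral>\<^sup>+\<omega>. f (y ## \<omega>) \<partial>\<beta> (fst y) \<partial>K r)"
    proof (rule nn_integral_cong)
      fix y
      have "(\<lambda>\<omega>. f (y ## \<omega>)) \<in> borel_measurable (stream_space record_space)"
        by (rule measurable_compose[OF _ f], rule measurable_Stream) (auto simp: space_pair_measure)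
      then have "(\<lambda>\<omega>. f (y ## \<omega>)) \<in> borel_measurable (distr ?V (stream_space record_space) (chain (fst y)))"
        by simp
      from nn_integral_distr[OF m\<beta> this]
      show "\<Psi> y = (\<integral>\<^sup>+\<omega>. f (y ## \<omega>) \<partial>\<beta> (fst y))"
        unfolding \<Psi>_def \<beta>_def by simp
    qed
    finally show "(\<integral>\<^sup>+\<omega>. f \<omega> \<partial>\<beta> r) = (\<integral>\<^sup>+y. \<integral>\<^sup>+\<omega>. f (y ## \<omega>) \<partial>\<beta> (fst y) \<partial>K r)" .
  qed (auto simp: \<alpha>_def \<beta>_def)
  then show ?thesis unfolding \<alpha>_def \<beta>_def .
qed

subsection \<open>Heights along the chain\<close>

lemma measurable_stream_expo: "N \<rightarrow>\<^sub>M gap_stream = N \<rightarrow>\<^sub>M stream_space (borel \<Otimes>\<^sub>M borel)"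
  by (intro measurable_cong_sets sets_stream_space_cong sets_marked_expo refl)

definition loggap :: "(real ^ 'n) \<times> real \<Rightarrow> real \<times> real" where
  "loggap = (\<lambda>(u, e). (- ln (height u), e))"

text \<open>One record step comprises \<open>d\<close> consecutive points: their gaps are added, and
  the mark is that of the last of them, the point where the record sits.\<close>

primcorec batch :: "nat \<Rightarrow> (real \<times> real) stream \<Rightarrow> (real \<times> real) stream" where
  "batch d w = (psum w d, snd (w !! (d - 1))) ## batch d (sdrop d w)"

lemma snth_batch: "batch d w !! k = (psum (sdrop (k * d) w) d, snd (w !! (k * d + (d - 1))))"
proof (induction k arbitrary: w)
  case (Suc k)
  have "batch d w !! Suc k = batch d (sdrop d w) !! k" by simp
  also have "\<dots> = (psum (sdrop (k * d) (sdrop d w)) d, snd (sdrop d w !! (k * d + (d - 1))))" by (rule Suc)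
  finally show ?case by (simp add: sdrop_snth add_ac)
qed simp

lemma psum_add: "psum w (m + n) = psum w m + psum (sdrop m w) n"
  unfolding psum_def by (induction n) (simp_all add: sdrop_snth add_ac)

lemma psum_batch: "psum (batch d w) k = psum w (k * d)"
proof (induction k)
  case (Suc k)
  have "psum (batch d w) (Suc k) = psum (batch d w) k + fst (batch d w !! k)" by (simp add: psum_def)
  also have "\<dots> = psum w (k * d + d)" unfolding Suc snth_batch psum_add by simp
  finally show ?case by (simp add: add.commute)
qed (simp add: psum_def)

lemma measurable_batch: "batch d \<in> gap_stream \<rightarrow>\<^sub>M stream_space (borel \<Otimes>\<^sub>M borel)"
proof (rule measurable_stream_space2)
  fix k
  have [measurable]: "(\<lambda>w. psum (sdrop (k * d) w) d) \<in> borel_measurable gap_stream"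
    by (rule measurable_compose[OF measurable_sdrop measurable_psum])
  show "(\<lambda>w. batch d w !! k) \<in> gap_stream \<rightarrow>\<^sub>M borel \<Otimes>\<^sub>M borel"
    unfolding snth_batch by measurable
qed

lemma nn_integral_psum_mark:
  fixes g :: "real \<times> real \<Rightarrow> ennreal"
  assumes "g \<in> borel_measurable (borel \<Otimes>\<^sub>M borel)"
  shows "(\<integral>\<^sup>+w. g (psum w (Suc k), snd (w !! k)) \<partial>gap_stream) = exp_iter (Suc k) (\<lambda>x. \<integral>\<^sup>+m. g (x, m) \<partial>expo)"
  using assms
proof (induction k arbitrary: g)
  case 0
  note [measurable] = 0
  have "(\<integral>\<^sup>+w. g (psum w (Suc 0), snd (w !! 0)) \<partial>gap_stream) =
    (\<integral>\<^sup>+y. \<integral>\<^sup>+w. g (psum (y ## w) (Suc 0), snd ((y ## w) !! 0)) \<partial>gap_stream \<partial>marked_expo)"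
    by (rule marked.nn_integral_stream_space) measurable
  also have "\<dots> = (\<integral>\<^sup>+y. g y \<partial>marked_expo)" by (simp add: psum_Stream)
  also have "\<dots> = (\<integral>\<^sup>+e. \<integral>\<^sup>+m. g (e, m) \<partial>expo \<partial>expo)"
    by (rule nn_integral_marked_expo) measurable
  finally show ?case by simp
next
  case (Suc k)
  note [measurable] = Suc(2)
  have "(\<integral>\<^sup>+w. g (psum w (Suc (Suc k)), snd (w !! Suc k)) \<partial>gap_stream) =
    (\<integral>\<^sup>+y. \<integral>\<^sup>+w. g (psum (y ## w) (Suc (Suc k)), snd ((y ## w) !! Suc k)) \<partial>gap_stream \<partial>marked_expo)"
    by (rule marked.nn_integral_stream_space) measurable
  also have "\<dots> = (\<integral>\<^sup>+y. \<integral>\<^sup>+w. (\<lambda>z. g (fst y + fst z, snd z)) (psum w (Suc k), snd (w !! k)) \<partial>gap_stream \<partial>marked_expo)"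
    by (simp add: psum_Stream)
  also have "\<dots> = (\<integral>\<^sup>+y. exp_iter (Suc k) (\<lambda>x. \<integral>\<^sup>+m. g (fst y + x, m) \<partial>expo) \<partial>marked_expo)"
    by (subst Suc(1)) simp_all
  also have "\<dots> = (\<integral>\<^sup>+e. \<integral>\<^sup>+m. exp_iter (Suc k) (\<lambda>x. \<integral>\<^sup>+m. g (e + x, m) \<partial>expo) \<partial>expo \<partial>expo)"
  proof -
    have "(\<lambda>x. \<integral>\<^sup>+m. g (x, m) \<partial>expo) \<in> borel_measurable borel" by measurable
    from measurable_exp_iter[OF this, of "Suc k"]
    have [measurable]: "(\<lambda>s. exp_iter (Suc k) (\<lambda>x. \<integral>\<^sup>+m. g (s + x, m) \<partial>expo)) \<in> borel_measurable borel" .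
    show ?thesis by (subst nn_integral_marked_expo) (simp_all del: exp_iter.simps)
  qed
  finally show ?case by (simp del: exp_iter.simps(2) add: exp_iter.simps(2)[of "Suc k"])
qed

text \<open>Both streams are independent and identically distributed, with a sum of \<open>d\<close>
  exponential variables and an independent exponential mark as common law of an entry. For
  \<open>batch\<close> the freshness of the remainder comes from dropping \<open>d\<close> entries.
  No state is involved, hence the type \<open>unit\<close>.\<close>

lemma distr_loggap_batch:
  "distr (stream_space (cube_measure \<Otimes>\<^sub>M expo)) (stream_space (borel \<Otimes>\<^sub>M borel)) (smap (loggap :: (real ^ 'n) \<times> real \<Rightarrow> _)) =
   distr gap_stream (stream_space (borel \<Otimes>\<^sub>M borel)) (batch CARD('n))"
proof -
  let ?C = "cube_measure :: (real ^ 'n) measure"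
  let ?V = "stream_space (?C \<Otimes>\<^sub>M expo)"
  let ?\<xi> = gap_stream
  let ?d = "CARD('n)"
  let ?B = "borel \<Otimes>\<^sub>M borel :: (real \<times> real) measure"
  interpret CE: pair_prob_space ?C expo by unfold_locales
  interpret V: prob_space ?V by (rule CE.prob_space_stream_space)
  have m\<phi>: "(loggap :: (real ^ 'n) \<times> real \<Rightarrow> _) \<in> ?C \<Otimes>\<^sub>M expo \<rightarrow>\<^sub>M ?B" unfolding loggap_def by measurable
  have ms: "smap (loggap :: (real ^ 'n) \<times> real \<Rightarrow> _) \<in> ?V \<rightarrow>\<^sub>M stream_space ?B" by (rule measurable_smap[OF m\<phi>])
  define K where "K = distr (?C \<Otimes>\<^sub>M expo) ?B loggap"
  define \<alpha> where "\<alpha> = distr ?V (stream_space ?B) (smap loggap)"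
  define \<beta> where "\<beta> = distr ?\<xi> (stream_space ?B) (batch ?d)"
  have meas1: "(\<lambda>\<omega>. f (y ## \<omega>)) \<in> borel_measurable (stream_space ?B)"
    if "f \<in> borel_measurable (stream_space ?B)" for f :: "_ \<Rightarrow> ennreal" and y
    by (rule measurable_compose[OF _ that], rule measurable_Stream) (auto simp: space_pair_measure)
  have "(\<lambda>_ :: unit. \<alpha>) () = (\<lambda>_ :: unit. \<beta>) ()"
  proof (rule stream_family_eq[where G = UNIV and K = "\<lambda>_. K" and nxt = "\<lambda>_ _. ()" and M = ?B])
    show "prob_space \<alpha>" unfolding \<alpha>_def by (rule V.prob_space_distr[OF ms])
    show "prob_space \<beta>" unfolding \<beta>_def by (rule gaps.prob_space_distr[OF measurable_batch])
    fix f :: "(real \<times> real) stream \<Rightarrow> ennreal" assume f[measurable]: "f \<in> borel_measurable (stream_space ?B)"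
    have "(\<integral>\<^sup>+\<omega>. f \<omega> \<partial>\<alpha>) = (\<integral>\<^sup>+v. f (smap loggap v) \<partial>?V)"
      unfolding \<alpha>_def by (rule nn_integral_distr[OF ms]) measurable
    also have "\<dots> = (\<integral>\<^sup>+x. \<integral>\<^sup>+v. f (smap loggap (x ## v)) \<partial>?V \<partial>(?C \<Otimes>\<^sub>M expo))"
      by (rule CE.nn_integral_stream_space) (rule measurable_compose[OF ms f])
    also have "\<dots> = (\<integral>\<^sup>+x. \<integral>\<^sup>+\<omega>. f (loggap x ## \<omega>) \<partial>\<alpha> \<partial>(?C \<Otimes>\<^sub>M expo))"
    proof (rule nn_integral_cong)
      fix x :: "(real ^ 'n) \<times> real"
      have "(\<lambda>\<omega>. f (loggap x ## \<omega>)) \<in> borel_measurable (distr ?V (stream_space ?B) (smap loggap))"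
        using meas1[OF f] by simp
      from nn_integral_distr[OF ms this]
      show "(\<integral>\<^sup>+v. f (smap loggap (x ## v)) \<partial>?V) = (\<integral>\<^sup>+\<omega>. f (loggap x ## \<omega>) \<partial>\<alpha>)"
        unfolding \<alpha>_def by simp
    qed
    also have "\<dots> = (\<integral>\<^sup>+y. \<integral>\<^sup>+\<omega>. f (y ## \<omega>) \<partial>\<alpha> \<partial>K)"
    proof -
      interpret \<alpha>: prob_space \<alpha> unfolding \<alpha>_def by (rule V.prob_space_distr[OF ms])
      have [measurable_cong]: "sets \<alpha> = sets (stream_space ?B)" unfolding \<alpha>_def by simp
      have "(\<lambda>y. \<integral>\<^sup>+\<omega>. f (y ## \<omega>) \<partial>\<alpha>) \<in> borel_measurable K" unfolding K_def by measurable
      from nn_integral_distr[OF m\<phi> this[unfolded K_def]] show ?thesis unfolding K_def by simp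
    qed
    finally show "(\<integral>\<^sup>+\<omega>. f \<omega> \<partial>\<alpha>) = (\<integral>\<^sup>+y. \<integral>\<^sup>+\<omega>. f (y ## \<omega>) \<partial>\<alpha> \<partial>K)" .
    define \<Phi> where "\<Phi> y = (\<integral>\<^sup>+w. f (y ## batch ?d w) \<partial>?\<xi>)" for y
    have mb2: "(\<lambda>x. snd x ## batch ?d (fst x)) \<in> ?\<xi> \<Otimes>\<^sub>M ?B \<rightarrow>\<^sub>M stream_space ?B"
      by (intro measurable_Stream measurable_compose[OF measurable_fst measurable_batch]) measurable
    have mb: "(\<lambda>x. f (snd x ## batch ?d (fst x))) \<in> borel_measurable (?\<xi> \<Otimes>\<^sub>M ?B)"
      by (rule measurable_compose[OF mb2 f])
    have [measurable]: "\<Phi> \<in> borel_measurable ?B"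
      unfolding \<Phi>_def
    proof (rule gaps.borel_measurable_nn_integral)
      have "(\<lambda>x. fst x ## batch ?d (snd x)) \<in> ?B \<Otimes>\<^sub>M ?\<xi> \<rightarrow>\<^sub>M stream_space ?B"
        by (intro measurable_Stream measurable_compose[OF measurable_snd measurable_batch]) measurable
      then show "(\<lambda>(y, w). f (y ## batch ?d w)) \<in> borel_measurable (?B \<Otimes>\<^sub>M ?\<xi>)"
        unfolding case_prod_unfold by (rule measurable_compose[OF _ f])
    qed
    have "(\<integral>\<^sup>+\<omega>. f \<omega> \<partial>\<beta>) = (\<integral>\<^sup>+w. f (batch ?d w) \<partial>?\<xi>)"
      unfolding \<beta>_def by (rule nn_integral_distr[OF measurable_batch]) measurable
    also have "\<dots> = (\<integral>\<^sup>+w. (\<lambda>w y. f (y ## batch ?d w)) (sdrop ?d w) (psum w ?d, snd (w !! (?d - 1))) \<partial>?\<xi>)"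
      by (subst batch.code) simp
    also have "\<dots> = (\<integral>\<^sup>+w. \<integral>\<^sup>+w'. (\<lambda>w y. f (y ## batch ?d w)) w' (psum w ?d, snd (w !! (?d - 1))) \<partial>?\<xi> \<partial>?\<xi>)"
    proof (rule marked.nn_integral_stream_independent)
      show "(\<lambda>w. (psum w ?d, snd (w !! (?d - 1)))) \<in> ?\<xi> \<rightarrow>\<^sub>M ?B" by measurable
      show "case_prod (\<lambda>w y. f (y ## batch ?d w)) \<in> borel_measurable (?\<xi> \<Otimes>\<^sub>M ?B)"
        using mb by (simp add: case_prod_unfold)
      fix w w' :: "(real \<times> real) stream"
      have "(stake ?d w @- w') !! i = w !! i" if "i < ?d" for i
        using that by (simp add: shift_snth_less del: snth.simps)
      then show "(psum (stake ?d w @- w') ?d, snd ((stake ?d w @- w') !! (?d - 1))) = (psum w ?d, snd (w !! (?d - 1)))"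
        unfolding psum_def by (simp del: snth.simps)
    qed
    also have "\<dots> = (\<integral>\<^sup>+w. \<Phi> (psum w ?d, snd (w !! (?d - 1))) \<partial>?\<xi>)" unfolding \<Phi>_def ..
    also have "\<dots> = exp_iter ?d (\<lambda>x. \<integral>\<^sup>+m. \<Phi> (x, m) \<partial>expo)"
    proof -
      have "Suc (?d - 1) = ?d" by simp
      then show ?thesis using nn_integral_psum_mark[of \<Phi> "?d - 1"] by (simp only:) measurable
    qed
    also have "\<dots> = (\<integral>\<^sup>+u. \<integral>\<^sup>+m. \<Phi> (- ln (height u), m) \<partial>expo \<partial>?C)"
      by (rule nn_integral_neg_ln_height[symmetric]) measurable
    also have "\<dots> = (\<integral>\<^sup>+x. \<Phi> (loggap x) \<partial>(?C \<Otimes>\<^sub>M expo))"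
    proof -
      have "(\<lambda>x. \<Phi> (loggap x)) \<in> borel_measurable (?C \<Otimes>\<^sub>M expo)" by (rule measurable_compose[OF m\<phi>]) measurable
      from expo.nn_integral_fst[OF this] show ?thesis by (simp add: loggap_def)
    qed
    also have "\<dots> = (\<integral>\<^sup>+y. \<Phi> y \<partial>K)" unfolding K_def by (rule nn_integral_distr[OF m\<phi>, symmetric]) measurable
    also have "\<dots> = (\<integral>\<^sup>+y. \<integral>\<^sup>+\<omega>. f (y ## \<omega>) \<partial>\<beta> \<partial>K)"
    proof (rule nn_integral_cong)
      fix y
      have "(\<lambda>\<omega>. f (y ## \<omega>)) \<in> borel_measurable (distr ?\<xi> (stream_space ?B) (batch ?d))"
        using meas1[OF f] by simp
      from nn_integral_distr[OF measurable_batch this]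
      show "\<Phi> y = (\<integral>\<^sup>+\<omega>. f (y ## \<omega>) \<partial>\<beta>)" unfolding \<Phi>_def \<beta>_def by simp
    qed
    finally show "(\<integral>\<^sup>+\<omega>. f \<omega> \<partial>\<beta>) = (\<integral>\<^sup>+y. \<integral>\<^sup>+\<omega>. f (y ## \<omega>) \<partial>\<beta> \<partial>K)" .
  qed (auto simp: \<alpha>_def \<beta>_def)
  then show ?thesis unfolding \<alpha>_def \<beta>_def .
qed

text \<open>In phase \<open>0\<close> the records sit at the indices
  \<open>h k = (k + 1) * d - 1\<close>, so passing to every \<open>d\<close>-th point is a
  reindexing of the sum of unit masses along \<open>h\<close>.\<close>

lemma walk_batch:
  assumes d: "0 < d"
  shows "walk d inc w x 0 t = walk (Suc 0) inc (batch d w) x 0 t"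
proof -
  define h where "h k = k * d + (d - 1)" for k
  have hS: "Suc (h k) = Suc k * d" for k using d by (simp add: h_def)
  have rec: "record_at d 0 n \<longleftrightarrow> n \<in> range h" for n
  proof -
    have e: "record_at d 0 n \<longleftrightarrow> d dvd Suc n"
      by (metis add.commute add_0 int_dvd_int_iff of_nat_Suc)
    show ?thesis
    proof
      assume "record_at d 0 n"
      then obtain k where k: "Suc n = d * k" unfolding e by (elim dvdE)
      then obtain k' where "k = Suc k'" by (cases k) auto
      then have "Suc n = Suc (h k')" unfolding hS using k by (simp add: mult.commute)
      then show "n \<in> range h" by auto
    next
      assume "n \<in> range h"
      then show "record_at d 0 n" unfolding e using hS by (auto simp del: mult_Suc)
    qed
  qed
  have hinj: "inj h"
  proof (rule injI)
    fix x y assume "h x = h y"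
    then have "Suc x * d = Suc y * d" unfolding hS[symmetric] by simp
    then show "x = y" using d by simp
  qed
  have hmono: "h i < h k \<longleftrightarrow> i < k" for i k
  proof -
    have "h i < h k \<longleftrightarrow> Suc i * d < Suc k * d" unfolding hS[symmetric] by simp
    also have "\<dots> \<longleftrightarrow> i < k" using d by (subst mult_less_cancel2) simp
    finally show ?thesis .
  qed
  have pos: "wpos w x (h k) = wpos (batch d w) x k" for k
    unfolding wpos_def psum_batch hS ..
  have time: "wtime d inc w x 0 t (h k) = wtime (Suc 0) inc (batch d w) x 0 t k" for k
  proof -
    have "(\<Sum>i<h k. if record_at d 0 i then inc (wpos w x i) (snd (w !! i)) else 0) =
      (\<Sum>i\<in>h ` {..<k}. inc (wpos w x i) (snd (w !! i)))"
    proof -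
      have "{i \<in> {..<h k}. record_at d 0 i} = h ` {..<k}" unfolding rec using hmono by auto
      then show ?thesis by (subst sum.inter_filter[symmetric]) auto
    qed
    also have "\<dots> = (\<Sum>i<k. inc (wpos w x (h i)) (snd (w !! h i)))"
      by (subst sum.reindex) (auto intro: inj_on_subset[OF hinj])
    also have "\<dots> = (\<Sum>i<k. inc (wpos (batch d w) x i) (snd (batch d w !! i)))"
      unfolding pos snth_batch by (simp add: h_def)
    finally show ?thesis unfolding wtime_def by simp
  qed
  have point: "wpoint d inc w x 0 t (h k) = wpoint (Suc 0) inc (batch d w) x 0 t k" for k
    unfolding wpoint_def pos time ..
  have "walk d inc w x 0 t = dirac_sum pos_quadrant {k. wpoint (Suc 0) inc (batch d w) x 0 t k \<in> pos_quadrant} (wpoint d inc w x 0 t \<circ> h)"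
    unfolding walk_def
  proof (rule dirac_sum_reindex)
    show "bij_betw h {k. wpoint (Suc 0) inc (batch d w) x 0 t k \<in> pos_quadrant} {n. record_at d 0 n \<and> wpoint d inc w x 0 t n \<in> pos_quadrant}"
      unfolding rec bij_betw_def
    proof
      show "inj_on h {k. wpoint (Suc 0) inc (batch d w) x 0 t k \<in> pos_quadrant}" by (rule inj_on_subset[OF hinj]) simp
      show "h ` {k. wpoint (Suc 0) inc (batch d w) x 0 t k \<in> pos_quadrant} = {n. n \<in> range h \<and> wpoint d inc w x 0 t n \<in> pos_quadrant}"
        unfolding point[symmetric] by auto
    qed
  qed auto
  also have "\<dots> = walk (Suc 0) inc (batch d w) x 0 t"
    unfolding walk_def by (rule dirac_sum_cong) (auto simp: point)
  finally show ?thesis .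
qed

subsection \<open>The scaled process as a function of the records\<close>

text \<open>The leading \<open>1\<close> is the index of the first record; each later record costs
  the failures before it and one success.\<close>

definition rpoint :: "real \<Rightarrow> ((real ^ 'n) \<times> nat) stream \<Rightarrow> nat \<Rightarrow> real \<times> real" where
  "rpoint b y k = (b * height (fst (y !! k)), real (1 + (\<Sum>i<k. 1 + snd (y !! i))) / b)"

definition rprocess :: "real \<Rightarrow> ((real ^ 'n) \<times> nat) stream \<Rightarrow> (real \<times> real) measure" where
  "rprocess b y = dirac_sum pos_quadrant {k. rpoint b y k \<in> pos_quadrant} (rpoint b y)"

lemma finite_second_coordinate:
  assumes b: "0 < b" and K: "compact (K :: (real \<times> real) set)" and p: "\<And>k. k \<in> I \<Longrightarrow> real k / b \<le> snd (p k)"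
  shows "finite {k \<in> I. p k \<in> K}"
proof -
  have "bounded K" using K by (rule compact_imp_bounded)
  then obtain B where B: "\<And>z. z \<in> K \<Longrightarrow> norm z \<le> B" unfolding bounded_iff by blast
  have "k \<le> nat \<lceil>B * b\<rceil>" if "k \<in> I" "p k \<in> K" for k
  proof -
    have "real k / b \<le> norm (snd (p k))" using p[OF that(1)] by simp
    also have "\<dots> \<le> norm (p k)" by (metis norm_snd_le prod.collapse)
    also have "\<dots> \<le> B" by (rule B[OF that(2)])
    finally have "real k \<le> B * b" using b by (simp add: field_simps)
    then show ?thesis by linarith
  qed
  then have "{k \<in> I. p k \<in> K} \<subseteq> {..nat \<lceil>B * b\<rceil>}" by auto
  then show ?thesis by (rule finite_subset) simp
qed

lemma measurable_rprocess:
  assumes b: "0 < b"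
  shows "rprocess b \<in> stream_space (record_space :: ((real ^ 'n) \<times> nat) measure) \<rightarrow>\<^sub>M vague_borel pos_quadrant"
  unfolding rprocess_def
proof (rule measurable_dirac_sum[OF open_pos_quadrant])
  have [measurable]: "(\<lambda>y. snd (y !! i)) \<in> stream_space (record_space :: ((real ^ 'n) \<times> nat) measure) \<rightarrow>\<^sub>M count_space UNIV" for i
    by measurable
  have "(\<lambda>y. rpoint b y i) \<in> stream_space (record_space :: ((real ^ 'n) \<times> nat) measure) \<rightarrow>\<^sub>M borel \<Otimes>\<^sub>M borel" for i
    unfolding rpoint_def by measurable
  then show [measurable]: "(\<lambda>y. rpoint b y i) \<in> borel_measurable (stream_space (record_space :: ((real ^ 'n) \<times> nat) measure))" for i
    unfolding borel_prod .
  have [measurable]: "pos_quadrant \<in> sets borel" by (rule borel_open[OF open_pos_quadrant])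
  show "Measurable.pred (stream_space (record_space :: ((real ^ 'n) \<times> nat) measure)) (\<lambda>y. i \<in> {k. rpoint b y k \<in> pos_quadrant})" for i
    unfolding mem_Collect_eq by measurable
  fix y :: "((real ^ 'n) \<times> nat) stream" and K :: "(real \<times> real) set" assume "compact K"
  moreover have "real k / b \<le> snd (rpoint b y k)" for k
  proof -
    have "k \<le> (\<Sum>i<k. 1 + snd (y !! i))" by (induction k) auto
    then show ?thesis using b unfolding rpoint_def snd_conv by (intro divide_right_mono) linarith+
  qed
  ultimately show "finite {k \<in> {k. rpoint b y k \<in> pos_quadrant}. rpoint b y k \<in> K}"
    using b by (intro finite_second_coordinate)
qed auto

lemma chain_heights:
  assumes "0 < height r" "\<And>i. 0 < height (fst (v !! i))"
  shows "height (fst (chain r v !! k)) = height r * exp (- psum (smap loggap v) (Suc k)) \<and>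
    snd (chain r v !! k) = nat \<lfloor>snd (v !! k) / - ln (1 - height r * exp (- psum (smap loggap v) (Suc k)))\<rfloor>"
  using assms
proof (induction k arbitrary: r v)
  case 0
  have "exp (ln (height (fst (v !! 0)))) = height (fst (v !! 0))" using 0(2)[of 0] by simp
  then show ?case by (simp add: wait_def psum_def loggap_def case_prod_unfold height_scale)
next
  case (Suc k)
  let ?r = "scale r (fst (shd v))"
  have s: "height ?r = height r * height (fst (shd v))" by (rule height_scale)
  have p: "0 < height (fst (shd v))" using Suc(3)[of 0] by simp
  have "0 < height ?r" unfolding s using Suc(2) p by simp
  moreover have "0 < height (fst (stl v !! i))" for i using Suc(3)[of "Suc i"] by simp
  ultimately have IH: "height (fst (chain ?r (stl v) !! k)) = height ?r * exp (- psum (smap loggap (stl v)) (Suc k)) \<and>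
    snd (chain ?r (stl v) !! k) = nat \<lfloor>snd (stl v !! k) / - ln (1 - height ?r * exp (- psum (smap loggap (stl v)) (Suc k)))\<rfloor>"
    by (rule Suc(1))
  have "psum (smap loggap v) (Suc (Suc k)) = fst (loggap (shd v)) + psum (smap loggap (stl v)) (Suc k)"
    using psum_Stream[of "loggap (shd v)" "smap loggap (stl v)" "Suc k"] by (metis stream.collapse stream.map_sel)
  also have "fst (loggap (shd v)) = - ln (height (fst (shd v)))" by (simp add: loggap_def case_prod_unfold)
  finally have "exp (- psum (smap loggap v) (Suc (Suc k))) = height (fst (shd v)) * exp (- psum (smap loggap (stl v)) (Suc k))"
    using p by (simp add: exp_diff exp_minus divide_inverse)
  then have e: "height ?r * exp (- psum (smap loggap (stl v)) (Suc k)) = height r * exp (- psum (smap loggap v) (Suc (Suc k)))"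
    unfolding s by simp
  show ?case using IH unfolding e by simp
qed

text \<open>Heights multiply along the chain, so minus their logarithms are the partial sums of the
  log gaps, and starting at \<open>- ln b\<close> accounts for the factor \<open>b\<close>. Each gap
  is already a whole record step, hence period one. The starting time \<open>1 / b\<close> belongs
  to the first record.\<close>

lemma rprocess_chain:
  assumes r: "height r = 1" and v: "\<And>i. 0 < height (fst (v !! i))" and b: "0 < b"
  shows "rprocess b (chain r v) = walk (Suc 0) (waiting_inc b) (smap loggap v) (- ln b) 0 (1 / b)"
proof -
  let ?l = "smap loggap v"
  have pos: "exp (- wpos ?l (- ln b) k) = b * exp (- psum ?l (Suc k))" for k
    unfolding wpos_def using b by (simp add: exp_diff exp_minus divide_inverse)
  have ch: "height (fst (chain r v !! k)) = exp (- psum ?l (Suc k))"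
    "snd (chain r v !! k) = nat \<lfloor>snd (?l !! k) / - ln (1 - exp (- psum ?l (Suc k)))\<rfloor>" for k
    using chain_heights[of r v k] r v by (simp_all add: loggap_def case_prod_unfold)
  have inc: "waiting_inc b (wpos ?l (- ln b) k) (snd (?l !! k)) = real (1 + snd (chain r v !! k)) / b" for k
    unfolding waiting_inc_def pos ch(2) using b by simp
  have "rpoint b (chain r v) k = wpoint (Suc 0) (waiting_inc b) ?l (- ln b) 0 (1 / b) k" for k
    unfolding rpoint_def wpoint_def wtime_def pos ch(1) inc
    by (simp add: add_divide_distrib sum_divide_distrib)
  then show ?thesis unfolding rprocess_def walk_def by (intro dirac_sum_cong) auto
qed

section \<open>Record times in the original sequence\<close>

lemma chain_time_Suc_Suc:
  fixes x :: "nat \<Rightarrow> real ^ 'n"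
  assumes "chain_time x (Suc k) = enat m" "\<exists>n. x (Suc (m + n)) \<prec> x m"
  shows "chain_time x (Suc (Suc k)) = enat (Suc (m + (LEAST n. x (Suc (m + n)) \<prec> x m)))"
proof -
  let ?L = "LEAST n. x (Suc (m + n)) \<prec> x m"
  have L: "x (Suc (m + ?L)) \<prec> x m" by (rule LeastI_ex[OF assms(2)])
  have "Inf {enat n | n. n > m \<and> x n \<prec> x m} = enat (Suc (m + ?L))"
  proof (rule Inf_eqI)
    fix y assume "y \<in> {enat n | n. n > m \<and> x n \<prec> x m}"
    then obtain n where n: "y = enat n" "m < n" "x n \<prec> x m" by blast
    obtain l where l: "n = Suc (m + l)" using less_imp_Suc_add[OF n(2)] by blast
    have "?L \<le> l" by (rule Least_le) (use n(3) l in simp)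
    then show "enat (Suc (m + ?L)) \<le> y" using n(1) l by simp
  next
    fix y assume y: "\<And>i. i \<in> {enat n | n. n > m \<and> x n \<prec> x m} \<Longrightarrow> y \<le> i"
    have "Suc (m + ?L) > m" by simp
    then show "y \<le> enat (Suc (m + ?L))" using L by (intro y) blast
  qed
  then show ?thesis using assms(1) by simp
qed

lemma chain_time_pos:
  fixes x :: "nat \<Rightarrow> real ^ 'n"
  shows "chain_time x (Suc k) = enat m \<Longrightarrow> 1 \<le> m"
proof (cases k)
  case (Suc l)
  assume a: "chain_time x (Suc k) = enat m"
  obtain m' where "chain_time x (Suc l) = enat m'"
    using a unfolding Suc by (cases "chain_time x (Suc l)") auto
  then have "Inf {enat n | n. n > m' \<and> x n \<prec> x m'} = enat m" using a unfolding Suc by simp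
  moreover have "1 \<le> Inf {enat n | n. n > m' \<and> x n \<prec> x m'}"
    by (rule Inf_greatest) (auto simp: one_enat_def)
  ultimately show "1 \<le> m" by (simp add: one_enat_def)
qed (simp add: one_enat_def)

lemma chain_time_ge:
  fixes x :: "nat \<Rightarrow> real ^ 'n"
  shows "enat k \<le> chain_time x k"
proof (induction x k rule: chain_time.induct)
  case (3 x k)
  show ?case
  proof (cases "chain_time x (Suc k)")
    case (enat m)
    have "enat (Suc (Suc k)) \<le> Inf {enat n | n. n > m \<and> x n \<prec> x m}"
      using 3 enat by (intro Inf_greatest) auto
    then show ?thesis using enat by simp
  qed simp
qed (simp_all add: zero_enat_def one_enat_def)

lemma chain_time_cong:
  fixes x y :: "nat \<Rightarrow> real ^ 'n"
  assumes "\<And>n. 1 \<le> n \<Longrightarrow> x n = y n"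
  shows "chain_time x k = chain_time y k"
proof (induction k rule: induct_nat_012)
  case (ge2 k)
  show ?case
  proof (cases "chain_time x (Suc k)")
    case (enat m)
    have "1 \<le> m" by (rule chain_time_pos[OF enat])
    then have "(n > m \<and> x n \<prec> x m) = (n > m \<and> y n \<prec> y m)" for n using assms[of m] assms[of n] by auto
    then show ?thesis using enat ge2 by simp
  qed (use ge2 in simp)
qed simp_all

lemma scaled_process_cong:
  fixes x y :: "nat \<Rightarrow> real ^ 'n"
  assumes "\<And>n. 1 \<le> n \<Longrightarrow> x n = y n"
  shows "scaled_process x b = scaled_process y b"
proof -
  have t: "chain_time x k = chain_time y k" for k by (rule chain_time_cong[OF assms])
  have p: "scaled_point x b k = scaled_point y b k" if k: "1 \<le> k" "chain_time x k \<noteq> \<infinity>" for k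
  proof -
    obtain l where l: "k = Suc l" using k(1) by (cases k) auto
    obtain m where m: "chain_time x k = enat m" using k(2) by auto
    then have "1 \<le> m" unfolding l by (rule chain_time_pos)
    then show ?thesis using m assms[of m] by (simp add: scaled_point_def chain_height_def chain_index_def t[symmetric])
  qed
  have "{k. 1 \<le> k \<and> chain_time x k \<noteq> \<infinity> \<and> scaled_point x b k \<in> pos_quadrant} =
    {k. 1 \<le> k \<and> chain_time y k \<noteq> \<infinity> \<and> scaled_point y b k \<in> pos_quadrant}"
    unfolding t[symmetric] using p by auto
  then show ?thesis unfolding scaled_process_def using p t by (intro dirac_sum_cong) auto
qed

lemma measurable_chain_time:
  fixes X :: "nat \<Rightarrow> 'm \<Rightarrow> real ^ 'n"
  assumes X[measurable]: "\<And>n. X n \<in> borel_measurable M"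
  shows "(\<lambda>\<omega>. chain_time (\<lambda>n. X n \<omega>) k) \<in> M \<rightarrow>\<^sub>M count_space UNIV"
proof (induction k rule: induct_nat_012)
  case (ge2 k)
  \<comment> \<open>The previous record time is random, but countably many values \<open>c\<close>
    can be treated one at a time.\<close>
  define g where "g c \<omega> = (case c of enat m \<Rightarrow> Inf {enat n | n. n > m \<and> X n \<omega> \<prec> X m \<omega>} | \<infinity> \<Rightarrow> \<infinity>)" for c \<omega>
  have "g c \<in> M \<rightarrow>\<^sub>M count_space UNIV" for c
  proof (cases c)
    case (enat m)
    have "g c \<omega> = (if \<exists>n. n > m \<and> X n \<omega> \<prec> X m \<omega> then enat (LEAST n. n > m \<and> X n \<omega> \<prec> X m \<omega>) else \<infinity>)" for \<omega>
    proof (cases "\<exists>n. n > m \<and> X n \<omega> \<prec> X m \<omega>")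
      case True
      have "Inf {enat n | n. n > m \<and> X n \<omega> \<prec> X m \<omega>} = enat (LEAST n. n > m \<and> X n \<omega> \<prec> X m \<omega>)"
      proof (rule Inf_eqI)
        fix i assume "i \<in> {enat n | n. n > m \<and> X n \<omega> \<prec> X m \<omega>}"
        then show "enat (LEAST n. n > m \<and> X n \<omega> \<prec> X m \<omega>) \<le> i" by (auto intro: Least_le)
      next
        fix y assume y: "\<And>i. i \<in> {enat n | n. n > m \<and> X n \<omega> \<prec> X m \<omega>} \<Longrightarrow> y \<le> i"
        show "y \<le> enat (LEAST n. n > m \<and> X n \<omega> \<prec> X m \<omega>)"
          using LeastI_ex[OF True] by (intro y) blast
      qed
      then show ?thesis using True enat by (simp add: g_def)
    next
      case False
      then have "{enat n | n. n > m \<and> X n \<omega> \<prec> X m \<omega>} = {}" by auto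
      then have "Inf {enat n | n. n > m \<and> X n \<omega> \<prec> X m \<omega>} = \<infinity>" by (simp only: Inf_empty top_enat_def)
      then show ?thesis using False enat by (simp add: g_def)
    qed
    then have "g c = (\<lambda>\<omega>. if \<exists>n. n > m \<and> X n \<omega> \<prec> X m \<omega> then enat (LEAST n. n > m \<and> X n \<omega> \<prec> X m \<omega>) else \<infinity>)" by (rule ext)
    also have "\<dots> \<in> M \<rightarrow>\<^sub>M count_space UNIV" by measurable
    finally show ?thesis .
  next
    case infinity
    then have "g c = (\<lambda>_. \<infinity>)" by (intro ext) (simp add: g_def)
    then show ?thesis by simp
  qed
  then have "(\<lambda>\<omega>. g (chain_time (\<lambda>n. X n \<omega>) (Suc k)) \<omega>) \<in> M \<rightarrow>\<^sub>M count_space UNIV"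
    by (rule measurable_compose_countable) (rule ge2)
  then show ?case by (simp add: g_def)
qed simp_all

lemma measurable_scaled_process:
  fixes X :: "nat \<Rightarrow> 'm \<Rightarrow> real ^ 'n"
  assumes b: "0 < b" and X: "\<And>n. 1 \<le> n \<Longrightarrow> X n \<in> borel_measurable M"
  shows "(\<lambda>\<omega>. scaled_process (\<lambda>n. X n \<omega>) b) \<in> M \<rightarrow>\<^sub>M vague_borel pos_quadrant"
proof -
  \<comment> \<open>Nothing is assumed about \<open>X 0\<close>, which need not be measurable; the
    process ignores it, so it may be replaced by a constant.\<close>
  define Y where "Y n = (if n = 0 then (\<lambda>_. 0) else X n)" for n
  have Y[measurable]: "Y n \<in> borel_measurable M" for n using X[of n] by (cases n) (auto simp: Y_def)
  have "scaled_process (\<lambda>n. X n \<omega>) b = scaled_process (\<lambda>n. Y n \<omega>) b" for \<omega>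
    by (rule scaled_process_cong) (simp add: Y_def)
  moreover have "(\<lambda>\<omega>. scaled_process (\<lambda>n. Y n \<omega>) b) \<in> M \<rightarrow>\<^sub>M vague_borel pos_quadrant"
    unfolding scaled_process_def
  proof (rule measurable_dirac_sum[OF open_pos_quadrant])
    have ct[measurable]: "(\<lambda>\<omega>. chain_time (\<lambda>n. Y n \<omega>) k) \<in> M \<rightarrow>\<^sub>M count_space UNIV" for k
      by (rule measurable_chain_time[OF Y])
    have ci[measurable]: "(\<lambda>\<omega>. chain_index (\<lambda>n. Y n \<omega>) k) \<in> M \<rightarrow>\<^sub>M count_space UNIV" for k
      unfolding chain_index_def by (rule measurable_compose[OF ct]) simp
    have "(\<lambda>\<omega>. Y (chain_index (\<lambda>n. Y n \<omega>) k) \<omega>) \<in> borel_measurable M" for k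
      by (rule measurable_compose_countable[OF Y ci])
    then have [measurable]: "(\<lambda>\<omega>. chain_height (\<lambda>n. Y n \<omega>) k) \<in> borel_measurable M" for k
      unfolding chain_height_def by (rule measurable_compose[OF _ measurable_height]) simp
    have "(\<lambda>\<omega>. scaled_point (\<lambda>n. Y n \<omega>) b k) \<in> M \<rightarrow>\<^sub>M borel \<Otimes>\<^sub>M borel" for k
      unfolding scaled_point_def by measurable
    then show [measurable]: "(\<lambda>\<omega>. scaled_point (\<lambda>n. Y n \<omega>) b k) \<in> borel_measurable M" for k
      unfolding borel_prod .
    have [measurable]: "pos_quadrant \<in> sets borel" by (rule borel_open[OF open_pos_quadrant])
    show "Measurable.pred M (\<lambda>\<omega>. i \<in> {k. 1 \<le> k \<and> chain_time (\<lambda>n. Y n \<omega>) k \<noteq> \<infinity> \<and> scaled_point (\<lambda>n. Y n \<omega>) b k \<in> pos_quadrant})" for i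
      unfolding mem_Collect_eq by measurable
    fix \<omega> and K :: "(real \<times> real) set" assume "compact K"
    moreover have "real k / b \<le> snd (scaled_point (\<lambda>n. Y n \<omega>) b k)" if finite: "chain_time (\<lambda>n. Y n \<omega>) k \<noteq> \<infinity>" for k
    proof -
      obtain m where m: "chain_time (\<lambda>n. Y n \<omega>) k = enat m" using finite by auto
      then show ?thesis using chain_time_ge[of k "\<lambda>n. Y n \<omega>"] b
        by (simp add: scaled_point_def chain_index_def divide_right_mono)
    qed
    ultimately show "finite {k \<in> {k. 1 \<le> k \<and> chain_time (\<lambda>n. Y n \<omega>) k \<noteq> \<infinity> \<and> scaled_point (\<lambda>n. Y n \<omega>) b k \<in> pos_quadrant}. scaled_point (\<lambda>n. Y n \<omega>) b k \<in> K}"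
      using b by (intro finite_second_coordinate) auto
  qed auto
  ultimately show ?thesis by simp
qed

abbreviation tail_stream :: "(nat \<Rightarrow> 'a) \<Rightarrow> 'a stream" where
  "tail_stream x \<equiv> to_stream (\<lambda>n. x (Suc n))"

lemma snth_to_stream: "to_stream x !! n = x n"
  by (simp add: to_stream_def)

text \<open>The invariant: after \<open>k\<close> records the rest of \<open>recs\<close> is
  \<open>recs\<close> started at the current record and fed with the observations after time
  \<open>T k\<close>. As \<open>tail_stream\<close> starts with \<open>x 1\<close>, dropping
  \<open>T k\<close> entries leaves exactly these.\<close>

lemma scaled_process_recs:
  fixes x :: "nat \<Rightarrow> real ^ 'n"
  assumes hits: "\<And>m. 1 \<le> m \<Longrightarrow> \<exists>n. x (Suc (m + n)) \<prec> x m"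
  shows "scaled_process x b = rprocess b (recs (shd (tail_stream x)) (stl (tail_stream x)))"
proof -
  define y where "y = recs (shd (tail_stream x)) (stl (tail_stream x))"
  define T where "T k = 1 + (\<Sum>i<k. 1 + snd (y !! i))" for k
  have *: "chain_time x (Suc k) = enat (T k) \<and> sdrop k y = recs (x (T k)) (sdrop (T k) (tail_stream x))" for k
  proof (induction k)
    case 0
    have "shd (tail_stream x) = x 1" using snth_to_stream[of "\<lambda>n. x (Suc n)" 0] by simp
    then show ?case by (simp add: T_def y_def one_enat_def)
  next
    case (Suc k)
    let ?r = "x (T k)" and ?w = "sdrop (T k) (tail_stream x)"
    have w: "?w !! n = x (Suc (T k + n))" for n by (simp add: sdrop_snth snth_to_stream)
    have y: "y !! k = (?r, hit ?r ?w)" "sdrop (Suc k) y = recs (?w !! hit ?r ?w) (sdrop (Suc (hit ?r ?w)) ?w)"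
    proof -
      have "y !! k = shd (sdrop k y)" by (simp add: sdrop_simps)
      then show "y !! k = (?r, hit ?r ?w)" using Suc by simp
      have "sdrop (Suc k) y = stl (sdrop k y)" by (simp add: sdrop_simps)
      then show "sdrop (Suc k) y = recs (?w !! hit ?r ?w) (sdrop (Suc (hit ?r ?w)) ?w)" using Suc by simp
    qed
    have T: "T (Suc k) = Suc (T k + hit ?r ?w)" by (simp add: T_def y(1))
    have "1 \<le> T k" by (simp add: T_def)
    have "chain_time x (Suc (Suc k)) = enat (Suc (T k + (LEAST n. x (Suc (T k + n)) \<prec> x (T k))))"
      using Suc by (intro chain_time_Suc_Suc hits \<open>1 \<le> T k\<close>) simp
    then have "chain_time x (Suc (Suc k)) = enat (T (Suc k))" unfolding T hit_def w .
    moreover have "sdrop (Suc k) y = recs (x (T (Suc k))) (sdrop (T (Suc k)) (tail_stream x))"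
      unfolding y(2) w T by (simp add: sdrop_add[symmetric] add_ac del: sdrop.simps(2))
    ultimately show ?case by simp
  qed
  have p: "scaled_point x b (Suc k) = rpoint b y k" for k
  proof -
    have "fst (y !! k) = x (T k)" using *[of k] by (metis fst_conv recs.simps(1) sdrop_simps(1))
    then show ?thesis using *[of k]
      by (simp add: scaled_point_def chain_height_def chain_index_def rpoint_def T_def)
  qed
  have "scaled_process x b = dirac_sum pos_quadrant {k. rpoint b y k \<in> pos_quadrant} (scaled_point x b \<circ> Suc)"
    unfolding scaled_process_def
  proof (rule dirac_sum_reindex)
    show "bij_betw Suc {k. rpoint b y k \<in> pos_quadrant} {k. 1 \<le> k \<and> chain_time x k \<noteq> \<infinity> \<and> scaled_point x b k \<in> pos_quadrant}"
      unfolding bij_betw_def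
    proof
      have "k \<in> Suc ` {k. rpoint b y k \<in> pos_quadrant}" if "1 \<le> k" "scaled_point x b k \<in> pos_quadrant" for k
        using that p by (cases k) auto
      then show "Suc ` {k. rpoint b y k \<in> pos_quadrant} = {k. 1 \<le> k \<and> chain_time x k \<noteq> \<infinity> \<and> scaled_point x b k \<in> pos_quadrant}"
        using * p by auto
    qed simp
  qed auto
  also have "\<dots> = rprocess b y" unfolding rprocess_def by (rule dirac_sum_cong) (auto simp: p)
  finally show ?thesis unfolding y_def .
qed

text \<open>Every observation, record or not, is asked to be followed by a smaller one. This event
  is larger in its demands than necessary for one chain, but it makes no reference to random record
  times.\<close>

lemma AE_all_hits:
  "AE xs in (cube_stream :: (real ^ 'n) stream measure). \<forall>m. \<exists>n. xs !! Suc (m + n) \<prec> xs !! m"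
proof -
  have [measurable_cong]: "sets (cube_stream :: (real ^ 'n) stream measure) = sets (stream_space borel)" by (rule sets_cube_stream)
  have "AE xs in (cube_stream :: (real ^ 'n) stream measure). \<exists>n. xs !! Suc (m + n) \<prec> xs !! m" for m
  proof (induction m)
    case 0
    have "AE xs in (cube_stream :: (real ^ 'n) stream measure). \<exists>n. xs !! Suc n \<prec> xs !! 0"
    proof (subst prob_space.AE_stream_space[OF prob_space_cube])
      show "Measurable.pred (cube_stream :: (real ^ 'n) stream measure) (\<lambda>xs. \<exists>n. xs !! Suc n \<prec> xs !! 0)"
        by measurable
      show "AE x in cube_measure. AE xs in (cube_stream :: (real ^ 'n) stream measure). \<exists>n. (x ## xs) !! Suc n \<prec> (x ## xs) !! 0"
        using AE_cube
      proof eventually_elim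
        fix x :: "real ^ 'n" assume "\<forall>i. 0 < x $ i \<and> x $ i < 1"
        then have "AE \<omega> in cube_stream. \<exists>n. \<omega> !! n \<prec> x" by (intro AE_hit) (auto simp: less_imp_le)
        then show "AE xs in cube_stream. \<exists>n. (x ## xs) !! Suc n \<prec> (x ## xs) !! 0" by simp
      qed
    qed
    then show ?case by simp
  next
    case (Suc m)
    show ?case
    proof (subst prob_space.AE_stream_space[OF prob_space_cube])
      show "Measurable.pred (cube_stream :: (real ^ 'n) stream measure) (\<lambda>xs. \<exists>n. xs !! Suc (Suc m + n) \<prec> xs !! Suc m)"
        by measurable
      show "AE x in cube_measure. AE xs in (cube_stream :: (real ^ 'n) stream measure). \<exists>n. (x ## xs) !! Suc (Suc m + n) \<prec> (x ## xs) !! Suc m"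
        using Suc by simp
    qed
  qed
  then show ?thesis by (subst AE_all_countable) simp
qed

lemma distr_tail_stream:
  fixes X :: "nat \<Rightarrow> 'm \<Rightarrow> real ^ 'n"
  assumes "prob_space M" and indep: "prob_space.indep_vars M (\<lambda>_. borel) X {1..}"
    and X: "\<And>n. 1 \<le> n \<Longrightarrow> distr M borel (X n) = cube_measure"
  shows "distr M (stream_space borel) (\<lambda>\<omega>. tail_stream (\<lambda>n. X n \<omega>)) = cube_stream"
    and "\<And>n. 1 \<le> n \<Longrightarrow> X n \<in> borel_measurable M"
proof -
  interpret prob_space M by fact
  show mX: "X n \<in> borel_measurable M" if "1 \<le> n" for n
    using indep that unfolding indep_vars_def by auto
  have m1: "(\<lambda>\<omega>. \<lambda>i\<in>{1..}. X i \<omega>) \<in> M \<rightarrow>\<^sub>M (\<Pi>\<^sub>M i\<in>{1..}. borel)"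
    using mX by (intro measurable_restrict) auto
  have m2: "(\<lambda>f. \<lambda>n\<in>UNIV. f (Suc n)) \<in> (\<Pi>\<^sub>M i\<in>{1..}. borel) \<rightarrow>\<^sub>M (\<Pi>\<^sub>M n\<in>UNIV. borel :: (real ^ 'n) measure)"
    by (intro measurable_restrict measurable_component_singleton) auto
  have p: "distr M (\<Pi>\<^sub>M i\<in>{1..}. borel) (\<lambda>\<omega>. \<lambda>i\<in>{1..}. X i \<omega>) = (\<Pi>\<^sub>M i\<in>{1..}. cube_measure)"
  proof -
    have "distr M (\<Pi>\<^sub>M i\<in>{1..}. borel) (\<lambda>\<omega>. \<lambda>i\<in>{1..}. X i \<omega>) = (\<Pi>\<^sub>M i\<in>{1..}. distr M borel (X i))"
      using indep by (subst (asm) indep_vars_iff_distr_eq_PiM') (use mX in auto)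
    also have "\<dots> = (\<Pi>\<^sub>M i\<in>{1..}. cube_measure)" using X by (intro PiM_cong) auto
    finally show ?thesis .
  qed
  have "distr M (\<Pi>\<^sub>M n\<in>UNIV. borel) (\<lambda>\<omega> n. X (Suc n) \<omega>) =
    distr (distr M (\<Pi>\<^sub>M i\<in>{1..}. borel) (\<lambda>\<omega>. \<lambda>i\<in>{1..}. X i \<omega>)) (\<Pi>\<^sub>M n\<in>UNIV. borel) (\<lambda>f. \<lambda>n\<in>UNIV. f (Suc n))"
    by (subst distr_distr[OF m2 m1]) (simp add: comp_def restrict_def)
  also have "\<dots> = distr (\<Pi>\<^sub>M i\<in>{1..}. cube_measure) (\<Pi>\<^sub>M n\<in>UNIV. cube_measure) (\<lambda>f. \<lambda>n\<in>UNIV. f (Suc n))"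
  proof -
    have s: "sets (\<Pi>\<^sub>M n\<in>(UNIV :: nat set). borel :: (real ^ 'n) measure) = sets (\<Pi>\<^sub>M n\<in>UNIV. cube_measure)"
      by (rule sets_PiM_cong) simp_all
    show ?thesis unfolding p by (rule distr_cong[OF refl s refl])
  qed
  also have "\<dots> = (\<Pi>\<^sub>M n\<in>UNIV. cube_measure)"
    by (rule distr_PiM_reindex[where M = "\<lambda>_. cube_measure"]) (auto intro: prob_space_cube)
  finally have pi: "distr M (\<Pi>\<^sub>M n\<in>UNIV. borel) (\<lambda>\<omega> n. X (Suc n) \<omega>) = (\<Pi>\<^sub>M n\<in>UNIV. cube_measure)" .
  have m3: "(\<lambda>\<omega> n. X (Suc n) \<omega>) \<in> M \<rightarrow>\<^sub>M (\<Pi>\<^sub>M n\<in>UNIV. borel)"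
    using mX by (intro measurable_PiM_single') auto
  have "distr M (stream_space borel) (\<lambda>\<omega>. tail_stream (\<lambda>n. X n \<omega>)) =
    distr (distr M (\<Pi>\<^sub>M n\<in>UNIV. borel) (\<lambda>\<omega> n. X (Suc n) \<omega>)) (stream_space borel) to_stream"
    by (subst distr_distr[OF measurable_to_stream m3]) (simp add: comp_def)
  also have "\<dots> = distr (\<Pi>\<^sub>M n\<in>UNIV. cube_measure) cube_stream to_stream"
    unfolding pi by (rule distr_cong) (simp_all add: sets_cube_stream)
  also have "\<dots> = cube_stream" by (rule stream_space_eq_distr[symmetric])
  finally show "distr M (stream_space borel) (\<lambda>\<omega>. tail_stream (\<lambda>n. X n \<omega>)) = cube_stream" .
qed

text \<open>Only expectations of one functional are compared, so it suffices to replace laws in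
  turn: observations by records, records by the multiplicative chain, the chain by its log gaps, and
  these by groups of \<open>d\<close> exponential gaps.\<close>

lemma integral_scaled_process:
  fixes X :: "nat \<Rightarrow> 'm \<Rightarrow> real ^ 'n" and F :: "(real \<times> real) measure \<Rightarrow> real"
  assumes M: "prob_space M" "prob_space.indep_vars M (\<lambda>_. borel) X {1..}"
      "\<And>n. 1 \<le> n \<Longrightarrow> distr M borel (X n) = cube_measure"
    and b: "0 < b" and F[measurable]: "F \<in> borel_measurable (vague_borel pos_quadrant)"
  shows "(\<integral>\<omega>. F (scaled_process (\<lambda>n. X n \<omega>) b) \<partial>M) =
    (\<integral>w. F (walk CARD('n) (waiting_inc b) w (- ln b) 0 (1 / b)) \<partial>gap_stream)"
proof -
  let ?C = "cube_measure :: (real ^ 'n) measure"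
  let ?S = "cube_stream :: (real ^ 'n) stream measure"
  let ?V = "stream_space (?C \<Otimes>\<^sub>M expo)"
  let ?W = "\<lambda>\<omega>. tail_stream (\<lambda>n. X n \<omega>)"
  \<comment> \<open>The first record is uniform in the whole cube, as if it had fallen below a
    virtual record of height one.\<close>
  let ?one = "(\<chi> i. 1) :: real ^ 'n"
  let ?B = "borel \<Otimes>\<^sub>M borel :: (real \<times> real) measure"
  interpret prob_space M by fact
  interpret CE: pair_prob_space ?C expo by unfold_locales
  interpret CS: pair_prob_space ?C ?S by unfold_locales
  interpret V: prob_space ?V by (rule CE.prob_space_stream_space)
  have [measurable_cong]: "sets ?S = sets (stream_space borel)" by (rule sets_cube_stream)
  have sCE: "sets (?C \<Otimes>\<^sub>M expo) = sets (borel \<Otimes>\<^sub>M borel)" by (rule sets_pair_measure_cong) auto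
  have [measurable_cong]: "sets ?V = sets (stream_space (borel \<Otimes>\<^sub>M borel))" by (rule sets_stream_space_cong[OF sCE])
  have law: "distr M (stream_space borel) ?W = ?S" "1 \<le> n \<Longrightarrow> X n \<in> borel_measurable M" for n
    using distr_tail_stream[OF M(1,2)] M(3) by blast+
  have mW: "?W \<in> M \<rightarrow>\<^sub>M stream_space borel"
    by (rule measurable_stream_space2) (simp add: snth_to_stream law(2))
  define G where "G y = F (rprocess b y)" for y :: "((real ^ 'n) \<times> nat) stream"
  have G[measurable]: "G \<in> borel_measurable (stream_space record_space)"
    unfolding G_def by (rule measurable_compose[OF measurable_rprocess[OF b] F])
  have mr: "(\<lambda>xs. recs (shd xs) (stl xs)) \<in> stream_space borel \<rightarrow>\<^sub>M stream_space (record_space :: ((real ^ 'n) \<times> nat) measure)"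
    by (rule measurable_recs) measurable
  have one: "scale ?one u = u" for u :: "real ^ 'n" by (simp add: vec_eq_iff)
  have onep: "0 < ?one $ i \<and> ?one $ i \<le> 1" for i :: 'n by simp
  have mpair: "(\<lambda>(u, \<omega>). recs (scale ?one u) \<omega>) \<in> ?C \<Otimes>\<^sub>M ?S \<rightarrow>\<^sub>M stream_space record_space"
    unfolding case_prod_unfold by (rule measurable_recs) measurable
  have mchain: "chain ?one \<in> ?V \<rightarrow>\<^sub>M stream_space record_space" by (rule measurable_chain) measurable
  have msmap: "smap (loggap :: (real ^ 'n) \<times> real \<Rightarrow> _) \<in> ?V \<rightarrow>\<^sub>M stream_space ?B"
    by (rule measurable_smap) (simp add: loggap_def)
  have law_recs: "distr ?S (stream_space record_space) (\<lambda>xs. recs (shd xs) (stl xs)) =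
    distr ?V (stream_space record_space) (chain ?one)"
  proof -
    have "distr ?S (stream_space record_space) (\<lambda>xs. recs (shd xs) (stl xs)) =
      distr (?C \<Otimes>\<^sub>M ?S) (stream_space record_space) (\<lambda>(u, \<omega>). recs (scale ?one u) \<omega>)"
    proof (rule measure_eqI)
      fix A assume "A \<in> sets (distr ?S (stream_space record_space) (\<lambda>xs. recs (shd xs) (stl xs :: (real ^ 'n) stream)))"
      then have A[measurable]: "A \<in> sets (stream_space record_space)" by simp
      define h where "h y = (indicator A y :: ennreal)" for y
      have h[measurable]: "h \<in> borel_measurable (stream_space record_space)" unfolding h_def by measurable
      have mr': "(\<lambda>xs. recs (shd xs) (stl xs)) \<in> ?S \<rightarrow>\<^sub>M stream_space record_space" using mr by measurable
      have "emeasure (distr ?S (stream_space record_space) (\<lambda>xs. recs (shd xs) (stl xs))) A = (\<integral>\<^sup>+y. h y \<partial>distr ?S (stream_space record_space) (\<lambda>xs. recs (shd xs) (stl xs)))"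
        unfolding h_def by simp
      also have "\<dots> = (\<integral>\<^sup>+xs. h (recs (shd xs) (stl xs)) \<partial>?S)" by (rule nn_integral_distr[OF mr']) measurable
      also have "\<dots> = (\<integral>\<^sup>+u. \<integral>\<^sup>+xs. h (recs (shd (u ## xs)) (stl (u ## xs))) \<partial>?S \<partial>?C)"
        by (rule prob_space.nn_integral_stream_space[OF prob_space_cube]) (rule measurable_compose[OF mr' h])
      also have "\<dots> = (\<integral>\<^sup>+x. h (case x of (u, \<omega>) \<Rightarrow> recs (scale ?one u) \<omega>) \<partial>(?C \<Otimes>\<^sub>M ?S))"
        using cube_stream.nn_integral_fst[OF measurable_compose[OF mpair h]] by (simp add: one)
      also have "\<dots> = (\<integral>\<^sup>+y. h y \<partial>distr (?C \<Otimes>\<^sub>M ?S) (stream_space record_space) (\<lambda>(u, \<omega>). recs (scale ?one u) \<omega>))"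
        by (rule nn_integral_distr[OF mpair, symmetric]) measurable
      also have "\<dots> = emeasure (distr (?C \<Otimes>\<^sub>M ?S) (stream_space record_space) (\<lambda>(u, \<omega>). recs (scale ?one u) \<omega>)) A"
        unfolding h_def by simp
      finally show "emeasure (distr ?S (stream_space record_space) (\<lambda>xs. recs (shd xs) (stl xs))) A =
        emeasure (distr (?C \<Otimes>\<^sub>M ?S) (stream_space record_space) (\<lambda>(u, \<omega>). recs (scale ?one u) \<omega>)) A" .
    qed simp
    also have "\<dots> = distr ?V (stream_space record_space) (chain ?one)" by (rule recs_chain_law[OF onep])
    finally show ?thesis .
  qed
  have hits: "AE xs in distr M (stream_space borel) ?W. \<forall>m. \<exists>n. xs !! Suc (m + n) \<prec> xs !! m"
    unfolding law(1) by (rule AE_all_hits)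
  have "AE \<omega> in M. \<forall>m. \<exists>n. ?W \<omega> !! Suc (m + n) \<prec> ?W \<omega> !! m"
    by (rule AE_distrD[OF mW hits])
  then have "AE \<omega> in M. F (scaled_process (\<lambda>n. X n \<omega>) b) = G (recs (shd (?W \<omega>)) (stl (?W \<omega>)))"
  proof eventually_elim
    fix \<omega> assume a: "\<forall>m. \<exists>n. ?W \<omega> !! Suc (m + n) \<prec> ?W \<omega> !! m"
    have "\<exists>n. X (Suc (m + n)) \<omega> \<prec> X m \<omega>" if "1 \<le> m" for m
    proof -
      obtain l where "m = Suc l" using \<open>1 \<le> m\<close> by (cases m) auto
      then show ?thesis using a[rule_format, of l] unfolding snth_to_stream by simp
    qed
    then show "F (scaled_process (\<lambda>n. X n \<omega>) b) = G (recs (shd (?W \<omega>)) (stl (?W \<omega>)))"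
      unfolding G_def by (subst scaled_process_recs) auto
  qed
  then have "(\<integral>\<omega>. F (scaled_process (\<lambda>n. X n \<omega>) b) \<partial>M) = (\<integral>\<omega>. G (recs (shd (?W \<omega>)) (stl (?W \<omega>))) \<partial>M)"
    using measurable_compose[OF measurable_scaled_process[OF b law(2)] F]
      measurable_compose[OF mW measurable_compose[OF mr G]]
    by (intro integral_cong_AE)
  also have "\<dots> = (\<integral>xs. G (recs (shd xs) (stl xs)) \<partial>distr M (stream_space borel) ?W)"
    by (rule integral_distr[OF mW measurable_compose[OF mr G], symmetric])
  also have "\<dots> = (\<integral>y. G y \<partial>distr ?S (stream_space record_space) (\<lambda>xs. recs (shd xs) (stl xs)))"
    unfolding law(1) by (rule integral_distr[symmetric]) (use mr in measurable)
  also have "\<dots> = (\<integral>v. G (chain ?one v) \<partial>?V)"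
    unfolding law_recs by (rule integral_distr[OF mchain G])
  also have "\<dots> = (\<integral>v. F (walk (Suc 0) (waiting_inc b) (smap loggap v) (- ln b) 0 (1 / b)) \<partial>?V)"
  proof -
    have mpos: "Measurable.pred (?C \<Otimes>\<^sub>M expo) (\<lambda>x. 0 < height (fst x))" by measurable
    have "AE x in ?C \<Otimes>\<^sub>M expo. 0 < height (fst x)"
    proof (rule CE.AE_pair_measure)
      show "{x \<in> space (?C \<Otimes>\<^sub>M expo). 0 < height (fst x)} \<in> sets (?C \<Otimes>\<^sub>M expo)" by measurable
      have "AE u in ?C. 0 < height u" using AE_cube by eventually_elim (auto intro: height_pos)
      then show "AE u in ?C. AE e in expo. 0 < height (fst (u, e))" by simp
    qed
    then have "AE v in ?V. stream_all (\<lambda>x. 0 < height (fst x)) v"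
      by (rule CE.AE_stream_all[OF mpos])
    then have "AE v in ?V. G (chain ?one v) = F (walk (Suc 0) (waiting_inc b) (smap loggap v) (- ln b) 0 (1 / b))"
    proof eventually_elim
      fix v :: "((real ^ 'n) \<times> real) stream" assume "stream_all (\<lambda>x. 0 < height (fst x)) v"
      then have "0 < height (fst (v !! i))" for i by (simp add: stream_all_def)
      then show "G (chain ?one v) = F (walk (Suc 0) (waiting_inc b) (smap loggap v) (- ln b) 0 (1 / b))"
        unfolding G_def using b by (subst rprocess_chain) (auto simp: height_def)
    qed
    moreover have "(\<lambda>v. F (walk (Suc 0) (waiting_inc b) (smap loggap v) (- ln b) 0 (1 / b))) \<in> borel_measurable ?V"
      by (rule measurable_compose[OF measurable_walk[OF b] F]) (use msmap in \<open>simp_all add: measurable_stream_expo\<close>)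
    ultimately show ?thesis using measurable_compose[OF mchain G] by (intro integral_cong_AE)
  qed
  also have "\<dots> = (\<integral>w. F (walk (Suc 0) (waiting_inc b) (batch CARD('n) w) (- ln b) 0 (1 / b)) \<partial>gap_stream)"
  proof -
    have mw: "(\<lambda>l. F (walk (Suc 0) (waiting_inc b) l (- ln b) 0 (1 / b))) \<in> borel_measurable (stream_space ?B)"
      by (rule measurable_compose[OF measurable_walk[OF b] F]) (simp_all add: measurable_stream_expo)
    show ?thesis
      using integral_distr[OF msmap mw] integral_distr[OF measurable_batch mw, of "CARD('n)"]
      unfolding distr_loggap_batch by simp
  qed
  also have "\<dots> = (\<integral>w. F (walk CARD('n) (waiting_inc b) w (- ln b) 0 (1 / b)) \<partial>gap_stream)"
    by (subst walk_batch) simp_all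
  finally show ?thesis .
qed

subsection \<open>The limiting point process\<close>

text \<open>\<open>B\<close> reads only the first \<open>Suc m\<close> entries, so the entry with
  index \<open>Suc m\<close> is independent of it, and \<open>distr_conc\<close> applies to the
  pair.\<close>

lemma distr_conc_blocks:
  assumes a: "0 \<le> a" and B: "B \<in> block_stream \<rightarrow>\<^sub>M gap_stream"
    and dep: "\<And>\<omega> \<omega>'. B (stake (Suc m) \<omega> @- \<omega>') = B \<omega>"
    and law: "distr (block_stream) gap_stream B = gap_stream"
  shows "distr (block_stream) gap_stream (\<lambda>\<omega>. conc a (\<omega> !! Suc m) (B \<omega>)) = gap_stream"
    and "(\<lambda>\<omega>. conc a (\<omega> !! Suc m) (B \<omega>)) \<in> block_stream \<rightarrow>\<^sub>M gap_stream"
proof -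
  let ?S = gap_stream
  interpret SS: pair_prob_space ?S ?S by unfold_locales
  show m: "(\<lambda>\<omega>. conc a (\<omega> !! Suc m) (B \<omega>)) \<in> stream_space ?S \<rightarrow>\<^sub>M ?S"
    using measurable_compose[OF measurable_Pair[OF measurable_snth[of "Suc m"] B] measurable_conc[of a]]
    by (simp del: snth.simps)
  have mflip: "(\<lambda>x. conc a (snd x) (fst x)) \<in> ?S \<Otimes>\<^sub>M ?S \<rightarrow>\<^sub>M ?S"
    using measurable_compose[OF measurable_Pair[OF measurable_snd measurable_fst] measurable_conc[of a]] by simp
  show "distr (stream_space ?S) ?S (\<lambda>\<omega>. conc a (\<omega> !! Suc m) (B \<omega>)) = ?S"
  proof (rule measure_eqI)
    fix A assume "A \<in> sets (distr (stream_space ?S) ?S (\<lambda>\<omega>. conc a (\<omega> !! Suc m) (B \<omega>)))"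
    then have A[measurable]: "A \<in> sets ?S" by simp
    define h where "h w = (indicator A w :: ennreal)" for w
    have h[measurable]: "h \<in> borel_measurable ?S" unfolding h_def by measurable
    define k where "k v = (\<integral>\<^sup>+u. h (conc a u v) \<partial>?S)" for v
    have mk: "k \<in> borel_measurable ?S"
      unfolding k_def
      by (rule gaps.borel_measurable_nn_integral) (use measurable_compose[OF mflip h] in \<open>simp add: case_prod_unfold\<close>)
    have "emeasure (distr (stream_space ?S) ?S (\<lambda>\<omega>. conc a (\<omega> !! Suc m) (B \<omega>))) A =
      (\<integral>\<^sup>+w. h w \<partial>distr (stream_space ?S) ?S (\<lambda>\<omega>. conc a (\<omega> !! Suc m) (B \<omega>)))"
      unfolding h_def by simp
    also have "\<dots> = (\<integral>\<^sup>+\<omega>. h (conc a (\<omega> !! Suc m) (B \<omega>)) \<partial>stream_space ?S)"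
      by (rule nn_integral_distr[OF m]) measurable
    also have "\<dots> = (\<integral>\<^sup>+\<omega>. (\<lambda>\<omega> v. h (conc a (shd \<omega>) v)) (sdrop (Suc m) \<omega>) (B \<omega>) \<partial>stream_space ?S)"
      by (simp only: sdrop_simps)
    also have "\<dots> = (\<integral>\<^sup>+\<omega>. \<integral>\<^sup>+\<omega>'. (\<lambda>\<omega> v. h (conc a (shd \<omega>) v)) \<omega>' (B \<omega>) \<partial>stream_space ?S \<partial>stream_space ?S)"
    proof (rule gaps.nn_integral_stream_independent[OF B dep])
      have "(\<lambda>x. (shd (fst x), snd x)) \<in> stream_space ?S \<Otimes>\<^sub>M ?S \<rightarrow>\<^sub>M ?S \<Otimes>\<^sub>M ?S"
        by (intro measurable_Pair measurable_compose[OF measurable_fst measurable_shd] measurable_snd)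
      from measurable_compose[OF measurable_compose[OF this measurable_conc[of a]] h]
      show "case_prod (\<lambda>\<omega> v. h (conc a (shd \<omega>) v)) \<in> borel_measurable (stream_space ?S \<Otimes>\<^sub>M ?S)"
        by (simp add: case_prod_unfold)
    qed
    also have "\<dots> = (\<integral>\<^sup>+\<omega>. k (B \<omega>) \<partial>stream_space ?S)"
    proof (rule nn_integral_cong)
      fix \<omega>
      have "(\<lambda>u. conc a u (B \<omega>)) \<in> ?S \<rightarrow>\<^sub>M ?S"
      proof -
        have "(\<lambda>u. (u, B \<omega>)) \<in> ?S \<rightarrow>\<^sub>M ?S \<Otimes>\<^sub>M ?S"
          by (rule measurable_Pair) simp_all
        from measurable_compose[OF this measurable_conc[of a]] show ?thesis by simp
      qed
      then have "(\<lambda>u. h (conc a u (B \<omega>))) \<in> borel_measurable ?S" by (rule measurable_compose[OF _ h])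
      from gaps.nn_integral_stream_snth[OF this, of 0]
      show "(\<integral>\<^sup>+\<omega>'. (\<lambda>\<omega> v. h (conc a (shd \<omega>) v)) \<omega>' (B \<omega>) \<partial>stream_space ?S) = k (B \<omega>)"
        unfolding k_def by simp
    qed
    also have "\<dots> = (\<integral>\<^sup>+v. k v \<partial>distr (stream_space ?S) ?S B)"
      by (rule nn_integral_distr[OF B, symmetric]) (use mk in simp)
    also have "\<dots> = (\<integral>\<^sup>+v. \<integral>\<^sup>+u. h (conc a u v) \<partial>?S \<partial>?S)" unfolding law k_def ..
    also have "\<dots> = (\<integral>\<^sup>+x. h (case x of (u, v) \<Rightarrow> conc a u v) \<partial>(?S \<Otimes>\<^sub>M ?S))"
      using SS.nn_integral_snd[OF measurable_compose[OF measurable_conc[of a] h]] by (simp add: case_prod_unfold)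
    also have "\<dots> = (\<integral>\<^sup>+w. h w \<partial>distr (?S \<Otimes>\<^sub>M ?S) ?S (\<lambda>(u, v). conc a u v))"
      by (rule nn_integral_distr[OF measurable_conc, symmetric]) simp
    also have "\<dots> = emeasure ?S A" unfolding distr_conc[OF a] h_def by simp
    finally show "emeasure (distr (stream_space ?S) ?S (\<lambda>\<omega>. conc a (\<omega> !! Suc m) (B \<omega>))) A = emeasure ?S A" .
  qed simp
qed

lemma blocks_shift: "m \<le> k \<Longrightarrow> blocks m (stake (Suc k) \<omega> @- \<omega>') = blocks m \<omega>"
  by (induction m) (simp_all add: shift_snth_less del: snth.simps stake.simps)

lemma distr_blocks:
  "distr (block_stream) gap_stream (blocks m) = gap_stream"
proof (induction m)
  case 0
  let ?S = gap_stream
  show ?case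
  proof (rule measure_eqI)
    fix A assume "A \<in> sets (distr (stream_space ?S) ?S (blocks 0))"
    then have A: "A \<in> sets ?S" by simp
    have "emeasure (distr (stream_space ?S) ?S (blocks 0)) A = (\<integral>\<^sup>+w. indicator A w \<partial>distr (stream_space ?S) ?S (blocks 0))"
      using A by simp
    also have "\<dots> = (\<integral>\<^sup>+\<omega>. indicator A (\<omega> !! 0) \<partial>stream_space ?S)"
      by (subst nn_integral_distr[OF measurable_blocks]) (use A in simp_all)
    also have "\<dots> = (\<integral>\<^sup>+w. indicator A w \<partial>?S)"
      by (rule gaps.nn_integral_stream_snth) (use A in simp)
    finally show "emeasure (distr (stream_space ?S) ?S (blocks 0)) A = emeasure ?S A" using A by simp
  qed simp
next
  case (Suc m)
  have "blocks (Suc m) = (\<lambda>\<omega>. conc 1 (\<omega> !! Suc m) (blocks m \<omega>))" by (rule ext) (rule blocks.simps(2))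
  then show ?case using distr_conc_blocks(1)[OF zero_le_one measurable_blocks blocks_shift[OF order_refl] Suc] by simp
qed

text \<open>The glued stream is again a Poisson process in law. Taking for \<open>j\<close> the
  number of points up to position \<open>0\<close> makes the phase at the start equal to
  \<open>0\<close>, as for the true walk; the price is that \<open>j\<close> now depends on the
  sample point.\<close>

lemma integral_walk_coupled:
  assumes b: "1 < b" and F: "F \<in> borel_measurable (vague_borel pos_quadrant)"
  shows "(\<integral>w. F (walk d (waiting_inc b) w (- ln b) 0 (1 / b)) \<partial>gap_stream) =
    (\<integral>\<omega>. F (coupled_process d \<omega> (count_before b \<omega>) b) \<partial>block_stream :: real)"
proof -
  let ?S = gap_stream
  define m a where "m = full_blocks b" and "a = ln b - real m"
  have a: "0 \<le> a" unfolding a_def m_def using full_blocks_bounds(1)[OF b] by simp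
  note blk = distr_conc_blocks[OF a measurable_blocks blocks_shift[OF order_refl] distr_blocks, of m]
  have mw: "(\<lambda>w. F (walk d (waiting_inc b) w (- ln b) 0 (1 / b))) \<in> borel_measurable ?S"
    by (rule measurable_compose[OF measurable_walk F]) (use b in simp_all)
  have "phase (count_before b \<omega>) \<omega> m - int (cnt a (\<omega> !! Suc m)) = 0" for \<omega>
    unfolding phase_def count_before_def m_def[symmetric] a_def by simp
  then have c: "coupled_process d \<omega> (count_before b \<omega>) b = walk d (waiting_inc b) (conc a (\<omega> !! Suc m) (blocks m \<omega>)) (- ln b) 0 (1 / b)" for \<omega>
    unfolding coupled_process_def Let_def m_def[symmetric] a_def[symmetric] by (simp del: snth.simps)
  show ?thesis unfolding c using integral_distr[OF blk(2) mw] unfolding blk(1) .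
qed

lemma coupled_process_cong:
  assumes "int d dvd j - j'"
  shows "coupled_process d \<omega> j b = coupled_process d \<omega> j' b"
proof -
  define m a where "m = full_blocks b" and "a = ln b - real m"
  let ?q = "\<lambda>j. phase j \<omega> m - int (cnt a (\<omega> !! Suc m))"
  have r: "record_at d (?q j) n \<longleftrightarrow> record_at d (?q j') n" for n
  proof -
    have "?q j + int n + 1 = (?q j' + int n + 1) + (j - j')" by (simp add: phase_def del: snth.simps)
    then show ?thesis using dvd_add_left_iff[OF assms, of "?q j' + int n + 1"] by metis
  qed
  have "walk d inc w x (?q j) t = walk d inc w x (?q j') t" for inc w x t
  proof -
    have "wpoint d inc w x (?q j) t = wpoint d inc w x (?q j') t"
      unfolding wpoint_def wtime_def r ..
    then show ?thesis unfolding walk_def r by simp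
  qed
  then show ?thesis unfolding coupled_process_def Let_def m_def[symmetric] a_def[symmetric] .
qed

lemma sum_residues:
  assumes "0 < d"
  shows "(\<Sum>r<d. indicator {\<omega>. int d dvd c \<omega> - int r} \<omega> * f (int r)) = (f (c \<omega> mod int d) :: real)"
proof -
  let ?r0 = "nat (c \<omega> mod int d)"
  have r0: "?r0 < d" "int ?r0 = c \<omega> mod int d" using assms by (auto simp: nat_less_iff)
  have "int d dvd c \<omega> - int r \<longleftrightarrow> r = ?r0" if "r < d" for r
    using that r0 by (auto simp: mod_eq_dvd_iff[symmetric])
  then have "(\<Sum>r<d. indicator {\<omega>. int d dvd c \<omega> - int r} \<omega> * f (int r)) = (\<Sum>r<d. if r = ?r0 then f (int r) else 0)"
    by (intro sum.cong) auto
  also have "\<dots> = f (int ?r0)" using r0(1) by simp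
  finally show ?thesis unfolding r0(2) .
qed

text \<open>Split by the residue \<open>r\<close> of the count. On each part the process has the
  fixed phase \<open>r\<close> and converges almost surely, so boundedly in the mean;
  \<open>mixing\<close> then turns the indicator of the part into the factor
  \<open>1 / real d\<close>.\<close>

lemma coupled_integral_limit:
  assumes d: "0 < d" and F: "continuous_map (vague_topology pos_quadrant) euclideanreal F"
      "\<forall>\<mu>\<in>point_measures pos_quadrant. \<bar>F \<mu>\<bar> \<le> B"
    and L: "\<And>r. L r \<in> block_stream \<rightarrow>\<^sub>M vague_borel pos_quadrant"
    and AE: "\<And>r. AE \<omega> in block_stream. admissible d \<omega> \<and> L r \<omega> = limit_process d (int r) \<omega>"
  shows "((\<lambda>b. \<integral>\<omega>. F (coupled_process d \<omega> (count_before b \<omega>) b) \<partial>block_stream) \<longlongrightarrow>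
    (\<Sum>r<d. \<integral>\<omega>. F (L r \<omega>) \<partial>block_stream) / real d) at_top"
proof -
  let ?\<Xi> = block_stream
  let ?J = "\<lambda>b r. {\<omega>. int d dvd count_before b \<omega> - int r}"
  note mF = continuous_map_vague_measurable[OF F(1)]
  have B: "\<bar>F (h \<omega>)\<bar> \<le> B" if "h \<in> ?\<Xi> \<rightarrow>\<^sub>M vague_borel pos_quadrant" for h \<omega>
    using measurable_space[OF that, of \<omega>] F(2) by simp
  have B0: "0 \<le> B" using B[OF L[of 0], of undefined] by (rule order_trans[OF abs_ge_zero])
  have int: "integrable ?\<Xi> (\<lambda>\<omega>. F (h \<omega>))" if "h \<in> ?\<Xi> \<rightarrow>\<^sub>M vague_borel pos_quadrant" for h
    using B[OF that] measurable_compose[OF that mF] by (intro block_space.integrable_const_bound[where B = B]) auto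
  have sJ: "?J b r \<in> sets ?\<Xi>" for b r by (rule count_before_sets)
  have mcp: "(\<lambda>\<omega>. coupled_process d \<omega> (int r) b) \<in> ?\<Xi> \<rightarrow>\<^sub>M vague_borel pos_quadrant" if "1 < b" for b r
    using that by (rule measurable_coupled_process)
  have intJ: "integrable ?\<Xi> (\<lambda>\<omega>. indicator (?J b r) \<omega> * f \<omega>)" if "integrable ?\<Xi> f" for b r and f :: "_ \<Rightarrow> real"
    using integrable_mult_indicator[OF sJ that] by simp
  have diff: "((\<lambda>b. \<integral>\<omega>. \<bar>F (coupled_process d \<omega> (int r) b) - F (L r \<omega>)\<bar> \<partial>?\<Xi>) \<longlongrightarrow> 0) at_top" for r
  proof -
    \<comment> \<open>The integrand is set to zero for \<open>b \<le> 1\<close>, because dominated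
      convergence wants measurability for every \<open>b\<close> while the coupling is built for
      \<open>1 < b\<close>.\<close>
    define s where "s b \<omega> = (if 1 < b then \<bar>F (coupled_process d \<omega> (int r) b) - F (L r \<omega>)\<bar> else 0)" for b \<omega>
    have ms: "s b \<in> borel_measurable ?\<Xi>" for b
    proof (cases "1 < b")
      case True
      have "(\<lambda>\<omega>. \<bar>F (coupled_process d \<omega> (int r) b) - F (L r \<omega>)\<bar>) \<in> borel_measurable ?\<Xi>"
        using measurable_compose[OF mcp[OF True, of r] mF] measurable_compose[OF L[of r] mF] by measurable
      then show ?thesis using True by (simp add: s_def[abs_def])
    qed (simp add: s_def[abs_def])
    have "((\<lambda>b. \<integral>\<omega>. s b \<omega> \<partial>?\<Xi>) \<longlongrightarrow> (\<integral>\<omega>. 0 \<partial>?\<Xi>)) at_top"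
    proof (rule integral_dominated_convergence_at_top[where w = "\<lambda>_. 2 * B"])
      show "AE \<omega> in ?\<Xi>. ((\<lambda>b. s b \<omega>) \<longlongrightarrow> 0) at_top"
        using AE[of r]
      proof eventually_elim
        fix \<omega> assume \<omega>: "admissible d \<omega> \<and> L r \<omega> = limit_process d (int r) \<omega>"
        have "((\<lambda>b. F (coupled_process d \<omega> (int r) b)) \<longlongrightarrow> F (limit_process d (int r) \<omega>)) at_top"
          using \<omega> by (intro limitin_continuous_map_tendsto[OF coupled_process_limit[OF _ d] F(1)]) simp
        then have "((\<lambda>b. \<bar>F (coupled_process d \<omega> (int r) b) - F (L r \<omega>)\<bar>) \<longlongrightarrow> \<bar>F (L r \<omega>) - F (L r \<omega>)\<bar>) at_top"
          using \<omega> by (intro tendsto_intros) simp_all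
        moreover have "eventually (\<lambda>b. \<bar>F (coupled_process d \<omega> (int r) b) - F (L r \<omega>)\<bar> = s b \<omega>) at_top"
          using eventually_gt_at_top[of 1] by eventually_elim (simp add: s_def)
        ultimately show "((\<lambda>b. s b \<omega>) \<longlongrightarrow> 0) at_top" by (simp add: tendsto_cong)
      qed
      show "\<forall>\<^sub>F b in at_top. AE \<omega> in ?\<Xi>. norm (s b \<omega>) \<le> 2 * B"
      proof (intro always_eventually allI AE_I2)
        fix b \<omega>
        show "norm (s b \<omega>) \<le> 2 * B"
        proof (cases "1 < b")
          case True
          then show ?thesis using B[OF mcp[OF True], of \<omega> r] B[OF L, of r \<omega>] by (simp add: s_def)
        qed (use B0 in \<open>simp add: s_def\<close>)
      qed
    qed (use ms in simp_all)
    moreover have "eventually (\<lambda>b. (\<integral>\<omega>. s b \<omega> \<partial>?\<Xi>) = (\<integral>\<omega>. \<bar>F (coupled_process d \<omega> (int r) b) - F (L r \<omega>)\<bar> \<partial>?\<Xi>)) at_top"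
      using eventually_gt_at_top[of 1] by eventually_elim (simp add: s_def)
    ultimately show ?thesis by (simp add: tendsto_cong)
  qed
  have part: "((\<lambda>b. \<integral>\<omega>. indicator (?J b r) \<omega> * F (coupled_process d \<omega> (int r) b) \<partial>?\<Xi>) \<longlongrightarrow> (\<integral>\<omega>. F (L r \<omega>) \<partial>?\<Xi>) / real d) at_top" for r
  proof -
    \<comment> \<open>The indicator is bounded by one, so the coupled process may be exchanged for
      its limit before mixing is applied to a function that no longer depends on
      \<open>b\<close>.\<close>
    have "((\<lambda>b. (\<integral>\<omega>. indicator (?J b r) \<omega> * F (coupled_process d \<omega> (int r) b) \<partial>?\<Xi>) - (\<integral>\<omega>. indicator (?J b r) \<omega> * F (L r \<omega>) \<partial>?\<Xi>)) \<longlongrightarrow> 0) at_top"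
    proof (rule Lim_null_comparison[OF _ diff[of r]])
      show "\<forall>\<^sub>F b in at_top. norm ((\<integral>\<omega>. indicator (?J b r) \<omega> * F (coupled_process d \<omega> (int r) b) \<partial>?\<Xi>) - (\<integral>\<omega>. indicator (?J b r) \<omega> * F (L r \<omega>) \<partial>?\<Xi>))
        \<le> (\<integral>\<omega>. \<bar>F (coupled_process d \<omega> (int r) b) - F (L r \<omega>)\<bar> \<partial>?\<Xi>)"
        using eventually_gt_at_top[of 1]
      proof eventually_elim
        fix b :: real assume b: "1 < b"
        note i1 = int[OF mcp[OF b, of r]] and i2 = int[OF L[of r]]
        have "(\<integral>\<omega>. indicator (?J b r) \<omega> * F (coupled_process d \<omega> (int r) b) \<partial>?\<Xi>) - (\<integral>\<omega>. indicator (?J b r) \<omega> * F (L r \<omega>) \<partial>?\<Xi>) =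
          (\<integral>\<omega>. indicator (?J b r) \<omega> * F (coupled_process d \<omega> (int r) b) - indicator (?J b r) \<omega> * F (L r \<omega>) \<partial>?\<Xi>)"
          by (rule Bochner_Integration.integral_diff[symmetric, OF intJ[OF i1] intJ[OF i2]])
        also have "norm \<dots> \<le> (\<integral>\<omega>. norm (indicator (?J b r) \<omega> * F (coupled_process d \<omega> (int r) b) - indicator (?J b r) \<omega> * F (L r \<omega>)) \<partial>?\<Xi>)"
          by (rule integral_norm_bound)
        also have "\<dots> \<le> (\<integral>\<omega>. \<bar>F (coupled_process d \<omega> (int r) b) - F (L r \<omega>)\<bar> \<partial>?\<Xi>)"
        proof (rule integral_mono)
          show "integrable ?\<Xi> (\<lambda>\<omega>. norm (indicator (?J b r) \<omega> * F (coupled_process d \<omega> (int r) b) - indicator (?J b r) \<omega> * F (L r \<omega>)))"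
            by (intro integrable_norm Bochner_Integration.integrable_diff intJ i1 i2)
          show "integrable ?\<Xi> (\<lambda>\<omega>. \<bar>F (coupled_process d \<omega> (int r) b) - F (L r \<omega>)\<bar>)"
            by (intro integrable_abs Bochner_Integration.integrable_diff i1 i2)
        qed (auto simp: indicator_def)
        finally show "norm ((\<integral>\<omega>. indicator (?J b r) \<omega> * F (coupled_process d \<omega> (int r) b) \<partial>?\<Xi>) - (\<integral>\<omega>. indicator (?J b r) \<omega> * F (L r \<omega>) \<partial>?\<Xi>))
          \<le> (\<integral>\<omega>. \<bar>F (coupled_process d \<omega> (int r) b) - F (L r \<omega>)\<bar> \<partial>?\<Xi>)" .
      qed
    qed
    from tendsto_add[OF this mixing[OF d int[OF L[of r]], of "int r"]] show ?thesis by simp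
  qed
  have "((\<lambda>b. \<Sum>r<d. \<integral>\<omega>. indicator (?J b r) \<omega> * F (coupled_process d \<omega> (int r) b) \<partial>?\<Xi>) \<longlongrightarrow> (\<Sum>r<d. (\<integral>\<omega>. F (L r \<omega>) \<partial>?\<Xi>) / real d)) at_top"
    by (intro tendsto_sum part)
  moreover have "\<forall>\<^sub>F b in at_top. (\<Sum>r<d. \<integral>\<omega>. indicator (?J b r) \<omega> * F (coupled_process d \<omega> (int r) b) \<partial>?\<Xi>) =
    (\<integral>\<omega>. F (coupled_process d \<omega> (count_before b \<omega>) b) \<partial>?\<Xi>)"
    using eventually_gt_at_top[of 1]
  proof eventually_elim
    fix b :: real assume b: "1 < b"
    have "(\<Sum>r<d. \<integral>\<omega>. indicator (?J b r) \<omega> * F (coupled_process d \<omega> (int r) b) \<partial>?\<Xi>) =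
      (\<integral>\<omega>. (\<Sum>r<d. indicator (?J b r) \<omega> * F (coupled_process d \<omega> (int r) b)) \<partial>?\<Xi>)"
      by (rule Bochner_Integration.integral_sum[symmetric]) (rule intJ[OF int[OF mcp[OF b]]])
    also have "\<dots> = (\<integral>\<omega>. F (coupled_process d \<omega> (count_before b \<omega>) b) \<partial>?\<Xi>)"
    proof (rule Bochner_Integration.integral_cong[OF refl])
      fix \<omega>
      have "coupled_process d \<omega> (count_before b \<omega> mod int d) b = coupled_process d \<omega> (count_before b \<omega>) b"
        by (rule coupled_process_cong) (metis dvd_minus_mod dvd_diff_commute)
      then show "(\<Sum>r<d. indicator (?J b r) \<omega> * F (coupled_process d \<omega> (int r) b)) = F (coupled_process d \<omega> (count_before b \<omega>) b)"
        using sum_residues[OF d, of "count_before b" \<omega> "\<lambda>j. F (coupled_process d \<omega> j b)"] by simp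
    qed
    finally show "(\<Sum>r<d. \<integral>\<omega>. indicator (?J b r) \<omega> * F (coupled_process d \<omega> (int r) b) \<partial>?\<Xi>) =
      (\<integral>\<omega>. F (coupled_process d \<omega> (count_before b \<omega>) b) \<partial>?\<Xi>)" .
  qed
  ultimately show ?thesis by (simp add: tendsto_cong sum_divide_distrib)
qed

subsection \<open>Invariance of the limit law\<close>

text \<open>Pathwise, a hyperbolic shift is a mere change of the parameter \<open>b\<close>; this is
  the source of all the invariances.\<close>

lemma push_hyperbolic_scaled_process:
  assumes "0 < c"
  shows "push pos_quadrant (hyperbolic_shift c) (scaled_process x b) = scaled_process x (c * b)"
proof -
  have p: "hyperbolic_shift c (scaled_point x b k) = scaled_point x (c * b) k" for k
    by (simp add: hyperbolic_shift_def scaled_point_def mult.commute)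
  have q: "scaled_point x (c * b) k \<in> pos_quadrant \<longleftrightarrow> scaled_point x b k \<in> pos_quadrant" for k
    using assms by (auto simp: scaled_point_def zero_less_mult_iff zero_less_divide_iff mult_less_0_iff)
  have "push pos_quadrant (hyperbolic_shift c) (scaled_process x b) = dirac_sum pos_quadrant
    {k. 1 \<le> k \<and> chain_time x k \<noteq> \<infinity> \<and> scaled_point x b k \<in> pos_quadrant} (hyperbolic_shift c \<circ> scaled_point x b)"
    unfolding scaled_process_def by (rule push_dirac_sum[OF hyperbolic_shift_maps(1,2)[OF assms]]) auto
  also have "\<dots> = scaled_process x (c * b)"
    unfolding scaled_process_def q by (rule dirac_sum_cong) (simp_all only: p o_apply)
  finally show ?thesis .
qed

text \<open>The shift is continuous for the vague topology, so the shifted processes converge to the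
  shifted limit law. They are also the processes along \<open>c * b\<close>, which tends to infinity
  with \<open>b\<close> and gives the unshifted limit. Limits are unique and determine the
  law.\<close>

lemma limit_law_hyperbolic:
  fixes N :: "real \<Rightarrow> 'm \<Rightarrow> (real \<times> real) measure"
  assumes Q: "prob_space Q" "sets Q = sets (vague_borel pos_quadrant)"
    and lim: "\<And>F. continuous_map (vague_topology pos_quadrant) euclideanreal F \<Longrightarrow>
      (\<exists>B. \<forall>\<mu>\<in>point_measures pos_quadrant. \<bar>F \<mu>\<bar> \<le> B) \<Longrightarrow>
      ((\<lambda>b. \<integral>\<omega>. F (N b \<omega>) \<partial>M) \<longlongrightarrow> (\<integral>\<mu>. F \<mu> \<partial>Q)) at_top"
    and c: "0 < c" and N: "\<And>b \<omega>. push pos_quadrant (hyperbolic_shift c) (N b \<omega>) = N (c * b) \<omega>"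
  shows "distr Q (vague_borel pos_quadrant) (push pos_quadrant (hyperbolic_shift c)) = Q"
proof (rule law_eqI[OF open_pos_quadrant])
  let ?h = "push pos_quadrant (hyperbolic_shift c)"
  note ch = continuous_map_push[OF hyperbolic_shift_maps[OF c]]
  have mQ: "measurable Q K = measurable (vague_borel pos_quadrant) K" for K :: "'k measure"
    by (rule measurable_cong_sets[OF Q(2) refl])
  have mh: "?h \<in> Q \<rightarrow>\<^sub>M vague_borel pos_quadrant"
    unfolding mQ by (rule continuous_map_vague_measurable_map[OF ch])
  show "prob_space (distr Q (vague_borel pos_quadrant) ?h)" by (rule prob_space.prob_space_distr[OF Q(1) mh])
  show "prob_space Q" "sets Q = sets (vague_borel pos_quadrant)" by fact+
  show "sets (distr Q (vague_borel pos_quadrant) ?h) = sets (vague_borel pos_quadrant)" by simp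
  fix F assume F: "continuous_map (vague_topology pos_quadrant) euclideanreal F"
    and B: "\<exists>B. \<forall>\<mu>\<in>point_measures pos_quadrant. \<bar>F \<mu>\<bar> \<le> B"
  have cF: "continuous_map (vague_topology pos_quadrant) euclideanreal (\<lambda>\<mu>. F (?h \<mu>))"
    using continuous_map_compose[OF ch F] by (simp add: comp_def)
  have "\<exists>B. \<forall>\<mu>\<in>point_measures pos_quadrant. \<bar>F (?h \<mu>)\<bar> \<le> B"
    using B push_in_point_measures[OF _ hyperbolic_shift_maps[OF c]] by meson
  from lim[OF cF this]
  have "((\<lambda>b. \<integral>\<omega>. F (N (c * b) \<omega>) \<partial>M) \<longlongrightarrow> (\<integral>\<mu>. F (?h \<mu>) \<partial>Q)) at_top" unfolding N .
  moreover have "((\<lambda>b. \<integral>\<omega>. F (N (c * b) \<omega>) \<partial>M) \<longlongrightarrow> (\<integral>\<mu>. F \<mu> \<partial>Q)) at_top"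
    by (rule filterlim_compose[OF lim[OF F B]]) (use c in \<open>intro filterlim_tendsto_pos_mult_at_top[OF tendsto_const] filterlim_ident\<close>)
  ultimately have "(\<integral>\<mu>. F (?h \<mu>) \<partial>Q) = (\<integral>\<mu>. F \<mu> \<partial>Q)"
    by (rule tendsto_unique[OF trivial_limit_at_top_linorder])
  then show "(\<integral>\<mu>. F \<mu> \<partial>distr Q (vague_borel pos_quadrant) ?h) = (\<integral>\<mu>. F \<mu> \<partial>Q)"
    using integral_distr[OF mh continuous_map_vague_measurable[OF F]] by simp
qed

lemma push_push:
  assumes \<mu>: "\<mu> \<in> point_measures S" and f: "continuous_on S f" "f \<in> S \<rightarrow> T" and g: "continuous_on T g" "g \<in> T \<rightarrow> U"
  shows "push U g (push T f \<mu>) = push U (g \<circ> f) \<mu>"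
  unfolding push_def
  by (rule distr_distr[OF measurable_restrict_borel_continuous[OF g] measurable_point_measure[OF \<mu> measurable_restrict_borel_continuous[OF f]]])

lemma push_projection_hyperbolic:
  assumes c: "0 < c" and \<mu>: "\<mu> \<in> point_measures pos_quadrant"
  shows "push pos_reals fst (push pos_quadrant (hyperbolic_shift c) \<mu>) = push pos_reals (\<lambda>x. c * x) (push pos_reals fst \<mu>)"
    and "push pos_reals snd (push pos_quadrant (hyperbolic_shift c) \<mu>) = push pos_reals (\<lambda>x. (1 / c) * x) (push pos_reals snd \<mu>)"
proof -
  note h = hyperbolic_shift_maps[OF c] and s = scaling_maps[OF c]
  have "fst \<circ> hyperbolic_shift c = (\<lambda>x. c * x) \<circ> fst" "snd \<circ> hyperbolic_shift c = (\<lambda>x. (1 / c) * x) \<circ> snd"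
    by (auto simp: hyperbolic_shift_def fun_eq_iff)
  then show "push pos_reals fst (push pos_quadrant (hyperbolic_shift c) \<mu>) = push pos_reals (\<lambda>x. c * x) (push pos_reals fst \<mu>)"
    and "push pos_reals snd (push pos_quadrant (hyperbolic_shift c) \<mu>) = push pos_reals (\<lambda>x. (1 / c) * x) (push pos_reals snd \<mu>)"
    by (simp_all only: push_push[OF \<mu> h(1,2) fst_snd_maps(1,2)] push_push[OF \<mu> fst_snd_maps(1,2) s(1,2)]
      push_push[OF \<mu> h(1,2) fst_snd_maps(3,4)] push_push[OF \<mu> fst_snd_maps(3,4) s(3,4)])
qed

lemma projectable_hyperbolic:
  assumes c: "0 < c" and \<mu>: "\<mu> \<in> projectable"
  shows "push pos_quadrant (hyperbolic_shift c) \<mu> \<in> projectable"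
proof -
  have m: "\<mu> \<in> point_measures pos_quadrant" "push pos_reals fst \<mu> \<in> point_measures pos_reals" "push pos_reals snd \<mu> \<in> point_measures pos_reals"
    using \<mu> unfolding projectable_def by auto
  have "0 < 1 / c" using c by simp
  note s = scaling_maps[OF this]
  have "push pos_reals (\<lambda>x. c * x) (push pos_reals fst \<mu>) \<in> point_measures pos_reals"
    by (rule push_in_point_measures[OF m(2) scaling_maps[OF c]])
  moreover have "push pos_reals (\<lambda>x. (1 / c) * x) (push pos_reals snd \<mu>) \<in> point_measures pos_reals"
    by (rule push_in_point_measures[OF m(3) s])
  ultimately show ?thesis
    unfolding projectable_def using push_in_point_measures[OF m(1) hyperbolic_shift_maps[OF c]]
    by (simp add: push_projection_hyperbolic[OF c m(1)])
qed

text \<open>Projecting intertwines a hyperbolic shift with a scaling, so the invariance of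
  \<open>P\<close> passes to the image law. This uses measurability of the projection but no
  continuity.\<close>

lemma self_similar_projection:
  assumes P: "prob_space P" "sets P = sets (restrict_space (vague_borel pos_quadrant) projectable)"
    and h: "\<And>c. 0 < c \<Longrightarrow> distr P (restrict_space (vague_borel pos_quadrant) projectable) (push pos_quadrant (hyperbolic_shift c)) = P"
    and mh: "\<And>c. 0 < c \<Longrightarrow> push pos_quadrant (hyperbolic_shift c) \<in> P \<rightarrow>\<^sub>M restrict_space (vague_borel pos_quadrant) projectable"
    and u: "push pos_reals u \<in> restrict_space (vague_borel pos_quadrant) projectable \<rightarrow>\<^sub>M vague_borel pos_reals"
    and conj: "\<And>c. 0 < c \<Longrightarrow> \<exists>c'>0. \<forall>\<mu>\<in>point_measures pos_quadrant.
      push pos_reals u (push pos_quadrant (hyperbolic_shift c') \<mu>) = push pos_reals (\<lambda>x. c * x) (push pos_reals u \<mu>)"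
  shows "self_similar P (\<lambda>\<mu>. push pos_reals u \<mu>)"
  unfolding self_similar_def law_invariant_def point_process_def law_def
proof (intro conjI allI impI)
  let ?S = "restrict_space (vague_borel pos_quadrant) projectable"
  have sp: "space P = projectable"
    using sets_eq_imp_space_eq[OF P(2)] by (auto simp: space_restrict_space projectable_def)
  have mu: "(\<lambda>\<mu>. push pos_reals u \<mu>) \<in> P \<rightarrow>\<^sub>M vague_borel pos_reals"
    using u measurable_cong_sets[OF P(2) refl, of "vague_borel pos_reals"] by simp
  show "prob_space P" "prob_space P" "(\<lambda>\<mu>. push pos_reals u \<mu>) \<in> P \<rightarrow>\<^sub>M vague_borel pos_reals" by fact+
  fix c :: real assume c: "0 < c"
  show "(\<lambda>\<mu>. push pos_reals (\<lambda>x. c * x) (push pos_reals u \<mu>)) \<in> P \<rightarrow>\<^sub>M vague_borel pos_reals"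
    by (rule measurable_compose[OF mu continuous_map_vague_measurable_map[OF continuous_map_push[OF scaling_maps[OF c]]]])
  obtain c' where c': "0 < c'" "\<forall>\<mu>\<in>point_measures pos_quadrant.
      push pos_reals u (push pos_quadrant (hyperbolic_shift c') \<mu>) = push pos_reals (\<lambda>x. c * x) (push pos_reals u \<mu>)"
    using conj[OF c] by blast
  have "distr P (vague_borel pos_reals) (\<lambda>\<mu>. push pos_reals (\<lambda>x. c * x) (push pos_reals u \<mu>)) =
    distr P (vague_borel pos_reals) (push pos_reals u \<circ> push pos_quadrant (hyperbolic_shift c'))"
    using c'(2) unfolding sp by (intro distr_cong) (auto simp: sp projectable_def)
  also have "\<dots> = distr (distr P ?S (push pos_quadrant (hyperbolic_shift c'))) (vague_borel pos_reals) (push pos_reals u)"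
    by (rule distr_distr[OF u mh[OF c'(1)], symmetric])
  also have "\<dots> = distr P (vague_borel pos_reals) (push pos_reals u)" unfolding h[OF c'(1)] ..
  finally show "distr P (vague_borel pos_reals) (\<lambda>\<mu>. push pos_reals (\<lambda>x. c * x) (push pos_reals u \<mu>)) =
    distr P (vague_borel pos_reals) (\<lambda>\<mu>. push pos_reals u \<mu>)" .
qed

text \<open>The limit law is that of \<open>limit_process\<close> with a phase drawn uniformly from
  the \<open>d\<close> residues, independently of the blocks; averaging over the phase reproduces
  the mean in \<open>coupled_integral_limit\<close>.\<close>

lemma limit_law_exists:
  assumes d: "0 < d"
  obtains P where "prob_space P" "sets P = sets (restrict_space (vague_borel pos_quadrant) projectable)"
    "\<And>F. continuous_map (vague_topology pos_quadrant) euclideanreal F \<Longrightarrow>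
      (\<exists>B. \<forall>\<mu>\<in>point_measures pos_quadrant. \<bar>F \<mu>\<bar> \<le> B) \<Longrightarrow>
      ((\<lambda>b. \<integral>w. F (walk d (waiting_inc b) w (- ln b) 0 (1 / b)) \<partial>gap_stream) \<longlongrightarrow> (\<integral>\<mu>. F \<mu> \<partial>P)) at_top"
proof -
  let ?\<Xi> = block_stream
  let ?S = "restrict_space (vague_borel pos_quadrant) projectable"
  let ?U = "uniform_count_measure {..<d}"
  obtain N where N: "{\<omega> \<in> space ?\<Xi>. \<not> admissible d \<omega>} \<subseteq> N" "emeasure ?\<Xi> N = 0" "N \<in> sets ?\<Xi>"
    using AE_E[OF AE_admissible[OF d]] by blast
  \<comment> \<open>A measurable set of full measure on which \<open>admissible\<close> holds, taken
    from the almost sure statement without showing that \<open>admissible\<close> is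
    measurable.\<close>
  define A where "A = space ?\<Xi> - N"
  have A: "A \<in> sets ?\<Xi>" "\<And>\<omega>. \<omega> \<in> A \<Longrightarrow> admissible d \<omega>"
    using sets.compl_sets[OF N(3)] N(1) unfolding A_def by auto
  have AEA: "AE \<omega> in ?\<Xi>. \<omega> \<in> A"
    using AE_not_in[of N ?\<Xi>] N by (auto simp: A_def null_sets_def)
  define L where "L r \<omega> = (if \<omega> \<in> A then limit_process d (int r) \<omega> else dirac_sum pos_quadrant {} (\<lambda>_. (0, 0)))" for r \<omega>
  have L: "L r \<in> ?\<Xi> \<rightarrow>\<^sub>M ?S" for r
    unfolding L_def by (rule measurable_limit_process[OF d A])
  have L': "L r \<in> ?\<Xi> \<rightarrow>\<^sub>M vague_borel pos_quadrant" for r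
    using L[of r] by (rule measurable_restrict_space2_iff[THEN iffD1, THEN conjunct1])
  interpret U: prob_space ?U using d by (intro prob_space_uniform_count_measure) auto
  interpret PU: pair_prob_space ?\<Xi> ?U by unfold_locales
  \<comment> \<open>The second coordinate is the uniform phase, with values in a finite set, so
    measurability is checked phase by phase.\<close>
  define G where "G x = L (snd x) (fst x)" for x
  have G: "G \<in> ?\<Xi> \<Otimes>\<^sub>M ?U \<rightarrow>\<^sub>M ?S"
    unfolding G_def
  proof (rule measurable_compose_countable'[where I = "{..<d}"])
    show "(\<lambda>x. L i (fst x)) \<in> ?\<Xi> \<Otimes>\<^sub>M ?U \<rightarrow>\<^sub>M ?S" for i
      by (rule measurable_compose[OF measurable_fst L])
    have "measurable (?\<Xi> \<Otimes>\<^sub>M ?U) (count_space {..<d}) = measurable (?\<Xi> \<Otimes>\<^sub>M ?U) ?U"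
      by (rule measurable_cong_sets) (simp_all add: sets_uniform_count_measure)
    then show "snd \<in> ?\<Xi> \<Otimes>\<^sub>M ?U \<rightarrow>\<^sub>M count_space {..<d}" by simp
  qed simp
  define P where "P = distr (?\<Xi> \<Otimes>\<^sub>M ?U) ?S G"
  show ?thesis
  proof (rule that[of P])
    show "prob_space P" unfolding P_def by (rule PU.prob_space_distr[OF G])
    show "sets P = sets ?S" by (simp add: P_def)
    fix F assume F: "continuous_map (vague_topology pos_quadrant) euclideanreal F"
      and "\<exists>B. \<forall>\<mu>\<in>point_measures pos_quadrant. \<bar>F \<mu>\<bar> \<le> B"
    then obtain B where B: "\<forall>\<mu>\<in>point_measures pos_quadrant. \<bar>F \<mu>\<bar> \<le> B" by blast
    have mF: "F \<in> borel_measurable (vague_borel pos_quadrant)" by (rule continuous_map_vague_measurable[OF F])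
    have mFS: "F \<in> borel_measurable ?S" by (rule measurable_restrict_space1[OF mF])
    have FG: "(\<lambda>x. F (G x)) \<in> borel_measurable (?\<Xi> \<Otimes>\<^sub>M ?U)" by (rule measurable_compose[OF G mFS])
    have "\<bar>F (G x)\<bar> \<le> B" for x
      using measurable_space[OF L', of "fst x" "snd x"] B by (simp add: G_def)
    then have iFG: "integrable (?\<Xi> \<Otimes>\<^sub>M ?U) (\<lambda>x. F (G x))"
      using FG by (intro PU.integrable_const_bound[where B = B]) auto
    have "(\<integral>\<mu>. F \<mu> \<partial>P) = (\<integral>x. F (G x) \<partial>(?\<Xi> \<Otimes>\<^sub>M ?U))"
      unfolding P_def by (rule integral_distr[OF G mFS])
    also have "\<dots> = (\<integral>r. \<integral>\<omega>. F (L r \<omega>) \<partial>?\<Xi> \<partial>?U)"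
      using PU.integral_snd[of "\<lambda>\<omega> r. F (L r \<omega>)"] iFG by (simp add: G_def case_prod_unfold)
    also have "\<dots> = (\<Sum>r<d. \<integral>\<omega>. F (L r \<omega>) \<partial>?\<Xi>) / real d"
      by (simp add: integral_uniform_count_measure)
    finally have P: "(\<integral>\<mu>. F \<mu> \<partial>P) = (\<Sum>r<d. \<integral>\<omega>. F (L r \<omega>) \<partial>?\<Xi>) / real d" .
    have "AE \<omega> in ?\<Xi>. admissible d \<omega> \<and> L r \<omega> = limit_process d (int r) \<omega>" for r
      using AEA by eventually_elim (use A(2) in \<open>auto simp: L_def\<close>)
    from coupled_integral_limit[OF d F B L' this]
    have "((\<lambda>b. \<integral>\<omega>. F (coupled_process d \<omega> (count_before b \<omega>) b) \<partial>?\<Xi>) \<longlongrightarrow> (\<integral>\<mu>. F \<mu> \<partial>P)) at_top"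
      unfolding P .
    moreover have "\<forall>\<^sub>F b in at_top. (\<integral>\<omega>. F (coupled_process d \<omega> (count_before b \<omega>) b) \<partial>?\<Xi>) =
      (\<integral>w. F (walk d (waiting_inc b) w (- ln b) 0 (1 / b)) \<partial>gap_stream)"
      using eventually_gt_at_top[of 1] by eventually_elim (simp add: integral_walk_coupled[OF _ mF])
    ultimately show "((\<lambda>b. \<integral>w. F (walk d (waiting_inc b) w (- ln b) 0 (1 / b)) \<partial>gap_stream) \<longlongrightarrow> (\<integral>\<mu>. F \<mu> \<partial>P)) at_top"
      by (simp add: tendsto_cong)
  qed
qed

theorem proposition7:
  fixes M :: "'m measure" and X :: "nat \<Rightarrow> 'm \<Rightarrow> real ^ 'n"
  assumes "prob_space M"
    and "prob_space.indep_vars M (\<lambda>_. borel) X {1..}"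
    and "\<And>n. 1 \<le> n \<Longrightarrow> distr M borel (X n) = uniform_measure lborel unit_cube"
  shows "\<exists>(P :: (real \<times> real) measure measure) (R :: (real \<times> real) measure \<Rightarrow> (real \<times> real) measure).
     weakly_converges pos_quadrant M (\<lambda>b \<omega>. scaled_process (\<lambda>n. X n \<omega>) b) P R \<and>
     (\<forall>b>0. law_invariant P pos_quadrant R (hyperbolic_shift b)) \<and>
     self_similar P (\<lambda>\<omega>. push pos_reals fst (R \<omega>)) \<and>
     self_similar P (\<lambda>\<omega>. push pos_reals snd (R \<omega>))"
proof -
  let ?S = "restrict_space (vague_borel pos_quadrant) projectable"
  let ?V = "vague_borel pos_quadrant"
  let ?N = "\<lambda>b \<omega>. scaled_process (\<lambda>n. X n \<omega>) b"
  have mN: "?N b \<in> M \<rightarrow>\<^sub>M ?V" if "0 < b" for b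
    using that distr_tail_stream(2)[OF assms(1,2)] assms(3) by (intro measurable_scaled_process) blast+
  obtain P where P: "prob_space P" "sets P = sets ?S"
    and walk: "\<And>F. continuous_map (vague_topology pos_quadrant) euclideanreal F \<Longrightarrow>
      (\<exists>B. \<forall>\<mu>\<in>point_measures pos_quadrant. \<bar>F \<mu>\<bar> \<le> B) \<Longrightarrow>
      ((\<lambda>b. \<integral>w. F (walk CARD('n) (waiting_inc b) w (- ln b) 0 (1 / b)) \<partial>gap_stream) \<longlongrightarrow> (\<integral>\<mu>. F \<mu> \<partial>P)) at_top"
    using limit_law_exists[of "CARD('n)"] by auto
  have lim: "((\<lambda>b. \<integral>\<omega>. F (?N b \<omega>) \<partial>M) \<longlongrightarrow> (\<integral>\<mu>. F \<mu> \<partial>P)) at_top"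
    if F: "continuous_map (vague_topology pos_quadrant) euclideanreal F"
      "\<exists>B. \<forall>\<mu>\<in>point_measures pos_quadrant. \<bar>F \<mu>\<bar> \<le> B" for F
  proof (rule Lim_transform_eventually[OF walk[OF F]])
    show "\<forall>\<^sub>F b in at_top. (\<integral>w. F (walk CARD('n) (waiting_inc b) w (- ln b) 0 (1 / b)) \<partial>gap_stream) = (\<integral>\<omega>. F (?N b \<omega>) \<partial>M)"
      using eventually_gt_at_top[of 0]
    proof eventually_elim
      fix b :: real assume "0 < b"
      then show "(\<integral>w. F (walk CARD('n) (waiting_inc b) w (- ln b) 0 (1 / b)) \<partial>gap_stream) = (\<integral>\<omega>. F (?N b \<omega>) \<partial>M)"
        by (intro integral_scaled_process[OF assms(1,2), symmetric] assms(3) continuous_map_vague_measurable[OF F(1)])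
    qed
  qed
  interpret P: prob_space P by fact
  have sp: "space P = projectable"
    using sets_eq_imp_space_eq[OF P(2)] by (auto simp: space_restrict_space projectable_def)
  have mP: "(\<lambda>\<mu>. f \<mu>) \<in> P \<rightarrow>\<^sub>M K" if "f \<in> ?V \<rightarrow>\<^sub>M K" for f and K :: "(real \<times> real) measure measure"
    using measurable_restrict_space1[OF that, of projectable] measurable_cong_sets[OF P(2) refl, of K] by simp
  have mid: "(\<lambda>\<mu>. \<mu>) \<in> P \<rightarrow>\<^sub>M ?V" by (rule mP) simp
  \<comment> \<open>\<open>P\<close> lives on the trace on \<open>projectable\<close>;
    \<open>Q\<close> is the same law on all point measures, where continuous functionals determine
    laws.\<close>
  define Q where "Q = distr P ?V (\<lambda>\<mu>. \<mu>)"
  have Q: "prob_space Q" "sets Q = sets ?V" unfolding Q_def by (rule P.prob_space_distr[OF mid]) simp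
  have mpush: "push pos_quadrant (hyperbolic_shift c) \<in> ?V \<rightarrow>\<^sub>M ?V" if "0 < c" for c
    by (rule continuous_map_vague_measurable_map[OF continuous_map_push[OF hyperbolic_shift_maps[OF that]]])
  have hyp: "distr P ?V (push pos_quadrant (hyperbolic_shift c)) = distr P ?V (\<lambda>\<mu>. \<mu>)" if c: "0 < c" for c
  proof -
    have "distr Q ?V (push pos_quadrant (hyperbolic_shift c)) = Q"
    proof (rule limit_law_hyperbolic[OF Q _ c, where N = ?N and M = M])
      show "push pos_quadrant (hyperbolic_shift c) (?N b \<omega>) = ?N (c * b) \<omega>" for b \<omega>
        by (rule push_hyperbolic_scaled_process[OF c])
      fix F assume F: "continuous_map (vague_topology pos_quadrant) euclideanreal F"
        "\<exists>B. \<forall>\<mu>\<in>point_measures pos_quadrant. \<bar>F \<mu>\<bar> \<le> B"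
      have "(\<integral>\<mu>. F \<mu> \<partial>Q) = (\<integral>\<mu>. F \<mu> \<partial>P)"
        unfolding Q_def by (rule integral_distr[OF mid continuous_map_vague_measurable[OF F(1)]])
      then show "((\<lambda>b. \<integral>\<omega>. F (?N b \<omega>) \<partial>M) \<longlongrightarrow> (\<integral>\<mu>. F \<mu> \<partial>Q)) at_top" using lim[OF F] by simp
    qed
    then show ?thesis unfolding Q_def using distr_distr[OF mpush[OF c] mid] by (simp add: comp_def)
  qed
  have mh: "push pos_quadrant (hyperbolic_shift c) \<in> P \<rightarrow>\<^sub>M ?S" if c: "0 < c" for c
    by (rule measurable_restrict_space2) (use projectable_hyperbolic[OF c] mP[OF mpush[OF c]] sp in auto)
  \<comment> \<open>A set of the trace has the form \<open>projectable \<inter> A'\<close>, and the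
    shift maps \<open>projectable\<close> into itself; so invariance on all point measures descends
    to the trace.\<close>
  have hS: "distr P ?S (push pos_quadrant (hyperbolic_shift c)) = P" if c: "0 < c" for c
  proof (rule measure_eqI)
    let ?h = "push pos_quadrant (hyperbolic_shift c)"
    show "sets (distr P ?S ?h) = sets P" using P(2) by simp
    fix A assume "A \<in> sets (distr P ?S ?h)"
    then have AS: "A \<in> sets ?S" by simp
    then obtain A' where A': "A' \<in> sets ?V" "A = projectable \<inter> A'" unfolding sets_restrict_space by blast
    have "emeasure (distr P ?S ?h) A = emeasure P (?h -` A \<inter> space P)" by (rule emeasure_distr[OF mh[OF c] AS])
    also have "?h -` A \<inter> space P = ?h -` A' \<inter> space P"
      using projectable_hyperbolic[OF c] unfolding A'(2) sp by auto
    also have "emeasure P (?h -` A' \<inter> space P) = emeasure (distr P ?V ?h) A'"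
      using emeasure_distr[OF mP[OF mpush[OF c]] A'(1)] by simp
    also have "\<dots> = emeasure P ((\<lambda>\<mu>. \<mu>) -` A' \<inter> space P)" unfolding hyp[OF c] by (rule emeasure_distr[OF mid A'(1)])
    also have "(\<lambda>\<mu>. \<mu>) -` A' \<inter> space P = A" unfolding A'(2) sp by auto
    finally show "emeasure (distr P ?S ?h) A = emeasure P A" .
  qed
  \<comment> \<open>The canonical realisation: the sample point is the measure itself, so
    \<open>R\<close> is the identity under the law \<open>P\<close>.\<close>
  have "weakly_converges pos_quadrant M ?N P (\<lambda>\<mu>. \<mu>)"
    unfolding weakly_converges_def point_process_def
  proof (intro conjI allI impI)
    show "\<forall>\<^sub>F b in at_top. prob_space M \<and> ?N b \<in> M \<rightarrow>\<^sub>M ?V"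
      using eventually_gt_at_top[of 0] by eventually_elim (intro conjI assms(1) mN)
  qed (use mid P(1) lim in auto)
  moreover have "law_invariant P pos_quadrant (\<lambda>\<mu>. \<mu>) (hyperbolic_shift c)" if c: "0 < c" for c
    unfolding law_invariant_def point_process_def law_def
    using P(1) mP[OF mpush[OF c]] hyp[OF c] by simp
  moreover have "self_similar P (\<lambda>\<mu>. push pos_reals fst \<mu>)"
    by (rule self_similar_projection[OF P hS mh measurable_push_fst_snd(1)])
      (use push_projection_hyperbolic(1) in blast)+
  moreover have "self_similar P (\<lambda>\<mu>. push pos_reals snd \<mu>)"
  proof (rule self_similar_projection[OF P hS mh measurable_push_fst_snd(2)])
    fix c :: real assume "0 < c"
    \<comment> \<open>A hyperbolic shift acts inversely on the second coordinate, hence the shift by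
      \<open>1 / c\<close> for the scaling by \<open>c\<close>.\<close>
    then have "0 < 1 / c" "1 / (1 / c) = c" by simp_all
    then show "\<exists>c'>0. \<forall>\<mu>\<in>point_measures pos_quadrant.
      push pos_reals snd (push pos_quadrant (hyperbolic_shift c') \<mu>) = push pos_reals (\<lambda>x. c * x) (push pos_reals snd \<mu>)"
      using push_projection_hyperbolic(2)[of "1 / c"] by (intro exI[of _ "1 / c"]) simp
  qed
  ultimately show ?thesis by blast
qed

end
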